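(* Every compact Riemann surface can be conformally immersed in $\mathbb{C}^2$ as an exact, algebraic Lagrangian surface.
   Context: $\mathbb{C}^2=\mathbb{R}^4$ has its standard Euclidean metric and standard symplectic form $\varpi$ (up to a constant factor $\mathrm{i}\sum_k dz^k\wedge d\bar z^k$). An immersion of a surface $M$ into $\mathbb{C}^2$ is Lagrangian if $\varpi$ pulls back to $0$; it is exact if an (equivalently any) 1-form $\eta$ on $\mathbb{C}^2$ with $d\eta=\varpi$ pulls back to an exact 1-form on $M$. Algebraic means that the image is contained in a real algebraic subset of $\mathbb{R}^4$ of dimension 2. Conformal is with respect to the given Riemann surface structure and the Euclidean metric. *)

theory Defs
  imports "HOL-Complex_Analysis.Complex_Analysis" "HOL-Library.Extended_Nat"
begin

text \<open>A chart is a pair of its domain and a coordinate function; the values of the coordinate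
  function outside the domain are irrelevant. The atlas need not be maximal.\<close>

type_synonym 'a chart = "'a set \<times> ('a \<Rightarrow> complex)"

locale riemann_surface =
  fixes X :: "'a topology" and A :: "'a chart set"
  assumes nonempty: "topspace X \<noteq> {}"
    and Hausdorff: "Hausdorff_space X"
    and connected: "connected_space X"
    and cover: "(\<Union>(U, \<phi>)\<in>A. U) = topspace X"
    and chart_domain: "(U, \<phi>) \<in> A \<Longrightarrow> openin X U"
    and chart_range: "(U, \<phi>) \<in> A \<Longrightarrow> open (\<phi> ` U)"
    and chart_homeomorphic:
      "(U, \<phi>) \<in> A \<Longrightarrow> homeomorphic_map (subtopology X U) (top_of_set (\<phi> ` U)) \<phi>"
    and chart_transition:
      "(U, \<phi>) \<in> A \<Longrightarrow> (V, \<psi>) \<in> A \<Longrightarrow> (\<psi> \<circ> inv_into U \<phi>) holomorphic_on \<phi> ` (U \<inter> V)"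

text \<open>Both notions are meant for an open set \<open>S\<close>.\<close>

primrec times_differentiable_on ::
    "nat \<Rightarrow> 'a::real_normed_vector set \<Rightarrow> ('a \<Rightarrow> 'b::real_normed_vector) \<Rightarrow> bool" where
  "times_differentiable_on 0 S f \<longleftrightarrow> continuous_on S f"
| "times_differentiable_on (Suc n) S f \<longleftrightarrow>
     (\<forall>x\<in>S. f differentiable (at x)) \<and>
     (\<forall>v. times_differentiable_on n S (\<lambda>x. frechet_derivative f (at x) v))"

definition smooth_on :: "'a::real_normed_vector set \<Rightarrow> ('a \<Rightarrow> 'b::real_normed_vector) \<Rightarrow> bool" where
  "smooth_on S f \<longleftrightarrow> (\<forall>n. times_differentiable_on n S f)"

definition in_chart :: "'a chart \<Rightarrow> ('a \<Rightarrow> 'b) \<Rightarrow> complex \<Rightarrow> 'b" where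
  "in_chart c f = f \<circ> inv_into (fst c) (snd c)"

definition chart_image :: "'a chart \<Rightarrow> complex set" where
  "chart_image c = snd c ` fst c"

text \<open>The differential of a map on the surface at the point with coordinate \<open>z\<close>, the tangent plane
  there being identified with the real vector space \<open>complex\<close> by means of the chart.\<close>

definition differential ::
    "'a chart \<Rightarrow> ('a \<Rightarrow> 'b::real_normed_vector) \<Rightarrow> complex \<Rightarrow> complex \<Rightarrow> 'b" where
  "differential c f z = frechet_derivative (in_chart c f) (at z)"

definition smooth_map :: "'a chart set \<Rightarrow> ('a \<Rightarrow> 'b::real_normed_vector) \<Rightarrow> bool" where
  "smooth_map A f \<longleftrightarrow> (\<forall>c\<in>A. smooth_on (chart_image c) (in_chart c f))"

definition immersion :: "'a chart set \<Rightarrow> ('a \<Rightarrow> 'b::real_normed_vector) \<Rightarrow> bool" where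
  "immersion A f \<longleftrightarrow>
     smooth_map A f \<and> (\<forall>c\<in>A. \<forall>z\<in>chart_image c. inj (differential c f z))"

definition conformal :: "'a chart set \<Rightarrow> ('a \<Rightarrow> 'b::real_inner) \<Rightarrow> bool" where
  "conformal A f \<longleftrightarrow>
     (\<forall>c\<in>A. \<forall>z\<in>chart_image c. \<exists>\<mu>>0. \<forall>v w.
        differential c f z v \<bullet> differential c f z w = \<mu> * (v \<bullet> w))"

text \<open>The form \<open>\<i>/2 \<Sum>\<^sub>k dz\<^sup>k \<and> d(cnj z\<^sup>k) = \<Sum>\<^sub>k dx\<^sup>k \<and> dy\<^sup>k\<close>, with constant coefficients.\<close>

definition symplectic_form :: "complex \<times> complex \<Rightarrow> complex \<times> complex \<Rightarrow> real" where
  "symplectic_form v w =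
     (Re (fst v) * Im (fst w) - Im (fst v) * Re (fst w)) +
     (Re (snd v) * Im (snd w) - Im (snd v) * Re (snd w))"

definition lagrangian :: "'a chart set \<Rightarrow> ('a \<Rightarrow> complex \<times> complex) \<Rightarrow> bool" where
  "lagrangian A f \<longleftrightarrow>
     (\<forall>c\<in>A. \<forall>z\<in>chart_image c. \<forall>v w.
        symplectic_form (differential c f z v) (differential c f z w) = 0)"

text \<open>A 1-form \<open>\<eta>\<close> on a vector space maps a point \<open>p\<close> and a tangent vector \<open>v\<close> to \<open>\<eta> p v\<close>.\<close>

definition smooth_one_form :: "('b::real_normed_vector \<Rightarrow> 'b \<Rightarrow> real) \<Rightarrow> bool" where
  "smooth_one_form \<eta> \<longleftrightarrow> (\<forall>p. linear (\<eta> p)) \<and> (\<forall>v. smooth_on UNIV (\<lambda>p. \<eta> p v))"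

definition exterior_derivative ::
    "('b::real_normed_vector \<Rightarrow> 'b \<Rightarrow> real) \<Rightarrow> 'b \<Rightarrow> 'b \<Rightarrow> 'b \<Rightarrow> real" where
  "exterior_derivative \<eta> p v w =
     frechet_derivative (\<lambda>q. \<eta> q w) (at p) v - frechet_derivative (\<lambda>q. \<eta> q v) (at p) w"

definition pullback_exact ::
    "'a chart set \<Rightarrow> ('a \<Rightarrow> 'b::real_normed_vector) \<Rightarrow> ('b \<Rightarrow> 'b \<Rightarrow> real) \<Rightarrow> bool" where
  "pullback_exact A f \<eta> \<longleftrightarrow>
     (\<exists>h::'a \<Rightarrow> real. smooth_map A h \<and>
        (\<forall>c\<in>A. \<forall>z\<in>chart_image c. \<forall>v.
           differential c h z v = \<eta> (in_chart c f z) (differential c f z v)))"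

definition exact_lagrangian :: "'a chart set \<Rightarrow> ('a \<Rightarrow> complex \<times> complex) \<Rightarrow> bool" where
  "exact_lagrangian A f \<longleftrightarrow>
     lagrangian A f \<and>
     (\<exists>\<eta>. smooth_one_form \<eta> \<and> exterior_derivative \<eta> = (\<lambda>p. symplectic_form) \<and>
          pullback_exact A f \<eta>)"

definition real_algebraic_set :: "'b::euclidean_space set \<Rightarrow> bool" where
  "real_algebraic_set V \<longleftrightarrow>
     (\<exists>P. (\<forall>p\<in>P. real_polynomial_function p) \<and> V = {x. \<forall>p\<in>P. p x = 0})"

definition irreducible_algebraic_set :: "'b::euclidean_space set \<Rightarrow> bool" where
  "irreducible_algebraic_set V \<longleftrightarrow>
     real_algebraic_set V \<and> V \<noteq> {} \<and>
     (\<forall>V1 V2. real_algebraic_set V1 \<and> real_algebraic_set V2 \<and> V = V1 \<union> V2 \<longrightarrow>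
        V = V1 \<or> V = V2)"

text \<open>Krull dimension in the Zariski topology: the supremum of the lengths of the chains
  \<open>Z\<^sub>0 \<subset> \<dots> \<subset> Z\<^sub>n\<close> of irreducible algebraic subsets of \<open>V\<close>. It equals the Krull dimension of the
  ring of polynomial functions on \<open>V\<close>, except that the empty set has dimension 0 here.\<close>

definition algebraic_dimension :: "'b::euclidean_space set \<Rightarrow> enat" where
  "algebraic_dimension V =
     Sup {enat n | n. \<exists>Z :: nat \<Rightarrow> 'b set.
       (\<forall>i\<le>n. irreducible_algebraic_set (Z i) \<and> Z i \<subseteq> V) \<and> (\<forall>i<n. Z i \<subset> Z (Suc i))}"

definition in_algebraic_surface :: "'b::euclidean_space set \<Rightarrow> bool" where
  "in_algebraic_surface S \<longleftrightarrow>
     (\<exists>V. real_algebraic_set V \<and> algebraic_dimension V = 2 \<and> S \<subseteq> V)"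

end

theory Submission
  imports Defs
begin

text \<open>The immersion is the image of a holomorphic contact curve under an inversion, in the spirit of
  Bryant's construction of minimal surfaces.

  The surface carries functions \<open>b\<close> and \<open>a\<close> with poles of orders \<open>m\<close> and \<open>m + 1\<close> at a point. The curve
  with homogeneous coordinates \<open>(1, a'/(2b'), b, a - b a'/(2b'))\<close> in projective space is tangent to the
  contact planes \<open>x\<^sub>0 dx\<^sub>3 - x\<^sub>3 dx\<^sub>0 - x\<^sub>1 dx\<^sub>2 + x\<^sub>2 dx\<^sub>1 = 0\<close>, it is immersed if the zeros and poles of \<open>a\<close> at the
  critical points of \<open>b\<close> are prescribed, and a generic linear contact transformation puts it in general
  position to the plane \<open>x\<^sub>0 = 0\<close>. In affine coordinates \<open>(f, g, h)\<close> put \<open>\<zeta> = (f - cnj g, g + cnj f)\<close> and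
  \<open>w = |\<zeta>|\<^sup>2 + 4\<i> Im h\<close>. Then \<open>dw = 2<d\<zeta>, \<zeta>>\<close> because of the contact condition, and therefore \<open>F = \<zeta>/w\<close>
  satisfies \<open><dF(u), dF(v)> = <d\<zeta>(u), d\<zeta>(v)>/|w|\<^sup>2\<close>, a real multiple of the inner product of \<open>u\<close> and \<open>v\<close>; the
  real part says that \<open>F\<close> is conformal, the imaginary part that it is Lagrangian. The Liouville form
  pulls back to the differential of \<open>Im (1/w)/4\<close>.

  To find \<open>a\<close> and \<open>b\<close>, cut-off principal parts are corrected by Cauchy transforms on finitely many discs.
  Gluing these with a partition of unity produces an error that depends compactly on the unknown, so by
  a Fredholm argument the correction exists for a nonzero combination of any sufficiently large number
  of principal parts.

  The map \<open>F\<close> is a quotient of forms in the curve and its conjugate. By the Schwarz lemma a form of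
  degree \<open>n\<close> on the curve vanishes if it does so at \<open>O(n)\<close> points, hence a bihomogeneous one is determined
  by \<open>O(n\<^sup>2)\<close> values. As three polynomials have of the order of \<open>n\<^sup>3\<close> monomials, any three are
  algebraically dependent on the image, which bounds the length of chains of irreducible sets.\<close>

section \<open>Nearly holomorphic functions\<close>

text \<open>The Cauchy transform of a merely continuous function need not be differentiable, so
  "dbar u = v" cannot be read pointwise, whereas the Fredholm argument wants the plain Banach space
  of bounded continuous functions. Hence \<open>weak_dbar\<close>: uniform approximants that satisfy
  the first-order expansion up to a relative error e. The notion survives sums, multiplication by
  functions with bounded dbar and holomorphic substitutions, and for right-hand side 0 Goursat's
  subdivision and Morera's theorem give holomorphy. No Hoelder estimates occur. The
  finite-dimensional obstruction to solving the equation means only that finitely many pole orders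
  may fail to occur at a given point. Quotients of sums of functions with a single pole then have
  any prescribed order at finitely many points, which is what \<open>a\<close> requires at the
  critical points of \<open>b\<close>. The pole orders m and m + 1 make the ratio of the last two
  homogeneous coordinates a local coordinate at the pole, and m \<ge> 2 keeps the last one nonzero
  there. The formula for the map is projectively invariant, so points of the curve at infinity
  produce no ends: the inversion sends them to the origin.\<close>

definition near_holomorphic_on :: "real \<Rightarrow> (complex \<Rightarrow> complex) \<Rightarrow> complex set \<Rightarrow> bool" where
  "near_holomorphic_on e f S \<longleftrightarrow> (\<forall>x\<in>S. \<exists>f' d. d > 0 \<and>
     (\<forall>y\<in>S. norm (y - x) \<le> d \<longrightarrow> norm (f y - f x - f' * (y - x)) \<le> e * norm (y - x)))"

lemma near_holomorphic_on_subset: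
  "near_holomorphic_on e f S \<Longrightarrow> T \<subseteq> S \<Longrightarrow> near_holomorphic_on e f T"
  unfolding near_holomorphic_on_def by (meson subsetD)

abbreviation triangle_integral :: "(complex \<Rightarrow> complex) \<Rightarrow> complex \<Rightarrow> complex \<Rightarrow> complex \<Rightarrow> complex" where
  "triangle_integral f a b c \<equiv>
     contour_integral (linepath a b) f + contour_integral (linepath b c) f + contour_integral (linepath c a) f"

text \<open>Affine functions integrate to zero round a triangle, so only the remainder of the
  expansion at \<open>x\<close> counts: at most \<open>e * k\<close> on each of three sides of
  length at most \<open>k\<close>.\<close>

lemma small_triangle_bound:
  assumes contf: "continuous_on T f" and T: "convex hull {a,b,c} \<subseteq> T"
    and x: "x \<in> convex hull {a,b,c}" and e: "e \<ge> 0"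
    and k: "norm (a - b) \<le> k" "norm (b - c) \<le> k" "norm (c - a) \<le> k"
    and f': "\<And>y. y \<in> T \<Longrightarrow> norm (y - x) \<le> k \<Longrightarrow> norm (f y - f x - f' * (y - x)) \<le> e * norm (y - x)"
  shows "norm (triangle_integral f a b c) \<le> 3 * e * k\<^sup>2"
proof -
  have k0: "k \<ge> 0" using k(1) norm_ge_zero order_trans by blast
  let ?g = "\<lambda>y. f y - f x - f' * (y - x)"
  have seg: "closed_segment a b \<subseteq> convex hull {a,b,c}" "closed_segment b c \<subseteq> convex hull {a,b,c}"
     "closed_segment c a \<subseteq> convex hull {a,b,c}"
    by (auto simp: segments_subset_convex_hull)
  have cg: "continuous_on T ?g" by (intro continuous_intros contf)
  have int: "h contour_integrable_on linepath u v" if "continuous_on T h" "closed_segment u v \<subseteq> convex hull {a,b,c}" for h u v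
    using that T by (meson contour_integrable_continuous_linepath continuous_on_subset order_trans)
  have 1: "norm (contour_integral (linepath u v) ?g) \<le> (e * k) * k"
    if uv: "closed_segment u v \<subseteq> convex hull {a,b,c}" "norm (u - v) \<le> k" for u v
  proof -
    have "norm (contour_integral (linepath u v) ?g) \<le> (e * k) * norm (v - u)"
    proof (rule contour_integral_bound_linepath)
      fix y assume "y \<in> closed_segment u v"
      with uv have y: "y \<in> convex hull {a,b,c}" by auto
      then have n: "norm (y - x) \<le> k" using triangle_points_closer[OF y x] k by linarith
      have "norm (?g y) \<le> e * norm (y - x)" using f'[OF _ n] y T by auto
      also have "\<dots> \<le> e * k" using n e by (intro mult_left_mono)
      finally show "norm (?g y) \<le> e * k" .
    qed (use int[OF cg uv(1)] e k0 in auto)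
    also have "\<dots> \<le> (e * k) * k" using uv(2) e k0
      by (intro mult_left_mono) (auto simp: norm_minus_commute)
    finally show ?thesis .
  qed
  have lin: "triangle_integral (\<lambda>y. f' * y + (f x - f' * x)) a b c = 0"
    by (rule has_chain_integral_chain_integral3[OF triangle_linear_has_chain_integral])
  have split: "contour_integral (linepath u v) f = contour_integral (linepath u v) ?g + contour_integral (linepath u v) (\<lambda>y. f' * y + (f x - f' * x))"
    if uv: "closed_segment u v \<subseteq> convex hull {a,b,c}" for u v
    by (subst contour_integral_add[symmetric, OF int[OF cg uv]])
       (auto intro!: int[OF _ uv] continuous_intros simp: algebra_simps)
  have "triangle_integral f a b c = triangle_integral ?g a b c"
    unfolding split[OF seg(1)] split[OF seg(2)] split[OF seg(3)] using lin by (simp add: algebra_simps)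
  also have "norm \<dots> \<le> (e * k) * k + (e * k) * k + (e * k) * k"
    by (intro norm_triangle_le add_mono 1 seg k)
  finally show ?thesis by (simp add: power2_eq_square algebra_simps)
qed

text \<open>Goursat's quadrisection with an error term. A triangle violating the bound contains
  smaller and smaller ones that violate it at their own scale; near their common point
  \<open>small_triangle_bound\<close> yields the factor 3 where the violation demands 4.\<close>

lemma near_holomorphic_triangle:
  assumes nh: "near_holomorphic_on e f (convex hull {a,b,c})"
    and contf: "continuous_on (convex hull {a,b,c}) f" and e: "e > 0"
    and K: "K > 0" "dist a b \<le> K" "dist b c \<le> K" "dist c a \<le> K"
  shows "norm (triangle_integral f a b c) \<le> 4 * e * K\<^sup>2"
proof (rule ccontr)
  let ?I = "\<lambda>x y. contour_integral (linepath x y) f"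
  let ?H = "convex hull {a,b,c}"
  assume big: "\<not> ?thesis"
  define At where "At x y z n \<longleftrightarrow> convex hull {x,y,z} \<subseteq> ?H \<and>
        dist x y \<le> K/2^n \<and> dist y z \<le> K/2^n \<and> dist z x \<le> K/2^n \<and>
        norm (?I x y + ?I y z + ?I z x) \<ge> (4*e)*(K/2^n)^2" for x y z and n::nat
  have At0: "At a b c 0" using big K by (simp add: At_def)
  have AtSuc: "\<exists>x' y' z'. At x' y' z' (Suc n) \<and> convex hull {x',y',z'} \<subseteq> convex hull {x,y,z}"
    if At: "At x y z n" for x y z n
  proof -
    have contf': "continuous_on (convex hull {x,y,z}) f"
      using contf At At_def continuous_on_subset by metis
    obtain x' y' z' where *: "{x',y',z'} \<subseteq> convex hull {x,y,z}" 
       "dist x' y' \<le> (K/2^n)/2"  "dist y' z' \<le> (K/2^n)/2"  "dist z' x' \<le> (K/2^n)/2" 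
        "norm (?I x' y' + ?I y' z' + ?I z' x') \<ge> (4*e)*((K/2^n)/2)^2"
      using Cauchy_theorem_quadrisection[OF contf', of "K/2^n" "4*e"] At
      unfolding At_def by (auto simp: add.assoc)
    have "convex hull {x',y',z'} \<subseteq> convex hull {x,y,z}"
      by (rule hull_minimal) (use *(1) in auto)
    moreover have "At x' y' z' (Suc n)"
      using * At calculation unfolding At_def by (auto simp: field_simps)
    ultimately show ?thesis by blast
  qed
  obtain fa fb fc where f0: "fa 0 = a" "fb 0 = b" "fc 0 = c"
    and At: "\<And>n. At (fa n) (fb n) (fc n) n"
    and sub: "\<And>n. convex hull {fa (Suc n), fb (Suc n), fc (Suc n)} \<subseteq> convex hull {fa n, fb n, fc n}"
    by (rule Chain3[of At a b c "\<lambda>x' y' z' x y z. convex hull {x',y',z'} \<subseteq> convex hull {x,y,z}", OF At0 AtSuc]) auto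
  obtain x where x: "\<And>n. x \<in> convex hull {fa n, fb n, fc n}"
  proof (rule bounded_closed_nest)
    show "\<And>n. closed (convex hull {fa n, fb n, fc n})"
      by (simp add: compact_imp_closed finite_imp_compact_convex_hull)
    show "\<And>m n. m \<le> n \<Longrightarrow> convex hull {fa n, fb n, fc n} \<subseteq> convex hull {fa m, fb m, fc m}"
      by (erule transitive_stepwise_le) (auto simp: sub)
  qed (fastforce intro: finite_imp_bounded_convex_hull)+
  have "x \<in> ?H" using x[of 0] f0 by simp
  then obtain f' d where d: "d > 0" and f': "\<And>y. y \<in> ?H \<Longrightarrow> norm (y - x) \<le> d \<Longrightarrow> norm (f y - f x - f' * (y - x)) \<le> e * norm (y - x)"
    using nh unfolding near_holomorphic_on_def by blast
  obtain n where n: "K/d < 2^n" using real_arch_pow[of 2] by auto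
  then have Kd: "K/2^n < d" using d by (simp add: field_simps)
  have "norm (?I (fa n) (fb n) + ?I (fb n) (fc n) + ?I (fc n) (fa n)) \<le> 3 * e * (K/2^n)\<^sup>2"
    by (rule small_triangle_bound[of ?H _ _ _ _ x _ _ f'])
       (use contf x[of n] e At[of n] f' Kd in \<open>auto simp: At_def dist_norm\<close>)
  moreover have "norm (?I (fa n) (fb n) + ?I (fb n) (fc n) + ?I (fc n) (fa n)) \<ge> (4*e) * (K/2^n)\<^sup>2"
    using At[of n] by (auto simp: At_def)
  moreover have "(3::real) * e * (K/2^n)\<^sup>2 < (4*e) * (K/2^n)\<^sup>2"
    using e K by simp
  ultimately show False by linarith
qed

text \<open>Continuity is inherited from the uniform approximants. The integral of \<open>f\<close>
  over a triangle is within \<open>3 * e * K\<close> of that of an approximant, which is at most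
  \<open>4 * e * K\<^sup>2\<close>; as e is arbitrary, Morera's theorem applies.\<close>

lemma holomorphic_limit_near_holomorphic:
  assumes S: "open S"
    and ap: "\<And>e. e > 0 \<Longrightarrow> \<exists>g. continuous_on S g \<and> near_holomorphic_on e g S \<and> (\<forall>z\<in>S. norm (g z - f z) \<le> e)"
  shows "f holomorphic_on S"
proof -
  have contf: "continuous_on S f"
  proof -
    define g where "g n = (SOME g. continuous_on S g \<and> near_holomorphic_on (inverse (real (Suc n))) g S \<and> (\<forall>z\<in>S. norm (g z - f z) \<le> inverse (real (Suc n))))" for n
    have g: "continuous_on S (g n)" "\<forall>z\<in>S. norm (g n z - f z) \<le> inverse (real (Suc n))" for n
      using someI_ex[OF ap[of "inverse (real (Suc n))"]] unfolding g_def by auto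
    have "uniform_limit S g f sequentially"
    proof (rule uniform_limitI)
      fix e::real assume "e > 0"
      then have "\<forall>\<^sub>F n in sequentially. inverse (real (Suc n)) < e"
        using LIMSEQ_inverse_real_of_nat order_tendstoD(2) by blast
      then show "\<forall>\<^sub>F n in sequentially. \<forall>x\<in>S. dist (g n x) (f x) < e"
        by eventually_elim (use g(2) in \<open>auto simp: dist_norm intro: le_less_trans\<close>)
    qed
    then show ?thesis using g(1) by (intro uniform_limit_theorem) auto
  qed
  have "f analytic_on S"
  proof (rule Morera_local_triangle)
    fix z assume z: "z \<in> S"
    obtain r where r: "r > 0" "ball z r \<subseteq> S" using S z open_contains_ball by blast
    have "triangle_integral f a b c = 0"
      if abc: "convex hull {a,b,c} \<subseteq> ball z r" for a b c
    proof -
      let ?I = "\<lambda>f. triangle_integral f a b c"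
      define K where "K = 1 + dist a b + dist b c + dist c a"
      have K: "K > 0" "dist a b \<le> K" "dist b c \<le> K" "dist c a \<le> K" 
        using zero_le_dist[of a b] zero_le_dist[of b c] zero_le_dist[of c a] unfolding K_def by linarith+
      have HS: "convex hull {a,b,c} \<subseteq> S" using abc r by auto
      have bnd: "norm (?I f) \<le> e * (4 * K\<^sup>2 + 3 * K)" if e: "e > 0" for e
      proof -
        obtain g where g: "continuous_on S g" "near_holomorphic_on e g S" "\<And>z. z \<in> S \<Longrightarrow> norm (g z - f z) \<le> e"
          using ap[OF e] by blast
        have 1: "norm (?I g) \<le> 4 * e * K\<^sup>2"
          by (rule near_holomorphic_triangle) (use g HS e K in \<open>auto intro: near_holomorphic_on_subset continuous_on_subset\<close>)
        have seg: "closed_segment a b \<subseteq> S" "closed_segment b c \<subseteq> S" "closed_segment c a \<subseteq> S"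
          using HS segments_subset_convex_hull by (meson order_trans)+
        have int: "h contour_integrable_on linepath u v" if "continuous_on S h" "closed_segment u v \<subseteq> S" for h u v
          using that by (meson contour_integrable_continuous_linepath continuous_on_subset)
        have 2: "norm (contour_integral (linepath u v) f - contour_integral (linepath u v) g) \<le> e * K" 
          if uv: "closed_segment u v \<subseteq> S" "dist u v \<le> K" for u v
        proof -
          have "contour_integral (linepath u v) f - contour_integral (linepath u v) g = contour_integral (linepath u v) (\<lambda>x. f x - g x)"
            using uv by (simp add: contour_integral_diff int contf g(1))
          also have "norm \<dots> \<le> e * norm (v - u)"
            by (rule contour_integral_bound_linepath)
              (use uv g e in \<open>auto intro!: int contf continuous_intros simp: norm_minus_commute subset_iff\<close>)
          also have "\<dots> \<le> e * K" using uv(2) e by (intro mult_left_mono) (auto simp: dist_norm norm_minus_commute)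
          finally show ?thesis .
        qed
        have "?I f = ?I g + ((contour_integral (linepath a b) f - contour_integral (linepath a b) g) + 
             (contour_integral (linepath b c) f - contour_integral (linepath b c) g) +
             (contour_integral (linepath c a) f - contour_integral (linepath c a) g))" by simp
        also have "norm \<dots> \<le> 4 * e * K\<^sup>2 + (e * K + e * K + e * K)"
          by (intro norm_triangle_le add_mono 1 2 seg K)
        finally show ?thesis by (simp add: algebra_simps)
      qed
      have "norm (?I f) \<le> 0 + d" if "d > 0" for d
      proof -
        have pos: "4 * K\<^sup>2 + 3 * K > 0" using K by (simp add: add_pos_pos)
        show ?thesis using bnd[of "d / (4 * K\<^sup>2 + 3 * K)"] pos that by simp
      qed
      then have "norm (?I f) \<le> 0" by (rule field_le_epsilon)
      then show ?thesis by simp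
    qed
    then show "\<exists>t. open t \<and> z \<in> t \<and> continuous_on t f \<and> (\<forall>a b c. convex hull {a,b,c} \<subseteq> t
        \<longrightarrow> triangle_integral f a b c = 0)"
      using r by (intro exI[of _ "ball z r"]) (auto intro: continuous_on_subset[OF contf])
  qed
  then show ?thesis by (rule analytic_imp_holomorphic)
qed

section \<open>The Cauchy transform\<close>

lemma has_integral_abs_powr:
  assumes e: "(e::real) \<ge> 0"
  shows "((\<lambda>x. \<bar>x\<bar> powr (-1/2)) has_integral (4 * sqrt e)) {-e..e}"
proof -
  have 1: "((\<lambda>x. \<bar>x\<bar> powr (-1/2)) has_integral (2 * sqrt e)) {0..e}"
  proof -
    have "((\<lambda>x. x powr (-1/2)) has_integral (2 * sqrt e)) {0..e}"
      using has_integral_powr_from_0[of "-1/2" e] e by (simp add: powr_half_sqrt mult.commute)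
    then show ?thesis by (rule has_integral_eq[rotated]) auto
  qed
  have 2: "((\<lambda>x. \<bar>x\<bar> powr (-1/2)) has_integral (2 * sqrt e)) {-e..0}"
    using 1 has_integral_reflect_real[of "\<lambda>x. \<bar>x\<bar> powr (-1/2)" "2 * sqrt e" e 0] by simp
  show ?thesis
    using has_integral_combine[OF _ _ 2 1] e by simp
qed

abbreviation sqbox :: "real \<Rightarrow> complex set" where
  "sqbox e \<equiv> cbox (Complex (-e) (-e)) (Complex e e)"

lemma mem_sqbox: "z \<in> sqbox e \<longleftrightarrow> \<bar>Re z\<bar> \<le> e \<and> \<bar>Im z\<bar> \<le> e"
  by (auto simp: in_cbox_complex_iff)

lemma cball_subset_sqbox: "cball 0 e \<subseteq> sqbox e"
  by (auto simp: mem_sqbox intro: order_trans[OF abs_Re_le_cmod] order_trans[OF abs_Im_le_cmod])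

text \<open>From |x y| \<le> |\<zeta>|^2 follows 1/|\<zeta>| \<le> |x|^(-1/2) |y|^(-1/2), so Tonelli
  reduces the singularity in the plane to two on the line and polar coordinates are avoided; 16 e is
  the square of 4 sqrt e.\<close>

lemma nn_integral_inverse_sqbox:
  assumes e: "e \<ge> 0"
  shows "(\<integral>\<^sup>+\<zeta>. indicator (sqbox e) \<zeta> * ennreal (norm (inverse \<zeta>)) \<partial>lborel) \<le> ennreal (16 * e)"
proof -
  define F where "F x = indicator {-e..e} x * ennreal (\<bar>x\<bar> powr (-1/2))" for x
  have F: "integral\<^sup>N lborel F = ennreal (4 * sqrt e)"
    using nn_integral_has_integral_lebesgue'[OF _ has_integral_abs_powr[OF e]] 
    by (simp add: F_def[abs_def] mult.commute)
  \<comment> \<open>On the axes the majorant is 0, since \<open>0 powr (-1/2) = 0\<close>, and the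
    bound fails; but they are null sets.\<close>
  have "AE \<zeta> in lborel. \<zeta> \<bullet> (1::complex) \<noteq> 0"
    by (rule AE_lborel_inner_neq) (simp add: Basis_complex_def)
  moreover have "AE \<zeta> in lborel. \<zeta> \<bullet> \<i> \<noteq> 0"
    by (rule AE_lborel_inner_neq) (simp add: Basis_complex_def)
  ultimately have "AE \<zeta> in lborel. indicator (sqbox e) \<zeta> * ennreal (norm (inverse \<zeta>)) \<le> (\<Prod>b\<in>Basis. F (\<zeta> \<bullet> b))"
  proof eventually_elim
    fix \<zeta>::complex assume nz: "\<zeta> \<bullet> 1 \<noteq> 0" "\<zeta> \<bullet> \<i> \<noteq> 0"
    let ?x = "Re \<zeta>" and ?y = "Im \<zeta>"
    have nz': "?x \<noteq> 0" "?y \<noteq> 0" using nz by (auto simp: inner_complex_def)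
    have P: "(\<Prod>b\<in>Basis. F (\<zeta> \<bullet> b)) = F ?x * F ?y"
      by (simp add: Basis_complex_def inner_complex_def)
    show "indicator (sqbox e) \<zeta> * ennreal (norm (inverse \<zeta>)) \<le> (\<Prod>b\<in>Basis. F (\<zeta> \<bullet> b))"
    proof (cases "\<zeta> \<in> sqbox e")
      case True
      then have xy: "?x \<in> {-e..e}" "?y \<in> {-e..e}" by (auto simp: mem_sqbox)
      have "\<bar>?x\<bar> * \<bar>?y\<bar> \<le> (norm \<zeta>)\<^sup>2"
      proof -
        have "0 \<le> (\<bar>?x\<bar> - \<bar>?y\<bar>)\<^sup>2 + ?x\<^sup>2 + ?y\<^sup>2" by simp
        then have "\<bar>?x\<bar> * \<bar>?y\<bar> \<le> ?x\<^sup>2 + ?y\<^sup>2" by (simp add: power2_eq_square algebra_simps)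
        then show ?thesis unfolding cmod_power2 .
      qed
      then have le: "sqrt (\<bar>?x\<bar> * \<bar>?y\<bar>) \<le> norm \<zeta>" by (simp add: real_le_lsqrt)
      have "norm (inverse \<zeta>) \<le> inverse (sqrt (\<bar>?x\<bar> * \<bar>?y\<bar>))"
        using le nz' by (simp add: norm_inverse le_imp_inverse_le)
      also have "\<dots> = \<bar>?x\<bar> powr (-1/2) * \<bar>?y\<bar> powr (-1/2)"
        using nz' by (simp add: powr_minus powr_half_sqrt real_sqrt_mult)
      finally show ?thesis unfolding P using True xy
        by (auto simp: F_def ennreal_mult[symmetric] intro!: ennreal_leI)
    qed auto
  qed
  then have "(\<integral>\<^sup>+\<zeta>. indicator (sqbox e) \<zeta> * ennreal (norm (inverse \<zeta>)) \<partial>lborel) \<le> (\<integral>\<^sup>+\<zeta>. (\<Prod>b\<in>Basis. F ((\<zeta>::complex) \<bullet> b)) \<partial>lborel)"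
    by (rule nn_integral_mono_AE)
  also have "\<dots> = (\<Prod>b\<in>(Basis::complex set). integral\<^sup>N lborel F)"
    by (rule nn_integral_lborel_prod) (auto simp: F_def)
  also have "\<dots> = ennreal (16 * e)"
    unfolding F using e by (simp add: Basis_complex_def ennreal_mult[symmetric])
  finally show ?thesis .
qed

lemma nn_integral_inverse_shift:
  assumes e: "e \<ge> 0"
  shows "(\<integral>\<^sup>+w. indicator (sqbox e) (z - w) * ennreal (norm (inverse (z - w))) \<partial>lborel) \<le> ennreal (16 * e)"
proof -
  let ?g = "\<lambda>\<zeta>. indicator (sqbox e) \<zeta> * ennreal (norm (inverse \<zeta>))"
  have g: "?g (- \<zeta>) = ?g \<zeta>" for \<zeta> by (auto simp: indicator_def mem_sqbox norm_inverse norm_minus_commute)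
  have gm: "?g \<in> borel_measurable borel" by measurable
  have "(\<integral>\<^sup>+w. ?g (z - w) \<partial>lborel) = (\<integral>\<^sup>+w. ?g (-z + w) \<partial>lborel)"
  proof (rule nn_integral_cong)
    fix w show "?g (z - w) = ?g (- z + w)" using g[of "- z + w"] by (simp only: minus_add_distrib minus_minus add_uminus_conv_diff)
  qed
  also have "\<dots> = integral\<^sup>N (distr lborel borel ((+) (-z))) ?g"
    by (subst nn_integral_distr) auto
  also have "\<dots> = integral\<^sup>N lborel ?g" by (simp only: lborel_distr_plus)
  finally show ?thesis using nn_integral_inverse_sqbox[OF e] by simp
qed

lemma nn_integral_cmult_inverse:
  "(\<integral>\<^sup>+w. ennreal M * (indicator (cbox a b) (z - w) * ennreal (norm (inverse (z - w::complex)))) \<partial>lborel)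
    = ennreal M * (\<integral>\<^sup>+w. (indicator (cbox a b) (z - w) * ennreal (norm (inverse (z - w)))) \<partial>lborel)"
  by (rule nn_integral_cmult) measurable

text \<open>The density is cut off sharply by a fixed square around the disc of radius 3 instead of
  being required to have compact support.\<close>

definition cauchy_transform :: "(complex \<Rightarrow> complex) \<Rightarrow> complex \<Rightarrow> complex" where
  "cauchy_transform v z = (LINT w:sqbox 3|lborel. v w * inverse (z - w))"

lemma sqbox_diff: "norm z \<le> 3 \<Longrightarrow> w \<in> sqbox 3 \<Longrightarrow> z - w \<in> sqbox 6"
  using abs_Re_le_cmod[of z] abs_Im_le_cmod[of z] by (auto simp: mem_sqbox)

context
  fixes v :: "complex \<Rightarrow> complex" and M :: real
  assumes contv: "continuous_on UNIV v" and M: "\<And>z. norm (v z) \<le> M"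
begin

lemma M_nonneg: "M \<ge> 0" using M[of 0] norm_ge_zero order_trans by blast

lemma v_measurable: "v \<in> borel_measurable borel"
  using contv by (rule borel_measurable_continuous_onI)

lemma nn_cauchy:
  assumes "norm z \<le> 3"
  shows "(\<integral>\<^sup>+w. ennreal (norm (indicat_real (sqbox 3) w *\<^sub>R (v w * inverse (z - w)))) \<partial>lborel) \<le> ennreal (96 * M)"
    (is "?L \<le> _")
proof -
  let ?J = "\<integral>\<^sup>+w. (indicator (sqbox 6) (z - w) * ennreal (norm (inverse (z - w)))) \<partial>lborel"
  have 1: "?L \<le> (\<integral>\<^sup>+w. ennreal M * (indicator (sqbox 6) (z - w) * ennreal (norm (inverse (z - w)))) \<partial>lborel)"
  proof (rule nn_integral_mono)
    fix w
    have "norm (v w) * norm (inverse (z - w)) \<le> M * norm (inverse (z - w))"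
      by (intro mult_right_mono M) auto
    then have "ennreal (norm (v w * inverse (z - w))) \<le> ennreal M * ennreal (norm (inverse (z - w)))"
      using M_nonneg by (subst ennreal_mult[symmetric]) (auto simp: norm_mult intro: ennreal_leI)
    then show "ennreal (norm (indicat_real (sqbox 3) w *\<^sub>R (v w * inverse (z - w)))) \<le>
      ennreal M * (indicator (sqbox 6) (z - w) * ennreal (norm (inverse (z - w))))"
      using sqbox_diff[OF assms, of w] by (cases "w \<in> sqbox 3") auto
  qed
  have 2: "?J \<le> ennreal (16 * 6)" by (rule nn_integral_inverse_shift) simp
  have 3: "ennreal M * ?J \<le> ennreal M * ennreal (16 * 6)" using 2 by (rule mult_left_mono) simp
  have 4: "ennreal M * ennreal (16 * 6) = ennreal (M * (16 * 6))" by (rule ennreal_mult[symmetric]) (use M_nonneg in auto)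
  have 5: "M * (16 * 6) = 96 * M" by simp
  note 6 = 1[unfolded nn_integral_cmult_inverse]
  note 7 = order_trans[OF 6 3]
  note 8 = 7[unfolded 4 5]
  show ?thesis
    by (rule 8)
qed

lemma cauchy_integrable:
  assumes "norm z \<le> 3"
  shows "set_integrable lborel (sqbox 3) (\<lambda>w. v w * inverse (z - w))"
  unfolding set_integrable_def integrable_iff_bounded
proof
  show "(\<lambda>x. indicat_real (sqbox 3) x *\<^sub>R (v x * inverse (z - x))) \<in> borel_measurable lborel"
    using v_measurable by measurable
  show "(\<integral>\<^sup>+ x. ennreal (norm (indicat_real (sqbox 3) x *\<^sub>R (v x * inverse (z - x)))) \<partial>lborel) < \<infinity>"
    unfolding infinity_ennreal_def using order_le_less_trans[OF nn_cauchy[OF assms] ennreal_less_top] .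
qed

end

lemma cauchy_transform_linear:
  fixes v :: "'i \<Rightarrow> complex \<Rightarrow> complex"
  assumes "\<And>i. i \<in> I \<Longrightarrow> continuous_on UNIV (v i)" "\<And>i z. i \<in> I \<Longrightarrow> norm (v i z) \<le> M i" "norm z \<le> 3"
  shows "cauchy_transform (\<lambda>w. \<Sum>i\<in>I. c i * v i w) z = (\<Sum>i\<in>I. c i * cauchy_transform (v i) z)"
proof -
  have int: "integrable lborel (\<lambda>w. indicat_real (sqbox 3) w *\<^sub>R (v i w * inverse (z - w)))" if "i \<in> I" for i
    using cauchy_integrable[OF assms(1,2,3), of i] that by (auto simp: set_integrable_def)
  have "cauchy_transform (\<lambda>w. \<Sum>i\<in>I. c i * v i w) z
     = (LINT w|lborel. (\<Sum>i\<in>I. c i * (indicat_real (sqbox 3) w *\<^sub>R (v i w * inverse (z - w)))))"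
    unfolding cauchy_transform_def set_lebesgue_integral_def
    by (intro Bochner_Integration.integral_cong refl)
       (simp only: sum_distrib_right scaleR_sum_right mult.assoc mult_scaleR_right)
  also have "\<dots> = (\<Sum>i\<in>I. LINT w|lborel. c i * (indicat_real (sqbox 3) w *\<^sub>R (v i w * inverse (z - w))))"
    by (intro Bochner_Integration.integral_sum integrable_mult_right int)
  also have "\<dots> = (\<Sum>i\<in>I. c i * cauchy_transform (v i) z)"
    unfolding cauchy_transform_def set_lebesgue_integral_def
    by (intro sum.cong refl Bochner_Integration.integral_mult_right) (rule int)
  finally show ?thesis .
qed

section \<open>The dbar operator, its weak form, and a regularised Cauchy kernel\<close>

definition has_dbar :: "(complex \<Rightarrow> complex) \<Rightarrow> complex \<Rightarrow> complex \<Rightarrow> bool" where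
  "has_dbar f a z \<longleftrightarrow> (\<exists>D. (f has_derivative (\<lambda>h. D * h + a * cnj h)) (at z))"

text \<open>The equation \<open>dbar f = \<eta>\<close> in a form that passes to uniform limits; the approximations \<open>g\<close> need
  not be differentiable.\<close>

definition weak_dbar :: "complex set \<Rightarrow> (complex \<Rightarrow> complex) \<Rightarrow> (complex \<Rightarrow> complex) \<Rightarrow> bool" where
  "weak_dbar S f \<eta> \<longleftrightarrow> (\<forall>e>0. \<exists>g. continuous_on S g \<and> (\<forall>z\<in>S. norm (g z - f z) \<le> e) \<and>
     (\<forall>x\<in>S. \<exists>D d. d > 0 \<and> (\<forall>y\<in>S. norm (y - x) \<le> d \<longrightarrow>
        norm (g y - g x - (D * (y - x) + \<eta> x * cnj (y - x))) \<le> e * norm (y - x))))"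

lemma weak_dbar_approx:
  assumes "\<And>e. e > 0 \<Longrightarrow> \<exists>g a. \<forall>z\<in>S. has_dbar g (a z) z \<and> norm (a z - \<eta> z) \<le> e \<and> norm (g z - f z) \<le> e"
  shows "weak_dbar S f \<eta>"
  unfolding weak_dbar_def
proof (intro allI impI)
  fix e::real assume e: "e > 0"
  obtain g a where ga: "\<And>z. z \<in> S \<Longrightarrow> has_dbar g (a z) z" "\<And>z. z \<in> S \<Longrightarrow> norm (a z - \<eta> z) \<le> e/2" "\<And>z. z \<in> S \<Longrightarrow> norm (g z - f z) \<le> e/2"
    using assms[of "e/2"] e by (metis half_gt_zero)
  have "continuous_on S g"
    using ga(1) unfolding has_dbar_def by (meson continuous_at_imp_continuous_on has_derivative_continuous)
  moreover have "\<exists>D d. d > 0 \<and> (\<forall>y\<in>S. norm (y - x) \<le> d \<longrightarrow>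
        norm (g y - g x - (D * (y - x) + \<eta> x * cnj (y - x))) \<le> e * norm (y - x))" if x: "x \<in> S" for x
  proof -
    obtain D where D: "(g has_derivative (\<lambda>h. D * h + a x * cnj h)) (at x)" using ga(1)[OF x] by (auto simp: has_dbar_def)
    then obtain d where d: "d > 0" "\<And>y. norm (y - x) < d \<Longrightarrow> norm (g y - g x - (D * (y - x) + a x * cnj (y - x))) \<le> e/2 * norm (y - x)"
      using e unfolding has_derivative_at_alt by (metis half_gt_zero)
    have "norm (g y - g x - (D * (y - x) + \<eta> x * cnj (y - x))) \<le> e * norm (y - x)" if "norm (y - x) \<le> d/2" for y
    proof -
      have "norm (y - x) < d" using that d(1) by simp
      have "g y - g x - (D * (y - x) + \<eta> x * cnj (y - x)) = (g y - g x - (D * (y - x) + a x * cnj (y - x))) + (a x - \<eta> x) * cnj (y - x)"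
        by (simp add: algebra_simps)
      also have "norm \<dots> \<le> e/2 * norm (y - x) + e/2 * norm (y - x)"
      proof (intro norm_triangle_le add_mono d(2))
        show "norm ((a x - \<eta> x) * cnj (y - x)) \<le> e/2 * norm (y - x)"
          unfolding norm_mult complex_mod_cnj using ga(2)[OF x] by (intro mult_right_mono) auto
      qed fact
      finally show ?thesis by simp
    qed
    then show ?thesis using d(1) by (intro exI[of _ D] exI[of _ "d/2"]) auto
  qed
  ultimately show "\<exists>g. continuous_on S g \<and> (\<forall>z\<in>S. norm (g z - f z) \<le> e) \<and>
     (\<forall>x\<in>S. \<exists>D d. d > 0 \<and> (\<forall>y\<in>S. norm (y - x) \<le> d \<longrightarrow>
        norm (g y - g x - (D * (y - x) + \<eta> x * cnj (y - x))) \<le> e * norm (y - x)))"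
  proof (intro exI[of _ g] conjI ballI)
    fix z assume "z \<in> S" then show "norm (g z - f z) \<le> e" using ga(3)[of z] e by linarith
  qed auto
qed

text \<open>The kernel \<open>1/z = cnj z / |z|\<^sup>2\<close> is made \<open>C\<^sup>1\<close> by changing \<open>1/s\<close> for \<open>s \<le> r\<^sup>2\<close>; \<open>ker_dz\<close> and \<open>ker_dbar\<close> are the
  Wirtinger derivatives of the new kernel.\<close>

definition inv_reg :: "real \<Rightarrow> real \<Rightarrow> real" where
  "inv_reg r s = (if s \<in> {..r\<^sup>2} then (2*r\<^sup>2 - s)/r^4 else 1/s)"

definition inv_reg' :: "real \<Rightarrow> real \<Rightarrow> real" where
  "inv_reg' r s = (if s \<in> {..r\<^sup>2} then -1/r^4 else -1/s\<^sup>2)"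

text \<open>The branch for small \<open>s\<close> is the tangent line of 1/s at
  \<open>r\<^sup>2\<close>, so that values and slopes agree at the seam.\<close>

lemma inv_reg_deriv:
  assumes r: "r > 0"
  shows "(inv_reg r has_field_derivative inv_reg' r s) (at s)"
proof -
  have cl: "closure {..r\<^sup>2} = {..r\<^sup>2}" "closure {r\<^sup>2<..} = {r\<^sup>2..}" by auto
  have U: "{..r\<^sup>2} \<union> {r\<^sup>2<..} = UNIV" by auto
  have sq: "r\<^sup>2 > 0" using r by simp
  have 1: "((\<lambda>s. (2*r\<^sup>2 - s)/r^4) has_derivative (\<lambda>h. -1/r^4 * h)) (at s within X)" for X
  proof -
    have "((\<lambda>s. (2*r\<^sup>2 - s) * (1/r^4)) has_derivative (\<lambda>h. (0 - h) * (1/r^4))) (at s within X)"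
      by (intro derivative_intros)
    then show ?thesis by (simp add: mult.commute)
  qed
  have 2: "((\<lambda>s. 1/s) has_derivative (\<lambda>h. -1/s\<^sup>2 * h)) (at s within X)" if "s \<ge> r\<^sup>2" for X
  proof -
    have "s \<noteq> 0" using that sq by auto
    then have "((\<lambda>s. inverse s) has_field_derivative - (inverse s ^ Suc (Suc 0))) (at s within X)"
      by (rule DERIV_inverse)
    then have d: "(inverse has_derivative (\<lambda>h. - (inverse s ^ Suc (Suc 0)) * h)) (at s within X)"
      unfolding has_field_derivative_def .
    have f: "(\<lambda>s::real. 1/s) = inverse" by (auto simp: fun_eq_iff divide_inverse)
    show ?thesis unfolding f
      by (rule has_derivative_eq_rhs[OF d]) (simp add: fun_eq_iff divide_inverse power2_eq_square)
  qed
  have "((\<lambda>s. if s \<in> {..r\<^sup>2} then (2*r\<^sup>2 - s)/r^4 else 1/s) has_derivative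
     (if s \<in> {..r\<^sup>2} then (\<lambda>h. -1/r^4 * h) else (\<lambda>h. -1/s\<^sup>2 * h))) (at s within {..r\<^sup>2} \<union> {r\<^sup>2<..})"
    by (rule has_derivative_If_within_closures[where f'="\<lambda>s h. -1/r^4 * h" and g'="\<lambda>s h. -1/s\<^sup>2 * h"])
       (use 1 2 r in \<open>auto simp: cl fun_eq_iff power2_eq_square field_simps eval_nat_numeral\<close>)
  then show ?thesis unfolding U has_field_derivative_def inv_reg_def[abs_def] inv_reg'_def
    by (auto simp: fun_eq_iff elim!: has_derivative_eq_rhs)
qed

lemma inv_reg_cont: "r > 0 \<Longrightarrow> continuous_on UNIV (inv_reg r)"
  by (meson inv_reg_deriv DERIV_continuous_on has_field_derivative_at_within)

lemma inv_reg'_cont: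
  assumes r: "r > 0" shows "continuous_on UNIV (inv_reg' r)"
proof -
  have sq: "r\<^sup>2 > 0" using r by simp
  have "inv_reg' r = (\<lambda>s. - 1 / (max s (r\<^sup>2))\<^sup>2)"
    by (auto simp: inv_reg'_def fun_eq_iff max_def)
  moreover have "continuous_on UNIV (\<lambda>s. - 1 / (max s (r\<^sup>2))\<^sup>2)"
    using sq by (intro continuous_intros) (auto simp: max_def)
  ultimately show ?thesis by simp
qed

definition ker_reg :: "real \<Rightarrow> complex \<Rightarrow> complex" where
  "ker_reg r z = cnj z * of_real (inv_reg r ((norm z)\<^sup>2))"

definition ker_dz :: "real \<Rightarrow> complex \<Rightarrow> complex" where
  "ker_dz r z = (cnj z)\<^sup>2 * of_real (inv_reg' r ((norm z)\<^sup>2))"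

definition ker_dbar :: "real \<Rightarrow> complex \<Rightarrow> real" where
  "ker_dbar r z = inv_reg r ((norm z)\<^sup>2) + (norm z)\<^sup>2 * inv_reg' r ((norm z)\<^sup>2)"

lemma ker_reg_deriv:
  assumes r: "r > 0"
  shows "(ker_reg r has_derivative (\<lambda>h. ker_dz r z * h + of_real (ker_dbar r z) * cnj h)) (at z)"
proof -
  have sq: "((\<lambda>z. (norm z)\<^sup>2) has_derivative (\<lambda>h. 2 * Re (cnj z * h))) (at z)" for z::complex
  proof -
    have "((\<lambda>z. z \<bullet> z) has_derivative (\<lambda>h. z \<bullet> h + h \<bullet> z)) (at z)"
      by (auto intro!: derivative_eq_intros)
    then show ?thesis by (simp add: power2_norm_eq_inner inner_complex_def algebra_simps)
  qed
  have g: "((\<lambda>z. inv_reg r ((norm z)\<^sup>2)) has_derivative (\<lambda>h. inv_reg' r ((norm z)\<^sup>2) * (2 * Re (cnj z * h)))) (at z)"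
    using has_derivative_compose[OF sq inv_reg_deriv[OF r, unfolded has_field_derivative_def]] by simp
  have "((\<lambda>z. cnj z * of_real (inv_reg r ((norm z)\<^sup>2))) has_derivative
     (\<lambda>h. cnj z * of_real (inv_reg' r ((norm z)\<^sup>2) * (2 * Re (cnj z * h))) + cnj h * of_real (inv_reg r ((norm z)\<^sup>2)))) (at z)"
    by (rule has_derivative_mult[OF has_derivative_cnj[OF has_derivative_ident] has_derivative_of_real[OF g]])
  moreover have "cnj z * of_real (inv_reg' r ((norm z)\<^sup>2) * (2 * Re (cnj z * h))) + cnj h * of_real (inv_reg r ((norm z)\<^sup>2))
     = ker_dz r z * h + of_real (ker_dbar r z) * cnj h" for h
  proof -
    have "of_real (2 * Re (cnj z * h)) = cnj z * h + z * cnj h"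
      using complex_add_cnj[of "cnj z * h"] by simp
    moreover have "complex_of_real ((norm z)\<^sup>2) = z * cnj z" by (simp only: complex_norm_square)
    ultimately show ?thesis
      unfolding ker_dz_def ker_dbar_def of_real_add of_real_mult by (simp add: power2_eq_square algebra_simps)
  qed
  ultimately show ?thesis by (simp add: ker_reg_def[abs_def])
qed

lemma ker_reg_cont: "r > 0 \<Longrightarrow> continuous_on UNIV (ker_reg r)"
  by (intro continuous_at_imp_continuous_on ballI has_derivative_continuous[OF ker_reg_deriv])

lemma ker_dz_cont: "r > 0 \<Longrightarrow> continuous_on UNIV (ker_dz r)"
  unfolding ker_dz_def[abs_def]
  by (intro continuous_intros continuous_on_compose2[OF inv_reg'_cont]) auto

lemma ker_dbar_cont: "r > 0 \<Longrightarrow> continuous_on UNIV (ker_dbar r)"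
  unfolding ker_dbar_def[abs_def]
  by (intro continuous_intros continuous_on_compose2[OF inv_reg'_cont] continuous_on_compose2[OF inv_reg_cont]) auto

text \<open>Beyond radius \<open>r\<close> the kernel is the holomorphic 1/z, so its dbar lives on
  the disc. Being nonnegative there, with a mass that does not depend on \<open>r\<close>, it is an
  approximate identity.\<close>

lemma ker_dbar_eq: "r > 0 \<Longrightarrow> ker_dbar r z = (if norm z \<le> r then 2/r\<^sup>2 * (1 - (norm z / r)\<^sup>2) else 0)"
proof (cases "norm z \<le> r")
  case True
  assume e: "r > 0"
  have "(norm z)\<^sup>2 \<le> r\<^sup>2" using True by (intro power_mono) auto
  then show ?thesis using True e by (simp add: ker_dbar_def inv_reg_def inv_reg'_def field_simps eval_nat_numeral)
next
  case False
  assume e: "r > 0"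
  then have "\<not> (norm z)\<^sup>2 \<le> r\<^sup>2" "norm z > 0" using False by (auto simp: abs_le_square_iff[symmetric])
  then show ?thesis using False e by (simp add: ker_dbar_def inv_reg_def inv_reg'_def field_simps eval_nat_numeral)
qed

lemma ker_dbar_nonneg: "r > 0 \<Longrightarrow> ker_dbar r z \<ge> 0"
  by (auto simp: ker_dbar_eq power_le_one_iff)

lemma ker_dbar_scale: "r > 0 \<Longrightarrow> ker_dbar r z = ker_dbar 1 (z /\<^sub>R r) / r\<^sup>2"
  by (auto simp: ker_dbar_eq field_simps)

lemma ker_reg_eq: "r > 0 \<Longrightarrow> norm z > r \<Longrightarrow> ker_reg r z = inverse z"
proof -
  assume a: "r > 0" "norm z > r"
  then have "\<not> (norm z)\<^sup>2 \<le> r\<^sup>2" by (auto simp: abs_le_square_iff[symmetric])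
  then have "ker_reg r z = cnj z / of_real ((norm z)\<^sup>2)" by (simp add: ker_reg_def inv_reg_def)
  also have "\<dots> = inverse z" using a unfolding complex_norm_square by (auto simp: field_simps)
  finally show ?thesis .
qed

lemma ker_reg_diff_le:
  assumes r: "r > 0"
  shows "norm (inverse z - ker_reg r z) \<le> indicator (sqbox r) z * norm (inverse z)"
proof (cases "norm z > r")
  case True then show ?thesis using ker_reg_eq[OF r True] by simp
next
  case False
  have zin: "z \<in> sqbox r" using False cball_subset_sqbox[of r] by auto
  show ?thesis
  proof (cases "z = 0")
    case False
    let ?s = "(norm z)\<^sup>2"
    have s: "?s > 0" "?s \<le> r\<^sup>2" using False \<open>\<not> norm z > r\<close> by (auto intro: power_mono)
    have e4: "r^4 = r\<^sup>2 * r\<^sup>2" by (simp add: power_add[symmetric])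
    have "ker_reg r z = inverse z * of_real (?s * inv_reg r ?s)"
      using False unfolding of_real_mult complex_norm_square ker_reg_def by simp
    then have "inverse z - ker_reg r z = inverse z * of_real (1 - ?s * inv_reg r ?s)"
      by (simp only: of_real_diff of_real_1 right_diff_distrib mult_1_right)
    then have "norm (inverse z - ker_reg r z) = norm (inverse z) * norm (1 - ?s * inv_reg r ?s)"
      by (simp only: norm_mult norm_of_real real_norm_def)
    also have "\<dots> \<le> norm (inverse z) * 1"
    proof (intro mult_left_mono)
      \<comment> \<open>With t = s/r^2 in [0,1] the relative error is 1 - t (2 - t) = (1 -
        t)^2.\<close>
      have t: "1 - ?s * inv_reg r ?s = (1 - ?s/r\<^sup>2)\<^sup>2"
        using s r by (simp add: inv_reg_def e4 power2_eq_square field_simps)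
      have "0 \<le> 1 - ?s/r\<^sup>2" "1 - ?s/r\<^sup>2 \<le> 1" using s r by (auto simp: field_simps)
      then show "norm (1 - ?s * inv_reg r ?s) \<le> 1" unfolding t by (simp add: power_le_one)
    qed auto
    finally show ?thesis using zin by simp
  qed (use zin in \<open>simp add: ker_reg_def\<close>)
qed

text \<open>This is \<pi>, the mass of the dbar of 1/z. Kept as an integral, it only has to be shown
  positive.\<close>

definition cauchy_const :: real where "cauchy_const = integral (sqbox 1) (ker_dbar 1)"

lemma cauchy_const_pos: "cauchy_const > 0"
proof -
  have c: "continuous_on (sqbox 1) (ker_dbar 1)" by (rule continuous_on_subset[OF ker_dbar_cont]) auto
  have "integral (sqbox 1) (ker_dbar 1) \<noteq> 0"
  proof -
    have "0 \<in> box (Complex (-1) (-1)) (Complex 1 1)" by (auto simp: in_box_complex_iff)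
    then have "box (Complex (-1) (-1)) (Complex 1 1) \<noteq> {}" by blast
    moreover have "ker_dbar 1 0 \<noteq> 0" by (simp add: ker_dbar_eq)
    moreover have "0 \<in> sqbox 1" by (simp add: mem_sqbox)
    moreover have "(integral (sqbox 1) (ker_dbar 1) = 0) \<longleftrightarrow> (\<forall>x\<in>sqbox 1. ker_dbar 1 x = 0)"
      by (rule integral_cbox_eq_0_iff[OF c calculation(1)]) (rule ker_dbar_nonneg, simp)
    ultimately show ?thesis by blast
  qed
  moreover have "integral (sqbox 1) (ker_dbar 1) \<ge> 0"
    using ker_dbar_nonneg[of 1] by (intro integral_nonneg integrable_continuous c) auto
  ultimately show ?thesis by (simp add: cauchy_const_def)
qed

text \<open>The substitution w = z + r x reduces the claim to \<open>r = 1\<close>. The bounds 5/2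
  and 1/2 keep the support, a disc of radius \<open>r\<close> about \<open>z\<close>, inside the
  square of integration; this is where the radius 5/2 of all later weak equations comes
  from.\<close>

lemma ker_dbar_has_integral:
  assumes r: "0 < r" "r \<le> 1/2" and z: "norm z \<le> 5/2"
  shows "((\<lambda>w. ker_dbar r (z - w)) has_integral cauchy_const) (sqbox 3)"
proof -
  have "(ker_dbar 1 has_integral cauchy_const) (sqbox 1)"
    unfolding cauchy_const_def
    by (intro integrable_integral integrable_continuous continuous_on_subset[OF ker_dbar_cont]) auto
  from has_integral_affinity[OF this, of "1/r" "- z /\<^sub>R r"] r
  have 1: "((\<lambda>x. ker_dbar 1 ((x - z) /\<^sub>R r)) has_integral r\<^sup>2 * cauchy_const) ((\<lambda>x. r *\<^sub>R x + z) ` sqbox 1)"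
    by (simp add: field_simps scaleR_diff_right)
  have sub: "(\<lambda>x. r *\<^sub>R x + z) ` sqbox 1 \<subseteq> sqbox 3"
  proof
    fix y assume "y \<in> (\<lambda>x. r *\<^sub>R x + z) ` sqbox 1"
    then obtain x where x: "y = r *\<^sub>R x + z" "\<bar>Re x\<bar> \<le> 1" "\<bar>Im x\<bar> \<le> 1"
      unfolding image_iff Bex_def mem_sqbox by blast
    have "\<bar>r * Re x\<bar> \<le> 1/2" "\<bar>r * Im x\<bar> \<le> 1/2"
      using mult_mono[OF r(2) x(2)] mult_mono[OF r(2) x(3)] r by (auto simp: abs_mult)
    moreover have "\<bar>Re z\<bar> \<le> 5/2" "\<bar>Im z\<bar> \<le> 5/2" using z abs_Re_le_cmod abs_Im_le_cmod order_trans by blast+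
    ultimately show "y \<in> sqbox 3" unfolding x(1) mem_sqbox by auto
  qed
  have 2: "ker_dbar 1 ((x - z) /\<^sub>R r) = 0" if "x \<notin> (\<lambda>x. r *\<^sub>R x + z) ` sqbox 1" for x
  proof -
    have "(x - z) /\<^sub>R r \<notin> sqbox 1"
    proof
      assume "(x - z) /\<^sub>R r \<in> sqbox 1"
      moreover have "x = r *\<^sub>R ((x - z) /\<^sub>R r) + z" using r by simp
      ultimately show False using that by blast
    qed
    then have "\<not> norm ((x - z) /\<^sub>R r) \<le> 1" using cball_subset_sqbox[of 1] by (auto simp del: norm_scaleR)
    then show ?thesis by (simp add: ker_dbar_eq)
  qed
  have "((\<lambda>x. ker_dbar 1 ((x - z) /\<^sub>R r)) has_integral r\<^sup>2 * cauchy_const) (sqbox 3)"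
    by (rule has_integral_on_superset[OF 1 2 sub])
  from has_integral_mult_right[OF this, of "1/r\<^sup>2"] r
  have 3: "((\<lambda>x. ker_dbar 1 ((x - z) /\<^sub>R r) / r\<^sup>2) has_integral cauchy_const) (sqbox 3)" by simp
  have "ker_dbar 1 ((x - z) /\<^sub>R r) / r\<^sup>2 = ker_dbar r (z - x)" for x
  proof -
    have "ker_dbar r (z - x) = ker_dbar r (x - z)" by (simp add: ker_dbar_def norm_minus_commute)
    then show ?thesis using ker_dbar_scale[OF r(1), of "x - z"] by simp
  qed
  then show ?thesis using 3 by simp
qed

definition cauchy_reg :: "real \<Rightarrow> (complex \<Rightarrow> complex) \<Rightarrow> complex \<Rightarrow> complex" where
  "cauchy_reg r v z = integral (sqbox 3) (\<lambda>w. v w * ker_reg r (z - w))"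

lemma continuous_on_UNIV_o: "continuous_on UNIV f \<Longrightarrow> continuous_on S g \<Longrightarrow> continuous_on S (\<lambda>x. f (g x))"
  by (rule continuous_on_compose2) auto

text \<open>The regularised kernel is C^1, so differentiation under the integral sign is allowed.
  The derivative is a bounded real-linear map, taken as an element of a Banach space and then
  evaluated at h to separate its h-part from its \<open>cnj h\<close>-part.\<close>

lemma cauchy_reg_dbar:
  fixes v :: "complex \<Rightarrow> complex"
  assumes contv: "continuous_on UNIV v" and r: "r > 0"
  shows "has_dbar (cauchy_reg r v) (integral (sqbox 3) (\<lambda>w. v w * of_real (ker_dbar r (z - w)))) z"
proof -
  define CN where "CN = Blinfun cnj"
  have CN: "blinfun_apply CN h = cnj h" for h
    unfolding CN_def by (subst bounded_linear_Blinfun_apply) (auto intro: bounded_linear_cnj)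
  define fx where "fx z w = blinfun_mult_right (v w * ker_dz r (z - w)) + (blinfun_mult_right (v w * of_real (ker_dbar r (z - w))) o\<^sub>L CN)" for z w
  have fx: "blinfun_apply (fx z w) h = v w * ker_dz r (z - w) * h + v w * of_real (ker_dbar r (z - w)) * cnj h" for z w h
    by (simp add: fx_def plus_blinfun.rep_eq CN)
  have cfx: "continuous_on (UNIV \<times> sqbox 3) (\<lambda>(z, w). fx z w)"
    unfolding fx_def split_beta
    by (intro continuous_intros continuous_on_UNIV_o[OF contv] continuous_on_UNIV_o[OF ker_dz_cont[OF r]] continuous_on_UNIV_o[OF ker_dbar_cont[OF r]] 
       bounded_linear.continuous_on[OF bounded_linear_blinfun_mult_right])
  have der: "((\<lambda>z. v w * ker_reg r (z - w)) has_derivative blinfun_apply (fx z w)) (at z within UNIV)" for z w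
  proof -
    have "((\<lambda>z. ker_reg r (z - w)) has_derivative (\<lambda>h. ker_dz r (z - w) * h + of_real (ker_dbar r (z - w)) * cnj h)) (at z)"
    proof -
      have "((\<lambda>z. z - w) has_derivative (\<lambda>h. h)) (at z)" by (auto intro!: derivative_eq_intros)
      from has_derivative_compose[OF this ker_reg_deriv[OF r]] show ?thesis .
    qed
    from has_derivative_mult_right[OF this, of "v w"] show ?thesis
      by (rule has_derivative_eq_rhs) (simp add: fun_eq_iff fx algebra_simps)
  qed
  have int: "(\<lambda>w. v w * ker_reg r (z - w)) integrable_on sqbox 3" for z
    by (intro integrable_continuous continuous_intros continuous_on_UNIV_o[OF contv] continuous_on_UNIV_o[OF ker_reg_cont[OF r]])
  have L: "(cauchy_reg r v has_derivative blinfun_apply (integral (sqbox 3) (fx z))) (at z within UNIV)"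
    unfolding cauchy_reg_def by (rule leibniz_rule[OF der int cfx]) auto
  have ci: "continuous_on (sqbox 3) (fx z)"
  proof -
    have "continuous_on (sqbox 3) (\<lambda>w. (z, w))" by (intro continuous_intros)
    from continuous_on_compose2[OF cfx this] show ?thesis by auto
  qed
  have i1: "(\<lambda>w. v w * ker_dz r (z - w)) integrable_on sqbox 3"
    by (intro integrable_continuous continuous_intros continuous_on_UNIV_o[OF contv] continuous_on_UNIV_o[OF ker_dz_cont[OF r]])
  have i2: "(\<lambda>w. v w * of_real (ker_dbar r (z - w))) integrable_on sqbox 3"
    by (intro integrable_continuous continuous_intros continuous_on_UNIV_o[OF contv] continuous_on_UNIV_o[OF ker_dbar_cont[OF r]])
  have "blinfun_apply (integral (sqbox 3) (fx z)) h = integral (sqbox 3) (\<lambda>w. v w * ker_dz r (z - w)) * h + integral (sqbox 3) (\<lambda>w. v w * of_real (ker_dbar r (z - w))) * cnj h" for h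
  proof -
    have "blinfun_apply (integral (sqbox 3) (fx z)) h = integral (sqbox 3) (\<lambda>w. blinfun_apply (fx z w) h)"
      by (rule blinfun_apply_integral[OF integrable_continuous[OF ci]])
    also have "\<dots> = integral (sqbox 3) (\<lambda>w. v w * ker_dz r (z - w) * h + v w * of_real (ker_dbar r (z - w)) * cnj h)"
      by (simp only: fx)
    also have "\<dots> = integral (sqbox 3) (\<lambda>w. v w * ker_dz r (z - w) * h) + integral (sqbox 3) (\<lambda>w. v w * of_real (ker_dbar r (z - w)) * cnj h)"
      by (intro Henstock_Kurzweil_Integration.integral_add integrable_on_mult_left i1 i2)
    finally show ?thesis by (simp only: Henstock_Kurzweil_Integration.integral_mult_left)
  qed
  then show ?thesis using L unfolding has_dbar_def
    by (intro exI[of _ "integral (sqbox 3) (\<lambda>w. v w * ker_dz r (z - w))"]) (simp add: has_derivative_eq_rhs fun_eq_iff)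
qed

text \<open>The two kernels differ by at most 1/|z|, and only on the square of half side
  \<open>r\<close>, where 1/|z| has integral at most 16 r.\<close>

lemma cauchy_reg_close:
  fixes v :: "complex \<Rightarrow> complex"
  assumes contv: "continuous_on UNIV v" and M: "\<And>z. norm (v z) \<le> M" and r: "r > 0" and z: "norm z \<le> 3"
  shows "norm (cauchy_transform v z - cauchy_reg r v z) \<le> 16 * M * r"
proof -
  have M0: "M \<ge> 0" using M[of 0] norm_ge_zero order_trans by blast
  have si: "set_integrable lborel (sqbox 3) (\<lambda>w. v w * ker_reg r (z - w))"
    unfolding set_integrable_def
    by (intro borel_integrable_compact compact_cbox continuous_intros continuous_on_UNIV_o[OF contv] continuous_on_UNIV_o[OF ker_reg_cont[OF r]])
  have eq: "cauchy_reg r v z = (LINT w:sqbox 3|lborel. v w * ker_reg r (z - w))"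
    unfolding cauchy_reg_def by (rule set_borel_integral_eq_integral(2)[symmetric, OF si])
  have sd: "set_integrable lborel (sqbox 3) (\<lambda>w. v w * inverse (z - w) - v w * ker_reg r (z - w))"
    by (intro set_integral_diff cauchy_integrable[OF contv M z] si)
  have df: "cauchy_transform v z - cauchy_reg r v z = (LINT w:sqbox 3|lborel. v w * inverse (z - w) - v w * ker_reg r (z - w))"
    unfolding eq cauchy_transform_def
    by (rule set_integral_diff(2)[symmetric, OF cauchy_integrable[OF contv M z] si])
  have "ennreal (norm (cauchy_transform v z - cauchy_reg r v z)) \<le>
     (\<integral>\<^sup>+w. ennreal (norm (indicat_real (sqbox 3) w *\<^sub>R (v w * inverse (z - w) - v w * ker_reg r (z - w)))) \<partial>lborel)"
    unfolding df set_lebesgue_integral_def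
    by (rule integral_norm_bound_ennreal[OF sd[unfolded set_integrable_def]])
  also have "\<dots> \<le> (\<integral>\<^sup>+w. ennreal M * (indicator (sqbox r) (z - w) * ennreal (norm (inverse (z - w)))) \<partial>lborel)"
  proof (rule nn_integral_mono)
    fix w
    have "norm (v w * inverse (z - w) - v w * ker_reg r (z - w)) = norm (v w) * norm (inverse (z - w) - ker_reg r (z - w))"
      by (simp only: right_diff_distrib[symmetric] norm_mult)
    also have "\<dots> \<le> M * (indicator (sqbox r) (z - w) * norm (inverse (z - w)))"
      by (intro mult_mono M ker_reg_diff_le r M0 norm_ge_zero)
    finally have "norm (indicat_real (sqbox 3) w *\<^sub>R (v w * inverse (z - w) - v w * ker_reg r (z - w))) \<le> M * (indicator (sqbox r) (z - w) * norm (inverse (z - w)))"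
      using M0 by (cases "w \<in> sqbox 3") auto
    then have "ennreal (norm (indicat_real (sqbox 3) w *\<^sub>R (v w * inverse (z - w) - v w * ker_reg r (z - w)))) \<le> ennreal (M * (indicator (sqbox r) (z - w) * norm (inverse (z - w))))"
      by (rule ennreal_leI)
    also have "\<dots> = ennreal M * (indicator (sqbox r) (z - w) * ennreal (norm (inverse (z - w))))"
      using M0 by (cases "z - w \<in> sqbox r") (simp_all add: ennreal_mult)
    finally show "ennreal (norm (indicat_real (sqbox 3) w *\<^sub>R (v w * inverse (z - w) - v w * ker_reg r (z - w)))) \<le> \<dots>" .
  qed
  also have "\<dots> = ennreal M * (\<integral>\<^sup>+w. (indicator (sqbox r) (z - w) * ennreal (norm (inverse (z - w)))) \<partial>lborel)"
    by (rule nn_integral_cmult_inverse)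
  also have "\<dots> \<le> ennreal M * ennreal (16 * r)"
    using r by (intro mult_left_mono nn_integral_inverse_shift) auto
  also have "\<dots> = ennreal (M * (16 * r))" by (rule ennreal_mult[symmetric]) (use M0 r in auto)
  finally have "norm (cauchy_transform v z - cauchy_reg r v z) \<le> M * (16 * r)"
    using M0 r by (subst (asm) ennreal_le_iff) auto
  then show ?thesis by (simp add: mult_ac)
qed

text \<open>The transforms with regularised kernel serve as approximants: they are uniformly close,
  and their exact dbar is an average of \<open>v\<close> against an approximate identity, hence
  close to \<open>cauchy_const * v\<close> by uniform continuity.\<close>

lemma weak_dbar_cauchy_transform:
  fixes v :: "complex \<Rightarrow> complex"
  assumes contv: "continuous_on UNIV v" and M: "\<And>z. norm (v z) \<le> M"
  shows "weak_dbar (ball 0 (5/2)) (cauchy_transform v) (\<lambda>z. cauchy_const * v z)"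
proof (rule weak_dbar_approx)
  fix e::real assume e: "e > 0"
  have M0: "M \<ge> 0" using M[of 0] norm_ge_zero order_trans by blast
  define e' where "e' = e / cauchy_const"
  have e': "e' > 0" using e cauchy_const_pos by (simp add: e'_def)
  have "uniformly_continuous_on (cball 0 4) v"
    by (intro compact_uniformly_continuous continuous_on_subset[OF contv]) auto
  then obtain d where d: "d > 0" "\<And>w z. w \<in> cball 0 4 \<Longrightarrow> z \<in> cball 0 4 \<Longrightarrow> dist w z < d \<Longrightarrow> dist (v w) (v z) < e'"
    unfolding uniformly_continuous_on_def using e' by blast
  \<comment> \<open>The three bounds on \<open>r\<close> keep the averaging disc in the square, make
    \<open>v\<close> vary by less than \<open>e'\<close> on it, and bring the error
    \<open>16 * M * r\<close> below \<open>e\<close>.\<close>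
  define r where "r = min (min (1/2) (d/2)) (e / (16 * M + 1))"
  have r: "0 < r" "r \<le> 1/2" "r < d" "r \<le> e / (16 * M + 1)" 
  proof -
    show "0 < r" using d(1) e M0 by (simp add: r_def)
    have "r \<le> d/2" unfolding r_def by linarith
    then show "r < d" using d(1) by linarith
    show "r \<le> 1/2" unfolding r_def by linarith
  qed (simp add: r_def min_le_iff_disj)
  show "\<exists>g a. \<forall>z\<in>ball 0 (5/2). has_dbar g (a z) z \<and> norm (a z - cauchy_const * v z) \<le> e \<and> norm (g z - cauchy_transform v z) \<le> e"
  proof (intro exI ballI conjI)
    fix z::complex assume z: "z \<in> ball 0 (5/2)"
    show "has_dbar (cauchy_reg r v) (integral (sqbox 3) (\<lambda>w. v w * of_real (ker_dbar r (z - w)))) z"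
      by (rule cauchy_reg_dbar[OF contv r(1)])
    have "norm (cauchy_transform v z - cauchy_reg r v z) \<le> 16 * M * r"
      using z by (intro cauchy_reg_close contv M r) auto
    also have "\<dots> \<le> e"
    proof -
      have "r * (16 * M + 1) \<le> e" using r(4) M0 by (simp add: pos_le_divide_eq)
      then show ?thesis using r(1) by (simp add: algebra_simps)
    qed
    finally show "norm (cauchy_reg r v z - cauchy_transform v z) \<le> e" by (simp add: norm_minus_commute)
    have pI: "((\<lambda>w. ker_dbar r (z - w)) has_integral cauchy_const) (sqbox 3)"
      using z r by (intro ker_dbar_has_integral) auto
    have pI': "((\<lambda>w. v z * of_real (ker_dbar r (z - w))) has_integral v z * of_real cauchy_const) (sqbox 3)"
      by (intro has_integral_mult_right has_integral_of_real pI)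
    have i2: "(\<lambda>w. v w * of_real (ker_dbar r (z - w))) integrable_on sqbox 3"
      by (intro integrable_continuous continuous_intros continuous_on_UNIV_o[OF contv] continuous_on_UNIV_o[OF ker_dbar_cont[OF r(1)]])
    have D: "((\<lambda>w. v w * of_real (ker_dbar r (z - w)) - v z * of_real (ker_dbar r (z - w))) has_integral
       (integral (sqbox 3) (\<lambda>w. v w * of_real (ker_dbar r (z - w))) - v z * of_real cauchy_const)) (sqbox 3)"
      by (intro has_integral_diff integrable_integral i2 pI')
    have B: "((\<lambda>w. e' * ker_dbar r (z - w)) has_integral e' * cauchy_const) (sqbox 3)"
      by (intro has_integral_mult_right pI)
    have "norm (integral (sqbox 3) (\<lambda>w. v w * of_real (ker_dbar r (z - w)) - v z * of_real (ker_dbar r (z - w)))) \<le> integral (sqbox 3) (\<lambda>w. e' * ker_dbar r (z - w))"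
    proof (rule integral_norm_bound_integral)
      fix w
      show "norm (v w * of_real (ker_dbar r (z - w)) - v z * of_real (ker_dbar r (z - w))) \<le> e' * ker_dbar r (z - w)"
      proof (cases "norm (z - w) \<le> r")
        case True
        have "norm w \<le> norm z + norm (z - w)" by (metis norm_minus_commute norm_triangle_sub)
        then have "dist (v w) (v z) < e'"
          using z True r by (intro d(2)) (auto simp: dist_norm norm_minus_commute)
        moreover have "norm (v w * of_real (ker_dbar r (z - w)) - v z * of_real (ker_dbar r (z - w))) = norm (v w - v z) * ker_dbar r (z - w)"
          using ker_dbar_nonneg[OF r(1)] by (simp add: left_diff_distrib[symmetric] norm_mult)
        ultimately show ?thesis using ker_dbar_nonneg[OF r(1)] by (simp add: dist_norm mult_right_mono)
      qed (simp add: ker_dbar_eq[OF r(1)])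
    qed (use D B in \<open>auto simp: has_integral_iff\<close>)
    also have "\<dots> = e" using B cauchy_const_pos by (simp add: has_integral_iff e'_def)
    finally show "norm (integral (sqbox 3) (\<lambda>w. v w * of_real (ker_dbar r (z - w))) - cauchy_const * v z) \<le> e"
      using D by (simp add: has_integral_iff mult.commute)
  qed
qed

text \<open>The modulus \<open>d\<close> depends on the density only through its bound
  \<open>M\<close>. This uniformity is the compactness of the operator and is used in place of the
  Arzela-Ascoli theorem.\<close>

lemma cauchy_transform_equicontinuous:
  assumes e: "e > 0"
  obtains d where "d > 0" "\<And>v M z z'. continuous_on UNIV v \<Longrightarrow> (\<And>z. norm (v z) \<le> M) \<Longrightarrow> norm z \<le> 3 \<Longrightarrow> norm z' \<le> 3 \<Longrightarrow>
     dist z z' < d \<Longrightarrow> norm (cauchy_transform v z - cauchy_transform v z') \<le> e * M"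
proof -
  \<comment> \<open>Regularising the kernel at the two points costs
    \<open>16 * M * r = e * M / 4\<close> each. The remaining \<open>e * M / 2\<close> is the
    modulus e/72 of the regular kernel times \<open>M\<close> and the area 36 of the square.\<close>
  define r where "r = e / 64"
  have r: "r > 0" using e by (simp add: r_def)
  have "uniformly_continuous_on (sqbox 6) (ker_reg r)"
    by (intro compact_uniformly_continuous continuous_on_subset[OF ker_reg_cont[OF r]]) auto
  then obtain d where d: "d > 0" "\<And>w z. w \<in> sqbox 6 \<Longrightarrow> z \<in> sqbox 6 \<Longrightarrow> dist w z < d \<Longrightarrow> dist (ker_reg r w) (ker_reg r z) < e/72"
    unfolding uniformly_continuous_on_def using e by (metis divide_pos_pos zero_less_numeral)
  have "norm (cauchy_transform v z - cauchy_transform v z') \<le> e * M"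
    if contv: "continuous_on UNIV v" and M: "\<And>z. norm (v z) \<le> M" and z: "norm z \<le> 3" "norm z' \<le> 3" and dz: "dist z z' < d" for v M z z'
  proof -
    have M0: "M \<ge> 0" using M[of 0] norm_ge_zero order_trans by blast
    have int: "(\<lambda>w. v w * ker_reg r (z - w)) integrable_on sqbox 3" for z
      by (intro integrable_continuous continuous_intros continuous_on_UNIV_o[OF contv] continuous_on_UNIV_o[OF ker_reg_cont[OF r]])
    have "norm (cauchy_reg r v z - cauchy_reg r v z') \<le> (M * (e/72)) * measure lborel (sqbox 3)"
    proof -
      have "((\<lambda>w. v w * ker_reg r (z - w) - v w * ker_reg r (z' - w)) has_integral (cauchy_reg r v z - cauchy_reg r v z')) (sqbox 3)"
        unfolding cauchy_reg_def by (intro has_integral_diff integrable_integral int)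
      then show ?thesis
      proof (rule has_integral_bound[rotated])
        fix w assume w: "w \<in> sqbox 3"
        have "dist (ker_reg r (z - w)) (ker_reg r (z' - w)) < e/72"
          using dz by (intro d(2) sqbox_diff z w) (simp add: dist_norm)
        then show "norm (v w * ker_reg r (z - w) - v w * ker_reg r (z' - w)) \<le> M * (e/72)"
          unfolding right_diff_distrib[symmetric] norm_mult dist_norm by (intro mult_mono M M0) auto
      qed (use M0 e in auto)
    qed
    moreover have "measure lborel (sqbox 3) = 36"
    proof -
      have "0 \<in> sqbox 3" by (simp add: mem_sqbox)
      then have "sqbox 3 \<noteq> {}" by blast
      then show ?thesis by (simp add: content_cbox_if Basis_complex_def inner_complex_def)
    qed
    ultimately have 2: "norm (cauchy_reg r v z - cauchy_reg r v z') \<le> e * M / 2" by (simp add: mult.commute)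
    have 1: "norm (cauchy_transform v u - cauchy_reg r v u) \<le> e * M / 4" if "norm u \<le> 3" for u
      using cauchy_reg_close[OF contv M r that] by (simp add: r_def mult.commute mult.left_commute)
    have "cauchy_transform v z - cauchy_transform v z' = (cauchy_transform v z - cauchy_reg r v z) + 
       (cauchy_reg r v z - cauchy_reg r v z') - (cauchy_transform v z' - cauchy_reg r v z')" by simp
    also have "norm \<dots> \<le> (e * M / 4 + e * M / 2) + e * M / 4"
      by (intro order_trans[OF norm_triangle_ineq4] order_trans[OF norm_triangle_ineq] add_mono 1 2 z)
    also have "\<dots> = e * M" by (simp add: field_simps)
    finally show ?thesis .
  qed
  then show ?thesis using d(1) that by blast
qed

section \<open>Weak solutions of the Cauchy-Riemann equation\<close>

definition near_dbar :: "real \<Rightarrow> complex set \<Rightarrow> (complex \<Rightarrow> complex) \<Rightarrow> complex \<Rightarrow> complex \<Rightarrow> bool" where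
  "near_dbar e S g a x \<longleftrightarrow> (\<exists>D d. d > 0 \<and> (\<forall>y\<in>S. norm (y - x) \<le> d \<longrightarrow>
        norm (g y - g x - (D * (y - x) + a * cnj (y - x))) \<le> e * norm (y - x)))"

lemma near_dbarI:
  assumes "d > 0" "\<And>y. y \<in> S \<Longrightarrow> norm (y - x) \<le> d \<Longrightarrow> norm (g y - g x - (D * (y - x) + a * cnj (y - x))) \<le> e * norm (y - x)"
  shows "near_dbar e S g a x"
  using assms unfolding near_dbar_def by blast

lemma near_dbar_add:
  assumes "near_dbar e1 S g1 a1 x" "near_dbar e2 S g2 a2 x"
  shows "near_dbar (e1 + e2) S (\<lambda>z. g1 z + g2 z) (a1 + a2) x"
proof -
  obtain D1 d1 where 1: "d1 > 0" "\<And>y. y \<in> S \<Longrightarrow> norm (y - x) \<le> d1 \<Longrightarrow> norm (g1 y - g1 x - (D1 * (y - x) + a1 * cnj (y - x))) \<le> e1 * norm (y - x)"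
    using assms(1) unfolding near_dbar_def by blast
  obtain D2 d2 where 2: "d2 > 0" "\<And>y. y \<in> S \<Longrightarrow> norm (y - x) \<le> d2 \<Longrightarrow> norm (g2 y - g2 x - (D2 * (y - x) + a2 * cnj (y - x))) \<le> e2 * norm (y - x)"
    using assms(2) unfolding near_dbar_def by blast
  show ?thesis
  proof (rule near_dbarI[of "min d1 d2" _ _ _ "D1 + D2"])
    fix y assume y: "y \<in> S" "norm (y - x) \<le> min d1 d2"
    have "g1 y + g2 y - (g1 x + g2 x) - ((D1 + D2) * (y - x) + (a1 + a2) * cnj (y - x)) = 
      (g1 y - g1 x - (D1 * (y - x) + a1 * cnj (y - x))) + (g2 y - g2 x - (D2 * (y - x) + a2 * cnj (y - x)))"
      by (simp add: algebra_simps)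
    also have "norm \<dots> \<le> e1 * norm (y - x) + e2 * norm (y - x)"
      using y by (intro norm_triangle_mono 1 2) auto
    finally show "norm (g1 y + g2 y - (g1 x + g2 x) - ((D1 + D2) * (y - x) + (a1 + a2) * cnj (y - x))) \<le> (e1 + e2) * norm (y - x)"
      by (simp add: algebra_simps)
  qed (use 1 2 in auto)
qed

lemma near_dbar_perturb:
  assumes "near_dbar e S g a x" "norm (a - a') \<le> e'"
  shows "near_dbar (e + e') S g a' x"
proof -
  obtain D d where 1: "d > 0" "\<And>y. y \<in> S \<Longrightarrow> norm (y - x) \<le> d \<Longrightarrow> norm (g y - g x - (D * (y - x) + a * cnj (y - x))) \<le> e * norm (y - x)"
    using assms(1) unfolding near_dbar_def by blast
  show ?thesis
  proof (rule near_dbarI[of "d" _ _ _ "D"])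
    fix y assume y: "y \<in> S" "norm (y - x) \<le> d"
    have "g y - g x - (D * (y - x) + a' * cnj (y - x)) = (g y - g x - (D * (y - x) + a * cnj (y - x))) + (a - a') * cnj (y - x)"
      by (simp add: algebra_simps)
    also have "norm \<dots> \<le> e * norm (y - x) + e' * norm (y - x)"
    proof (intro norm_triangle_mono 1 y)
      show "norm ((a - a') * cnj (y - x)) \<le> e' * norm (y - x)"
        unfolding norm_mult complex_mod_cnj using assms(2) by (intro mult_right_mono) auto
    qed
    finally show "norm (g y - g x - (D * (y - x) + a' * cnj (y - x))) \<le> (e + e') * norm (y - x)"
      by (simp add: algebra_simps)
  qed (use 1 in auto)
qed

lemma near_dbar_subset: "near_dbar e S g a x \<Longrightarrow> T \<subseteq> S \<Longrightarrow> near_dbar e T g a x"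
  unfolding near_dbar_def by (meson subsetD)

lemma has_dbar_near:
  assumes "has_dbar f a x" "e > 0"
  shows "near_dbar e S f a x"
proof -
  obtain D where "(f has_derivative (\<lambda>h. D * h + a * cnj h)) (at x)" using assms by (auto simp: has_dbar_def)
  then obtain d where "d > 0" "\<And>y. norm (y - x) < d \<Longrightarrow> norm (f y - f x - (D * (y - x) + a * cnj (y - x))) \<le> e * norm (y - x)"
    unfolding has_derivative_at_alt using assms(2) by blast
  then show ?thesis by (intro near_dbarI[of "d/2" _ _ _ D]) auto
qed

text \<open>In the product rule the error \<open>e\<close> of \<open>g\<close> is multiplied by the
  size of \<open>\<theta> x\<close>, while all other remainders are o(|y - x|); the strict
  inequality for \<open>e'\<close> leaves room for the latter.\<close>

lemma near_dbar_mult: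
  assumes g: "near_dbar e S g a x" and \<theta>: "has_dbar \<theta> c x" and e': "norm (\<theta> x) * e < e'" and e: "e \<ge> 0"
  shows "near_dbar e' S (\<lambda>z. \<theta> z * g z) (\<theta> x * a + g x * c) x"
proof -
  obtain D d where 1: "d > 0" "\<And>y. y \<in> S \<Longrightarrow> norm (y - x) \<le> d \<Longrightarrow> norm (g y - g x - (D * (y - x) + a * cnj (y - x))) \<le> e * norm (y - x)"
    using g unfolding near_dbar_def by blast
  define s where "s = e' - norm (\<theta> x) * e"
  have s: "s > 0" using e' by (simp add: s_def)
  define K where "K = norm D + norm a + e"
  have K: "K \<ge> 0" using e by (simp add: K_def)
  have "near_dbar (s / 2 / (norm (g x) + 1)) UNIV \<theta> c x"
    using s by (intro has_dbar_near \<theta> divide_pos_pos) (auto intro: add_nonneg_pos)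
  then obtain D2 d2 where 2: "d2 > 0" "\<And>y. norm (y - x) \<le> d2 \<Longrightarrow> norm (\<theta> y - \<theta> x - (D2 * (y - x) + c * cnj (y - x))) \<le> s / 2 / (norm (g x) + 1) * norm (y - x)"
    unfolding near_dbar_def by blast
  have "isCont \<theta> x" using \<theta> unfolding has_dbar_def by (auto intro: has_derivative_continuous)
  then obtain d3 where 3: "d3 > 0" "\<And>y. norm (y - x) < d3 \<Longrightarrow> norm (\<theta> y - \<theta> x) < s / 2 / (K + 1)"
    unfolding continuous_at_eps_delta dist_norm using s K by (metis add_nonneg_pos divide_pos_pos half_gt_zero zero_less_one)
  show ?thesis
  proof (rule near_dbarI[of "min d (min d2 (d3/2))" _ _ _ "\<theta> x * D + g x * D2"])
    fix y assume y: "y \<in> S" "norm (y - x) \<le> min d (min d2 (d3/2))"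
    let ?h = "norm (y - x)"
    have y': "?h \<le> d" "?h \<le> d2" "?h < d3" using y(2) 3(1) by auto
    have gd: "norm (g y - g x) \<le> K * ?h"
    proof -
      have "g y - g x = (g y - g x - (D * (y - x) + a * cnj (y - x))) + (D * (y - x) + a * cnj (y - x))" by simp
      also have "norm \<dots> \<le> e * ?h + (norm D * ?h + norm a * ?h)"
        by (intro norm_triangle_mono 1(2) y y') (auto simp: norm_mult complex_mod_cnj simp flip: complex_cnj_diff)
      finally show ?thesis by (simp add: K_def algebra_simps)
    qed
    have "\<theta> y * g y - \<theta> x * g x - ((\<theta> x * D + g x * D2) * (y - x) + (\<theta> x * a + g x * c) * cnj (y - x))
       = \<theta> x * (g y - g x - (D * (y - x) + a * cnj (y - x))) + g x * (\<theta> y - \<theta> x - (D2 * (y - x) + c * cnj (y - x)))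
        + (\<theta> y - \<theta> x) * (g y - g x)"
      by (simp add: algebra_simps)
    also have "norm \<dots> \<le> norm (\<theta> x) * (e * ?h) + norm (g x) * (s / 2 / (norm (g x) + 1) * ?h) + s / 2 / (K + 1) * (K * ?h)"
    proof (intro norm_triangle_mono)
      show "norm (\<theta> x * (g y - g x - (D * (y - x) + a * cnj (y - x)))) \<le> norm (\<theta> x) * (e * ?h)"
        unfolding norm_mult by (intro mult_left_mono 1(2) y y') simp
      show "norm (g x * (\<theta> y - \<theta> x - (D2 * (y - x) + c * cnj (y - x)))) \<le> norm (g x) * (s / 2 / (norm (g x) + 1) * ?h)"
        unfolding norm_mult by (intro mult_left_mono 2(2) y') simp
      show "norm ((\<theta> y - \<theta> x) * (g y - g x)) \<le> s / 2 / (K + 1) * (K * ?h)"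
        unfolding norm_mult by (intro mult_mono less_imp_le[OF 3(2)[OF y'(3)]] gd) (use s K in auto)
    qed
    also have "\<dots> \<le> norm (\<theta> x) * (e * ?h) + s / 2 * ?h + s / 2 * ?h"
    proof -
      have "norm (g x) * (s / 2 / (norm (g x) + 1) * ?h) = (norm (g x) / (norm (g x) + 1)) * (s / 2 * ?h)" by simp
      also have "\<dots> \<le> 1 * (s / 2 * ?h)"
      proof (intro mult_right_mono)
        have "norm (g x) + 1 > 0" by (intro add_nonneg_pos) auto
        then show "norm (g x) / (norm (g x) + 1) \<le> 1" by simp
      qed (use s in auto)
      finally have A: "norm (g x) * (s / 2 / (norm (g x) + 1) * ?h) \<le> s / 2 * ?h" by simp
      have "s / 2 / (K + 1) * (K * ?h) = (K / (K + 1)) * (s / 2 * ?h)" by (simp add: mult_ac)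
      also have "\<dots> \<le> 1 * (s / 2 * ?h)" using s K by (intro mult_right_mono) (auto simp: field_simps)
      finally have B: "s / 2 / (K + 1) * (K * ?h) \<le> s / 2 * ?h" by simp
      show ?thesis using A B by linarith
    qed
    also have "\<dots> = e' * ?h" by (simp add: s_def field_simps)
    finally show "norm (\<theta> y * g y - \<theta> x * g x - ((\<theta> x * D + g x * D2) * (y - x) + (\<theta> x * a + g x * c) * cnj (y - x))) \<le> e' * ?h" .
  qed (use 1 2 3 in auto)
qed

text \<open>A holomorphic substitution turns \<open>cnj (\<tau> y - \<tau> x)\<close> into
  \<open>cnj t * cnj (y - x)\<close> up to o(|y - x|), and scales the error by |t|.\<close>

lemma near_dbar_compose:
  assumes g: "near_dbar e S g a (\<tau> x)" and \<tau>: "(\<tau> has_field_derivative t) (at x)" and im: "\<tau> ` T \<subseteq> S"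
    and e': "e * norm t < e'" and e: "e \<ge> 0"
  shows "near_dbar e' T (\<lambda>z. g (\<tau> z)) (a * cnj t) x"
proof -
  obtain D d where 1: "d > 0" "\<And>y. y \<in> S \<Longrightarrow> norm (y - \<tau> x) \<le> d \<Longrightarrow> norm (g y - g (\<tau> x) - (D * (y - \<tau> x) + a * cnj (y - \<tau> x))) \<le> e * norm (y - \<tau> x)"
    using g unfolding near_dbar_def by blast
  define K where "K = norm D + norm a + e"
  have K: "K \<ge> 0" using e by (simp add: K_def)
  define s where "s = (e' - e * norm t) / (K + 1)"
  have s: "s > 0" using e' K by (simp add: s_def add_nonneg_pos)
  have sK: "K * s \<le> e' - e * norm t" using e' K by (simp add: s_def field_simps)
  have "(\<tau> has_derivative (\<lambda>h. t * h)) (at x)" using \<tau> by (simp add: has_field_derivative_def)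
  then obtain d2 where 2: "d2 > 0" "\<And>y. norm (y - x) < d2 \<Longrightarrow> norm (\<tau> y - \<tau> x - t * (y - x)) \<le> s * norm (y - x)"
    unfolding has_derivative_at_alt using s by blast
  have "isCont \<tau> x" using \<tau> by (rule DERIV_isCont)
  then obtain d3 where 3: "d3 > 0" "\<And>y. norm (y - x) < d3 \<Longrightarrow> norm (\<tau> y - \<tau> x) < d"
    unfolding continuous_at_eps_delta dist_norm using 1(1) by blast
  show ?thesis
  proof (rule near_dbarI[of "min (d2/2) (d3/2)" _ _ _ "D * t"])
    fix y assume y: "y \<in> T" "norm (y - x) \<le> min (d2/2) (d3/2)"
    let ?h = "norm (y - x)"
    have y': "?h < d2" "?h < d3" using y(2) 2(1) 3(1) by auto
    define r where "r = \<tau> y - \<tau> x - t * (y - x)"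
    have r: "norm r \<le> s * ?h" unfolding r_def by (rule 2(2)[OF y'(1)])
    have \<tau>d: "\<tau> y - \<tau> x = t * (y - x) + r" by (simp add: r_def)
    have n: "norm (\<tau> y - \<tau> x) \<le> (norm t + s) * ?h"
      unfolding \<tau>d by (rule order_trans[OF norm_triangle_ineq]) (use r in \<open>simp add: norm_mult distrib_right\<close>)
    have "g (\<tau> y) - g (\<tau> x) - (D * t * (y - x) + a * cnj t * cnj (y - x)) =
       (g (\<tau> y) - g (\<tau> x) - (D * (\<tau> y - \<tau> x) + a * cnj (\<tau> y - \<tau> x))) + (D * r + a * cnj r)"
      unfolding \<tau>d by (simp add: algebra_simps)
    also have "norm \<dots> \<le> e * ((norm t + s) * ?h) + (norm D * (s * ?h) + norm a * (s * ?h))"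
    proof (intro norm_triangle_mono)
      have "norm (g (\<tau> y) - g (\<tau> x) - (D * (\<tau> y - \<tau> x) + a * cnj (\<tau> y - \<tau> x))) \<le> e * norm (\<tau> y - \<tau> x)"
        using y im 3(2)[OF y'(2)] by (intro 1(2)) auto
      also have "\<dots> \<le> e * ((norm t + s) * ?h)" using n e by (intro mult_left_mono)
      finally show "norm (g (\<tau> y) - g (\<tau> x) - (D * (\<tau> y - \<tau> x) + a * cnj (\<tau> y - \<tau> x))) \<le> e * ((norm t + s) * ?h)" .
    qed (auto simp: norm_mult intro!: mult_left_mono r)
    also have "\<dots> = (e * norm t + K * s) * ?h" by (simp add: K_def algebra_simps)
    also have "\<dots> \<le> e' * ?h" using sK by (intro mult_right_mono) auto
    finally show "norm (g (\<tau> y) - g (\<tau> x) - (D * t * (y - x) + a * cnj t * cnj (y - x))) \<le> e' * ?h" .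
  qed (use 1 2 3 in auto)
qed

lemma weak_dbar_iff:
  "weak_dbar S f \<eta> \<longleftrightarrow> (\<forall>e>0. \<exists>g. continuous_on S g \<and> (\<forall>z\<in>S. norm (g z - f z) \<le> e) \<and> (\<forall>x\<in>S. near_dbar e S g (\<eta> x) x))"
  by (simp add: weak_dbar_def near_dbar_def)

lemma weak_dbarD:
  assumes "weak_dbar S f \<eta>" "e > 0"
  obtains g where "continuous_on S g" "\<And>z. z \<in> S \<Longrightarrow> norm (g z - f z) \<le> e" "\<And>x. x \<in> S \<Longrightarrow> near_dbar e S g (\<eta> x) x"
  using assms unfolding weak_dbar_iff by blast

lemma weak_dbar_exact:
  assumes "\<And>z. z \<in> S \<Longrightarrow> has_dbar f (\<eta> z) z"
  shows "weak_dbar S f \<eta>"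
  by (rule weak_dbar_approx) (rule exI[of _ f], rule exI[of _ \<eta>], use assms in auto)

lemma weak_dbar_subset: "weak_dbar S f \<eta> \<Longrightarrow> T \<subseteq> S \<Longrightarrow> weak_dbar T f \<eta>"
  unfolding weak_dbar_iff by (meson continuous_on_subset near_dbar_subset subsetD)

lemma weak_dbar_cong:
  assumes "weak_dbar S f \<eta>" "\<And>z. z \<in> S \<Longrightarrow> f z = f' z" "\<And>z. z \<in> S \<Longrightarrow> \<eta> z = \<eta>' z"
  shows "weak_dbar S f' \<eta>'"
  using assms unfolding weak_dbar_iff by simp

lemma weak_dbar_add:
  assumes "weak_dbar S f \<eta>" "weak_dbar S f' \<eta>'"
  shows "weak_dbar S (\<lambda>z. f z + f' z) (\<lambda>z. \<eta> z + \<eta>' z)"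
  unfolding weak_dbar_iff
proof (intro allI impI)
  fix e::real assume "e > 0"
  then have e: "e/2 > 0" by simp
  obtain g where g: "continuous_on S g" "\<And>z. z \<in> S \<Longrightarrow> norm (g z - f z) \<le> e/2" "\<And>x. x \<in> S \<Longrightarrow> near_dbar (e/2) S g (\<eta> x) x"
    using weak_dbarD[OF assms(1) e] by blast
  obtain g' where g': "continuous_on S g'" "\<And>z. z \<in> S \<Longrightarrow> norm (g' z - f' z) \<le> e/2" "\<And>x. x \<in> S \<Longrightarrow> near_dbar (e/2) S g' (\<eta>' x) x"
    using weak_dbarD[OF assms(2) e] by blast
  show "\<exists>g. continuous_on S g \<and> (\<forall>z\<in>S. norm (g z - (f z + f' z)) \<le> e) \<and> (\<forall>x\<in>S. near_dbar e S g (\<eta> x + \<eta>' x) x)"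
  proof (intro exI[of _ "\<lambda>z. g z + g' z"] conjI ballI)
    fix z assume z: "z \<in> S"
    have "g z + g' z - (f z + f' z) = (g z - f z) + (g' z - f' z)" by simp
    also have "norm \<dots> \<le> e/2 + e/2" by (intro norm_triangle_mono g g' z)
    finally show "norm (g z + g' z - (f z + f' z)) \<le> e" by simp
    show "near_dbar e S (\<lambda>z. g z + g' z) (\<eta> z + \<eta>' z) z"
      using near_dbar_add[OF g(3)[OF z] g'(3)[OF z]] by simp
  qed (intro continuous_intros g g')
qed

lemma weak_dbar_zero: "weak_dbar S (\<lambda>z. 0) (\<lambda>z. 0)"
  by (rule weak_dbar_exact) (auto simp: has_dbar_def intro!: exI[of _ 0])

lemma weak_dbar_sum:
  assumes "\<And>i. i \<in> I \<Longrightarrow> weak_dbar S (f i) (\<eta> i)"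
  shows "weak_dbar S (\<lambda>z. \<Sum>i\<in>I. f i z) (\<lambda>z. \<Sum>i\<in>I. \<eta> i z)"
proof (cases "finite I")
  case True
  then show ?thesis using assms
    by (induction I) (simp_all add: weak_dbar_zero weak_dbar_add)
qed (simp add: weak_dbar_zero)

lemma weak_dbar_mult:
  assumes f: "weak_dbar S f \<eta>" and \<theta>: "\<And>z. z \<in> S \<Longrightarrow> has_dbar \<theta> (c z) z"
    and M: "\<And>z. z \<in> S \<Longrightarrow> norm (\<theta> z) \<le> M" "\<And>z. z \<in> S \<Longrightarrow> norm (c z) \<le> M"
  shows "weak_dbar S (\<lambda>z. \<theta> z * f z) (\<lambda>z. \<theta> z * \<eta> z + f z * c z)"
proof (cases "S = {}")
  case False
  have M0: "M \<ge> 0" using False M(1) norm_ge_zero order_trans by blast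
  show ?thesis
  unfolding weak_dbar_iff
  proof (intro allI impI)
    fix e::real assume e0: "e > 0"
    define e' where "e' = e / (2 * (M + 1))"
    have e': "e' > 0" using e0 M0 by (simp add: e'_def)
    have e'2: "(M + 1) * e' = e/2" using M0 by (simp add: e'_def field_simps)
    then have e'3: "M * e' < e/2" "M * e' \<le> e/2" using e' by (auto simp: algebra_simps)
    obtain g where g: "continuous_on S g" "\<And>z. z \<in> S \<Longrightarrow> norm (g z - f z) \<le> e'" "\<And>x. x \<in> S \<Longrightarrow> near_dbar e' S g (\<eta> x) x"
      using weak_dbarD[OF f e'] by blast
    show "\<exists>g. continuous_on S g \<and> (\<forall>z\<in>S. norm (g z - (\<theta> z * f z)) \<le> e) \<and> (\<forall>x\<in>S. near_dbar e S g (\<theta> x * \<eta> x + f x * c x) x)"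
    proof (intro exI[of _ "\<lambda>z. \<theta> z * g z"] conjI ballI)
      fix z assume z: "z \<in> S"
      have "norm (\<theta> z * g z - \<theta> z * f z) = norm (\<theta> z) * norm (g z - f z)"
        by (simp only: right_diff_distrib[symmetric] norm_mult)
      also have "\<dots> \<le> M * e'" by (intro mult_mono M g z M0) auto
      finally show "norm (\<theta> z * g z - \<theta> z * f z) \<le> e" using e'3 e0 by linarith
      have "norm (\<theta> z) * e' < e/2"
        using mult_right_mono[OF M(1)[OF z], of e'] e' e'3 by linarith
      then have "near_dbar (e/2) S (\<lambda>z. \<theta> z * g z) (\<theta> z * \<eta> z + g z * c z) z"
        using e' by (intro near_dbar_mult[OF g(3)[OF z] \<theta>[OF z]]) auto
      \<comment> \<open>The product rule yields the term with the approximant \<open>g\<close>;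
        exchanging it for \<open>f\<close> is a further perturbation of the right-hand side by at
        most \<open>e' * M\<close>.\<close>
      moreover have "norm ((\<theta> z * \<eta> z + g z * c z) - (\<theta> z * \<eta> z + f z * c z)) \<le> e/2"
      proof -
        have "norm ((\<theta> z * \<eta> z + g z * c z) - (\<theta> z * \<eta> z + f z * c z)) = norm (g z - f z) * norm (c z)"
          by (simp add: norm_mult flip: left_diff_distrib)
        also have "\<dots> \<le> e' * M" using e' by (intro mult_mono g M z) auto
        finally show ?thesis using e'3 by (simp add: mult.commute)
      qed
      ultimately have "near_dbar (e/2 + e/2) S (\<lambda>z. \<theta> z * g z) (\<theta> z * \<eta> z + f z * c z) z"
        by (rule near_dbar_perturb)
      then show "near_dbar e S (\<lambda>z. \<theta> z * g z) (\<theta> z * \<eta> z + f z * c z) z" by simp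
    next
      have "continuous_on S \<theta>"
        using \<theta> unfolding has_dbar_def by (meson continuous_at_imp_continuous_on has_derivative_continuous)
      then show "continuous_on S (\<lambda>z. \<theta> z * g z)" by (intro continuous_intros g)
    qed
  qed
qed (simp add: weak_dbar_def)

lemma weak_dbar_compose:
  assumes f: "weak_dbar S f \<eta>" and \<tau>: "\<And>z. z \<in> T \<Longrightarrow> (\<tau> has_field_derivative t z) (at z)" and im: "\<tau> ` T \<subseteq> S"
    and M: "\<And>z. z \<in> T \<Longrightarrow> norm (t z) \<le> M"
  shows "weak_dbar T (\<lambda>z. f (\<tau> z)) (\<lambda>z. \<eta> (\<tau> z) * cnj (t z))"
proof (cases "T = {}")
  case False
  have M0: "M \<ge> 0" using False M norm_ge_zero order_trans by blast
  show ?thesis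
  unfolding weak_dbar_iff
  proof (intro allI impI)
    fix e::real assume e0: "e > 0"
    define e' where "e' = e / (2 * (M + 1))"
    have e': "e' > 0" using e0 M0 by (simp add: e'_def)
    have e'2: "(M + 1) * e' = e/2" using M0 by (simp add: e'_def field_simps)
    then have e'3: "e' * M < e" using e' e0 by (auto simp: algebra_simps)
    have e'4: "e' \<le> e" using e' e0 M0 mult_nonneg_nonneg[OF M0, of e'] e'2 by (auto simp: algebra_simps)
    obtain g where g: "continuous_on S g" "\<And>z. z \<in> S \<Longrightarrow> norm (g z - f z) \<le> e'" "\<And>x. x \<in> S \<Longrightarrow> near_dbar e' S g (\<eta> x) x"
      using weak_dbarD[OF f e'] by blast
    show "\<exists>g. continuous_on T g \<and> (\<forall>z\<in>T. norm (g z - f (\<tau> z)) \<le> e) \<and> (\<forall>x\<in>T. near_dbar e T g (\<eta> (\<tau> x) * cnj (t x)) x)"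
    proof (intro exI[of _ "\<lambda>z. g (\<tau> z)"] conjI ballI)
      fix z assume z: "z \<in> T"
      then have \<tau>z: "\<tau> z \<in> S" using im by auto
      show "norm (g (\<tau> z) - f (\<tau> z)) \<le> e" using g(2)[OF \<tau>z] e'4 by linarith
      have "e' * norm (t z) < e" using mult_left_mono[OF M[OF z], of e'] e' e'3 by linarith
      then show "near_dbar e T (\<lambda>z. g (\<tau> z)) (\<eta> (\<tau> z) * cnj (t z)) z"
        using e' by (intro near_dbar_compose[OF g(3)[OF \<tau>z] \<tau>[OF z] im]) auto
    next
      have "continuous_on T \<tau>" using \<tau> by (meson DERIV_isCont continuous_at_imp_continuous_on)
      then show "continuous_on T (\<lambda>z. g (\<tau> z))" using im by (intro continuous_on_compose2[OF g(1)])
    qed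
  qed
qed (simp add: weak_dbar_def)

text \<open>Weyl's lemma for this notion of solution: with right-hand side 0 the approximants are
  nearly holomorphic.\<close>

lemma weak_dbar_zero_holomorphic:
  assumes "weak_dbar S f (\<lambda>z. 0)" "open S"
  shows "f holomorphic_on S"
proof (rule holomorphic_limit_near_holomorphic[OF assms(2)])
  fix e::real assume "e > 0"
  from weak_dbarD[OF assms(1) this] obtain g where g: "continuous_on S g" "\<And>z. z \<in> S \<Longrightarrow> norm (g z - f z) \<le> e" "\<And>x. x \<in> S \<Longrightarrow> near_dbar e S g 0 x"
    by metis
  then show "\<exists>g. continuous_on S g \<and> near_holomorphic_on e g S \<and> (\<forall>z\<in>S. norm (g z - f z) \<le> e)"
    by (intro exI[of _ g]) (auto simp: near_holomorphic_on_def near_dbar_def)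
qed

section \<open>Exact rules for the dbar operator\<close>

lemma has_dbar_mult:
  assumes "has_dbar f a z" "has_dbar g b z"
  shows "has_dbar (\<lambda>w. f w * g w) (f z * b + a * g z) z"
proof -
  obtain D E where "(f has_derivative (\<lambda>h. D * h + a * cnj h)) (at z)" "(g has_derivative (\<lambda>h. E * h + b * cnj h)) (at z)"
    using assms by (auto simp: has_dbar_def)
  from has_derivative_mult[OF this] show ?thesis unfolding has_dbar_def
    by (intro exI[of _ "f z * E + D * g z"]) (simp add: algebra_simps)
qed

lemma has_dbar_add:
  assumes "has_dbar f a z" "has_dbar g b z"
  shows "has_dbar (\<lambda>w. f w + g w) (a + b) z"
proof -
  obtain D E where "(f has_derivative (\<lambda>h. D * h + a * cnj h)) (at z)" "(g has_derivative (\<lambda>h. E * h + b * cnj h)) (at z)"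
    using assms by (auto simp: has_dbar_def)
  from has_derivative_add[OF this] show ?thesis unfolding has_dbar_def
    by (intro exI[of _ "D + E"]) (simp add: algebra_simps)
qed

lemma has_dbar_const: "has_dbar (\<lambda>w. c) 0 z"
  unfolding has_dbar_def by (intro exI[of _ 0]) auto

lemma has_dbar_sum:
  assumes "\<And>i. i \<in> I \<Longrightarrow> has_dbar (f i) (a i) z"
  shows "has_dbar (\<lambda>w. \<Sum>i\<in>I. f i w) (\<Sum>i\<in>I. a i) z"
  using assms by (induction I rule: infinite_finite_induct) (auto simp: has_dbar_const has_dbar_add)

lemma has_dbar_compose:
  assumes "has_dbar f a (\<tau> z)" "(\<tau> has_field_derivative t) (at z)"
  shows "has_dbar (\<lambda>w. f (\<tau> w)) (a * cnj t) z"
proof -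
  obtain D where "(f has_derivative (\<lambda>h. D * h + a * cnj h)) (at (\<tau> z))" using assms by (auto simp: has_dbar_def)
  from has_derivative_compose[OF assms(2)[unfolded has_field_derivative_def] this] show ?thesis unfolding has_dbar_def
    by (intro exI[of _ "D * t"]) (simp add: algebra_simps)
qed

lemma has_dbar_holomorphic:
  assumes "(f has_field_derivative t) (at z)"
  shows "has_dbar f 0 z"
  using assms unfolding has_dbar_def has_field_derivative_def by auto

lemma has_dbar_unique:
  assumes "has_dbar f a z" "has_dbar f b z"
  shows "a = b"
proof -
  obtain D E where "(f has_derivative (\<lambda>h. D * h + a * cnj h)) (at z)" "(f has_derivative (\<lambda>h. E * h + b * cnj h)) (at z)"
    using assms by (auto simp: has_dbar_def)
  from has_derivative_unique[OF this] have e: "D * h + a * cnj h = E * h + b * cnj h" for h by metis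
  have "D + a = E + b" using e[of 1] by simp
  moreover have "D - a = E - b"
  proof -
    have "\<i> * (D - a) = \<i> * (E - b)" using e[of \<i>] by (simp add: right_diff_distrib mult.commute)
    then show ?thesis by simp
  qed
  ultimately have "(D + a) - (D - a) = (E + b) - (E - b)" by simp
  then show ?thesis by simp
qed

lemma has_dbar_cong:
  assumes "has_dbar f a z" "eventually (\<lambda>w. f w = g w) (nhds z)"
  shows "has_dbar g a z"
proof -
  obtain D where D: "(f has_derivative (\<lambda>h. D * h + a * cnj h)) (at z)" using assms by (auto simp: has_dbar_def)
  have "(g has_derivative (\<lambda>h. D * h + a * cnj h)) (at z)"
    by (rule has_derivative_transform_eventually[OF D])
      (use assms(2) eventually_nhds_x_imp_x in \<open>auto simp: eventually_at_filter elim: eventually_mono\<close>)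
  then show ?thesis unfolding has_dbar_def by blast
qed

lemma has_dbar_inverse:
  assumes "has_dbar f a z" "f z \<noteq> 0"
  shows "has_dbar (\<lambda>w. inverse (f w)) (- a / (f z)\<^sup>2) z"
proof -
  obtain D where D: "(f has_derivative (\<lambda>h. D * h + a * cnj h)) (at z)" using assms by (auto simp: has_dbar_def)
  have "(\<lambda>h. - (inverse (f z) * (D * h + a * cnj h) * inverse (f z))) = (\<lambda>h. - D / (f z)\<^sup>2 * h + - a / (f z)\<^sup>2 * cnj h)"
    using assms(2) by (intro ext) (simp add: power2_eq_square divide_simps; simp add: algebra_simps)
  with Deriv.has_derivative_inverse[OF assms(2) D] show ?thesis unfolding has_dbar_def
    by (intro exI[of _ "- D / (f z)\<^sup>2"]) simp
qed

section \<open>Charts\<close>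

abbreviation par :: "'a chart \<Rightarrow> complex \<Rightarrow> 'a" where "par c \<equiv> inv_into (fst c) (snd c)"

text \<open>The given atlas need not contain small discs. Restricting and rescaling its charts adds
  them, and as the old charts remain, properties stated for all charts can be passed back.\<close>

definition refined_atlas :: "'a topology \<Rightarrow> 'a chart set \<Rightarrow> 'a chart set" where
  "refined_atlas X A = {(V, \<lambda>x. (\<phi> x - a) / of_real r) | V U \<phi> a r. (U, \<phi>) \<in> A \<and> openin X V \<and> V \<subseteq> U \<and> r > 0}"

lemma refined_atlas_superset:
  assumes "riemann_surface X A" shows "A \<subseteq> refined_atlas X A"
proof
  fix c assume c: "c \<in> A"
  obtain U \<phi> where [simp]: "c = (U, \<phi>)" by (cases c)
  have "openin X U" using assms c by (auto simp: riemann_surface.chart_domain)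
  then show "c \<in> refined_atlas X A" unfolding refined_atlas_def mem_Collect_eq using c
    by (intro exI[where x=U] exI[where x=\<phi>] exI[where x="0::complex"] exI[where x="1::real"]) simp
qed

context riemann_surface
begin

lemma chart_sub: "c \<in> A \<Longrightarrow> fst c \<subseteq> topspace X"
  using chart_domain[of "fst c" "snd c"] openin_subset by auto

lemma chart_everything:
  assumes "c \<in> A"
  shows "continuous_map (subtopology X (fst c)) (top_of_set (snd c ` fst c)) (snd c)"
    and "open_map (subtopology X (fst c)) (top_of_set (snd c ` fst c)) (snd c)"
    and "inj_on (snd c) (fst c)"
  using chart_homeomorphic[of "fst c" "snd c"] chart_sub[OF assms] assms
  by (auto simp: homeomorphic_eq_everything_map topspace_subtopology Int_absorb1)

lemmas chart_inj = chart_everything(3)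

lemma chart_open: "c \<in> A \<Longrightarrow> openin X (fst c)"
  using chart_domain[of "fst c" "snd c"] by auto

lemma chart_image_open: "c \<in> A \<Longrightarrow> open (snd c ` fst c)"
  using chart_range[of "fst c" "snd c"] by auto

lemma chart_open_image:
  assumes "c \<in> A" "openin X W" "W \<subseteq> fst c"
  shows "open (snd c ` W)"
proof -
  have "openin (subtopology X (fst c)) W"
    using assms chart_open openin_open_subtopology by blast
  then have "openin (top_of_set (snd c ` fst c)) (snd c ` W)"
    using chart_everything(2)[OF assms(1)] by (auto simp: open_map_def)
  then show ?thesis using chart_image_open[OF assms(1)] openin_open_trans by blast
qed

lemma chart_preimage_open:
  assumes "c \<in> A" "open S"
  shows "openin X {x \<in> fst c. snd c x \<in> S}"
proof -
  have "openin (top_of_set (snd c ` fst c)) (snd c ` fst c \<inter> S)" using assms(2) by (simp add: openin_open_Int)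
  then have "openin (subtopology X (fst c)) {x \<in> topspace (subtopology X (fst c)). snd c x \<in> snd c ` fst c \<inter> S}"
    using chart_everything(1)[OF assms(1)] by (rule openin_continuous_map_preimage[rotated])
  moreover have "{x \<in> topspace (subtopology X (fst c)). snd c x \<in> snd c ` fst c \<inter> S} = {x \<in> fst c. snd c x \<in> S}"
    using chart_sub[OF assms(1)] by (auto simp: topspace_subtopology)
  ultimately show ?thesis using openin_open_subtopology[OF chart_open[OF assms(1)]] by auto
qed

lemma par_crd: "c \<in> A \<Longrightarrow> x \<in> fst c \<Longrightarrow> par c (snd c x) = x"
  by (simp add: chart_inj inv_into_f_f)

lemma crd_par: "z \<in> snd c ` fst c \<Longrightarrow> snd c (par c z) = z"
  by (simp add: f_inv_into_f)

lemma par_mem: "z \<in> snd c ` fst c \<Longrightarrow> par c z \<in> fst c"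
  by (simp add: inv_into_into)

lemma trans_holomorphic:
  assumes "c \<in> A" "d \<in> A"
  shows "(\<lambda>z. snd d (par c z)) holomorphic_on snd c ` (fst c \<inter> fst d)"
  using chart_transition[of "fst c" "snd c" "fst d" "snd d"] assms by (simp add: o_def)

lemma overlap_open:
  assumes "c \<in> A" "openin X S"
  shows "open (snd c ` (fst c \<inter> S))"
  using assms by (intro chart_open_image openin_Int chart_open) auto

lemma trans_image:
  assumes "c \<in> A" "d \<in> A" "z \<in> snd c ` (fst c \<inter> fst d)"
  shows "par c z \<in> fst c \<inter> fst d" "snd d (par c z) \<in> snd d ` (fst c \<inter> fst d)" "par d (snd d (par c z)) = par c z"
proof -
  show 1: "par c z \<in> fst c \<inter> fst d" using assms by (auto simp: par_crd)
  then show "snd d (par c z) \<in> snd d ` (fst c \<inter> fst d)" by blast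
  show "par d (snd d (par c z)) = par c z" using 1 assms by (auto simp: par_crd)
qed

lemma trans_deriv:
  assumes "c \<in> A" "d \<in> A" "z \<in> snd c ` (fst c \<inter> fst d)"
  shows "((\<lambda>z. snd d (par c z)) has_field_derivative deriv (\<lambda>z. snd d (par c z)) z) (at z)"
  using holomorphic_derivI[OF trans_holomorphic[OF assms(1,2)] overlap_open[OF assms(1) chart_open[OF assms(2)]]] assms by auto

lemma trans_deriv_nonzero:
  assumes "c \<in> A" "d \<in> A" "z \<in> snd c ` (fst c \<inter> fst d)"
  shows "deriv (\<lambda>z. snd d (par c z)) z \<noteq> 0"
proof -
  let ?\<tau> = "\<lambda>z. snd d (par c z)" and ?\<sigma> = "\<lambda>z. snd c (par d z)"
  have w: "?\<tau> z \<in> snd d ` (fst d \<inter> fst c)" using trans_image[OF assms] by (auto simp: Int_commute)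
  have "((\<lambda>z. ?\<sigma> (?\<tau> z)) has_field_derivative deriv ?\<sigma> (?\<tau> z) * deriv ?\<tau> z) (at z)"
    by (rule DERIV_chain2[OF trans_deriv[OF assms(2,1) w] trans_deriv[OF assms]])
  moreover have "((\<lambda>z. ?\<sigma> (?\<tau> z)) has_field_derivative 1) (at z)"
  proof (rule has_field_derivative_transform_within_open[OF DERIV_ident overlap_open[OF assms(1) chart_open[OF assms(2)]] assms(3)])
    fix u assume u: "u \<in> snd c ` (fst c \<inter> fst d)"
    have "u \<in> snd c ` fst c" using u by auto
    then show "u = ?\<sigma> (?\<tau> u)" using trans_image(3)[OF assms(1,2) u] by (simp add: crd_par)
  qed
  ultimately have "deriv ?\<sigma> (?\<tau> z) * deriv ?\<tau> z = 1" by (rule DERIV_unique)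
  then show ?thesis by auto
qed

lemma in_chart_trans:
  assumes "c \<in> A" "d \<in> A" "z \<in> snd c ` (fst c \<inter> fst d)"
  shows "in_chart c f z = in_chart d f (snd d (par c z))"
  using trans_image[OF assms] by (simp add: in_chart_def)

definition holo :: "'a set \<Rightarrow> ('a \<Rightarrow> complex) \<Rightarrow> bool" where
  "holo S f \<longleftrightarrow> (\<forall>c\<in>A. in_chart c f holomorphic_on snd c ` (fst c \<inter> S))"

lemma chart_at:
  assumes "x \<in> topspace X" obtains c where "c \<in> A" "x \<in> fst c"
proof -
  obtain U \<phi> where "(U, \<phi>) \<in> A" "x \<in> U" using assms unfolding cover[symmetric] by auto
  then show ?thesis using that[of "(U, \<phi>)"] by simp
qed

lemma chart_nbhd_ball:
  assumes "c \<in> A" "openin X S" "x \<in> fst c \<inter> S"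
  obtains r where "r > 0" "ball (snd c x) r \<subseteq> snd c ` (fst c \<inter> S)"
  using overlap_open[OF assms(1,2)] assms(3) by (meson imageI open_contains_ball)

text \<open>One chart around each point suffices because the transition maps are
  holomorphic.\<close>

lemma holo_local:
  assumes S: "openin X S" and loc: "\<And>x. x \<in> S \<Longrightarrow> \<exists>d\<in>A. x \<in> fst d \<and> (\<exists>r>0. in_chart d f holomorphic_on ball (snd d x) r)"
  shows "holo S f"
  unfolding holo_def
proof
  fix c assume c: "c \<in> A"
  show "in_chart c f holomorphic_on snd c ` (fst c \<inter> S)"
  proof (subst holomorphic_on_open[OF overlap_open[OF c S]], intro ballI)
    fix z assume "z \<in> snd c ` (fst c \<inter> S)"
    then obtain x where x: "x \<in> fst c" "x \<in> S" "z = snd c x" by auto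
    obtain d r where d: "d \<in> A" "x \<in> fst d" "r > 0" "in_chart d f holomorphic_on ball (snd d x) r" using loc[OF x(2)] by blast
    have z: "z \<in> snd c ` (fst c \<inter> fst d)" using x d by auto
    have pz: "snd d (par c z) = snd d x" using x c by (simp add: par_crd)
    have op: "open (snd c ` (fst c \<inter> fst d))" by (rule overlap_open[OF c chart_open[OF d(1)]])
    have "(in_chart d f has_field_derivative deriv (in_chart d f) (snd d x)) (at (snd d (par c z)))"
      unfolding pz using d(3) by (intro holomorphic_derivI[OF d(4)]) auto
    then have "((\<lambda>z. in_chart d f (snd d (par c z))) has_field_derivative deriv (in_chart d f) (snd d x) * deriv (\<lambda>z. snd d (par c z)) z) (at z)"
      by (rule DERIV_chain2[OF _ trans_deriv[OF c d(1) z]])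
    then have "(in_chart c f has_field_derivative deriv (in_chart d f) (snd d x) * deriv (\<lambda>z. snd d (par c z)) z) (at z)"
      by (rule has_field_derivative_transform_within_open[OF _ op z]) (simp add: in_chart_trans[OF c d(1)])
    then show "\<exists>f'. (in_chart c f has_field_derivative f') (at z)" by blast
  qed
qed

lemma points_closed: "closedin X {x}" if "x \<in> topspace X"
  using Hausdorff that by (simp add: closedin_Hausdorff_sing_eq)

lemma no_isolated_points:
  assumes "x \<in> topspace X" shows "\<not> openin X {x}"
proof
  assume o: "openin X {x}"
  obtain c where c: "c \<in> A" "x \<in> fst c" using chart_at[OF assms] .
  have "open (snd c ` {x})" using c o by (intro chart_open_image) auto
  then show False by (simp add: not_open_singleton)
qed

lemma punctured_nbhd_open: "openin X {x \<in> topspace X. \<exists>N. openin X N \<and> x \<in> N \<and> N - {x} \<subseteq> Z}" (is "openin X ?E")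
proof (subst openin_subopen, intro ballI)
  fix x assume "x \<in> ?E"
  then obtain N where N: "openin X N" "x \<in> N" "N - {x} \<subseteq> Z" "x \<in> topspace X" by blast
  have "N \<subseteq> ?E"
  proof
    fix y assume y: "y \<in> N"
    have yt: "y \<in> topspace X" using y N(1) openin_subset by blast
    have "openin X (N - {x})" using N points_closed by (intro openin_diff) auto
    moreover have "y \<noteq> x \<Longrightarrow> y \<in> N - {x} \<and> (N - {x}) - {y} \<subseteq> Z" using y N by auto
    ultimately show "y \<in> ?E" using N y yt by (cases "y = x") blast+
  qed
  then show "\<exists>T. openin X T \<and> x \<in> T \<and> T \<subseteq> ?E" using N by blast
qed

text \<open>The identity theorem in topological form. Points near which \<open>Z\<close> is
  everything, and points near which it is nothing, the point itself disregarded, form two disjoint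
  open sets that cover the surface. Since \<open>p\<close> is in the second, connectedness empties
  the first, and compactness makes \<open>Z\<close> finite.\<close>

lemma finite_or_generic:
  assumes cpt: "compact_space X" and Z: "Z \<subseteq> topspace X"
    and loc: "\<And>x. x \<in> topspace X \<Longrightarrow> \<exists>N. openin X N \<and> x \<in> N \<and> (N - {x} \<subseteq> Z \<or> N - {x} \<subseteq> - Z)"
    and p: "openin X N0" "p \<in> N0" "N0 - {p} \<subseteq> - Z"
  shows "finite Z"
proof -
  define E where "E = {x \<in> topspace X. \<exists>N. openin X N \<and> x \<in> N \<and> N - {x} \<subseteq> Z}"
  define F where "F = {x \<in> topspace X. \<exists>N. openin X N \<and> x \<in> N \<and> N - {x} \<subseteq> - Z}"
  have "openin X E" "openin X F" unfolding E_def F_def by (rule punctured_nbhd_open)+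
  moreover have "E \<inter> F = {}"
  proof (rule ccontr)
    assume "E \<inter> F \<noteq> {}"
    then obtain x N N' where x: "x \<in> topspace X" "openin X N" "x \<in> N" "N - {x} \<subseteq> Z" "openin X N'" "x \<in> N'" "N' - {x} \<subseteq> - Z"
      unfolding E_def F_def by blast
    \<comment> \<open>Both alternatives at the same point would isolate it.\<close>
    then have "N \<inter> N' = {x}" by blast
    then have "openin X {x}" using x by (metis openin_Int)
    then show False using no_isolated_points x by blast
  qed
  moreover have EF: "topspace X \<subseteq> E \<union> F"
  proof
    fix x assume x: "x \<in> topspace X"
    then obtain N where "openin X N" "x \<in> N" "N - {x} \<subseteq> Z \<or> N - {x} \<subseteq> - Z" using loc by meson
    then show "x \<in> E \<union> F" unfolding E_def F_def using x by blast
  qed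
  moreover have "F \<noteq> {}"
  proof -
    have "p \<in> topspace X" using p openin_subset[OF p(1)] by auto
    then have "p \<in> F" unfolding F_def using p by blast
    then show ?thesis by blast
  qed
  ultimately have "E = {}" using connected unfolding connected_space_def by meson
  then have F: "\<exists>N. openin X N \<and> x \<in> N \<and> N - {x} \<subseteq> - Z" if "x \<in> topspace X" for x
    using that EF \<open>E = {}\<close> unfolding F_def by blast
  then obtain N where N: "\<And>x. x \<in> topspace X \<Longrightarrow> openin X (N x) \<and> x \<in> N x \<and> N x - {x} \<subseteq> - Z" by metis
  obtain T where T: "finite T" "T \<subseteq> topspace X" "topspace X \<subseteq> (\<Union>x\<in>T. N x)"
  proof -
    have "\<exists>\<F>. finite \<F> \<and> \<F> \<subseteq> N ` topspace X \<and> topspace X \<subseteq> \<Union>\<F>"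
      using cpt unfolding compact_space_alt by (rule allE[of _ "N ` topspace X"]) (use N in blast)
    then show ?thesis using that by (metis finite_subset_image)
  qed
  have "Z \<subseteq> T"
  proof
    fix z assume z: "z \<in> Z"
    then obtain x where x: "x \<in> T" "z \<in> N x" using Z T(3) by blast
    then have "z = x" using N[of x] T(2) z by blast
    then show "z \<in> T" using x by simp
  qed
  then show ?thesis using T(1) finite_subset by blast
qed

lemma refined_chart:
  fixes a :: complex and r :: real
  assumes "(U, \<phi>) \<in> A" "openin X V" "V \<subseteq> U" "r > 0"
  defines "\<zeta> \<equiv> (\<lambda>x. (\<phi> x - a) / of_real r)"
  shows "open (\<zeta> ` V)" "homeomorphic_map (subtopology X V) (top_of_set (\<zeta> ` V)) \<zeta>"
proof -
  let ?L = "\<lambda>z. (z - a) / of_real r"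
  have z: "\<zeta> ` W = ?L ` (\<phi> ` W)" for W by (simp add: \<zeta>_def image_image)
  have L: "open (?L ` S)" if "open S" for S
  proof -
    have "?L = (\<lambda>z. (1 / of_real r) * z + (- a / of_real r))" by (simp add: fun_eq_iff diff_divide_distrib)
    then have "?L ` S = (\<lambda>z. (- a / of_real r) + z) ` ((\<lambda>z. (1 / of_real r) * z) ` S)" by (simp add: image_image diff_divide_distrib)
    moreover have "open ((\<lambda>z. (1 / of_real r) * z) ` S)"
      using open_scaling[of "1/r" S] that assms(4) by (simp add: scaleR_conv_of_real)
    ultimately show ?thesis using open_translation by metis
  qed
  have \<phi>o: "open (\<phi> ` W)" if "openin X W" "W \<subseteq> U" for W using chart_open_image[OF assms(1) that(1)] that by simp
  show "open (\<zeta> ` V)" unfolding z by (intro L \<phi>o assms)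
  have cm: "continuous_map (subtopology X U) euclidean \<phi>"
    using chart_everything(1)[OF assms(1)] by (auto intro: continuous_map_into_fulltopology)
  have cV: "continuous_map (subtopology X V) euclidean \<phi>"
    using continuous_map_from_subtopology_mono[OF cm assms(3)] .
  have c\<zeta>: "continuous_map (subtopology X V) euclidean \<zeta>"
  proof -
    have "continuous_on UNIV ?L" using assms(4) by (intro continuous_intros) auto
    then have "continuous_map euclidean euclidean ?L" by simp
    from continuous_map_compose[OF cV this] show ?thesis by (simp add: \<zeta>_def o_def)
  qed
  have inj: "inj_on \<zeta> V"
    using inj_on_subset[OF chart_inj[OF assms(1)], of V] assms(3,4) by (auto simp: inj_on_def \<zeta>_def)
  have top: "topspace (subtopology X V) = V" using assms(2) openin_subset by (force simp: topspace_subtopology)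
  have om: "open_map (subtopology X V) (top_of_set (\<zeta> ` V)) \<zeta>"
    unfolding open_map_def
  proof (intro allI impI)
    fix W assume "openin (subtopology X V) W"
    then have W: "openin X W" "W \<subseteq> V" using openin_open_subtopology[OF assms(2)] by auto
    then have "open (\<zeta> ` W)" unfolding z using assms(3) by (intro L \<phi>o) auto
    then show "openin (top_of_set (\<zeta> ` V)) (\<zeta> ` W)" using W by (intro open_subset image_mono)
  qed
  show "homeomorphic_map (subtopology X V) (top_of_set (\<zeta> ` V)) \<zeta>"
    using c\<zeta> om inj top
    by (intro bijective_open_imp_homeomorphic_map) (auto simp: continuous_map_in_subtopology)
qed

lemma refined_riemann_surface: "riemann_surface X (refined_atlas X A)"
proof
  show "topspace X \<noteq> {}" by (rule nonempty)
  show "Hausdorff_space X" by (rule Hausdorff)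
  show "connected_space X" by (rule connected)
  show "(\<Union>(U, \<phi>)\<in>refined_atlas X A. U) = topspace X"
  proof
    show "(\<Union>(U, \<phi>)\<in>refined_atlas X A. U) \<subseteq> topspace X"
      using openin_subset by (fastforce simp: refined_atlas_def)
    show "topspace X \<subseteq> (\<Union>(U, \<phi>)\<in>refined_atlas X A. U)"
      using refined_atlas_superset[OF riemann_surface_axioms] cover by blast
  qed
next
  fix V \<zeta> assume "(V, \<zeta>) \<in> refined_atlas X A"
  then obtain U \<phi> a r where *: "(U, \<phi>) \<in> A" "openin X V" "V \<subseteq> U" "r > 0" "\<zeta> = (\<lambda>x. (\<phi> x - a) / of_real r)"
    unfolding refined_atlas_def by blast
  show "openin X V" by fact
  show "open (\<zeta> ` V)" "homeomorphic_map (subtopology X V) (top_of_set (\<zeta> ` V)) \<zeta>"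
    unfolding *(5) by (rule refined_chart[OF *(1-4)])+
next
  fix V1 \<zeta>1 V2 \<zeta>2 assume 1: "(V1, \<zeta>1) \<in> refined_atlas X A" and 2: "(V2, \<zeta>2) \<in> refined_atlas X A"
  obtain U1 \<phi>1 a1 r1 where *: "(U1, \<phi>1) \<in> A" "openin X V1" "V1 \<subseteq> U1" "r1 > 0" "\<zeta>1 = (\<lambda>x. (\<phi>1 x - a1) / of_real r1)"
    using 1 unfolding refined_atlas_def by blast
  obtain U2 \<phi>2 a2 r2 where **: "(U2, \<phi>2) \<in> A" "openin X V2" "V2 \<subseteq> U2" "r2 > 0" "\<zeta>2 = (\<lambda>x. (\<phi>2 x - a2) / of_real r2)"
    using 2 unfolding refined_atlas_def by blast
  have inj1: "inj_on \<phi>1 U1" using chart_inj[OF *(1)] by simp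
  then have injz: "inj_on \<zeta>1 V1" using inj_on_subset[OF inj1 *(3)] *(4) by (auto simp: inj_on_def *(5))
  let ?g = "\<lambda>w. ((\<phi>2 \<circ> inv_into U1 \<phi>1) (of_real r1 * w + a1) - a2) / of_real r2"
  have "?g holomorphic_on \<zeta>1 ` (V1 \<inter> V2)"
  proof -
    have "(\<lambda>w. (\<phi>2 \<circ> inv_into U1 \<phi>1) (of_real r1 * w + a1)) holomorphic_on \<zeta>1 ` (V1 \<inter> V2)"
    proof (rule holomorphic_on_compose_gen[of "\<lambda>w. of_real r1 * w + a1" _ "\<phi>2 \<circ> inv_into U1 \<phi>1" "\<phi>1 ` (U1 \<inter> U2)", unfolded o_def[of "\<phi>2 \<circ> inv_into U1 \<phi>1"]])
      show "(\<phi>2 \<circ> inv_into U1 \<phi>1) holomorphic_on \<phi>1 ` (U1 \<inter> U2)" by (rule chart_transition[OF *(1) **(1)])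
      show "(\<lambda>w. of_real r1 * w + a1) ` (\<zeta>1 ` (V1 \<inter> V2)) \<subseteq> \<phi>1 ` (U1 \<inter> U2)"
        using *(3,4) **(3) by (auto simp: *(5))
    qed (intro holomorphic_intros)
    then show ?thesis using **(4) by (intro holomorphic_intros) auto
  qed
  then show "(\<zeta>2 \<circ> inv_into V1 \<zeta>1) holomorphic_on \<zeta>1 ` (V1 \<inter> V2)"
  proof (rule holomorphic_transform)
    fix w assume "w \<in> \<zeta>1 ` (V1 \<inter> V2)"
    then obtain x where x: "x \<in> V1" "w = \<zeta>1 x" by auto
    have "inv_into V1 \<zeta>1 w = x" using x injz by simp
    moreover have "of_real r1 * w + a1 = \<phi>1 x" using x *(4) by (simp add: *(5))
    moreover have "inv_into U1 \<phi>1 (\<phi>1 x) = x" using inj1 x *(3) by (auto intro: inv_into_f_f)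
    ultimately show "?g w = (\<zeta>2 \<circ> inv_into V1 \<zeta>1) w" by (simp add: **(5))
  qed
qed

end

text \<open>The discs are covered where \<open>|z| < 1\<close>; the radii 2 and 3 are those of the supports of the partition of
  unity and of the cut-off functions.\<close>

locale compact_surface = riemann_surface +
  assumes compact: "compact_space X"
    and disc: "openin X N \<Longrightarrow> p \<in> N \<Longrightarrow> \<exists>c\<in>A. p \<in> fst c \<and> fst c \<subseteq> N \<and> snd c p = 0 \<and> snd c ` fst c = ball 0 4"

lemma compact_surface_refined:
  assumes "riemann_surface X A" "compact_space X"
  shows "compact_surface X (refined_atlas X A)"
proof -
  interpret A: riemann_surface X A by fact
  interpret R: riemann_surface X "refined_atlas X A" by (rule A.refined_riemann_surface)
  show ?thesis
  proof
    fix N p assume N: "openin X N" "p \<in> N"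
    then have "p \<in> topspace X" using openin_subset by blast
    then obtain c where c: "c \<in> A" "p \<in> fst c" by (rule A.chart_at)
    obtain r where r: "r > 0" "ball (snd c p) r \<subseteq> snd c ` (fst c \<inter> N)" using A.chart_nbhd_ball[OF c(1) N(1)] c N by blast
    define V where "V = {x \<in> fst c \<inter> N. snd c x \<in> ball (snd c p) r}"
    \<comment> \<open>Dividing by r/4 makes the image a disc of radius exactly 4.\<close>
    define \<zeta> where "\<zeta> = (\<lambda>x. (snd c x - snd c p) / of_real (r/4))"
    have oV: "openin X V"
    proof -
      have "V = N \<inter> {x \<in> fst c. snd c x \<in> ball (snd c p) r}" by (auto simp: V_def)
      then show ?thesis using N(1) A.chart_preimage_open[OF c(1), of "ball (snd c p) r"] by (simp add: openin_Int)
    qed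
    have "(V, \<zeta>) \<in> refined_atlas X A"
      unfolding refined_atlas_def mem_Collect_eq \<zeta>_def
      by (rule exI[of _ V], rule exI[of _ "fst c"], rule exI[of _ "snd c"], rule exI[of _ "snd c p"], rule exI[of _ "r/4"])
         (use c r oV in \<open>auto simp: V_def\<close>)
    moreover have "\<zeta> ` V = ball 0 4"
    proof
      show "\<zeta> ` V \<subseteq> ball 0 4" 
      proof
        fix w assume "w \<in> \<zeta> ` V"
        then obtain x where x: "x \<in> V" "w = \<zeta> x" by blast
        have "norm (snd c x - snd c p) < r" using x(1) by (auto simp: V_def dist_norm norm_minus_commute)
        moreover have "norm w = norm (snd c x - snd c p) / (r/4)" unfolding x(2) \<zeta>_def using r(1) by (simp only: norm_divide norm_of_real)
        ultimately show "w \<in> ball 0 4" using r(1) by (simp add: pos_divide_less_eq)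
      qed
      show "ball 0 4 \<subseteq> \<zeta> ` V"
      proof
        fix w::complex assume w: "w \<in> ball 0 4"
        let ?u = "snd c p + of_real (r/4) * w"
        have "norm (of_real (r/4) * w) < r" using w r(1) by (simp add: norm_mult)
        then have u: "?u \<in> ball (snd c p) r" by (simp add: dist_norm)
        then obtain x where x: "x \<in> fst c \<inter> N" "?u = snd c x" using r(2) by blast
        have "x \<in> V" using x u by (auto simp: V_def)
        moreover have "\<zeta> x = w" using r(1) by (simp add: \<zeta>_def flip: x(2))
        ultimately show "w \<in> \<zeta> ` V" by blast
      qed
    qed
    ultimately show "\<exists>c\<in>refined_atlas X A. p \<in> fst c \<and> fst c \<subseteq> N \<and> snd c p = 0 \<and> snd c ` fst c = ball 0 4"
      using c N r by (intro bexI[of _ "(V, \<zeta>)"]) (auto simp: V_def \<zeta>_def)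
  qed fact
qed

context compact_surface
begin

text \<open>The property \<open>P\<close> travels along so that a disc can be chosen together with
  extra data on it, later a lift of the curve.\<close>

lemma finite_disc_cover:
  assumes P: "\<And>x. x \<in> topspace X \<Longrightarrow> \<exists>c\<in>A. x \<in> fst c \<and> snd c x = 0 \<and> snd c ` fst c = ball 0 4 \<and> P c" and r: "r > 0"
  obtains C where "finite C" "C \<subseteq> A" "\<And>c. c \<in> C \<Longrightarrow> snd c ` fst c = ball 0 4 \<and> P c"
    "\<And>x. x \<in> topspace X \<Longrightarrow> \<exists>c\<in>C. x \<in> fst c \<and> norm (snd c x) < r"
proof -
  obtain ch where ch: "\<And>x. x \<in> topspace X \<Longrightarrow> ch x \<in> A \<and> x \<in> fst (ch x) \<and> snd (ch x) x = 0 \<and> snd (ch x) ` fst (ch x) = ball 0 4 \<and> P (ch x)"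
    using P by metis
  define N where "N x = {y \<in> fst (ch x). snd (ch x) y \<in> ball 0 r}" for x
  have N: "openin X (N x)" "x \<in> N x" if "x \<in> topspace X" for x
    unfolding N_def using ch[OF that] r chart_preimage_open[of "ch x" "ball 0 r"] by auto
  have "\<exists>\<F>. finite \<F> \<and> \<F> \<subseteq> N ` topspace X \<and> topspace X \<subseteq> \<Union>\<F>"
    using compact unfolding compact_space_alt by (rule allE[of _ "N ` topspace X"]) (use N in blast)
  then obtain T where T: "finite T" "T \<subseteq> topspace X" "topspace X \<subseteq> (\<Union>x\<in>T. N x)"
    by (metis finite_subset_image)
  show ?thesis
  proof (rule that[of "ch ` T"])
    fix x assume "x \<in> topspace X"
    then obtain y where "y \<in> T" "x \<in> N y" using T(3) by blast
    then show "\<exists>c\<in>ch ` T. x \<in> fst c \<and> norm (snd c x) < r" by (auto simp: N_def)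
  next
    fix c assume "c \<in> ch ` T"
    then obtain x where "x \<in> topspace X" "c = ch x" using T(2) by blast
    then show "snd c ` fst c = ball 0 4 \<and> P c" using ch[of x] by blast
  next
    show "ch ` T \<subseteq> A" using T(2) ch by blast
  qed (use T in auto)
qed

end

section \<open>Finite linear systems and the Fredholm argument\<close>

lemma homogeneous_system_nontrivial:
  fixes a :: "'j \<Rightarrow> 'i \<Rightarrow> 'f::field"
  assumes "finite J" "finite I" "card J < card I"
  shows "\<exists>c. (\<exists>i\<in>I. c i \<noteq> 0) \<and> (\<forall>j\<in>J. (\<Sum>i\<in>I. c i * a j i) = 0)"
  using assms
proof (induction J arbitrary: I a rule: finite_induct)
  case empty
  then have "I \<noteq> {}" by auto
  then show ?case by (intro exI[of _ "\<lambda>_. 1"]) auto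
next
  case (insert j J)
  show ?case
  proof (cases "\<forall>i\<in>I. a j i = 0")
    case True
    have "card J < card I" using insert by simp
    from insert.IH[OF insert.prems(1) this, of a] obtain c where "\<exists>i\<in>I. c i \<noteq> 0" "\<forall>j\<in>J. (\<Sum>i\<in>I. c i * a j i) = 0" by blast
    then show ?thesis using True by (intro exI[of _ c]) auto
  next
    case False
    then obtain i0 where i0: "i0 \<in> I" "a j i0 \<noteq> 0" by blast
    define I' where "I' = I - {i0}"
    have I': "finite I'" "card J < card I'" "I = insert i0 I'" "i0 \<notin> I'"
      using insert i0 by (auto simp: I'_def)
    \<comment> \<open>The remaining system after the unknown \<open>i0\<close> has been eliminated
      by means of equation \<open>j\<close>.\<close>
    define b where "b k i = a k i - a k i0 * a j i / a j i0" for k i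
    from insert.IH[OF I'(1,2), of b] obtain c where c: "\<exists>i\<in>I'. c i \<noteq> 0" "\<forall>k\<in>J. (\<Sum>i\<in>I'. c i * b k i) = 0" by blast
    define s where "s = (\<Sum>i\<in>I'. c i * a j i)"
    define c' where "c' = c(i0 := - s / a j i0)"
    have c': "(\<Sum>i\<in>I. c' i * a k i) = - s / a j i0 * a k i0 + (\<Sum>i\<in>I'. c i * a k i)" for k
    proof -
      have "(\<Sum>i\<in>I'. c' i * a k i) = (\<Sum>i\<in>I'. c i * a k i)" using I'(4) by (intro sum.cong) (auto simp: c'_def)
      then show ?thesis using I' by (simp add: c'_def)
    qed
    have "(\<Sum>i\<in>I. c' i * a k i) = 0" if "k \<in> insert j J" for k
    proof (cases "k = j")
      case True then show ?thesis unfolding c' using i0 by (simp add: s_def)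
    next
      case False
      then have "(\<Sum>i\<in>I'. c i * b k i) = 0" using that c(2) by blast
      moreover have "(\<Sum>i\<in>I'. c i * b k i) = (\<Sum>i\<in>I'. c i * a k i) - a k i0 / a j i0 * s"
        unfolding b_def s_def by (simp add: right_diff_distrib sum_subtractf sum_distrib_left algebra_simps)
      ultimately show ?thesis unfolding c' by (simp add: algebra_simps)
    qed
    moreover have "\<exists>i\<in>I. c' i \<noteq> 0" using c(1) I' by (auto simp: c'_def)
    ultimately show ?thesis by blast
  qed
qed

text \<open>Since \<open>Q\<close> is a contraction, v + Q v = N k has a solution w k for every k.
  The obstruction \<open>F\<close> is controlled by \<open>card L\<close> functionals, and with more
  right-hand sides than functionals some nontrivial combination of the w k is killed by all of
  them.\<close>

lemma fredholm_finite_codimension: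
  fixes Q F :: "'b::{real_normed_vector, complete_space} \<Rightarrow> 'b" and l :: "'l \<Rightarrow> 'b \<Rightarrow> real"
  assumes Q: "linear Q" "\<And>v. norm (Q v) \<le> norm v / 2" and F: "linear F"
    and l: "finite L" "\<And>i. i \<in> L \<Longrightarrow> linear (l i)" "\<And>v. (\<And>i. i \<in> L \<Longrightarrow> l i v = 0) \<Longrightarrow> F v = 0"
    and I: "finite I" "card L < card I"
  shows "\<exists>c v. (\<exists>k\<in>I. c k \<noteq> 0) \<and> v + (Q v + F v) = (\<Sum>k\<in>I. c k *\<^sub>R N k)"
proof -
  have "\<exists>v. v + Q v = N k" for k
  proof -
    have "\<exists>!v. N k - Q v = v"
    proof (rule banach_fix_type[of "1/2"])
      have "dist (N k - Q x) (N k - Q y) \<le> 1/2 * dist x y" for x y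
        using Q(2)[of "y - x"] by (simp add: dist_norm norm_minus_commute linear_diff[OF Q(1)])
      then show "\<forall>x y. dist (N k - Q x) (N k - Q y) \<le> 1/2 * dist x y" by blast
    qed auto
    then show ?thesis by (metis diff_add_cancel add.commute)
  qed
  then obtain w where w: "\<And>k. w k + Q (w k) = N k" by metis
  obtain c where c: "\<exists>k\<in>I. c k \<noteq> 0" "\<And>i. i \<in> L \<Longrightarrow> (\<Sum>k\<in>I. c k * l i (w k)) = 0"
    using homogeneous_system_nontrivial[OF l(1) I, of "\<lambda>i k. l i (w k)"] by blast
  define v where "v = (\<Sum>k\<in>I. c k *\<^sub>R w k)"
  have "F v = 0"
    by (rule l(3)) (simp add: v_def linear_sum[OF l(2)] linear_scale[OF l(2)] c(2))
  moreover have "v + Q v = (\<Sum>k\<in>I. c k *\<^sub>R N k)"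
    unfolding v_def by (simp add: linear_sum[OF Q(1)] linear_scale[OF Q(1)] flip: w) (simp add: scaleR_add_right sum.distrib)
  ultimately show ?thesis using c(1) by (intro exI[of _ c] exI[of _ v]) auto
qed

section \<open>Functions with one pole\<close>

text \<open>The simplest C^1 function that is flat on a half line; one derivative is all that the
  cut-offs are asked for.\<close>

definition sqpos :: "real \<Rightarrow> real" where "sqpos t = (max 0 t)\<^sup>2"

lemma sqpos_deriv: "(sqpos has_field_derivative 2 * max 0 t) (at t)"
proof -
  have cl: "closure {..0} = {..0::real}" "closure {0<..} = {0::real..}" by auto
  have U: "{..0} \<union> {0<..} = (UNIV::real set)" by auto
  have 2: "((\<lambda>t::real. t\<^sup>2) has_derivative (\<lambda>h. (2 * t) * h)) (at t within X)" for X t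
    by (auto intro!: derivative_eq_intros)
  have "((\<lambda>t. if t \<in> {..0} then 0 else t\<^sup>2) has_derivative
     (if t \<in> {..0} then (\<lambda>h. 0) else (\<lambda>h. (2 * t) * h))) (at t within {..0} \<union> {0<..})"
    by (rule has_derivative_If_within_closures[where f'="\<lambda>t h. 0" and g'="\<lambda>t h. (2 * t) * h"])
       (use 2 in \<open>auto simp: cl\<close>)
  moreover have "(\<lambda>t::real. if t \<in> {..0} then 0 else t\<^sup>2) = sqpos" by (auto simp: sqpos_def max_def)
  moreover have "(if t \<in> {..0} then (\<lambda>h. 0) else (\<lambda>h. (2 * t) * h)) = (\<lambda>h. (2 * max 0 t) * h)" by (auto simp: fun_eq_iff)
  ultimately show ?thesis unfolding has_field_derivative_def U by simp
qed

text \<open>To be used with s = |z|^2: the map (s - 1)/3 carries [1, 4] to [0, 1], so the profile is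
  1 up to radius 1 and 0 from radius 2 on.\<close>

definition bump_profile :: "real \<Rightarrow> real" where "bump_profile s = sqpos (1 - sqpos ((s - 1) / 3))"

definition bump_profile' :: "real \<Rightarrow> real" where
  "bump_profile' s = 2 * max 0 (1 - sqpos ((s - 1) / 3)) * (- (2 * max 0 ((s - 1) / 3) * (1/3)))"

lemma bump_profile_deriv: "(bump_profile has_field_derivative bump_profile' s) (at s)"
proof -
  have "((\<lambda>s. (s - 1) / 3) has_field_derivative 1/3) (at s)" for s :: real
    by (auto intro!: derivative_eq_intros)
  from DERIV_chain2[OF sqpos_deriv this]
  have "((\<lambda>s. 1 - sqpos ((s - 1) / 3)) has_field_derivative - (2 * max 0 ((s - 1) / 3) * (1/3))) (at s)" for s
    by (auto intro!: derivative_eq_intros)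
  from DERIV_chain2[OF sqpos_deriv this] show ?thesis by (simp add: bump_profile_def[abs_def] bump_profile'_def)
qed

lemma continuous_sqpos: "continuous_on S f \<Longrightarrow> continuous_on S (\<lambda>x. sqpos (f x))"
  unfolding sqpos_def by (intro continuous_intros)

definition bump :: "complex \<Rightarrow> complex" where "bump z = of_real (bump_profile ((norm z)\<^sup>2))"

definition bump' :: "complex \<Rightarrow> complex" where "bump' z = of_real (bump_profile' ((norm z)\<^sup>2)) * z"

lemma bump_dbar: "has_dbar bump (bump' z) z"
proof -
  have sq: "((\<lambda>z. (norm z)\<^sup>2) has_derivative (\<lambda>h. 2 * Re (cnj z * h))) (at z)" for z::complex
  proof -
    have "((\<lambda>z. z \<bullet> z) has_derivative (\<lambda>h. z \<bullet> h + h \<bullet> z)) (at z)"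
      by (auto intro!: derivative_eq_intros)
    then show ?thesis by (simp add: power2_norm_eq_inner inner_complex_def algebra_simps)
  qed
  have "((\<lambda>z. bump_profile ((norm z)\<^sup>2)) has_derivative (\<lambda>h. bump_profile' ((norm z)\<^sup>2) * (2 * Re (cnj z * h)))) (at z)"
    using has_derivative_compose[OF sq bump_profile_deriv[unfolded has_field_derivative_def]] by simp
  from has_derivative_of_real[OF this]
  have "(bump has_derivative (\<lambda>h. of_real (bump_profile' ((norm z)\<^sup>2) * (2 * Re (cnj z * h))))) (at z)"
    unfolding bump_def[abs_def] .
  moreover have "complex_of_real (bump_profile' ((norm z)\<^sup>2) * (2 * Re (cnj z * h))) = of_real (bump_profile' ((norm z)\<^sup>2)) * cnj z * h + bump' z * cnj h" for h
  proof -
    have "complex_of_real (2 * Re (cnj z * h)) = cnj z * h + z * cnj h"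
      using complex_add_cnj[of "cnj z * h"] by simp
    then show ?thesis unfolding of_real_mult[of "bump_profile' _"] by (simp only: bump'_def) (simp add: algebra_simps)
  qed
  ultimately show ?thesis unfolding has_dbar_def by (intro exI[of _ "of_real (bump_profile' ((norm z)\<^sup>2)) * cnj z"]) simp
qed

lemma continuous_bump': "continuous_on S bump'"
  unfolding bump'_def[abs_def] bump_profile'_def[abs_def]
  by (intro continuous_intros continuous_sqpos) auto

lemma bump_eq_1: "norm z \<le> 1 \<Longrightarrow> bump z = 1"
proof -
  assume "norm z \<le> 1"
  then have "(norm z)\<^sup>2 \<le> 1" by (simp add: power_le_one)
  then show ?thesis by (simp add: bump_def bump_profile_def sqpos_def max_def)
qed

lemma bump_eq_0: "norm z \<ge> 2 \<Longrightarrow> bump z = 0"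
proof -
  assume "norm z \<ge> 2"
  then have "2\<^sup>2 \<le> (norm z)\<^sup>2" by (intro power_mono) auto
  then have t: "((norm z)\<^sup>2 - 1) / 3 \<ge> 1" by simp
  then have "sqpos (((norm z)\<^sup>2 - 1) / 3) \<ge> 1" unfolding sqpos_def by (intro one_le_power) auto
  then show ?thesis by (simp add: bump_def bump_profile_def sqpos_def[of "1 - _"])
qed

lemma bump_real: "bump z = of_real (bump_profile ((norm z)\<^sup>2))" "bump_profile s \<ge> 0"
  by (auto simp: bump_def bump_profile_def sqpos_def)

section \<open>Functions on the surface with continuous dbar, and extension by zero\<close>

context riemann_surface
begin

text \<open>Continuity is demanded of the dbar alone, because it becomes the right-hand side of an
  equation in a space of continuous functions.\<close>

definition cdbar :: "'a set \<Rightarrow> ('a \<Rightarrow> complex) \<Rightarrow> bool" where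
  "cdbar S f \<longleftrightarrow> (\<forall>c\<in>A. \<exists>a. continuous_on (snd c ` (fst c \<inter> S)) a \<and> (\<forall>z\<in>snd c ` (fst c \<inter> S). has_dbar (in_chart c f) (a z) z))"

definition dbar :: "'a chart \<Rightarrow> ('a \<Rightarrow> complex) \<Rightarrow> complex \<Rightarrow> complex" where
  "dbar c f z = (THE a. has_dbar (in_chart c f) a z)"

lemma dbar_eq: "has_dbar (in_chart c f) a z \<Longrightarrow> dbar c f z = a"
  unfolding dbar_def using has_dbar_unique by blast

lemma cdbarD:
  assumes "cdbar S f" "c \<in> A"
  shows "continuous_on (snd c ` (fst c \<inter> S)) (dbar c f)"
    and "z \<in> snd c ` (fst c \<inter> S) \<Longrightarrow> has_dbar (in_chart c f) (dbar c f z) z"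
proof -
  obtain a where a: "continuous_on (snd c ` (fst c \<inter> S)) a" "\<And>z. z \<in> snd c ` (fst c \<inter> S) \<Longrightarrow> has_dbar (in_chart c f) (a z) z"
    using assms unfolding cdbar_def by blast
  have e: "dbar c f z = a z" if "z \<in> snd c ` (fst c \<inter> S)" for z using dbar_eq[OF a(2)[OF that]] .
  show "continuous_on (snd c ` (fst c \<inter> S)) (dbar c f)" using a(1) by (rule continuous_on_eq) (simp add: e)
  show "has_dbar (in_chart c f) (dbar c f z) z" if "z \<in> snd c ` (fst c \<inter> S)" using a(2)[OF that] e[OF that] by simp
qed

lemma cdbar_cont:
  assumes "cdbar S f" "c \<in> A"
  shows "continuous_on (snd c ` (fst c \<inter> S)) (in_chart c f)"
  using cdbarD(2)[OF assms] unfolding has_dbar_def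
  by (meson continuous_at_imp_continuous_on has_derivative_continuous)

lemma cdbar_mult:
  assumes "cdbar S f" "cdbar S g" shows "cdbar S (\<lambda>x. f x * g x)"
  unfolding cdbar_def
proof
  fix c assume c: "c \<in> A"
  let ?a = "\<lambda>z. in_chart c f z * dbar c g z + dbar c f z * in_chart c g z"
  have "continuous_on (snd c ` (fst c \<inter> S)) ?a"
    by (intro continuous_intros cdbarD(1) cdbar_cont assms c)
  moreover have "has_dbar (in_chart c (\<lambda>x. f x * g x)) (?a z) z" if "z \<in> snd c ` (fst c \<inter> S)" for z
    using has_dbar_mult[OF cdbarD(2)[OF assms(1) c that] cdbarD(2)[OF assms(2) c that]] by (simp add: in_chart_def o_def)
  ultimately show "\<exists>a. continuous_on (snd c ` (fst c \<inter> S)) a \<and> (\<forall>z\<in>snd c ` (fst c \<inter> S). has_dbar (in_chart c (\<lambda>x. f x * g x)) (a z) z)" by blast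
qed

lemma cdbar_sum:
  assumes "\<And>i. i \<in> I \<Longrightarrow> cdbar S (f i)" shows "cdbar S (\<lambda>x. \<Sum>i\<in>I. f i x)"
  unfolding cdbar_def
proof
  fix c assume c: "c \<in> A"
  let ?a = "\<lambda>z. \<Sum>i\<in>I. dbar c (f i) z"
  have "continuous_on (snd c ` (fst c \<inter> S)) ?a"
    by (intro continuous_intros cdbarD(1) assms c)
  moreover have "has_dbar (in_chart c (\<lambda>x. \<Sum>i\<in>I. f i x)) (?a z) z" if "z \<in> snd c ` (fst c \<inter> S)" for z
    using has_dbar_sum[of I "\<lambda>i. in_chart c (f i)" "\<lambda>i. dbar c (f i) z", OF cdbarD(2)[OF assms c that]] by (simp add: in_chart_def o_def)
  ultimately show "\<exists>a. continuous_on (snd c ` (fst c \<inter> S)) a \<and> (\<forall>z\<in>snd c ` (fst c \<inter> S). has_dbar (in_chart c (\<lambda>x. \<Sum>i\<in>I. f i x)) (a z) z)" by blast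
qed

lemma cdbar_inverse:
  assumes "cdbar S f" "\<And>x. x \<in> S \<Longrightarrow> f x \<noteq> 0" shows "cdbar S (\<lambda>x. inverse (f x))"
  unfolding cdbar_def
proof
  fix c assume c: "c \<in> A"
  let ?a = "\<lambda>z. - dbar c f z / (in_chart c f z)\<^sup>2"
  have nz: "in_chart c f z \<noteq> 0" if z: "z \<in> snd c ` (fst c \<inter> S)" for z
  proof -
    have "par c z \<in> S" using z c by (auto simp: par_crd)
    then show ?thesis using assms(2) by (simp add: in_chart_def)
  qed
  have "continuous_on (snd c ` (fst c \<inter> S)) ?a"
    using nz by (intro continuous_intros cdbarD(1) cdbar_cont assms c) auto
  moreover have "has_dbar (in_chart c (\<lambda>x. inverse (f x))) (?a z) z" if z: "z \<in> snd c ` (fst c \<inter> S)" for z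
    using has_dbar_inverse[OF cdbarD(2)[OF assms(1) c z] nz[OF z]] by (simp add: in_chart_def o_def)
  ultimately show "\<exists>a. continuous_on (snd c ` (fst c \<inter> S)) a \<and> (\<forall>z\<in>snd c ` (fst c \<inter> S). has_dbar (in_chart c (\<lambda>x. inverse (f x))) (a z) z)" by blast
qed

lemma par_continuous:
  assumes "c \<in> A" shows "continuous_map (top_of_set (snd c ` fst c)) X (par c)"
  unfolding continuous_map_def
proof (intro conjI allI impI)
  show "par c \<in> topspace (top_of_set (snd c ` fst c)) \<rightarrow> topspace X"
    using chart_sub[OF assms] par_mem[of _ c] by (auto intro: subsetD)
  fix W assume W: "openin X W"
  have "{z \<in> topspace (top_of_set (snd c ` fst c)). par c z \<in> W} = snd c ` (fst c \<inter> W)"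
  proof (intro equalityI subsetI)
    fix z assume z: "z \<in> {z \<in> topspace (top_of_set (snd c ` fst c)). par c z \<in> W}"
    then have "z \<in> snd c ` fst c" "par c z \<in> W" by auto
    then show "z \<in> snd c ` (fst c \<inter> W)" using crd_par[of z c] par_mem[of z c] by (metis IntI imageI)
  next
    fix z assume "z \<in> snd c ` (fst c \<inter> W)"
    then show "z \<in> {z \<in> topspace (top_of_set (snd c ` fst c)). par c z \<in> W}" using assms by (auto simp: par_crd)
  qed
  then show "openin (top_of_set (snd c ` fst c)) {z \<in> topspace (top_of_set (snd c ` fst c)). par c z \<in> W}"
    using overlap_open[OF assms W] by (auto intro: open_subset)
qed

text \<open>A closed coordinate disc is compact, hence closed in the whole surface by the Hausdorff
  property. Without this, extension by zero could fail to be continuous.\<close>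

lemma closed_disc_closed:
  assumes c: "c \<in> A" and sub: "cball 0 r \<subseteq> snd c ` fst c"
  shows "closedin X {x \<in> fst c. norm (snd c x) \<le> r}"
proof -
  have "compactin (top_of_set (snd c ` fst c)) (cball 0 r)" using sub by (simp add: compactin_subtopology)
  from image_compactin[OF this par_continuous[OF c]] have "compactin X (par c ` cball 0 r)" .
  then have "closedin X (par c ` cball 0 r)" using Hausdorff compactin_imp_closedin by blast
  moreover have "par c ` cball 0 r = {x \<in> fst c. norm (snd c x) \<le> r}"
  proof (intro equalityI subsetI)
    fix x assume "x \<in> par c ` cball 0 r"
    then obtain z where z: "z \<in> cball 0 r" "x = par c z" by blast
    then have "z \<in> snd c ` fst c" using sub by blast
    then show "x \<in> {x \<in> fst c. norm (snd c x) \<le> r}" using z crd_par[of z c] par_mem[of z c] by auto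
  next
    fix x assume x: "x \<in> {x \<in> fst c. norm (snd c x) \<le> r}"
    then have "x = par c (snd c x)" "snd c x \<in> cball 0 r" using c by (auto simp: par_crd)
    then show "x \<in> par c ` cball 0 r" by blast
  qed
  ultimately show ?thesis by simp
qed

definition extend0 :: "'a chart \<Rightarrow> (complex \<Rightarrow> complex) \<Rightarrow> 'a \<Rightarrow> complex" where
  "extend0 d F x = (if x \<in> fst d then F (snd d x) else 0)"

text \<open>The chart domain and the complement of the closed disc of radius 2 are open and cover
  \<open>S\<close>; the extension is \<open>F\<close> on the one and 0 on the other. The set
  \<open>T\<close> admits a singularity of \<open>F\<close> outside \<open>S\<close>, as for the
  cut-off principal parts.\<close>

lemma cdbar_extend0:
  assumes d: "d \<in> A" "snd d ` fst d = ball 0 4" and S: "openin X S" and T: "\<And>x. x \<in> S \<inter> fst d \<Longrightarrow> snd d x \<in> T"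
    and F: "\<And>z. z \<in> T \<Longrightarrow> has_dbar F (F' z) z" "continuous_on T F'" and F0: "\<And>z. norm z \<ge> 2 \<Longrightarrow> F z = 0"
  shows "cdbar S (extend0 d F)"
  unfolding cdbar_def
proof
  fix c assume c: "c \<in> A"
  let ?f = "extend0 d F" and ?D = "snd c ` (fst c \<inter> S)"
  let ?\<tau> = "\<lambda>z. snd d (par c z)"
  let ?K = "{x \<in> fst d. norm (snd d x) \<le> 2}"
  define a where "a z = (if par c z \<in> fst d then F' (?\<tau> z) * cnj (deriv ?\<tau> z) else 0)" for z
  define D1 where "D1 = snd c ` (fst c \<inter> (S \<inter> fst d))"
  define D2 where "D2 = snd c ` (fst c \<inter> (S - ?K))"
  have oS: "openin X (S - ?K)"
    using d(2) by (intro openin_diff S closed_disc_closed d) auto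
  have o1: "open D1" unfolding D1_def by (intro overlap_open c openin_Int S chart_open d)
  have o2: "open D2" unfolding D2_def by (intro overlap_open c oS)
  have D: "?D = D1 \<union> D2" unfolding D1_def D2_def by blast
  have D1': "par c z \<in> S \<inter> fst d" "z \<in> snd c ` (fst c \<inter> fst d)" if "z \<in> D1" for z
    using that c unfolding D1_def by (auto simp: par_crd)
  have D2': "par c z \<in> S" "par c z \<notin> ?K" if "z \<in> D2" for z
    using that c unfolding D2_def by (auto simp: par_crd)
  have db1: "has_dbar (in_chart c ?f) (a z) z" if z: "z \<in> D1" for z
  proof (rule has_dbar_cong)
    show "has_dbar (\<lambda>z. F (?\<tau> z)) (a z) z"
      using D1'[OF z] has_dbar_compose[of F _ ?\<tau>, OF F(1)[OF T[OF D1'(1)[OF z]]] trans_deriv[OF c d(1) D1'(2)[OF z]]]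
      by (simp add: a_def)
    show "\<forall>\<^sub>F w in nhds z. F (?\<tau> w) = in_chart c ?f w"
      using eventually_nhds_in_open[OF o1 z] by eventually_elim (use D1' in \<open>auto simp: in_chart_def extend0_def\<close>)
  qed
  have f2: "in_chart c ?f z = 0" if "z \<in> D2" for z
    using D2'[OF that] F0[of "?\<tau> z"] by (auto simp: in_chart_def extend0_def)
  have db2: "has_dbar (in_chart c ?f) 0 z" if z: "z \<in> D2" for z
  proof (rule has_dbar_cong[OF has_dbar_const])
    show "\<forall>\<^sub>F w in nhds z. 0 = in_chart c ?f w"
      using eventually_nhds_in_open[OF o2 z] by eventually_elim (simp add: f2)
  qed
  \<comment> \<open>On the overlap the formula for \<open>a\<close> must give 0 because the dbar is
    unique.\<close>
  have a2: "a z = 0" if z: "z \<in> D2" for z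
  proof (cases "par c z \<in> fst d")
    case True
    have "z \<in> D1" using z True D2'[OF z] c unfolding D1_def D2_def by (auto simp: par_crd)
    from has_dbar_unique[OF db1[OF this] db2[OF z]] show ?thesis .
  qed (simp add: a_def)
  have "continuous_on D1 (\<lambda>z. F' (?\<tau> z) * cnj (deriv ?\<tau> z))"
  proof (intro continuous_intros continuous_on_compose2[OF F(2)])
    have sub: "D1 \<subseteq> snd c ` (fst c \<inter> fst d)" using D1' by blast
    show "continuous_on D1 ?\<tau>"
      using trans_holomorphic[OF c d(1)] sub by (meson continuous_on_subset holomorphic_on_imp_continuous_on)
    show "continuous_on D1 (deriv ?\<tau>)"
      using holomorphic_deriv[OF trans_holomorphic[OF c d(1)] overlap_open[OF c chart_open[OF d(1)]]] sub
      by (meson continuous_on_subset holomorphic_on_imp_continuous_on)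
    show "?\<tau> ` D1 \<subseteq> T" using D1' T by blast
  qed
  then have c1: "continuous_on D1 a" by (rule continuous_on_eq) (use D1' in \<open>auto simp: a_def\<close>)
  have c2: "continuous_on D2 a" by (rule continuous_on_eq[of _ "\<lambda>_. 0"]) (auto simp: a2)
  have "continuous_on ?D a" unfolding D by (rule continuous_on_open_Un[OF o1 o2 c1 c2])
  moreover have "has_dbar (in_chart c ?f) (a z) z" if "z \<in> ?D" for z
    using that db1 db2 a2 unfolding D by auto
  ultimately show "\<exists>a. continuous_on ?D a \<and> (\<forall>z\<in>?D. has_dbar (in_chart c ?f) (a z) z)" by blast
qed

text \<open>The dbar of a function is a form of type (0,1): a change of chart multiplies it by the
  conjugate of the derivative.\<close>

lemma dbar_transform:
  assumes f: "cdbar S f" and S: "openin X S" and c: "c \<in> A" "d \<in> A" and z: "z \<in> snd c ` (fst c \<inter> (S \<inter> fst d))"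
  shows "dbar c f z = dbar d f (snd d (par c z)) * cnj (deriv (\<lambda>z. snd d (par c z)) z)"
proof -
  have p: "par c z \<in> fst c" "par c z \<in> S" "par c z \<in> fst d" using z c by (auto simp: par_crd)
  have o: "open (snd c ` (fst c \<inter> (S \<inter> fst d)))" by (intro overlap_open c openin_Int S chart_open)
  have z': "z \<in> snd c ` (fst c \<inter> fst d)" using z by auto
  have "has_dbar (in_chart d f) (dbar d f (snd d (par c z))) (snd d (par c z))"
    using p by (intro cdbarD(2)[OF f c(2)]) auto
  from has_dbar_compose[of _ _ "\<lambda>z. snd d (par c z)", OF this trans_deriv[OF c z']]
  have "has_dbar (\<lambda>w. in_chart d f (snd d (par c w))) (dbar d f (snd d (par c z)) * cnj (deriv (\<lambda>z. snd d (par c z)) z)) z" .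
  then have "has_dbar (in_chart c f) (dbar d f (snd d (par c z)) * cnj (deriv (\<lambda>z. snd d (par c z)) z)) z"
  proof (rule has_dbar_cong)
    show "\<forall>\<^sub>F w in nhds z. in_chart d f (snd d (par c w)) = in_chart c f w"
      using eventually_nhds_in_open[OF o z] by eventually_elim (subst in_chart_trans[OF c], auto)
  qed
  then show ?thesis by (rule dbar_eq)
qed

end

lemma continuous_on_nat_prod:
  fixes f :: "nat \<times> 'a::topological_space \<Rightarrow> 'b::topological_space"
  assumes "\<And>j. continuous_on UNIV (\<lambda>z. f (j, z))"
  shows "continuous_on UNIV f"
proof -
  have "continuous_on (\<Union>j. {j} \<times> UNIV) f"
  proof (rule continuous_on_open_UN)
    fix j :: nat
    show "open ({j} \<times> (UNIV :: 'a set))" by (intro open_Times open_discrete open_UNIV)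
    have "continuous_on ({j} \<times> UNIV) (\<lambda>x. f (j, snd x))"
      by (rule continuous_on_compose2[OF assms]) (auto intro: continuous_intros)
    then show "continuous_on ({j} \<times> UNIV) f" by (rule continuous_on_eq) auto
  qed
  moreover have "(\<Union>j. {j} \<times> UNIV) = (UNIV :: (nat \<times> 'a) set)" by auto
  ultimately show ?thesis by simp
qed

text \<open>It multiplies right-hand sides and is never differentiated, so continuity is
  enough.\<close>

definition cutoff :: "complex \<Rightarrow> complex" where "cutoff z = of_real (min 1 (max 0 (3 - norm z)))"

lemma cutoff_cont: "continuous_on S cutoff"
  unfolding cutoff_def[abs_def] by (intro continuous_intros)

lemma cutoff_simps: "norm z \<le> 2 \<Longrightarrow> cutoff z = 1" "norm z \<ge> 3 \<Longrightarrow> cutoff z = 0" "norm (cutoff z) \<le> 1"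
  by (auto simp: cutoff_def min_def max_def)

definition solve_dbar :: "(complex \<Rightarrow> complex) \<Rightarrow> complex \<Rightarrow> complex" where
  "solve_dbar v z = inverse (of_real cauchy_const) * cauchy_transform v z"

text \<open>A partition of unity along a finite d-net of the disc. Replacing a function by its
  values on the net, combined with these weights, has finite rank and moves it by no more than its
  oscillation at distance d.\<close>

lemma interpolation_weights:
  assumes d: "(d::real) > 0"
  obtains G :: "complex set" and \<rho> :: "complex \<Rightarrow> complex \<Rightarrow> real"
  where "finite G" "G \<subseteq> cball 0 2" "\<And>g. continuous_on UNIV (\<rho> g)" "\<And>g z. \<rho> g z \<ge> 0"
    "\<And>g z. \<rho> g z \<noteq> 0 \<Longrightarrow> dist z g < d" "\<And>z. z \<in> cball 0 2 \<Longrightarrow> (\<Sum>g\<in>G. \<rho> g z) = 1"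
proof -
  have "compact (cball (0::complex) 2)" by simp
  then obtain G where G: "finite G" "G \<subseteq> cball (0::complex) 2" "cball 0 2 \<subseteq> (\<Union>g\<in>G. ball g d)"
    using compactE_image[of "cball (0::complex) 2" "cball 0 2" "\<lambda>g. ball g d"] d by (metis (no_types, lifting) UN_I centre_in_ball open_ball subsetI)
  define t where "t g z = max 0 (d - norm (z - g))" for g z :: complex
  \<comment> \<open>The last summand keeps the denominator positive on the whole plane and vanishes
    on the disc, where the weights must sum to 1.\<close>
  define s where "s z = (\<Sum>g\<in>G. t g z) + max 0 (norm z - 2)" for z
  have t0: "t g z \<ge> 0" for g z by (simp add: t_def)
  have s: "s z > 0" for z
  proof (cases "norm z \<le> 2")
    case True
    then obtain g where g: "g \<in> G" "z \<in> ball g d" using G(3) by auto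
    then have "t g z > 0" by (simp add: t_def dist_norm norm_minus_commute)
    also have "t g z \<le> (\<Sum>g\<in>G. t g z)" using G(1) g t0 by (intro member_le_sum) auto
    finally show ?thesis by (simp add: s_def add_pos_nonneg)
  next
    case False
    then show ?thesis using sum_nonneg[of G "\<lambda>g. t g z"] t0 by (simp add: s_def add_nonneg_pos)
  qed
  show ?thesis
  proof (rule that[of G "\<lambda>g z. t g z / s z"])
    show "continuous_on UNIV (\<lambda>z. t g z / s z)" for g
      using s unfolding t_def s_def by (intro continuous_intros) (auto simp: less_le)
    show "t g z / s z \<ge> 0" for g z using t0[of g z] s[of z] by simp
    show "dist z g < d" if "t g z / s z \<noteq> 0" for g z
      using that by (auto simp: t_def dist_norm max_def split: if_splits)
    show "(\<Sum>g\<in>G. t g z / s z) = 1" if "z \<in> cball 0 2" for z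
      using that s[of z] by (simp add: s_def flip: sum_divide_distrib)
  qed (use G in auto)
qed

section \<open>A finite cover by discs and the coupling between them\<close>

locale disc_cover = compact_surface +
  fixes ch :: "nat \<Rightarrow> 'a chart" and n :: nat
  assumes ch: "i < n \<Longrightarrow> ch i \<in> A" and ch_ball: "i < n \<Longrightarrow> snd (ch i) ` fst (ch i) = ball 0 4"
    and ch_cov: "x \<in> topspace X \<Longrightarrow> \<exists>i<n. x \<in> fst (ch i) \<and> norm (snd (ch i) x) < 1"
begin

abbreviation dm where "dm i \<equiv> fst (ch i)"
abbreviation crd where "crd i \<equiv> snd (ch i)"
abbreviation pr where "pr i \<equiv> par (ch i)"

definition unity :: "nat \<Rightarrow> 'a \<Rightarrow> complex" where
  "unity i x = extend0 (ch i) bump x * inverse (\<Sum>k<n. extend0 (ch k) bump x)"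

lemma bump_total_nonzero:
  assumes "x \<in> topspace X" shows "(\<Sum>k<n. extend0 (ch k) bump x) \<noteq> 0"
proof -
  define b where "b k = (if x \<in> dm k then bump_profile ((norm (crd k x))\<^sup>2) else 0)" for k
  have e: "extend0 (ch k) bump x = of_real (b k)" for k by (simp add: extend0_def b_def bump_real(1))
  obtain i where i: "i < n" "x \<in> dm i" "norm (crd i x) < 1" using ch_cov[OF assms] by blast
  have "bump (crd i x) = 1" using i by (intro bump_eq_1) simp
  then have "b i = 1" using i by (simp add: b_def bump_real(1))
  moreover have "b i \<le> (\<Sum>k<n. b k)" using i by (intro member_le_sum) (auto simp: b_def bump_real(2))
  ultimately have "(\<Sum>k<n. b k) \<noteq> 0" by auto
  then show ?thesis by (simp add: e flip: of_real_sum)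
qed

lemma unity_cdbar: assumes "i < n" shows "cdbar (topspace X) (unity i)"
proof -
  have b: "cdbar (topspace X) (extend0 (ch k) bump)" if "k < n" for k
    by (rule cdbar_extend0[OF ch[OF that] ch_ball[OF that], where T=UNIV and F'=bump'])
       (auto simp: bump_dbar continuous_bump' bump_eq_0)
  show ?thesis unfolding unity_def[abs_def]
    by (intro cdbar_mult cdbar_inverse cdbar_sum b assms) (auto simp: bump_total_nonzero)
qed

lemma unity_sum: "x \<in> topspace X \<Longrightarrow> (\<Sum>i<n. unity i x) = 1"
  using bump_total_nonzero by (simp add: unity_def flip: sum_distrib_right)

lemma unity_zero: "\<not> (x \<in> dm i \<and> norm (crd i x) < 2) \<Longrightarrow> unity i x = 0"
  using bump_eq_0[of "crd i x"] by (auto simp: unity_def extend0_def)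

lemma image_top: "j < n \<Longrightarrow> crd j ` (dm j \<inter> topspace X) = ball 0 4"
  using chart_sub[OF ch] ch_ball by (simp add: Int_absorb2)

definition unity_dbar :: "nat \<Rightarrow> nat \<Rightarrow> complex \<Rightarrow> complex" where "unity_dbar i j z = dbar (ch j) (unity i) z"

lemma unity_dbar_cont: "i < n \<Longrightarrow> j < n \<Longrightarrow> continuous_on (ball 0 4) (unity_dbar i j)"
  using cdbarD(1)[OF unity_cdbar ch, of i j] image_top[of j] by (simp add: unity_dbar_def[abs_def])

lemma unity_dbar_dbar: "i < n \<Longrightarrow> j < n \<Longrightarrow> z \<in> ball 0 4 \<Longrightarrow> has_dbar (in_chart (ch j) (unity i)) (unity_dbar i j z) z"
  using cdbarD(2)[OF unity_cdbar ch, of i j z] image_top[of j] by (simp add: unity_dbar_def[abs_def])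

lemma disc_closed: "i < n \<Longrightarrow> closedin X {x \<in> dm i. norm (crd i x) \<le> 2}"
  using ch_ball by (intro closed_disc_closed ch) auto

lemma outside_open: "i < n \<Longrightarrow> j < n \<Longrightarrow> open (crd j ` (dm j \<inter> (topspace X - {x \<in> dm i. norm (crd i x) \<le> 2})))"
  by (intro overlap_open ch openin_diff disc_closed) auto

lemma inside_open: "i < n \<Longrightarrow> j < n \<Longrightarrow> open (crd j ` (dm j \<inter> {x \<in> dm i. crd i x \<in> ball 0 r}))"
  by (intro overlap_open ch chart_preimage_open) auto

lemma mem_image_iff: "j < n \<Longrightarrow> z \<in> crd j ` (dm j \<inter> S) \<longleftrightarrow> z \<in> ball 0 4 \<and> pr j z \<in> S"
proof
  assume j: "j < n" and "z \<in> crd j ` (dm j \<inter> S)"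
  then show "z \<in> ball 0 4 \<and> pr j z \<in> S" using ch_ball[OF j] par_crd[OF ch[OF j]] by auto
next
  assume j: "j < n" and z: "z \<in> ball 0 4 \<and> pr j z \<in> S"
  then have "z \<in> crd j ` dm j" using ch_ball by auto
  then show "z \<in> crd j ` (dm j \<inter> S)" using crd_par[of z "ch j"] par_mem[of z "ch j"] z by (metis IntI imageI)
qed

lemma pr_top: "j < n \<Longrightarrow> z \<in> ball 0 4 \<Longrightarrow> pr j z \<in> topspace X"
  using mem_image_iff[of j z "topspace X"] image_top[of j] by blast

lemma unity_dbar_zero:
  assumes ij: "i < n" "j < n" and z: "z \<in> ball 0 4" "\<not> (pr j z \<in> dm i \<and> norm (crd i (pr j z)) \<le> 2)"
  shows "unity_dbar i j z = 0"
proof -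
  let ?S = "topspace X - {x \<in> dm i. norm (crd i x) \<le> 2}"
  have zS: "z \<in> crd j ` (dm j \<inter> ?S)" using z pr_top[OF ij(2) z(1)] by (subst mem_image_iff[OF ij(2)]) auto
  have "has_dbar (in_chart (ch j) (unity i)) 0 z"
  proof (rule has_dbar_cong[OF has_dbar_const])
    show "\<forall>\<^sub>F w in nhds z. 0 = in_chart (ch j) (unity i) w"
      using eventually_nhds_in_open[OF outside_open[OF ij] zS]
    proof eventually_elim
      case (elim w)
      then have "pr j w \<in> ?S" by (subst (asm) mem_image_iff[OF ij(2)]) auto
      then have "unity i (pr j w) = 0" by (intro unity_zero) auto
      then show ?case by (simp add: in_chart_def)
    qed
  qed
  with unity_dbar_dbar[OF ij z(1)] show ?thesis using has_dbar_unique by blast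
qed

text \<open>If \<open>dbar (q i) = v i\<close> on the discs and the \<open>v i\<close> are the expressions of one form, then the \<open>dbar\<close> of
  \<open>\<Sum>i<n. unity i * q i\<close> differs from it by \<open>coupling q\<close>; the pair \<open>(j, z)\<close> is the point \<open>z\<close> of the \<open>j\<close>-th disc.\<close>

definition coupling :: "(nat \<Rightarrow> complex \<Rightarrow> complex) \<Rightarrow> nat \<times> complex \<Rightarrow> complex" where
  "coupling q = (\<lambda>(j, z). if j < n \<and> z \<in> ball 0 4 then
     cutoff z * (\<Sum>i<n. if pr j z \<in> dm i then unity_dbar i j z * q i (crd i (pr j z)) else 0) else 0)"

text \<open>The partition function of a disc, and with it its dbar, vanishes beyond radius 2, so
  only values within that radius enter. Solutions therefore have to be controlled on the closed disc
  of radius 3 at most.\<close>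

lemma coupling_cong:
  assumes "\<And>i w. i < n \<Longrightarrow> norm w \<le> 2 \<Longrightarrow> q i w = q' i w"
  shows "coupling q = coupling q'"
proof -
  have "(if pr j z \<in> dm i then unity_dbar i j z * q i (crd i (pr j z)) else 0) = (if pr j z \<in> dm i then unity_dbar i j z * q' i (crd i (pr j z)) else 0)"
    if "j < n" "z \<in> ball 0 4" "i < n" for i j z
    using assms[OF that(3), of "crd i (pr j z)"] unity_dbar_zero[OF that(3,1,2)] by auto
  then show ?thesis unfolding coupling_def by (intro ext) (auto intro!: sum.cong)
qed

lemma coupling_add: "coupling (\<lambda>i w. q i w + q' i w) x = coupling q x + coupling q' x"
proof -
  have "(\<Sum>i<n. if P i then a i * (b i + b' i) else 0) = (\<Sum>i<n. if P i then a i * b i else 0) + (\<Sum>i<n. if P i then a i * b' i else 0)" for P and a b b' :: "nat \<Rightarrow> complex"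
    unfolding sum.distrib[symmetric] by (intro sum.cong) (auto simp: distrib_left)
  then show ?thesis by (simp add: coupling_def split_beta distrib_left)
qed

lemma coupling_cmult: "coupling (\<lambda>i w. c * q i w) x = c * coupling q x"
proof -
  have "(\<Sum>i<n. if P i then a i * (c * b i) else 0) = c * (\<Sum>i<n. if P i then a i * b i else 0)" for P and a b :: "nat \<Rightarrow> complex"
    unfolding sum_distrib_left by (intro sum.cong) (auto simp: mult_ac)
  then show ?thesis by (simp add: coupling_def split_beta mult_ac)
qed

lemma coupling_zero: "coupling (\<lambda>i w. 0) x = 0"
  using coupling_cmult[of 0 "\<lambda>i w. 0" x] by simp

lemma term_cont:
  assumes ij: "i < n" "j < n" and q: "continuous_on (cball 0 3) q"
  shows "continuous_on (ball 0 4) (\<lambda>z. if pr j z \<in> dm i then unity_dbar i j z * q (crd i (pr j z)) else 0)" (is "continuous_on _ ?g")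
proof -
  define D1 where "D1 = crd j ` (dm j \<inter> {x \<in> dm i. crd i x \<in> ball 0 3})"
  define D2 where "D2 = crd j ` (dm j \<inter> (topspace X - {x \<in> dm i. norm (crd i x) \<le> 2}))"
  have o: "open D1" "open D2" unfolding D1_def D2_def by (intro inside_open outside_open ij)+
  have D1: "z \<in> D1 \<longleftrightarrow> z \<in> ball 0 4 \<and> pr j z \<in> dm i \<and> norm (crd i (pr j z)) < 3" for z
    unfolding D1_def by (subst mem_image_iff[OF ij(2)]) auto
  have D2: "z \<in> D2 \<longleftrightarrow> z \<in> ball 0 4 \<and> pr j z \<in> topspace X \<and> \<not> (pr j z \<in> dm i \<and> norm (crd i (pr j z)) \<le> 2)" for z
    unfolding D2_def by (subst mem_image_iff[OF ij(2)]) auto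
  have D: "ball 0 4 = D1 \<union> D2" using pr_top[OF ij(2)] D1 D2 by (auto simp del: mem_ball)
  have sub: "D1 \<subseteq> crd j ` (dm j \<inter> dm i)" unfolding D1_def by auto
  have "continuous_on D1 (\<lambda>z. unity_dbar i j z * q (crd i (pr j z)))"
  proof (intro continuous_intros continuous_on_compose2[OF q])
    show "continuous_on D1 (unity_dbar i j)" using unity_dbar_cont[OF ij] by (rule continuous_on_subset) (use D1 in blast)
    show "continuous_on D1 (\<lambda>z. crd i (pr j z))"
      using trans_holomorphic[OF ch[OF ij(2)] ch[OF ij(1)]] sub by (meson continuous_on_subset holomorphic_on_imp_continuous_on)
    show "(\<lambda>z. crd i (pr j z)) ` D1 \<subseteq> cball 0 3" using D1 by auto
  qed
  then have c1: "continuous_on D1 ?g" by (rule continuous_on_eq) (use D1 in auto)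
  have c2: "continuous_on D2 ?g"
    by (rule continuous_on_eq[of _ "\<lambda>_. 0"]) (use D2 unity_dbar_zero[OF ij] in auto)
  show ?thesis unfolding D by (rule continuous_on_open_Un[OF o c1 c2])
qed

lemma coupling_cont:
  assumes q: "\<And>i. i < n \<Longrightarrow> continuous_on (cball 0 3) (q i)"
  shows "continuous_on UNIV (coupling q)"
proof (rule continuous_on_nat_prod)
  fix j
  show "continuous_on UNIV (\<lambda>z. coupling q (j, z))"
  proof (cases "j < n")
    case True
    have "continuous_on (ball 0 4) (\<lambda>z. cutoff z * (\<Sum>i<n. if pr j z \<in> dm i then unity_dbar i j z * q i (crd i (pr j z)) else 0))"
      by (intro continuous_on_mult cutoff_cont continuous_on_sum term_cont q True) auto
    then have c1: "continuous_on (ball 0 4) (\<lambda>z. coupling q (j, z))" by (rule continuous_on_eq) (simp add: coupling_def True)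
    have c2: "continuous_on (- cball 0 3) (\<lambda>z. coupling q (j, z))"
      by (rule continuous_on_eq[of _ "\<lambda>_. 0"]) (auto simp: coupling_def cutoff_simps)
    have U: "UNIV = ball 0 4 \<union> - cball (0::complex) 3" by auto
    show ?thesis unfolding U by (rule continuous_on_open_Un[OF _ _ c1 c2]) auto
  qed (simp add: coupling_def)
qed

lemma coupling_bound:
  "\<exists>B>0. \<forall>q m x. (\<forall>i w. i < n \<longrightarrow> norm w \<le> 2 \<longrightarrow> norm (q i w) \<le> m) \<longrightarrow> m \<ge> 0 \<longrightarrow> norm (coupling q x) \<le> B * m"
proof -
  have "bounded (\<Union>i\<in>{..<n}. \<Union>j\<in>{..<n}. unity_dbar i j ` cball 0 3)"
    by (intro bounded_UN finite_lessThan ballI compact_imp_bounded compact_continuous_image continuous_on_subset[OF unity_dbar_cont]) auto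
  then obtain M where M0: "\<And>x. x \<in> (\<Union>i\<in>{..<n}. \<Union>j\<in>{..<n}. unity_dbar i j ` cball 0 3) \<Longrightarrow> norm x \<le> M"
    unfolding bounded_iff by blast
  have M: "norm (unity_dbar i j z) \<le> M" if "i < n" "j < n" "z \<in> cball 0 3" for i j z
    by (rule M0) (use that in blast)
  define M' where "M' = max M 0"
  have M': "M' \<ge> 0" "\<And>i j z. i < n \<Longrightarrow> j < n \<Longrightarrow> z \<in> cball 0 3 \<Longrightarrow> norm (unity_dbar i j z) \<le> M'" using M by (auto simp: M'_def le_max_iff_disj)
  have bound: "norm (coupling q (j, z)) \<le> (real n * M' + 1) * m"
    if q: "\<And>i w. i < n \<Longrightarrow> norm w \<le> 2 \<Longrightarrow> norm (q i w) \<le> m" and m: "m \<ge> 0" for q m j z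
  proof (cases "j < n \<and> z \<in> cball 0 3")
    case True
    have z4: "z \<in> ball 0 4" using True by auto
    have "norm (if pr j z \<in> dm i then unity_dbar i j z * q i (crd i (pr j z)) else 0) \<le> M' * m" if i: "i < n" for i
    proof (cases "pr j z \<in> dm i \<and> norm (crd i (pr j z)) \<le> 2")
      case True2: True
      then show ?thesis using M'(2)[OF i, of j z] q[OF i, of "crd i (pr j z)"] True M'(1) m
        by (auto simp: norm_mult intro!: mult_mono)
    next
      case False
      then show ?thesis using unity_dbar_zero[OF i _ z4 False] True M'(1) m by auto
    qed
    then have "norm (\<Sum>i<n. if pr j z \<in> dm i then unity_dbar i j z * q i (crd i (pr j z)) else 0) \<le> real n * (M' * m)"
      using sum_norm_bound[of "{..<n}"] by (metis (no_types, lifting) card_lessThan lessThan_iff)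
    then have "norm (cutoff z) * norm (\<Sum>i<n. if pr j z \<in> dm i then unity_dbar i j z * q i (crd i (pr j z)) else 0) \<le> 1 * (real n * (M' * m))"
      by (intro mult_mono cutoff_simps) auto
    then show ?thesis using True z4 m by (simp add: coupling_def norm_mult algebra_simps)
  next
    case False
    have "cutoff z = 0" if "\<not> norm z \<le> 3" using that cutoff_simps(2)[of z] by simp
    then have "coupling q (j, z) = 0" using False by (auto simp: coupling_def)
    then show ?thesis using M'(1) m by simp
  qed
  show ?thesis
  proof (intro exI[of _ "real n * M' + 1"] conjI allI impI)
    show "real n * M' + 1 > 0" using M'(1) by (simp add: add_nonneg_pos)
    fix q :: "nat \<Rightarrow> complex \<Rightarrow> complex" and m :: real and x
    assume "\<forall>i w. i < n \<longrightarrow> norm w \<le> 2 \<longrightarrow> norm (q i w) \<le> m" "m \<ge> 0"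
    then show "norm (coupling q x) \<le> (real n * M' + 1) * m" using bound[of q m "fst x" "snd x"] by simp
  qed
qed

end

text \<open>The \<open>n\<close> functions on the discs are encoded by one bounded continuous function on the plane, with the
  \<open>i\<close>-th one around \<open>10 i\<close>, so that the Fredholm argument takes place in a single Banach space.\<close>

definition slice :: "complex \<Rightarrow>\<^sub>C complex \<Rightarrow> nat \<Rightarrow> complex \<Rightarrow> complex" where
  "slice u i w = apply_bcontfun u (w + of_nat (10 * i))"

lemma slice_cont: "continuous_on UNIV (slice u i)"
  unfolding slice_def[abs_def]
  by (rule continuous_on_compose2[of UNIV "apply_bcontfun u"]) (auto intro!: continuous_intros)

lemma slice_bound: "norm (slice u i w) \<le> norm u"
  unfolding slice_def by (rule norm_bounded)

lemma cauchy_transform_cont: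
  assumes "continuous_on UNIV v" "\<And>z. norm (v z) \<le> M"
  shows "continuous_on (cball 0 3) (cauchy_transform v)"
proof (rule uniformly_continuous_imp_continuous, unfold uniformly_continuous_on_def, intro allI impI)
  fix e::real assume e: "e > 0"
  have M: "M \<ge> 0" using assms(2)[of 0] norm_ge_zero order_trans by blast
  define e' where "e' = e / (M + 1)"
  have e': "e' > 0" "e' * M < e" using e M by (auto simp: e'_def field_simps)
  obtain d where "d > 0" and d: "\<And>v M z z'. continuous_on UNIV v \<Longrightarrow> (\<And>z. norm (v z) \<le> M) \<Longrightarrow> norm z \<le> 3 \<Longrightarrow> norm z' \<le> 3 \<Longrightarrow>
     dist z z' < d \<Longrightarrow> norm (cauchy_transform v z - cauchy_transform v z') \<le> e' * M"
    using cauchy_transform_equicontinuous[OF e'(1)] by blast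
  show "\<exists>d>0. \<forall>x\<in>cball 0 3. \<forall>x'\<in>cball 0 3. dist x' x < d \<longrightarrow> dist (cauchy_transform v x') (cauchy_transform v x) < e"
  proof (intro exI[of _ d] conjI ballI impI)
    fix x x' :: complex assume "x \<in> cball 0 3" "x' \<in> cball 0 3" "dist x' x < d"
    then have "norm (cauchy_transform v x' - cauchy_transform v x) \<le> e' * M"
      by (intro d assms) auto
    then show "dist (cauchy_transform v x') (cauchy_transform v x) < e" using e'(2) by (simp add: dist_norm)
  qed fact
qed

lemma solve_dbar_cont:
  assumes "continuous_on UNIV v" "\<And>z. norm (v z) \<le> M"
  shows "continuous_on (cball 0 3) (solve_dbar v)"
  unfolding solve_dbar_def[abs_def] by (intro continuous_intros cauchy_transform_cont[OF assms])

lemma solve_dbar_slice_add: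
  assumes "norm z \<le> 3"
  shows "solve_dbar (slice (u + v) i) z = solve_dbar (slice u i) z + solve_dbar (slice v i) z"
proof -
  let ?v = "\<lambda>b. if b then slice u i else slice v i"
  have "cauchy_transform (\<lambda>w. \<Sum>b\<in>UNIV. 1 * ?v b w) z = (\<Sum>b\<in>UNIV. 1 * cauchy_transform (?v b) z)"
    by (rule cauchy_transform_linear[where M="\<lambda>b. if b then norm u else norm v"]) (auto simp: slice_cont slice_bound assms)
  moreover have "(\<lambda>w. \<Sum>b\<in>UNIV. 1 * ?v b w) = slice (u + v) i" by (simp add: UNIV_bool slice_def fun_eq_iff plus_bcontfun.rep_eq add.commute)
  ultimately show ?thesis by (simp add: solve_dbar_def UNIV_bool algebra_simps)
qed

lemma solve_dbar_slice_scale: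
  assumes "norm z \<le> 3"
  shows "solve_dbar (slice (r *\<^sub>R u) i) z = of_real r * solve_dbar (slice u i) z"
proof -
  have "cauchy_transform (\<lambda>w. \<Sum>b\<in>{True}. of_real r * slice u i w) z = (\<Sum>b\<in>{True}. of_real r * cauchy_transform (slice u i) z)"
    by (rule cauchy_transform_linear[where M="\<lambda>b. norm u"]) (auto simp: slice_cont slice_bound assms)
  moreover have "(\<lambda>w. \<Sum>b\<in>{True}. of_real r * slice u i w) = slice (r *\<^sub>R u) i" by (simp add: slice_def fun_eq_iff scaleR_bcontfun.rep_eq scaleR_conv_of_real)
  ultimately show ?thesis by (simp add: solve_dbar_def)
qed

section \<open>The coupled equation as a compact perturbation of the identity\<close>

context disc_cover
begin

definition couplings :: "(nat \<Rightarrow> complex \<Rightarrow> complex) \<Rightarrow> complex \<Rightarrow> complex" where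
  "couplings q w = (\<Sum>j<n. coupling q (j, w - of_nat (10 * j)))"

lemma couplings_cong:
  assumes "\<And>i w. i < n \<Longrightarrow> norm w \<le> 2 \<Longrightarrow> q i w = q' i w"
  shows "couplings q = couplings q'"
  unfolding couplings_def[abs_def] using coupling_cong[OF assms] by simp

lemma couplings_add: "couplings (\<lambda>i w. q i w + q' i w) x = couplings q x + couplings q' x"
  by (simp add: couplings_def coupling_add sum.distrib)

lemma couplings_cmult: "couplings (\<lambda>i w. c * q i w) x = c * couplings q x"
  by (simp add: couplings_def coupling_cmult sum_distrib_left)

lemma couplings_zero: "couplings (\<lambda>i w. 0) x = 0"
  by (simp add: couplings_def coupling_zero)

lemma couplings_cont:
  assumes q: "\<And>i. i < n \<Longrightarrow> continuous_on (cball 0 3) (q i)"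
  shows "continuous_on UNIV (couplings q)"
  unfolding couplings_def[abs_def]
  by (intro continuous_intros continuous_on_compose2[OF coupling_cont[OF q]]) auto

lemma couplings_bound:
  "\<exists>B>0. \<forall>q m x. (\<forall>i w. i < n \<longrightarrow> norm w \<le> 2 \<longrightarrow> norm (q i w) \<le> m) \<longrightarrow> m \<ge> 0 \<longrightarrow> norm (couplings q x) \<le> B * m"
proof -
  obtain B where B: "B > 0" "\<And>q m x. (\<And>i w. i < n \<Longrightarrow> norm w \<le> 2 \<Longrightarrow> norm (q i w) \<le> m) \<Longrightarrow> m \<ge> 0 \<Longrightarrow> norm (coupling q x) \<le> B * m"
    using coupling_bound by blast
  show ?thesis
  proof (intro exI[of _ "(real n + 1) * B"] conjI allI impI)
    show "(real n + 1) * B > 0" using B(1) by simp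
    fix q :: "nat \<Rightarrow> complex \<Rightarrow> complex" and m :: real and x
    assume q: "\<forall>i w. i < n \<longrightarrow> norm w \<le> 2 \<longrightarrow> norm (q i w) \<le> m" and m: "m \<ge> 0"
    have "norm (couplings q x) \<le> (\<Sum>j<n. B * m)"
      unfolding couplings_def by (rule sum_norm_le) (use q m in \<open>auto intro!: B(2)\<close>)
    also have "\<dots> \<le> (real n + 1) * B * m" using B(1) m by (simp add: algebra_simps)
    finally show "norm (couplings q x) \<le> (real n + 1) * B * m" .
  qed
qed

lemma coupling_outside: "norm z \<ge> 3 \<Longrightarrow> coupling q (j, z) = 0"
  by (simp add: coupling_def cutoff_simps)

lemma shift_far:
  assumes "norm (z::complex) \<le> 3" "j \<noteq> k"
  shows "norm (z + of_nat (10 * j) - of_nat (10 * k)) \<ge> 3"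
proof -
  have "norm (of_nat (10 * j) - of_nat (10 * k) :: complex) = norm (real (10 * j) - real (10 * k))"
    by (metis norm_of_real of_real_diff of_real_of_nat_eq real_norm_def)
  also have "\<dots> \<ge> 10" using assms(2) by auto
  finally have "norm (of_nat (10 * j) - of_nat (10 * k) :: complex) \<ge> 10" .
  moreover have "norm (of_nat (10 * j) - of_nat (10 * k) :: complex) \<le> norm (z + of_nat (10 * j) - of_nat (10 * k)) + norm z"
    using norm_triangle_ineq4[of "z + of_nat (10 * j) - of_nat (10 * k)" z] by (simp add: algebra_simps)
  ultimately show ?thesis using assms(1) by linarith
qed

lemma sum_shift:
  assumes "norm (z::complex) \<le> 3" "j < n" "\<And>k w. norm w \<ge> 3 \<Longrightarrow> f k w = (0::complex)"
  shows "(\<Sum>k<n. f k (z + of_nat (10 * j) - of_nat (10 * k))) = f j z"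
proof -
  have "(\<Sum>k<n. f k (z + of_nat (10 * j) - of_nat (10 * k))) = (\<Sum>k<n. if k = j then f j z else 0)"
    by (intro sum.cong refl) (use assms(3) shift_far[OF assms(1)] in auto)
  then show ?thesis using assms(2) by simp
qed

lemma couplings_eq: "norm z \<le> 3 \<Longrightarrow> j < n \<Longrightarrow> couplings q (z + of_nat (10 * j)) = coupling q (j, z)"
  unfolding couplings_def using sum_shift[of z j "\<lambda>k w. coupling q (k, w)"] coupling_outside by blast

lemma couplings_bcontfun:
  assumes q: "\<And>i. i < n \<Longrightarrow> continuous_on (cball 0 3) (q i)"
  shows "apply_bcontfun (Bcontfun (couplings q)) = couplings q"
proof (rule Bcontfun_inverse)
  obtain B where B: "B > 0" "\<And>q m x. (\<And>i w. i < n \<Longrightarrow> norm w \<le> 2 \<Longrightarrow> norm (q i w) \<le> m) \<Longrightarrow> m \<ge> 0 \<Longrightarrow> norm (couplings q x) \<le> B * m"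
    using couplings_bound by blast
  have "bounded (\<Union>i\<in>{..<n}. q i ` cball 0 2)"
    by (intro bounded_UN finite_lessThan ballI compact_imp_bounded compact_continuous_image continuous_on_subset[OF q]) auto
  then obtain M where M0: "\<And>x. x \<in> (\<Union>i\<in>{..<n}. q i ` cball 0 2) \<Longrightarrow> norm x \<le> M" unfolding bounded_iff by blast
  have M: "norm (q i w) \<le> max M 0" if "i < n" "norm w \<le> 2" for i w
  proof -
    have "w \<in> cball 0 2" using that by simp
    then have "norm (q i w) \<le> M" using that(1) by (intro M0) blast
    then show ?thesis by simp
  qed
  have "norm (couplings q x) \<le> B * max M 0" for x by (rule B(2)) (use M in auto)
  then have "bounded (range (couplings q))" unfolding bounded_iff by blast
  then show "couplings q \<in> bcontfun" using couplings_cont[OF q] by (auto simp: bcontfun_def)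
qed

text \<open>The operator \<open>K\<close> that solves on every disc and couples the solutions is
  compact: by equicontinuity it is within 1/2 of the finite-rank operator \<open>F\<close>, which
  reads the solutions only at the points of a net. So \<open>fredholm_finite_codimension\<close>
  applies with \<open>Q = K - F\<close>.\<close>

lemma solve_modulo_finite:
  obtains m :: nat where "\<And>(N :: nat \<Rightarrow> complex \<Rightarrow>\<^sub>C complex) I. finite I \<Longrightarrow> card I > m \<Longrightarrow>
     \<exists>(c :: nat \<Rightarrow> real) v. (\<exists>k\<in>I. c k \<noteq> 0) \<and> (\<forall>x. apply_bcontfun v x + couplings (\<lambda>i. solve_dbar (slice v i)) x = (\<Sum>k\<in>I. of_real (c k) * apply_bcontfun (N k) x))"
proof -
  obtain B where B: "B > 0" "\<And>q m x. (\<And>i w. i < n \<Longrightarrow> norm w \<le> 2 \<Longrightarrow> norm (q i w) \<le> m) \<Longrightarrow> m \<ge> 0 \<Longrightarrow> norm (couplings q x) \<le> B * m"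
    using couplings_bound by blast
  \<comment> \<open>Chosen so that the bound \<open>B * (e / cauchy_const)\<close> on
    \<open>Q\<close> becomes 1/2.\<close>
  define e where "e = cauchy_const / (2 * B)"
  have e: "e > 0" using cauchy_const_pos B(1) by (simp add: e_def)
  obtain d where "d > 0" and d: "\<And>v M z z'. continuous_on UNIV v \<Longrightarrow> (\<And>z. norm (v z) \<le> M) \<Longrightarrow> norm z \<le> 3 \<Longrightarrow> norm z' \<le> 3 \<Longrightarrow>
     dist z z' < d \<Longrightarrow> norm (cauchy_transform v z - cauchy_transform v z') \<le> e * M"
    using cauchy_transform_equicontinuous[OF e] by blast
  obtain G and \<rho> :: "complex \<Rightarrow> complex \<Rightarrow> real" where G: "finite G" "G \<subseteq> cball 0 2" and \<rho>: "\<And>g. continuous_on UNIV (\<rho> g)" "\<And>g z. \<rho> g z \<ge> 0"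
    "\<And>g z. \<rho> g z \<noteq> 0 \<Longrightarrow> dist z g < d" "\<And>z. z \<in> cball 0 2 \<Longrightarrow> (\<Sum>g\<in>G. \<rho> g z) = 1"
    using interpolation_weights[OF \<open>d > 0\<close>] by blast
  have G2: "norm g \<le> 3" if "g \<in> G" for g using that G(2) by auto
  define qK where "qK u = (\<lambda>i. solve_dbar (slice u i))" for u
  \<comment> \<open>The disc solutions interpolated from their values on the net.\<close>
  define qF where "qF u = (\<lambda>i z. \<Sum>g\<in>G. of_real (\<rho> g z) * solve_dbar (slice u i) g)" for u
  have cK: "continuous_on (cball 0 3) (qK u i)" for u i
    unfolding qK_def by (rule solve_dbar_cont[OF slice_cont slice_bound])
  have cF: "continuous_on (cball 0 3) (qF u i)" for u i
    unfolding qF_def by (intro continuous_intros continuous_on_subset[OF \<rho>(1)]) auto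
  define K where "K u = Bcontfun (couplings (qK u))" for u
  define F where "F u = Bcontfun (couplings (qF u))" for u
  define Q where "Q u = K u - F u" for u
  have Ka: "apply_bcontfun (K u) = couplings (qK u)" and Fa: "apply_bcontfun (F u) = couplings (qF u)" for u
    unfolding K_def F_def by (intro couplings_bcontfun cK cF)+
  have linK: "linear K"
  proof (rule linearI; rule bcontfun_eqI)
    fix u v x
    have "couplings (qK (u + v)) x = couplings (\<lambda>i w. qK u i w + qK v i w) x"
      by (rule fun_cong[OF couplings_cong]) (auto simp: qK_def solve_dbar_slice_add)
    then show "apply_bcontfun (K (u + v)) x = apply_bcontfun (K u + K v) x"
      by (simp add: Ka plus_bcontfun.rep_eq couplings_add)
  next
    fix r u x
    have "couplings (qK (r *\<^sub>R u)) x = couplings (\<lambda>i w. of_real r * qK u i w) x"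
      by (rule fun_cong[OF couplings_cong]) (auto simp: qK_def solve_dbar_slice_scale)
    then show "apply_bcontfun (K (r *\<^sub>R u)) x = apply_bcontfun (r *\<^sub>R K u) x"
      by (simp add: Ka scaleR_bcontfun.rep_eq couplings_cmult scaleR_conv_of_real)
  qed
  have linF: "linear F"
  proof (rule linearI; rule bcontfun_eqI)
    fix u v x
    have "qF (u + v) = (\<lambda>i w. qF u i w + qF v i w)"
      by (auto simp: qF_def fun_eq_iff solve_dbar_slice_add[OF G2] algebra_simps sum.distrib)
    then show "apply_bcontfun (F (u + v)) x = apply_bcontfun (F u + F v) x"
      by (simp add: Fa plus_bcontfun.rep_eq couplings_add)
  next
    fix r u x
    have "qF (r *\<^sub>R u) = (\<lambda>i w. of_real r * qF u i w)"
      by (auto simp: qF_def fun_eq_iff solve_dbar_slice_scale[OF G2] sum_distrib_left mult_ac intro!: sum.cong)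
    then show "apply_bcontfun (F (r *\<^sub>R u)) x = apply_bcontfun (r *\<^sub>R F u) x"
      by (simp add: Fa scaleR_bcontfun.rep_eq couplings_cmult scaleR_conv_of_real)
  qed
  have linQ: "linear Q" unfolding Q_def[abs_def] by (rule linear_compose_sub[OF linK linF])
  have Qb: "norm (Q u) \<le> norm u / 2" for u
  proof (rule norm_bound)
    fix x
    have "apply_bcontfun (Q u) x = couplings (\<lambda>i w. qK u i w + (- 1) * qF u i w) x"
      unfolding couplings_add couplings_cmult by (simp add: Q_def minus_bcontfun.rep_eq Ka Fa)
    also have "norm \<dots> \<le> B * (e / cauchy_const * norm u)"
    proof (rule B(2))
      fix i w assume i: "i < n" and w: "norm (w::complex) \<le> 2"
      have c0: "cauchy_const > 0" by (rule cauchy_const_pos)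
      have "qK u i w + (- 1) * qF u i w = (\<Sum>g\<in>G. of_real (\<rho> g w) * (solve_dbar (slice u i) w - solve_dbar (slice u i) g))"
      proof -
        have "(\<Sum>g\<in>G. of_real (\<rho> g w) * solve_dbar (slice u i) w) = solve_dbar (slice u i) w"
          using \<rho>(4)[of w] w by (simp flip: sum_distrib_right of_real_sum)
        then show ?thesis by (simp add: qK_def qF_def right_diff_distrib sum_subtractf)
      qed
      also have "norm \<dots> \<le> (\<Sum>g\<in>G. \<rho> g w * (e / cauchy_const * norm u))"
      proof (rule sum_norm_le)
        fix g assume g: "g \<in> G"
        show "norm (of_real (\<rho> g w) * (solve_dbar (slice u i) w - solve_dbar (slice u i) g)) \<le> \<rho> g w * (e / cauchy_const * norm u)"
        proof (cases "\<rho> g w = 0")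
          case False
          then have "norm (cauchy_transform (slice u i) w - cauchy_transform (slice u i) g) \<le> e * norm u"
            using w G2[OF g] \<rho>(3) by (intro d slice_cont slice_bound) auto
          moreover have "solve_dbar (slice u i) w - solve_dbar (slice u i) g = inverse (of_real cauchy_const) * (cauchy_transform (slice u i) w - cauchy_transform (slice u i) g)"
            by (simp add: solve_dbar_def algebra_simps)
          ultimately have "norm (solve_dbar (slice u i) w - solve_dbar (slice u i) g) \<le> e / cauchy_const * norm u"
            using c0 by (simp add: norm_mult norm_inverse divide_inverse mult_ac)
          from mult_left_mono[OF this \<rho>(2)[of g w]] show ?thesis
            unfolding norm_mult norm_of_real using \<rho>(2)[of g w] by simp
        qed simp
      qed
      also have "\<dots> = e / cauchy_const * norm u" unfolding sum_distrib_right[symmetric] using \<rho>(4)[of w] w by simp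
      finally show "norm (qK u i w + (- 1) * qF u i w) \<le> e / cauchy_const * norm u" .
    qed (use e cauchy_const_pos in auto)
    also have "\<dots> = norm u / 2" using B(1) cauchy_const_pos by (simp add: e_def)
    finally show "norm (apply_bcontfun (Q u) x) \<le> norm u / 2" .
  qed
  \<comment> \<open>The real and imaginary parts of the sampled values; if they all vanish, so does
    \<open>F\<close>. Their number is the bound \<open>m\<close>.\<close>
  define L where "L = G \<times> {..<n} \<times> (UNIV :: bool set)"
  define l where "l t u = (case t of (g, i, b) \<Rightarrow> if b then Re (solve_dbar (slice u i) g) else Im (solve_dbar (slice u i) g))" for t and u :: "complex \<Rightarrow>\<^sub>C complex"
  have finL: "finite L" using G by (simp add: L_def)
  have linl: "linear (l t)" if "t \<in> L" for t
    using that G2 by (auto simp: L_def l_def solve_dbar_slice_add solve_dbar_slice_scale intro!: linearI)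
  have l0: "F u = 0" if z: "\<And>t. t \<in> L \<Longrightarrow> l t u = 0" for u
  proof (rule bcontfun_eqI)
    fix x
    have c: "solve_dbar (slice u i) g = 0" if "g \<in> G" "i < n" for g i
      using z[of "(g, i, True)"] z[of "(g, i, False)"] that by (auto simp: L_def l_def complex_eq_iff)
    have "couplings (qF u) x = couplings (\<lambda>i w. 0) x"
      by (rule fun_cong[OF couplings_cong]) (simp add: qF_def c)
    then show "apply_bcontfun (F u) x = apply_bcontfun 0 x" by (simp add: Fa couplings_zero)
  qed
  show ?thesis
  proof (rule that[of "card L"])
    fix N :: "nat \<Rightarrow> complex \<Rightarrow>\<^sub>C complex" and I :: "nat set" assume I: "finite I" "card I > card L"
    have "\<exists>c v. (\<exists>k\<in>I. c k \<noteq> 0) \<and> v + (Q v + F v) = (\<Sum>k\<in>I. c k *\<^sub>R N k)"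
      by (rule fredholm_finite_codimension[of Q F L l]) (fact linQ Qb linF finL linl l0 I)+
    then obtain c v where cv: "\<exists>k\<in>I. c k \<noteq> 0" "v + (Q v + F v) = (\<Sum>k\<in>I. c k *\<^sub>R N k)"
      by blast
    have sumap: "apply_bcontfun (\<Sum>k\<in>J. c k *\<^sub>R N k) x = (\<Sum>k\<in>J. of_real (c k) * apply_bcontfun (N k) x)" for J x
      by (induction J rule: infinite_finite_induct) (auto simp: plus_bcontfun.rep_eq scaleR_bcontfun.rep_eq scaleR_conv_of_real)
    have "apply_bcontfun v x + couplings (\<lambda>i. solve_dbar (slice v i)) x = (\<Sum>k\<in>I. of_real (c k) * apply_bcontfun (N k) x)" for x
    proof -
      have "v + K v = (\<Sum>k\<in>I. c k *\<^sub>R N k)" using cv(2) by (simp add: Q_def)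
      then have "apply_bcontfun (v + K v) x = (\<Sum>k\<in>I. of_real (c k) * apply_bcontfun (N k) x)" by (simp add: sumap)
      then show ?thesis by (simp add: plus_bcontfun.rep_eq Ka qK_def)
    qed
    then show "\<exists>(c :: nat \<Rightarrow> real) v. (\<exists>k\<in>I. c k \<noteq> 0) \<and> (\<forall>x. apply_bcontfun v x + couplings (\<lambda>i. solve_dbar (slice v i)) x = (\<Sum>k\<in>I. of_real (c k) * apply_bcontfun (N k) x))"
      using cv(1) by blast
  qed
qed

end

lemma weak_dbar_ctr:
  assumes "continuous_on UNIV v" "\<And>z. norm (v z) \<le> M"
  shows "weak_dbar (ball 0 (5/2)) (solve_dbar v) v"
proof -
  let ?c = "inverse (of_real cauchy_const) :: complex"
  have "weak_dbar (ball 0 (5/2)) (\<lambda>z. ?c * cauchy_transform v z) (\<lambda>z. ?c * (cauchy_const * v z) + cauchy_transform v z * 0)"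
    by (rule weak_dbar_mult[OF weak_dbar_cauchy_transform[OF assms] has_dbar_const, where M="norm ?c"]) auto
  then show ?thesis
    by (rule weak_dbar_cong) (use cauchy_const_pos in \<open>auto simp: solve_dbar_def\<close>)
qed

lemma bump'_eq_0: "norm z \<le> 1 \<Longrightarrow> bump' z = 0"
proof -
  assume "norm z \<le> 1"
  then have "(norm z)\<^sup>2 \<le> 1" by (simp add: power_le_one)
  then show ?thesis by (simp add: bump'_def bump_profile'_def max_def)
qed

section \<open>Prescribing principal parts at one point\<close>

locale pointed_disc_cover = disc_cover +
  fixes p
  assumes n0: "0 < n" and p: "p \<in> dm 0" "crd 0 p = 0"
begin

lemma p_top: "p \<in> topspace X" using p chart_sub[OF ch[OF n0]] by blast

lemma puncture_open: "openin X (topspace X - {p})" by (intro openin_diff points_closed p_top) auto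

definition tail :: "nat \<Rightarrow> 'a \<Rightarrow> complex" where
  "tail k = extend0 (ch 0) (\<lambda>z. bump z * inverse z ^ k)"

lemma crd0_nonzero: "x \<in> dm 0 \<Longrightarrow> x \<noteq> p \<Longrightarrow> crd 0 x \<noteq> 0"
  using p inj_onD[OF chart_inj[OF ch[OF n0]], of x p] by auto

lemma tail_dbar: "z \<noteq> 0 \<Longrightarrow> has_dbar (\<lambda>z. bump z * inverse z ^ k) (bump' z * inverse z ^ k) z"
proof -
  assume z: "z \<noteq> 0"
  have "(\<lambda>z. inverse z ^ k) field_differentiable (at z)" using z by (intro derivative_intros) auto
  then have "has_dbar (\<lambda>z. inverse z ^ k) 0 z" unfolding field_differentiable_def using has_dbar_holomorphic by blast
  from has_dbar_mult[OF bump_dbar this] show ?thesis by simp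
qed

lemma tail_cdbar: "cdbar (topspace X - {p}) (tail k)"
  unfolding tail_def
proof (rule cdbar_extend0[OF ch[OF n0] ch_ball[OF n0] puncture_open, where T="UNIV - {0}" and F'="\<lambda>z. bump' z * inverse z ^ k"])
  show "continuous_on (UNIV - {0}) (\<lambda>z. bump' z * inverse z ^ k)"
    by (intro continuous_intros continuous_bump') auto
qed (use crd0_nonzero tail_dbar bump_eq_0 in auto)

text \<open>Where the bump function is 1 the tail is a pure power and holomorphic off
  \<open>p\<close>, so its dbar extends by 0 over the pole.\<close>

lemma tail_dbar_zero:
  assumes j: "j < n" and z: "z \<in> ball 0 4" "pr j z \<in> dm 0" "norm (crd 0 (pr j z)) < 1" "pr j z \<noteq> p"
  shows "dbar (ch j) (tail k) z = 0"
proof -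
  let ?w = "crd 0 (pr j z)"
  have zi: "z \<in> crd j ` (dm j \<inter> ((topspace X - {p}) \<inter> dm 0))"
    using z pr_top[OF j z(1)] by (subst mem_image_iff[OF j]) auto
  have w: "?w \<in> ball 0 4" "?w \<noteq> 0" using z crd0_nonzero by auto
  have "has_dbar (in_chart (ch 0) (tail k)) (bump' ?w * inverse ?w ^ k) ?w"
  proof (rule has_dbar_cong[OF tail_dbar[OF w(2)]])
    show "\<forall>\<^sub>F u in nhds ?w. bump u * inverse u ^ k = in_chart (ch 0) (tail k) u"
      using eventually_nhds_in_open[OF open_ball w(1)]
    proof eventually_elim
      case (elim u)
      then have "u \<in> crd 0 ` dm 0" using ch_ball[OF n0] by auto
      then show ?case using par_mem[of u "ch 0"] crd_par[of u "ch 0"] by (simp add: in_chart_def tail_def extend0_def)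
    qed
  qed
  then have "dbar (ch 0) (tail k) ?w = 0" using z by (subst dbar_eq) (auto simp: bump'_eq_0)
  then show ?thesis using dbar_transform[OF tail_cdbar puncture_open ch[OF j] ch[OF n0] zi] by simp
qed

definition source :: "nat \<Rightarrow> nat \<Rightarrow> complex \<Rightarrow> complex" where
  "source k j z = (if j < n \<and> z \<in> ball 0 4 \<and> pr j z \<noteq> p then cutoff z * dbar (ch j) (tail k) z else 0)"

lemma source_outside: "norm z \<ge> 3 \<Longrightarrow> source k j z = 0"
  by (simp add: source_def cutoff_simps)

text \<open>Three open sets cover the plane: off \<open>p\<close> the defining formula is
  continuous, while in the unit disc about \<open>p\<close> and beyond radius 3 the source is
  identically 0.\<close>

lemma source_cont: "continuous_on UNIV (source k j)"
proof (cases "j < n")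
  case True
  define D1 where "D1 = crd j ` (dm j \<inter> (topspace X - {p}))"
  define D2 where "D2 = crd j ` (dm j \<inter> {x \<in> dm 0. crd 0 x \<in> ball 0 1})"
  have o: "open D1" "open D2" "open (- cball (0::complex) 3)" unfolding D1_def D2_def
    by (intro overlap_open ch True puncture_open inside_open n0)+ auto
  have D1: "z \<in> D1 \<longleftrightarrow> z \<in> ball 0 4 \<and> pr j z \<in> topspace X \<and> pr j z \<noteq> p" for z
    unfolding D1_def by (subst mem_image_iff[OF True]) auto
  have D2: "z \<in> D2 \<longleftrightarrow> z \<in> ball 0 4 \<and> pr j z \<in> dm 0 \<and> norm (crd 0 (pr j z)) < 1" for z
    unfolding D2_def by (subst mem_image_iff[OF True]) auto
  have U: "UNIV = (D1 \<union> D2) \<union> - cball 0 3"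
  proof -
    have "z \<in> D1 \<union> D2" if "z \<in> cball 0 3" for z
    proof -
      have z4: "z \<in> ball 0 4" using that by auto
      show ?thesis using z4 pr_top[OF True z4] p D1[of z] D2[of z] by (cases "pr j z = p") auto
    qed
    then show ?thesis by blast
  qed
  have "continuous_on D1 (\<lambda>z. cutoff z * dbar (ch j) (tail k) z)"
    using cdbarD(1)[OF tail_cdbar ch[OF True]] unfolding D1_def by (intro continuous_on_mult cutoff_cont)
  then have c1: "continuous_on D1 (source k j)" by (rule continuous_on_eq) (use True D1 in \<open>auto simp: source_def\<close>)
  have c2: "continuous_on D2 (source k j)"
    by (rule continuous_on_eq[of _ "\<lambda>_. 0"]) (use True D2 tail_dbar_zero[OF True] in \<open>auto simp: source_def\<close>)
  have c3: "continuous_on (- cball 0 3) (source k j)"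
    by (rule continuous_on_eq[of _ "\<lambda>_. 0"]) (auto simp: source_outside)
  show ?thesis unfolding U
    by (intro continuous_on_open_Un open_Un o c1 c2 c3)
next
  case False
  then have "source k j = (\<lambda>_. 0)" by (simp add: source_def fun_eq_iff)
  then show ?thesis by simp
qed

definition source_fun :: "nat \<Rightarrow> complex \<Rightarrow>\<^sub>C complex" where
  "source_fun k = Bcontfun (\<lambda>w. \<Sum>j<n. source k j (w - of_nat (10 * j)))"

lemma source_fun_apply: "apply_bcontfun (source_fun k) w = (\<Sum>j<n. source k j (w - of_nat (10 * j)))"
proof -
  have "(\<lambda>w. \<Sum>j<n. source k j (w - of_nat (10 * j))) \<in> bcontfun"
  proof -
    have "bounded (\<Union>j\<in>{..<n}. source k j ` cball 0 3)"
      by (intro bounded_UN finite_lessThan ballI compact_imp_bounded compact_continuous_image continuous_on_subset[OF source_cont]) auto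
    then obtain M where M: "\<And>x. x \<in> (\<Union>j\<in>{..<n}. source k j ` cball 0 3) \<Longrightarrow> norm x \<le> M" unfolding bounded_iff by blast
    have M': "norm (source k j z) \<le> max M 0" if "j < n" for j z
    proof (cases "z \<in> cball 0 3")
      case True
      then have "norm (source k j z) \<le> M" using that by (intro M) blast
      then show ?thesis by simp
    next
      case False then show ?thesis using source_outside[of z k j] by simp
    qed
    have "norm (\<Sum>j<n. source k j (w - of_nat (10 * j))) \<le> (\<Sum>j<n. max M 0)" for w
      by (rule sum_norm_le) (auto intro: M')
    then have "bounded (range (\<lambda>w. \<Sum>j<n. source k j (w - of_nat (10 * j))))" unfolding bounded_iff by blast
    moreover have "continuous_on UNIV (\<lambda>w. \<Sum>j<n. source k j (w - of_nat (10 * j)))"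
      by (intro continuous_intros continuous_on_compose2[OF source_cont]) auto
    ultimately show ?thesis by (simp add: bcontfun_def)
  qed
  then show ?thesis by (simp add: source_fun_def Bcontfun_inverse)
qed

lemma source_fun_eq: "norm z \<le> 3 \<Longrightarrow> j < n \<Longrightarrow> apply_bcontfun (source_fun k) (z + of_nat (10 * j)) = source k j z"
  unfolding source_fun_apply using sum_shift[of z j "source k"] source_outside by blast

lemma coupling_eq: "j < n \<Longrightarrow> norm z < 2 \<Longrightarrow> coupling q (j, z) = (\<Sum>i<n. if pr j z \<in> dm i then unity_dbar i j z * q i (crd i (pr j z)) else 0)"
  by (simp add: coupling_def cutoff_simps)

lemma source_eq: "j < n \<Longrightarrow> norm z < 2 \<Longrightarrow> source k j z = (if pr j z \<noteq> p then dbar (ch j) (tail k) z else 0)"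
  by (simp add: source_def cutoff_simps)

context
  fixes v :: "complex \<Rightarrow>\<^sub>C complex" and c :: "nat \<Rightarrow> real" and I :: "nat set"
  assumes eq: "\<And>j z. j < n \<Longrightarrow> norm z \<le> 3 \<Longrightarrow> slice v j z + coupling (\<lambda>i. solve_dbar (slice v i)) (j, z) = (\<Sum>k\<in>I. of_real (c k) * source k j z)"
begin

definition correction :: "'a \<Rightarrow> complex" where
  "correction x = (\<Sum>i<n. if x \<in> dm i then unity i x * solve_dbar (slice v i) (crd i x) else 0)"

text \<open>That the disc data are expressions of one form of type (0,1) is not imposed; it follows
  from \<open>eq\<close>. This equation expresses them by sources and couplings, which transform
  correctly wherever the cut-offs are 1, that is, for coordinates below 2.\<close>

lemma slice_transform:
  assumes ij: "i < n" "j < n" and z: "norm z < 2" "pr j z \<in> dm i" "norm (crd i (pr j z)) < 2"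
  shows "slice v i (crd i (pr j z)) * cnj (deriv (\<lambda>z. crd i (pr j z)) z) = slice v j z"
proof -
  let ?w = "crd i (pr j z)" and ?t = "cnj (deriv (\<lambda>z. crd i (pr j z)) z)" and ?x = "pr j z"
  have z4: "z \<in> ball 0 4" using z by auto
  have px: "pr i ?w = ?x" using z par_crd[OF ch[OF ij(1)]] by simp
  have zi: "z \<in> crd j ` (dm j \<inter> (topspace X \<inter> dm i))" using z4 z pr_top[OF ij(2) z4] by (subst mem_image_iff[OF ij(2)]) auto
  have unity_dbar: "unity_dbar l j z = unity_dbar l i ?w * ?t" if "l < n" for l
    unfolding unity_dbar_def by (rule dbar_transform[OF unity_cdbar[OF that] openin_topspace ch[OF ij(2)] ch[OF ij(1)] zi])
  have N: "source k j z = source k i ?w * ?t" for k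
  proof (cases "?x = p")
    case False
    have zi': "z \<in> crd j ` (dm j \<inter> ((topspace X - {p}) \<inter> dm i))" using z4 z False pr_top[OF ij(2) z4] by (subst mem_image_iff[OF ij(2)]) auto
    show ?thesis using False z px source_eq[OF ij(2) z(1)] source_eq[OF ij(1) z(3)]
       dbar_transform[OF tail_cdbar puncture_open ch[OF ij(2)] ch[OF ij(1)] zi'] by simp
  qed (use source_eq[OF ij(2) z(1)] source_eq[OF ij(1) z(3)] px in simp)
  have T: "coupling q (j, z) = coupling q (i, ?w) * ?t" for q
    unfolding coupling_eq[OF ij(2) z(1)] coupling_eq[OF ij(1) z(3)] px sum_distrib_right
    by (intro sum.cong) (auto simp: unity_dbar)
  have "slice v i ?w * ?t = ((\<Sum>k\<in>I. of_real (c k) * source k i ?w) - coupling (\<lambda>i. solve_dbar (slice v i)) (i, ?w)) * ?t"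
    using eq[OF ij(1), of ?w] z(3) by (simp add: eq_diff_eq)
  also have "\<dots> = (\<Sum>k\<in>I. of_real (c k) * source k j z) - coupling (\<lambda>i. solve_dbar (slice v i)) (j, z)"
    by (simp add: N T left_diff_distrib sum_distrib_right mult.assoc)
  also have "\<dots> = slice v j z" using eq[OF ij(2), of z] z(1) by (simp add: diff_eq_eq)
  finally show ?thesis .
qed

definition correction_dbar :: "nat \<Rightarrow> nat \<Rightarrow> complex \<Rightarrow> complex" where
  "correction_dbar j i z = (if pr j z \<in> dm i then unity i (pr j z) * (slice v i (crd i (pr j z)) * cnj (deriv (\<lambda>z. crd i (pr j z)) z)) +
     solve_dbar (slice v i) (crd i (pr j z)) * unity_dbar i j z else 0)"

text \<open>The terms that differentiate the local solutions add up to the form itself, as the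
  partition sums to 1; the terms that differentiate the partition add up to the coupling. Equation
  \<open>eq\<close> identifies the total.\<close>

lemma correction_dbar_sum:
  assumes j: "j < n" and z: "norm z < 2"
  shows "(\<Sum>i<n. correction_dbar j i z) = (\<Sum>k\<in>I. of_real (c k) * source k j z)"
proof -
  have z4: "z \<in> ball 0 4" using z by auto
  have "correction_dbar j i z = unity i (pr j z) * slice v j z + (if pr j z \<in> dm i then unity_dbar i j z * solve_dbar (slice v i) (crd i (pr j z)) else 0)" if i: "i < n" for i
  proof (cases "pr j z \<in> dm i \<and> norm (crd i (pr j z)) < 2")
    case True
    then show ?thesis using slice_transform[OF i j z] by (simp add: correction_dbar_def mult.commute)
  next
    case False
    then show ?thesis using unity_zero[OF False] by (auto simp: correction_dbar_def)
  qed
  then have "(\<Sum>i<n. correction_dbar j i z) = (\<Sum>i<n. unity i (pr j z) * slice v j z) + coupling (\<lambda>i. solve_dbar (slice v i)) (j, z)"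
    by (simp add: coupling_eq[OF j z] sum.distrib)
  also have "(\<Sum>i<n. unity i (pr j z) * slice v j z) = slice v j z"
    using unity_sum[OF pr_top[OF j z4]] by (simp flip: sum_distrib_right)
  also have "slice v j z + coupling (\<lambda>i. solve_dbar (slice v i)) (j, z) = (\<Sum>k\<in>I. of_real (c k) * source k j z)" using z by (intro eq j) auto
  finally show ?thesis .
qed

text \<open>Up to radius 5/2 in the i-th disc the Cauchy transform solves its equation and can be
  transported and multiplied; beyond radius 2 the partition function vanishes. The two open regions
  overlap, so every point lies in one of them.\<close>

lemma term_weak:
  assumes ij: "i < n" "j < n" and z0: "norm z0 < 2"
  shows "\<exists>r>0. ball z0 r \<subseteq> ball 0 2 \<and> weak_dbar (ball z0 r) (\<lambda>z. if pr j z \<in> dm i then unity i (pr j z) * solve_dbar (slice v i) (crd i (pr j z)) else 0) (correction_dbar j i)"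
proof (cases "pr j z0 \<in> dm i \<and> norm (crd i (pr j z0)) < 5/2")
  case True
  define D where "D = crd j ` (dm j \<inter> {x \<in> dm i. crd i x \<in> ball 0 (5/2)}) \<inter> ball 0 2"
  let ?\<tau> = "\<lambda>z. crd i (pr j z)"
  have oD: "open D" unfolding D_def by (intro open_Int inside_open ij) auto
  have D: "z \<in> D \<longleftrightarrow> pr j z \<in> dm i \<and> norm (?\<tau> z) < 5/2 \<and> norm z < 2" for z
    unfolding D_def Int_iff by (subst mem_image_iff[OF ij(2)]) auto
  have "z0 \<in> D" using True z0 D by simp
  then obtain r where r: "r > 0" "cball z0 r \<subseteq> D" using oD open_contains_cball by blast
  have sub: "cball z0 r \<subseteq> crd j ` (dm j \<inter> dm i)" using r(2) unfolding D_def by auto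
  have sub4: "cball z0 r \<subseteq> ball 0 4" using r(2) D by fastforce
  have "continuous_on (cball z0 r) (deriv ?\<tau>)"
    using holomorphic_deriv[OF trans_holomorphic[OF ch[OF ij(2)] ch[OF ij(1)]] overlap_open[OF ch[OF ij(2)] chart_open[OF ch[OF ij(1)]]]] sub
    by (meson continuous_on_subset holomorphic_on_imp_continuous_on)
  then have "bounded (deriv ?\<tau> ` cball z0 r)" by (intro compact_imp_bounded compact_continuous_image) auto
  then obtain M1 where M1: "\<And>z. z \<in> cball z0 r \<Longrightarrow> norm (deriv ?\<tau> z) \<le> M1" unfolding bounded_iff by blast
  have "bounded (unity_dbar i j ` cball z0 r)"
    by (intro compact_imp_bounded compact_continuous_image continuous_on_subset[OF unity_dbar_cont[OF ij]] sub4) auto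
  then obtain M2 where M2: "\<And>z. z \<in> cball z0 r \<Longrightarrow> norm (unity_dbar i j z) \<le> M2" unfolding bounded_iff by blast
  have "continuous_on (cball z0 r) (in_chart (ch j) (unity i))"
    using cdbar_cont[OF unity_cdbar[OF ij(1)] ch[OF ij(2)]] image_top[OF ij(2)] sub4 continuous_on_subset by metis
  then have "bounded (in_chart (ch j) (unity i) ` cball z0 r)" by (intro compact_imp_bounded compact_continuous_image) auto
  then obtain M3 where M3: "\<And>z. z \<in> cball z0 r \<Longrightarrow> norm (in_chart (ch j) (unity i) z) \<le> M3" unfolding bounded_iff by blast
  have w1: "weak_dbar (ball z0 r) (\<lambda>z. solve_dbar (slice v i) (?\<tau> z)) (\<lambda>z. slice v i (?\<tau> z) * cnj (deriv ?\<tau> z))"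
  proof (rule weak_dbar_compose[OF weak_dbar_ctr[OF slice_cont slice_bound]])
    show "(?\<tau> has_field_derivative deriv ?\<tau> z) (at z)" if "z \<in> ball z0 r" for z
      using that sub by (intro trans_deriv ch ij) auto
    show "?\<tau> ` ball z0 r \<subseteq> ball 0 (5/2)"
    proof
      fix w assume "w \<in> ?\<tau> ` ball z0 r"
      then obtain z where "w = ?\<tau> z" "z \<in> D" using r(2) ball_subset_cball by blast
      then show "w \<in> ball 0 (5/2)" using D by simp
    qed
    show "norm (deriv ?\<tau> z) \<le> M1" if "z \<in> ball z0 r" for z using that by (intro M1) auto
  qed
  have w2: "weak_dbar (ball z0 r) (\<lambda>z. in_chart (ch j) (unity i) z * solve_dbar (slice v i) (?\<tau> z))
     (\<lambda>z. in_chart (ch j) (unity i) z * (slice v i (?\<tau> z) * cnj (deriv ?\<tau> z)) + solve_dbar (slice v i) (?\<tau> z) * unity_dbar i j z)"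
  proof (rule weak_dbar_mult[OF w1, where M="max M2 M3"])
    show "has_dbar (in_chart (ch j) (unity i)) (unity_dbar i j z) z" if "z \<in> ball z0 r" for z
      using that by (intro unity_dbar_dbar ij subsetD[OF sub4]) auto
    show "norm (in_chart (ch j) (unity i) z) \<le> max M2 M3" "norm (unity_dbar i j z) \<le> max M2 M3" if "z \<in> ball z0 r" for z
      using that M2[of z] M3[of z] by (auto simp: le_max_iff_disj)
  qed
  have "weak_dbar (ball z0 r) (\<lambda>z. if pr j z \<in> dm i then unity i (pr j z) * solve_dbar (slice v i) (?\<tau> z) else 0) (correction_dbar j i)"
  proof (rule weak_dbar_cong[OF w2])
    fix z assume "z \<in> ball z0 r"
    then have "z \<in> D" using r(2) by auto
    then have m: "pr j z \<in> dm i" using D by blast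
    show "in_chart (ch j) (unity i) z * solve_dbar (slice v i) (?\<tau> z) = (if pr j z \<in> dm i then unity i (pr j z) * solve_dbar (slice v i) (?\<tau> z) else 0)"
      using m by (simp add: in_chart_def)
    show "in_chart (ch j) (unity i) z * (slice v i (?\<tau> z) * cnj (deriv ?\<tau> z)) + solve_dbar (slice v i) (?\<tau> z) * unity_dbar i j z = correction_dbar j i z"
      using m by (simp add: in_chart_def correction_dbar_def)
  qed
  moreover have "ball z0 r \<subseteq> ball 0 2"
    using order_trans[OF ball_subset_cball r(2)] by (rule order_trans) (unfold D_def, rule Int_lower2)
  ultimately show ?thesis by (intro exI[of _ r] conjI r(1))
next
  case False
  define D where "D = crd j ` (dm j \<inter> (topspace X - {x \<in> dm i. norm (crd i x) \<le> 2})) \<inter> ball 0 2"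
  have oD: "open D" unfolding D_def by (intro open_Int outside_open ij) auto
  have D: "z \<in> D \<Longrightarrow> z \<in> ball 0 4 \<and> \<not> (pr j z \<in> dm i \<and> norm (crd i (pr j z)) \<le> 2)" for z
    unfolding D_def Int_iff by (subst (asm) mem_image_iff[OF ij(2)]) auto
  have z04: "z0 \<in> ball 0 4" using z0 by auto
  have "z0 \<in> D" unfolding D_def Int_iff using False z0 pr_top[OF ij(2) z04] by (subst mem_image_iff[OF ij(2)]) auto
  then obtain r where r: "r > 0" "ball z0 r \<subseteq> D" using oD open_contains_ball by blast
  have "weak_dbar (ball z0 r) (\<lambda>z. if pr j z \<in> dm i then unity i (pr j z) * solve_dbar (slice v i) (crd i (pr j z)) else 0) (correction_dbar j i)"
  proof (rule weak_dbar_cong[OF weak_dbar_zero])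
    fix z assume "z \<in> ball z0 r"
    then have "z \<in> D" using r(2) by auto
    from D[OF this] have z: "z \<in> ball 0 4" "\<not> (pr j z \<in> dm i \<and> norm (crd i (pr j z)) \<le> 2)" by auto
    have pz: "unity i (pr j z) = 0" using z(2) by (intro unity_zero) auto
    then show "0 = (if pr j z \<in> dm i then unity i (pr j z) * solve_dbar (slice v i) (crd i (pr j z)) else 0)" by simp
    show "0 = correction_dbar j i z" using pz unity_dbar_zero[OF ij z] by (simp add: correction_dbar_def)
  qed
  moreover have "ball z0 r \<subseteq> ball 0 2"
    using r(2) by (rule order_trans) (unfold D_def, rule Int_lower2)
  ultimately show ?thesis by (intro exI[of _ r] conjI r(1))
qed

lemma correction_weak:
  assumes j: "j < n" and z0: "norm z0 < 2"
  shows "\<exists>r>0. ball z0 r \<subseteq> ball 0 2 \<and> weak_dbar (ball z0 r) (in_chart (ch j) correction) (\<lambda>z. \<Sum>k\<in>I. of_real (c k) * source k j z)"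
proof -
  define P where "P i r \<longleftrightarrow> r > 0 \<and> ball z0 r \<subseteq> ball 0 2 \<and> weak_dbar (ball z0 r) (\<lambda>z. if pr j z \<in> dm i then unity i (pr j z) * solve_dbar (slice v i) (crd i (pr j z)) else 0) (correction_dbar j i)" for i r
  define R where "R i = (SOME r. P i r)" for i
  have "P i (R i)" if "i < n" for i
    unfolding R_def by (rule someI_ex) (use term_weak[OF that j z0] in \<open>simp only: P_def\<close>)
  then have R: "\<And>i. i < n \<Longrightarrow> R i > 0 \<and> ball z0 (R i) \<subseteq> ball 0 2 \<and> weak_dbar (ball z0 (R i)) (\<lambda>z. if pr j z \<in> dm i then unity i (pr j z) * solve_dbar (slice v i) (crd i (pr j z)) else 0) (correction_dbar j i)"
    unfolding P_def .
  define r where "r = Min (R ` {..<n})"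
  have r: "r > 0" "\<And>i. i < n \<Longrightarrow> r \<le> R i" 
  proof -
    have "R ` {..<n} \<noteq> {}" using n0 by auto
    then show "r > 0" unfolding r_def using R by (subst Min_gr_iff) auto
    show "r \<le> R i" if "i < n" for i unfolding r_def using that by (intro Min_le) auto
  qed
  have sub: "ball z0 r \<subseteq> ball 0 2" using subset_ball[OF r(2)[OF n0], of z0] R[OF n0] by (meson order_trans)
  have "weak_dbar (ball z0 r) (\<lambda>z. \<Sum>i<n. if pr j z \<in> dm i then unity i (pr j z) * solve_dbar (slice v i) (crd i (pr j z)) else 0) (\<lambda>z. \<Sum>i<n. correction_dbar j i z)"
  proof (rule weak_dbar_sum)
    fix i assume "i \<in> {..<n}"
    then show "weak_dbar (ball z0 r) (\<lambda>z. if pr j z \<in> dm i then unity i (pr j z) * solve_dbar (slice v i) (crd i (pr j z)) else 0) (correction_dbar j i)"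
      using R[of i] subset_ball[OF r(2)[of i], of z0] weak_dbar_subset by (meson lessThan_iff)
  qed
  then have "weak_dbar (ball z0 r) (in_chart (ch j) correction) (\<lambda>z. \<Sum>k\<in>I. of_real (c k) * source k j z)"
  proof (rule weak_dbar_cong)
    fix z assume "z \<in> ball z0 r"
    then have "norm z < 2" using sub by auto
    then show "(\<Sum>i<n. correction_dbar j i z) = (\<Sum>k\<in>I. of_real (c k) * source k j z)" by (rule correction_dbar_sum[OF j])
  qed (simp add: in_chart_def correction_def)
  then show ?thesis by (intro exI[of _ r] conjI r(1) sub)
qed

definition solution :: "'a \<Rightarrow> complex" where "solution x = (\<Sum>k\<in>I. of_real (c k) * tail k x) - correction x"

text \<open>The combined tails and the correction have the same dbar off \<open>p\<close>, so Weyl's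
  lemma applies to their difference.\<close>

lemma solution_holo: "holo (topspace X - {p}) solution"
proof (rule holo_local[OF puncture_open])
  fix x assume x: "x \<in> topspace X - {p}"
  then obtain j where j: "j < n" "x \<in> dm j" "norm (crd j x) < 1" using ch_cov by blast
  let ?z0 = "crd j x"
  obtain r1 where r1: "r1 > 0" "ball ?z0 r1 \<subseteq> ball 0 2" "weak_dbar (ball ?z0 r1) (in_chart (ch j) correction) (\<lambda>z. \<Sum>k\<in>I. of_real (c k) * source k j z)"
    using correction_weak[OF j(1), of ?z0] j(3) by auto
  have "open (crd j ` (dm j \<inter> (topspace X - {p})))" by (intro overlap_open ch j puncture_open)
  moreover have "?z0 \<in> crd j ` (dm j \<inter> (topspace X - {p}))" using x j by blast
  ultimately obtain r2 where r2: "r2 > 0" "ball ?z0 r2 \<subseteq> crd j ` (dm j \<inter> (topspace X - {p}))" using open_contains_ball by blast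
  define r where "r = min r1 r2"
  have r: "r > 0" "ball ?z0 r \<subseteq> ball 0 2" "ball ?z0 r \<subseteq> crd j ` (dm j \<inter> (topspace X - {p}))"
    using r1 r2 by (auto simp: r_def)
  have g: "weak_dbar (ball ?z0 r) (in_chart (ch j) correction) (\<lambda>z. \<Sum>k\<in>I. of_real (c k) * source k j z)"
    by (rule weak_dbar_subset[OF r1(3)]) (auto simp: r_def)
  have e: "has_dbar (in_chart (ch j) (\<lambda>x. \<Sum>k\<in>I. of_real (c k) * tail k x)) (\<Sum>k\<in>I. of_real (c k) * dbar (ch j) (tail k) z) z" if "z \<in> ball ?z0 r" for z
  proof -
    have "has_dbar (\<lambda>w. \<Sum>k\<in>I. of_real (c k) * in_chart (ch j) (tail k) w) (\<Sum>k\<in>I. of_real (c k) * dbar (ch j) (tail k) z + 0 * in_chart (ch j) (tail k) z) z"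
      using that r(3) by (intro has_dbar_sum has_dbar_mult has_dbar_const cdbarD(2)[OF tail_cdbar ch[OF j(1)]]) blast
    then show ?thesis by (simp add: in_chart_def o_def)
  qed
  have "weak_dbar (ball ?z0 r) (\<lambda>z. in_chart (ch j) (\<lambda>x. \<Sum>k\<in>I. of_real (c k) * tail k x) z + (-1) * in_chart (ch j) correction z)
     (\<lambda>z. (\<Sum>k\<in>I. of_real (c k) * dbar (ch j) (tail k) z) + ((-1) * (\<Sum>k\<in>I. of_real (c k) * source k j z) + in_chart (ch j) correction z * 0))"
    by (intro weak_dbar_add weak_dbar_exact e weak_dbar_mult[OF g, where M=1] has_dbar_const) auto
  then have "weak_dbar (ball ?z0 r) (in_chart (ch j) solution) (\<lambda>z. 0)"
  proof (rule weak_dbar_cong)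
    fix z assume z: "z \<in> ball ?z0 r"
    have n2: "norm z < 2" using z r(2) by auto
    have "z \<in> crd j ` (dm j \<inter> (topspace X - {p}))" using z r(3) by blast
    then have "pr j z \<noteq> p" by (subst (asm) mem_image_iff[OF j(1)]) auto
    then show "(\<Sum>k\<in>I. of_real (c k) * dbar (ch j) (tail k) z) + ((-1) * (\<Sum>k\<in>I. of_real (c k) * source k j z) + in_chart (ch j) correction z * 0) = 0"
      by (simp add: source_eq[OF j(1) n2])
  qed (simp add: in_chart_def solution_def)
  then have "in_chart (ch j) solution holomorphic_on ball ?z0 r" by (rule weak_dbar_zero_holomorphic) auto
  then show "\<exists>d\<in>A. x \<in> fst d \<and> (\<exists>r>0. in_chart d solution holomorphic_on ball (snd d x) r)"
    using ch[OF j(1)] j r(1) by blast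
qed

text \<open>Near \<open>p\<close> all sources vanish, so the correction leaves the principal part of
  the tails as it is.\<close>

lemma correction_holo: "in_chart (ch 0) correction holomorphic_on ball 0 1"
proof -
  have "\<exists>r>0. in_chart (ch 0) correction holomorphic_on ball z0 r" if z0: "z0 \<in> ball 0 1" for z0
  proof -
    obtain r1 where r1: "r1 > 0" "weak_dbar (ball z0 r1) (in_chart (ch 0) correction) (\<lambda>z. \<Sum>k\<in>I. of_real (c k) * source k 0 z)"
      using correction_weak[OF n0, of z0] z0 by auto
    obtain r2 where r2: "r2 > 0" "ball z0 r2 \<subseteq> ball 0 1" using z0 open_contains_ball open_ball by blast
    define r where "r = min r1 r2"
    have "weak_dbar (ball z0 r) (in_chart (ch 0) correction) (\<lambda>z. \<Sum>k\<in>I. of_real (c k) * source k 0 z)"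
      by (rule weak_dbar_subset[OF r1(2)]) (auto simp: r_def)
    then have "weak_dbar (ball z0 r) (in_chart (ch 0) correction) (\<lambda>z. 0)"
    proof (rule weak_dbar_cong)
      fix z assume "z \<in> ball z0 r"
      then have "z \<in> ball 0 1" using r2 by (auto simp: r_def)
      then have z: "norm z < 1" by simp
      have "z \<in> crd 0 ` dm 0" using z ch_ball[OF n0] by auto
      then have m: "pr 0 z \<in> dm 0" "crd 0 (pr 0 z) = z" using par_mem[of z "ch 0"] crd_par[of z "ch 0"] by auto
      have "source k 0 z = 0" for k using z m tail_dbar_zero[OF n0, of z k] by (auto simp: source_eq n0)
      then show "(\<Sum>k\<in>I. of_real (c k) * source k 0 z) = 0" by simp
    qed simp
    then have "in_chart (ch 0) correction holomorphic_on ball z0 r" by (rule weak_dbar_zero_holomorphic) auto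
    then show ?thesis using r1 r2 by (intro exI[of _ r]) (auto simp: r_def)
  qed
  then show ?thesis
    by (subst holomorphic_on_open[OF open_ball]) (metis centre_in_ball holomorphic_on_open open_ball)
qed

lemma solution_tail:
  assumes z: "z \<in> ball 0 1"
  shows "in_chart (ch 0) solution z = (\<Sum>k\<in>I. of_real (c k) * inverse z ^ k) - in_chart (ch 0) correction z"
proof -
  have "z \<in> crd 0 ` dm 0" using z ch_ball[OF n0] by auto
  then have m: "pr 0 z \<in> dm 0" "crd 0 (pr 0 z) = z" using par_mem[of z "ch 0"] crd_par[of z "ch 0"] by auto
  then show ?thesis using z bump_eq_1[of z] by (simp add: in_chart_def solution_def tail_def extend0_def)
qed

end

lemma principal_parts:
  "\<exists>m. \<forall>I. finite I \<longrightarrow> card I > m \<longrightarrow> (\<exists>(c::nat \<Rightarrow> real) f g. (\<exists>k\<in>I. c k \<noteq> 0) \<and> holo (topspace X - {p}) f \<and> g holomorphic_on ball 0 1 \<and>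
     (\<forall>z\<in>ball 0 1. in_chart (ch 0) f z = (\<Sum>k\<in>I. of_real (c k) * inverse z ^ k) - g z))"
proof -
  obtain m :: nat where m: "\<And>(N :: nat \<Rightarrow> complex \<Rightarrow>\<^sub>C complex) I. finite I \<Longrightarrow> card I > m \<Longrightarrow>
     \<exists>(c :: nat \<Rightarrow> real) v. (\<exists>k\<in>I. c k \<noteq> 0) \<and> (\<forall>x. apply_bcontfun v x + couplings (\<lambda>i. solve_dbar (slice v i)) x = (\<Sum>k\<in>I. of_real (c k) * apply_bcontfun (N k) x))"
    using solve_modulo_finite by blast
  show ?thesis
  proof (intro exI[of _ m] allI impI)
    fix I :: "nat set" assume I: "finite I" "card I > m"
    obtain c :: "nat \<Rightarrow> real" and v where cv: "\<exists>k\<in>I. c k \<noteq> 0" "\<And>x. apply_bcontfun v x + couplings (\<lambda>i. solve_dbar (slice v i)) x = (\<Sum>k\<in>I. of_real (c k) * apply_bcontfun (source_fun k) x)"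
      using m[OF I, of source_fun] by blast
    have eq: "slice v j z + coupling (\<lambda>i. solve_dbar (slice v i)) (j, z) = (\<Sum>k\<in>I. of_real (c k) * source k j z)" if "j < n" "norm z \<le> 3" for j z
      using cv(2)[of "z + of_nat (10 * j)"] by (simp only: couplings_eq[OF that(2,1)] source_fun_eq[OF that(2,1)] slice_def)
    show "\<exists>(c::nat \<Rightarrow> real) f g. (\<exists>k\<in>I. c k \<noteq> 0) \<and> holo (topspace X - {p}) f \<and> g holomorphic_on ball 0 1 \<and>
     (\<forall>z\<in>ball 0 1. in_chart (ch 0) f z = (\<Sum>k\<in>I. of_real (c k) * inverse z ^ k) - g z)"
      using cv(1) solution_holo[OF eq] correction_holo[OF eq] solution_tail[OF eq] by blast
  qed
qed

end

section \<open>Local lifts of the contact curve\<close>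

text \<open>The order of a germ of a meromorphic function. The value at 0 itself is left free, since
  a quotient has an arbitrary value at its poles and removable singularities.\<close>

definition order_at0 :: "(complex \<Rightarrow> complex) \<Rightarrow> int \<Rightarrow> bool" where
  "order_at0 f k \<longleftrightarrow> (\<exists>r>0. \<exists>h. h holomorphic_on ball 0 r \<and> (\<forall>z\<in>ball 0 r. h z \<noteq> 0) \<and> (\<forall>z\<in>ball 0 r - {0}. f z = h z * z powi k))"

definition contact_form :: "(nat \<Rightarrow> complex) \<Rightarrow> (nat \<Rightarrow> complex) \<Rightarrow> complex" where
  "contact_form x y = x 0 * y 3 - x 3 * y 0 - x 1 * y 2 + x 2 * y 1"

text \<open>The last condition says that the planes \<open>x\<^sub>3 = c x\<^sub>0\<close> meet the curve transversally at its points with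
  \<open>x\<^sub>0 = x\<^sub>3 = 0\<close>.\<close>

definition lift_of :: "(complex \<Rightarrow> complex) \<Rightarrow> (complex \<Rightarrow> complex) \<Rightarrow> real \<Rightarrow> (nat \<Rightarrow> complex \<Rightarrow> complex) \<Rightarrow> bool" where
  "lift_of a b r W \<longleftrightarrow> r > 0 \<and> (\<forall>i. W i holomorphic_on ball 0 r) \<and>
     (\<forall>z\<in>ball 0 r - {0}. W 0 z \<noteq> 0 \<and> deriv b z \<noteq> 0 \<and> a field_differentiable at z \<and> b field_differentiable at z \<and>
        W 1 z = W 0 z * (deriv a z / (2 * deriv b z)) \<and> W 2 z = W 0 z * b z \<and>
        W 3 z = W 0 z * (a z - b z * (deriv a z / (2 * deriv b z)))) \<and>
     (\<exists>i<4. \<exists>j<4. W i 0 * deriv (W j) 0 \<noteq> W j 0 * deriv (W i) 0) \<and>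
     (\<forall>c. c \<noteq> 0 \<longrightarrow> W 0 0 = 0 \<longrightarrow> W 3 0 = c * W 0 0 \<longrightarrow> deriv (W 3) 0 \<noteq> c * deriv (W 0) 0)"

definition vec4 :: "'b \<Rightarrow> 'b \<Rightarrow> 'b \<Rightarrow> 'b \<Rightarrow> nat \<Rightarrow> 'b" where
  "vec4 p q s t i = (if i = 0 then p else if i = 1 then q else if i = 2 then s else t)"

lemma vec4_simps [simp]: "vec4 p q s t 0 = p" "vec4 p q s t (Suc 0) = q" "vec4 p q s t 2 = s" "vec4 p q s t 3 = t"
  by (simp_all add: vec4_def)

lemma nonzero_ball:
  assumes "f holomorphic_on ball 0 r" "r > 0" "f 0 \<noteq> (0::complex)"
  obtains r' where "0 < r'" "r' \<le> r" "\<And>z. z \<in> ball 0 r' \<Longrightarrow> f z \<noteq> 0"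
proof -
  have "isCont f 0" using holomorphic_on_imp_continuous_on[OF assms(1)] assms(2) by (simp add: continuous_on_eq_continuous_at)
  from continuous_at_avoid[OF this assms(3)] obtain e where "e > 0" "\<And>y. dist 0 y < e \<Longrightarrow> f y \<noteq> 0" by blast
  then show ?thesis using assms(2) by (intro that[of "min e r"]) auto
qed

lemma lift_ofI:
  assumes r: "r > 0" and hol: "\<And>f. f \<in> {w0, w1, w2, w3} \<Longrightarrow> f holomorphic_on ball 0 r"
    and a: "\<And>z. z \<in> ball 0 r - {0} \<Longrightarrow> (a has_field_derivative a' z) (at z)"
    and b: "\<And>z. z \<in> ball 0 r - {0} \<Longrightarrow> (b has_field_derivative b' z) (at z)"
    and eqs: "\<And>z. z \<in> ball 0 r - {0} \<Longrightarrow> w0 z \<noteq> 0 \<and> b' z \<noteq> 0 \<and> w1 z = w0 z * (a' z / (2 * b' z)) \<and> w2 z = w0 z * b z \<and> w3 z = w0 z * (a z - b z * (a' z / (2 * b' z)))"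
    and wedge: "i < 4" "j < 4" "vec4 w0 w1 w2 w3 i 0 * deriv (vec4 w0 w1 w2 w3 j) 0 \<noteq> vec4 w0 w1 w2 w3 j 0 * deriv (vec4 w0 w1 w2 w3 i) 0"
    and pencil: "\<And>c. c \<noteq> 0 \<Longrightarrow> w0 0 = 0 \<Longrightarrow> w3 0 = 0 \<Longrightarrow> deriv w3 0 \<noteq> c * deriv w0 0"
  shows "lift_of a b r (vec4 w0 w1 w2 w3)"
  unfolding lift_of_def
proof (intro conjI allI ballI impI)
  show "vec4 w0 w1 w2 w3 i holomorphic_on ball 0 r" for i using hol by (auto simp: vec4_def)
  fix z :: complex assume z: "z \<in> ball 0 r - {0}"
  have d: "deriv a z = a' z" "deriv b z = b' z" using a[OF z] b[OF z] by (auto simp: DERIV_imp_deriv)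
  show "a field_differentiable at z" "b field_differentiable at z" using a[OF z] b[OF z] by (auto simp: field_differentiable_def)
  show "vec4 w0 w1 w2 w3 0 z \<noteq> 0" "deriv b z \<noteq> 0" "vec4 w0 w1 w2 w3 1 z = vec4 w0 w1 w2 w3 0 z * (deriv a z / (2 * deriv b z))"
    "vec4 w0 w1 w2 w3 2 z = vec4 w0 w1 w2 w3 0 z * b z"
    "vec4 w0 w1 w2 w3 3 z = vec4 w0 w1 w2 w3 0 z * (a z - b z * (deriv a z / (2 * deriv b z)))"
    using eqs[OF z] unfolding d by auto
next
  show "\<exists>i<4. \<exists>j<4. vec4 w0 w1 w2 w3 i 0 * deriv (vec4 w0 w1 w2 w3 j) 0 \<noteq> vec4 w0 w1 w2 w3 j 0 * deriv (vec4 w0 w1 w2 w3 i) 0"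
    using wedge by blast
  fix c :: complex assume "c \<noteq> 0" "vec4 w0 w1 w2 w3 0 0 = 0" "vec4 w0 w1 w2 w3 3 0 = c * vec4 w0 w1 w2 w3 0 0"
  then show "deriv (vec4 w0 w1 w2 w3 3) 0 \<noteq> c * deriv (vec4 w0 w1 w2 w3 0) 0" using pencil by simp
qed fact

lemma deriv_at: "f holomorphic_on ball 0 r \<Longrightarrow> z \<in> ball 0 r \<Longrightarrow> (f has_field_derivative deriv f z) (at z)"
  by (rule holomorphic_derivI[OF _ open_ball])

lemma punctured_deriv:
  assumes "\<And>w. w \<in> ball 0 r - {0} \<Longrightarrow> f w = g w" "z \<in> ball 0 r - {0}" "(g has_field_derivative d) (at z)"
  shows "(f has_field_derivative d) (at z)"
  using assms(3) by (rule has_field_derivative_transform_within_open[where S="ball 0 r - {0}"]) (use assms in auto)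

text \<open>Where \<open>b\<close> is a local coordinate, the components 1 and \<open>b\<close>
  alone make the lift immersed. \<open>h\<close> removes the singularity of
  \<open>a\<close>.\<close>

lemma lift_regular:
  assumes r: "r > 0" and h: "h holomorphic_on ball 0 r" "\<And>z. z \<in> ball 0 r - {0} \<Longrightarrow> a z = h z"
    and b: "b holomorphic_on ball 0 r" "deriv b 0 \<noteq> 0"
  shows "\<exists>r W. lift_of a b r W"
proof -
  obtain s where s: "0 < s" "s \<le> r" "\<And>z. z \<in> ball 0 s \<Longrightarrow> deriv b z \<noteq> 0"
    using nonzero_ball[OF holomorphic_deriv[OF b(1) open_ball] r b(2)] by blast
  have sub: "ball 0 s \<subseteq> ball 0 r" using s(2) by auto
  have hs: "h holomorphic_on ball 0 s" "b holomorphic_on ball 0 s" using h b sub by (auto intro: holomorphic_on_subset)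
  define w1 where "w1 z = deriv h z / (2 * deriv b z)" for z
  have w1: "w1 holomorphic_on ball 0 s" unfolding w1_def using s(3) by (intro holomorphic_intros holomorphic_deriv hs open_ball) auto
  have "lift_of a b s (vec4 (\<lambda>z. 1) w1 b (\<lambda>z. h z - b z * w1 z))"
  proof (rule lift_ofI[where a'="deriv h" and b'="deriv b" and i=0 and j=2])
    show "f holomorphic_on ball 0 s" if "f \<in> {\<lambda>z. 1, w1, b, \<lambda>z. h z - b z * w1 z}" for f
      using that hs w1 by (auto intro!: holomorphic_intros)
    show "(a has_field_derivative deriv h z) (at z)" if "z \<in> ball 0 s - {0}" for z
    proof (rule punctured_deriv[OF _ that deriv_at[OF hs(1)]])
      show "a w = h w" if "w \<in> ball 0 s - {0}" for w using that sub by (intro h(2)) blast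
    qed (use that in auto)
    show "(b has_field_derivative deriv b z) (at z)" if "z \<in> ball 0 s - {0}" for z
      using that by (intro deriv_at[OF hs(2)]) auto
  qed (use s h(2) sub b(2) in \<open>auto simp: w1_def subset_iff\<close>)
  then show ?thesis by blast
qed

lemma order_at0I:
  assumes "r > 0" "h holomorphic_on ball 0 r" "h 0 \<noteq> 0" "\<And>z. z \<in> ball 0 r - {0} \<Longrightarrow> f z = h z * z powi k"
  shows "order_at0 f k"
proof -
  obtain s where "0 < s" "s \<le> r" "\<And>z. z \<in> ball 0 s \<Longrightarrow> h z \<noteq> 0" using nonzero_ball[OF assms(2,1,3)] by blast
  moreover have "ball 0 s \<subseteq> ball (0::complex) r" using calculation by auto
  ultimately show ?thesis unfolding order_at0_def using assms(2,4)
    by (intro exI[of _ s] conjI exI[of _ h]) (auto intro: holomorphic_on_subset)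
qed

lemma powi_product_deriv:
  assumes h: "h holomorphic_on ball 0 r" and f: "\<And>w. w \<in> ball 0 r - {0} \<Longrightarrow> f w = c + h w * w powi k" and z: "z \<in> ball 0 r - {0}"
  shows "(f has_field_derivative (of_int k * h z + z * deriv h z) * z powi (k - 1)) (at z)"
proof -
  have zb: "z \<in> ball 0 r" and nz: "z \<noteq> 0" using z by auto
  have e: "z powi k = z * z powi (k - 1)" using power_int_add[of z 1 "k - 1"] nz by simp
  have d: "((\<lambda>w. c + h w * w powi k) has_field_derivative 0 + (deriv h z * z powi k + of_int k * z powi (k - 1) * 1 * h z)) (at z)"
    by (intro DERIV_add DERIV_const DERIV_mult deriv_at[OF h zb] DERIV_power_int DERIV_ident disjI2[OF nz])
  have "0 + (deriv h z * z powi k + of_int k * z powi (k - 1) * 1 * h z) = (of_int k * h z + z * deriv h z) * z powi (k - 1)"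
    unfolding e by (simp add: algebra_simps)
  then show ?thesis using punctured_deriv[OF f z d] by metis
qed

lemma order_at0_simple_zero:
  assumes b: "b holomorphic_on ball 0 r" "r > 0" "deriv b 0 \<noteq> 0"
  shows "order_at0 (\<lambda>z. b z - b 0) 1"
proof (rule order_at0I[where h="\<lambda>z. if z = 0 then deriv b 0 else (b z - b 0) / (z - 0)", OF b(2)])
  show "(\<lambda>z. if z = 0 then deriv b 0 else (b z - b 0) / (z - 0)) holomorphic_on ball 0 r" by (rule pole_lemma_open[OF b(1) open_ball])
qed (use b in auto)

text \<open>Multiplying \<open>(1, a'/(2b'), b, a - b a'/(2b'))\<close> by \<open>z\<^sup>e\<close> removes the poles; the three uses below
  take \<open>n1 = e + k - m\<close>, \<open>n2 = e + m\<close> and \<open>n3 = e + k\<close> nonnegative.\<close>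

lemma lift_normal_form:
  assumes a: "order_at0 a k" and b: "order_at0 (\<lambda>z. b z - b0) m" and m: "m \<noteq> 0"
    and n: "int n1 = int e + k - m" "int n2 = int e + m" "int n3 = int e + k"
  obtains r \<alpha> \<beta> \<kappa> where "r > 0" "\<alpha> holomorphic_on ball 0 r" "\<beta> holomorphic_on ball 0 r" "\<kappa> holomorphic_on ball 0 r"
    "\<alpha> 0 \<noteq> 0" "\<beta> 0 \<noteq> 0" "\<kappa> 0 = of_int k * \<alpha> 0 / (2 * (of_int m * \<beta> 0))"
    "\<And>W i j. W = vec4 (\<lambda>z. z ^ e) (\<lambda>z. z ^ n1 * \<kappa> z) (\<lambda>z. b0 * z ^ e + z ^ n2 * \<beta> z) (\<lambda>z. z ^ n3 * (\<alpha> z - \<beta> z * \<kappa> z) - b0 * (z ^ n1 * \<kappa> z)) \<Longrightarrow>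
      i < 4 \<Longrightarrow> j < 4 \<Longrightarrow> W i 0 * deriv (W j) 0 \<noteq> W j 0 * deriv (W i) 0 \<Longrightarrow>
      (\<And>c. c \<noteq> 0 \<Longrightarrow> W 0 0 = 0 \<Longrightarrow> W 3 0 = 0 \<Longrightarrow> deriv (W 3) 0 \<noteq> c * deriv (W 0) 0) \<Longrightarrow> lift_of a b r W"
proof -
  obtain r1 \<alpha> where r1: "r1 > 0" "\<alpha> holomorphic_on ball 0 r1" "\<And>z. z \<in> ball 0 r1 \<Longrightarrow> \<alpha> z \<noteq> 0"
    "\<And>z. z \<in> ball 0 r1 - {0} \<Longrightarrow> a z = \<alpha> z * z powi k" using a unfolding order_at0_def by blast
  obtain r2 \<beta> where r2: "r2 > 0" "\<beta> holomorphic_on ball 0 r2" "\<And>z. z \<in> ball 0 r2 \<Longrightarrow> \<beta> z \<noteq> 0"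
    "\<And>z. z \<in> ball 0 r2 - {0} \<Longrightarrow> b z - b0 = \<beta> z * z powi m" using b unfolding order_at0_def by blast
  define v where "v z = of_int m * \<beta> z + z * deriv \<beta> z" for z
  define u where "u z = of_int k * \<alpha> z + z * deriv \<alpha> z" for z
  have vh: "v holomorphic_on ball 0 r2" unfolding v_def by (intro holomorphic_intros holomorphic_deriv r2 open_ball)
  have v0: "v 0 \<noteq> 0" using r2 m by (simp add: v_def)
  obtain r3 where r3: "0 < r3" "r3 \<le> r2" "\<And>z. z \<in> ball 0 r3 \<Longrightarrow> v z \<noteq> 0"
    using nonzero_ball[OF vh r2(1) v0] by blast
  define s where "s = min r1 r3"
  have s: "s > 0" "ball 0 s \<subseteq> ball 0 r1" "ball 0 s \<subseteq> ball 0 r2" "ball 0 s \<subseteq> ball 0 r3" using r1 r2 r3 by (auto simp: s_def)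
  have hs: "\<alpha> holomorphic_on ball 0 s" "\<beta> holomorphic_on ball 0 s" "v holomorphic_on ball 0 s" using r1 r2 vh s by (auto intro: holomorphic_on_subset)
  have vnz: "v z \<noteq> 0" if "z \<in> ball 0 s" for z using r3(3) s(4) that by blast
  define \<kappa> where "\<kappa> z = u z / (2 * v z)" for z
  have \<kappa>: "\<kappa> holomorphic_on ball 0 s" unfolding \<kappa>_def u_def using vnz by (intro holomorphic_intros holomorphic_deriv hs open_ball) auto
  have aeq: "a z = 0 + \<alpha> z * z powi k" and beq: "b z = b0 + \<beta> z * z powi m" if "z \<in> ball 0 s - {0}" for z
  proof -
    have "z \<in> ball 0 r1 - {0}" "z \<in> ball 0 r2 - {0}" using that s by blast+
    from r1(4)[OF this(1)] r2(4)[OF this(2)] show "a z = 0 + \<alpha> z * z powi k" "b z = b0 + \<beta> z * z powi m" by (simp_all add: algebra_simps)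
  qed
  have lift: "lift_of a b s W" if W: "W = vec4 (\<lambda>z. z ^ e) (\<lambda>z. z ^ n1 * \<kappa> z) (\<lambda>z. b0 * z ^ e + z ^ n2 * \<beta> z) (\<lambda>z. z ^ n3 * (\<alpha> z - \<beta> z * \<kappa> z) - b0 * (z ^ n1 * \<kappa> z))"
      and wedge: "i < 4" "j < 4" "W i 0 * deriv (W j) 0 \<noteq> W j 0 * deriv (W i) 0"
      and pencil: "\<And>c. c \<noteq> 0 \<Longrightarrow> W 0 0 = 0 \<Longrightarrow> W 3 0 = 0 \<Longrightarrow> deriv (W 3) 0 \<noteq> c * deriv (W 0) 0" for W i j
    unfolding W
  proof (rule lift_ofI[where a'="\<lambda>z. u z * z powi (k - 1)" and b'="\<lambda>z. v z * z powi (m - 1)" and i=i and j=j, OF s(1)])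
    fix z :: complex assume z: "z \<in> ball 0 s - {0}"
    then have zb: "z \<in> ball 0 s" and nz: "z \<noteq> 0" by auto
    show "(a has_field_derivative u z * z powi (k - 1)) (at z)" unfolding u_def by (rule powi_product_deriv[OF hs(1) aeq z])
    show "(b has_field_derivative v z * z powi (m - 1)) (at z)" unfolding v_def by (rule powi_product_deriv[OF hs(2) beq z])
    define t where "t = u z * z powi (k - 1) / (2 * (v z * z powi (m - 1)))"
    have "z powi (k - 1) = z powi (k - m) * z powi (m - 1)" using power_int_add[of z "k - m" "m - 1"] nz by simp
    then have t: "t = z powi (k - m) * \<kappa> z" unfolding t_def \<kappa>_def using nz vnz[OF zb] by (simp add: mult_ac)
    have p: "z ^ n1 = z ^ e * z powi (k - m)" "z ^ n2 = z ^ e * z powi m" "z ^ n3 = z ^ e * z powi k" "z powi k = z powi m * z powi (k - m)"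
      using n nz by (simp_all add: power_int_add[symmetric] add_diff_eq flip: power_int_of_nat)
    show "z ^ e \<noteq> 0 \<and> v z * z powi (m - 1) \<noteq> 0 \<and> z ^ n1 * \<kappa> z = z ^ e * (u z * z powi (k - 1) / (2 * (v z * z powi (m - 1)))) \<and>
        b0 * z ^ e + z ^ n2 * \<beta> z = z ^ e * b z \<and>
        z ^ n3 * (\<alpha> z - \<beta> z * \<kappa> z) - b0 * (z ^ n1 * \<kappa> z) = z ^ e * (a z - b z * (u z * z powi (k - 1) / (2 * (v z * z powi (m - 1)))))"
      unfolding t_def[symmetric] t aeq[OF z] beq[OF z] p(1-3) using nz vnz[OF zb] by (simp add: p(4) algebra_simps)
  qed (use wedge pencil hs \<kappa> W in \<open>auto intro!: holomorphic_intros\<close>)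
  have "0 \<in> ball (0::complex) s" using s(1) by simp
  then have "\<alpha> 0 \<noteq> 0" "\<beta> 0 \<noteq> 0" using r1(3) r2(3) s by blast+
  then show ?thesis using that[OF s(1) hs(1,2) \<kappa> _ _ _ lift] by (simp add: \<kappa>_def u_def v_def)
qed

text \<open>The strongest pole is that of a', of order j + 1, which fixes the power of z. The lift
  then passes through a point with second coordinate nonzero and moves to first order in the
  direction of the last coordinate.\<close>

lemma lift_pole:
  assumes a: "order_at0 a (- int j)" and j: "j \<ge> 1" and r: "r > 0" and b: "b holomorphic_on ball 0 r" "deriv b 0 \<noteq> 0"
  shows "\<exists>r W. lift_of a b r W"
proof (rule lift_normal_form[OF a order_at0_simple_zero[OF b(1) r b(2)], of 0 "Suc j" "Suc (Suc j)" 1])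
  fix s \<alpha> \<beta> \<kappa>
  assume H: "s > 0" "\<alpha> holomorphic_on ball 0 s" "\<beta> holomorphic_on ball 0 s" "\<kappa> holomorphic_on ball 0 s" "\<alpha> 0 \<noteq> 0" "\<beta> 0 \<noteq> 0"
    "\<kappa> 0 = of_int (- int j) * \<alpha> 0 / (2 * (of_int 1 * \<beta> 0))"
  let ?W = "vec4 (\<lambda>z. z ^ Suc j) (\<lambda>z. z ^ 0 * \<kappa> z) (\<lambda>z. b 0 * z ^ Suc j + z ^ Suc (Suc j) * \<beta> z) (\<lambda>z. z ^ 1 * (\<alpha> z - \<beta> z * \<kappa> z) - b 0 * (z ^ 0 * \<kappa> z))"
  assume lift: "\<And>W i k. W = ?W \<Longrightarrow> i < 4 \<Longrightarrow> k < 4 \<Longrightarrow> W i 0 * deriv (W k) 0 \<noteq> W k 0 * deriv (W i) 0 \<Longrightarrow>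
      (\<And>c. c \<noteq> 0 \<Longrightarrow> W 0 0 = 0 \<Longrightarrow> W 3 0 = 0 \<Longrightarrow> deriv (W 3) 0 \<noteq> c * deriv (W 0) 0) \<Longrightarrow> lift_of a b s W"
  have z0: "0 \<in> ball 0 s" using H(1) by simp
  have d3: "deriv (?W 3) 0 = \<alpha> 0 - \<beta> 0 * \<kappa> 0 - b 0 * deriv \<kappa> 0" and d1: "deriv (?W 1) 0 = deriv \<kappa> 0" and d0: "deriv (?W 0) 0 = 0"
    unfolding vec4_def using j by (auto intro!: DERIV_imp_deriv derivative_eq_intros deriv_at[OF H(2) z0] deriv_at[OF H(3) z0] deriv_at[OF H(4) z0])
  have \<kappa>0: "\<kappa> 0 \<noteq> 0" using H(5-7) j by simp
  \<comment> \<open>The two contributions do not cancel: their sum is \<alpha> (1 + j/2) at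
    0.\<close>
  have "\<alpha> 0 - \<beta> 0 * \<kappa> 0 = \<alpha> 0 * (of_nat (j + 2) / 2)" unfolding H(7) using H(6) by (simp add: field_simps)
  moreover have "of_nat (j + 2) \<noteq> (0::complex)" unfolding of_nat_eq_0_iff by simp
  ultimately have k0: "\<alpha> 0 - \<beta> 0 * \<kappa> 0 \<noteq> 0" using H(5) by (simp only: mult_eq_0_iff divide_eq_0_iff) simp
  have "lift_of a b s ?W"
  proof (rule lift[OF refl, of 1 3])
    have "\<kappa> 0 * (\<alpha> 0 - \<beta> 0 * \<kappa> 0) \<noteq> 0" using \<kappa>0 k0 by simp
    then show "?W 1 0 * deriv (?W 3) 0 \<noteq> ?W 3 0 * deriv (?W 1) 0" unfolding d3 d1 by (simp add: algebra_simps)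
    show "deriv (?W 3) 0 \<noteq> c * deriv (?W 0) 0" if "c \<noteq> 0" "?W 3 0 = 0" for c using that \<kappa>0 k0 unfolding d3 d0 by simp
  qed simp_all
  then show ?thesis by blast
qed simp_all

text \<open>With the order of \<open>a\<close> one less than that of b - b(0), the quotient a'/b'
  has a simple pole exactly. Multiplication by z makes the first coordinate equal to z and the
  second nonzero, whence the immersion.\<close>

lemma lift_critical:
  assumes a: "order_at0 a (int k)" and b: "order_at0 (\<lambda>z. b z - b 0) (int (Suc k))" and k: "k \<ge> 1"
  shows "\<exists>r W. lift_of a b r W"
proof (rule lift_normal_form[OF a b, of 0 1 "k + 2" "Suc k"])
  fix s \<alpha> \<beta> \<kappa>
  assume H: "s > 0" "\<alpha> holomorphic_on ball 0 s" "\<beta> holomorphic_on ball 0 s" "\<kappa> holomorphic_on ball 0 s" "\<alpha> 0 \<noteq> 0" "\<beta> 0 \<noteq> 0"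
    "\<kappa> 0 = of_int (int k) * \<alpha> 0 / (2 * (of_int (int (Suc k)) * \<beta> 0))"
  let ?W = "vec4 (\<lambda>z. z ^ 1) (\<lambda>z. z ^ 0 * \<kappa> z) (\<lambda>z. b 0 * z ^ 1 + z ^ (k + 2) * \<beta> z) (\<lambda>z. z ^ Suc k * (\<alpha> z - \<beta> z * \<kappa> z) - b 0 * (z ^ 0 * \<kappa> z))"
  assume lift: "\<And>W i j. W = ?W \<Longrightarrow> i < 4 \<Longrightarrow> j < 4 \<Longrightarrow> W i 0 * deriv (W j) 0 \<noteq> W j 0 * deriv (W i) 0 \<Longrightarrow>
      (\<And>c. c \<noteq> 0 \<Longrightarrow> W 0 0 = 0 \<Longrightarrow> W 3 0 = 0 \<Longrightarrow> deriv (W 3) 0 \<noteq> c * deriv (W 0) 0) \<Longrightarrow> lift_of a b s W"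
  have z0: "0 \<in> ball 0 s" using H(1) by simp
  have d3: "deriv (?W 3) 0 = - (b 0 * deriv \<kappa> 0)" and d0: "deriv (?W 0) 0 = 1"
    unfolding vec4_def using k by (auto intro!: DERIV_imp_deriv derivative_eq_intros deriv_at[OF H(2) z0] deriv_at[OF H(3) z0] deriv_at[OF H(4) z0])
  have \<kappa>0: "\<kappa> 0 \<noteq> 0" using H(5-7) k by (simp del: of_nat_Suc)
  have "lift_of a b s ?W"
  proof (rule lift[OF refl, of 0 1])
    show "?W 0 0 * deriv (?W 1) 0 \<noteq> ?W 1 0 * deriv (?W 0) 0" unfolding d0 using \<kappa>0 by simp
    \<comment> \<open>The last coordinate at 0 is \<open>- b 0 * \<kappa> 0\<close>; if it vanishes
      then \<open>b 0 = 0\<close>, and its derivative is 0 as well, whereas the first coordinate has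
      derivative 1.\<close>
    show "deriv (?W 3) 0 \<noteq> c * deriv (?W 0) 0" if "c \<noteq> 0" "?W 3 0 = 0" for c using that \<kappa>0 unfolding d3 d0 by auto
  qed simp_all
  then show ?thesis by blast
qed simp_all

text \<open>After multiplication by z^(m+1) the last coordinate at 0 is \<alpha> (m - 1)/(2m),
  nonzero because m \<ge> 2, and the third one has a simple zero, so their ratio is a local
  coordinate.\<close>

lemma lift_main_pole:
  assumes a: "order_at0 a (- int (Suc m))" and b: "order_at0 b (- int m)" and m: "m \<ge> 2"
  shows "\<exists>r W. lift_of a b r W \<and> W 0 0 = 0 \<and> W 1 0 = 0 \<and> W 3 0 \<noteq> 0"
proof (rule lift_normal_form[where b=b and ?b0.0=0 and m="- int m", OF a _ _, of m "Suc m" 1 0])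
  fix s \<alpha> \<beta> \<kappa>
  assume H: "s > 0" "\<alpha> holomorphic_on ball 0 s" "\<beta> holomorphic_on ball 0 s" "\<kappa> holomorphic_on ball 0 s" "\<alpha> 0 \<noteq> 0" "\<beta> 0 \<noteq> 0"
    "\<kappa> 0 = of_int (- int (Suc m)) * \<alpha> 0 / (2 * (of_int (- int m) * \<beta> 0))"
  let ?W = "vec4 (\<lambda>z. z ^ Suc m) (\<lambda>z. z ^ m * \<kappa> z) (\<lambda>z. 0 * z ^ Suc m + z ^ 1 * \<beta> z) (\<lambda>z. z ^ 0 * (\<alpha> z - \<beta> z * \<kappa> z) - 0 * (z ^ m * \<kappa> z))"
  assume lift: "\<And>W i j. W = ?W \<Longrightarrow> i < 4 \<Longrightarrow> j < 4 \<Longrightarrow> W i 0 * deriv (W j) 0 \<noteq> W j 0 * deriv (W i) 0 \<Longrightarrow>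
      (\<And>c. c \<noteq> 0 \<Longrightarrow> W 0 0 = 0 \<Longrightarrow> W 3 0 = 0 \<Longrightarrow> deriv (W 3) 0 \<noteq> c * deriv (W 0) 0) \<Longrightarrow> lift_of a b s W"
  have z0: "0 \<in> ball 0 s" using H(1) by simp
  have nz: "of_nat m - 1 \<noteq> (0::complex)" "of_nat m \<noteq> (0::complex)" using m by (auto simp: eq_diff_eq of_nat_eq_1_iff)
  have "\<alpha> 0 - \<beta> 0 * \<kappa> 0 = \<alpha> 0 * (of_nat m - 1) / (2 * of_nat m)" unfolding H(7) using H(6) nz by (simp add: field_simps)
  then have w3: "?W 3 0 \<noteq> 0" using H(5) nz by simp
  have d2: "deriv (?W 2) 0 = \<beta> 0"
    unfolding vec4_def by (auto intro!: DERIV_imp_deriv derivative_eq_intros deriv_at[OF H(3) z0])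
  have "lift_of a b s ?W"
  proof (rule lift[OF refl, of 3 2])
    have "?W 3 0 * deriv (?W 2) 0 \<noteq> 0" unfolding d2 using w3 H(6) by simp
    then show "?W 3 0 * deriv (?W 2) 0 \<noteq> ?W 2 0 * deriv (?W 3) 0" by simp
  qed (use w3 in simp_all)
  moreover have "?W 0 0 = 0" "?W 1 0 = 0" using m by simp_all
  ultimately show ?thesis using w3 by blast
qed (use b m in simp_all)

text \<open>For f = a'/(2b'), g = b and h = a - b f the identity a' = 2 b' f gives h' = f g' - g f',
  which is the contact condition in affine coordinates. Continuity extends it to the centre.\<close>

lemma lift_contact_form:
  assumes W: "lift_of a b r W" and z: "z \<in> ball 0 r"
  shows "contact_form (\<lambda>i. W i z) (\<lambda>i. deriv (W i) z) = 0"
proof -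
  have hol: "W i holomorphic_on ball 0 r" for i using W by (simp add: lift_of_def)
  let ?S = "\<lambda>z. contact_form (\<lambda>i. W i z) (\<lambda>i. deriv (W i) z)"
  have off: "?S z = 0" if z: "z \<in> ball 0 r - {0}" for z
  proof -
    have zb: "z \<in> ball 0 r" using z by auto
    have nz: "W 0 w \<noteq> 0" and w1: "W 1 w = W 0 w * (deriv a w / (2 * deriv b w))" and w2: "W 2 w = W 0 w * b w" and bnz: "deriv b w \<noteq> 0"
       and w3: "W 3 w = W 0 w * (a w - b w * (deriv a w / (2 * deriv b w)))" if "w \<in> ball 0 r - {0}" for w
      using W that by (auto simp: lift_of_def)
    have D: "(W i has_field_derivative deriv (W i) z) (at z)" for i by (rule deriv_at[OF hol zb])
    have beq: "b w = W 2 w / W 0 w" if "w \<in> ball 0 r - {0}" for w using w2[OF that] nz[OF that] by simp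
    have aeq: "a w = W 3 w / W 0 w + (W 2 w / W 0 w) * (W 1 w / W 0 w)" if "w \<in> ball 0 r - {0}" for w
      using w1[OF that] w2[OF that] w3[OF that] nz[OF that] by simp
    let ?n = "W 0 z"
    have "((\<lambda>w. W 2 w / W 0 w) has_field_derivative (deriv (W 2) z * ?n - W 2 z * deriv (W 0) z) / (?n * ?n)) (at z)"
      by (rule DERIV_divide[OF D D nz[OF z]])
    then have b': "deriv b z = (deriv (W 2) z * ?n - W 2 z * deriv (W 0) z) / (?n * ?n)"
      by (intro DERIV_imp_deriv punctured_deriv[OF beq z])
    have "((\<lambda>w. W 3 w / W 0 w + (W 2 w / W 0 w) * (W 1 w / W 0 w)) has_field_derivative
       (deriv (W 3) z * ?n - W 3 z * deriv (W 0) z) / (?n * ?n) + ((deriv (W 2) z * ?n - W 2 z * deriv (W 0) z) / (?n * ?n) * (W 1 z / ?n)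
        + (deriv (W 1) z * ?n - W 1 z * deriv (W 0) z) / (?n * ?n) * (W 2 z / ?n))) (at z)"
      by (intro DERIV_add DERIV_mult DERIV_divide D nz[OF z])
    then have a': "deriv a z = (deriv (W 3) z * ?n - W 3 z * deriv (W 0) z) / (?n * ?n) + ((deriv (W 2) z * ?n - W 2 z * deriv (W 0) z) / (?n * ?n) * (W 1 z / ?n)
        + (deriv (W 1) z * ?n - W 1 z * deriv (W 0) z) / (?n * ?n) * (W 2 z / ?n))"
      by (intro DERIV_imp_deriv punctured_deriv[OF aeq z])
    have "deriv a z = 2 * deriv b z * (W 1 z / ?n)" using w1[OF z] nz[OF z] bnz[OF z] by simp
    then have "(deriv (W 3) z * ?n - W 3 z * deriv (W 0) z) / (?n * ?n) + ((deriv (W 2) z * ?n - W 2 z * deriv (W 0) z) / (?n * ?n) * (W 1 z / ?n)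
        + (deriv (W 1) z * ?n - W 1 z * deriv (W 0) z) / (?n * ?n) * (W 2 z / ?n)) = 2 * ((deriv (W 2) z * ?n - W 2 z * deriv (W 0) z) / (?n * ?n)) * (W 1 z / ?n)"
      unfolding a' b' .
    then have "?n * (?n * deriv (W 3) z) + ?n * (deriv (W 1) z * W 2 z) = ?n * (deriv (W 0) z * W 3 z) + ?n * (W 1 z * deriv (W 2) z)"
      using nz[OF z] by (simp add: divide_simps) (simp add: algebra_simps)
    then have "?n * (?n * deriv (W 3) z + deriv (W 1) z * W 2 z - deriv (W 0) z * W 3 z - W 1 z * deriv (W 2) z) = 0"
      by (simp only: right_diff_distrib distrib_left diff_diff_eq right_minus_eq)
    then have "?n * ?S z = 0" unfolding contact_form_def by (simp add: algebra_simps)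
    then show ?thesis using nz[OF z] by simp
  qed
  show ?thesis
  proof (cases "z = 0")
    case True
    have r: "r > 0" using W by (simp add: lift_of_def)
    have "continuous_on (ball 0 r) ?S"
      unfolding contact_form_def by (intro continuous_intros holomorphic_on_imp_continuous_on hol holomorphic_deriv open_ball)
    then have "isCont ?S 0" using r by (simp add: continuous_on_eq_continuous_at)
    then have 1: "?S \<midarrow>0\<rightarrow> ?S 0" by (simp add: isCont_def)
    have "eventually (\<lambda>w. w \<in> ball 0 r - {0}) (at (0::complex))"
      using r eventually_at_ball'[of r "0::complex" UNIV] by (auto simp: eventually_at_filter)
    then have "eventually (\<lambda>w. 0 = ?S w) (at 0)" by eventually_elim (simp add: off)
    from Lim_transform_eventually[OF tendsto_const this] have "?S \<midarrow>0\<rightarrow> 0" .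
    then show ?thesis using 1 True LIM_unique by blast
  qed (use off z in auto)
qed

section \<open>Arithmetic of orders\<close>

lemma order_at0_divide:
  assumes "order_at0 f k" "order_at0 g l"
  shows "order_at0 (\<lambda>z. f z / g z) (k - l)"
proof -
  obtain r1 h1 where 1: "r1 > 0" "h1 holomorphic_on ball 0 r1" "\<And>z. z \<in> ball 0 r1 \<Longrightarrow> h1 z \<noteq> 0" "\<And>z. z \<in> ball 0 r1 - {0} \<Longrightarrow> f z = h1 z * z powi k"
    using assms(1) unfolding order_at0_def by blast
  obtain r2 h2 where 2: "r2 > 0" "h2 holomorphic_on ball 0 r2" "\<And>z. z \<in> ball 0 r2 \<Longrightarrow> h2 z \<noteq> 0" "\<And>z. z \<in> ball 0 r2 - {0} \<Longrightarrow> g z = h2 z * z powi l"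
    using assms(2) unfolding order_at0_def by blast
  define r where "r = min r1 r2"
  have r: "r > 0" "ball 0 r \<subseteq> ball 0 r1" "ball 0 r \<subseteq> ball 0 r2" using 1 2 by (auto simp: r_def)
  show ?thesis
  proof (rule order_at0I[OF r(1), of "\<lambda>z. h1 z / h2 z"])
    show "(\<lambda>z. h1 z / h2 z) holomorphic_on ball 0 r"
      by (intro holomorphic_intros holomorphic_on_subset[OF 1(2)] holomorphic_on_subset[OF 2(2)] r) (use 2(3) r(3) in blast)
    show "h1 0 / h2 0 \<noteq> 0" using 1 2 by simp
    fix z :: complex assume z: "z \<in> ball 0 r - {0}"
    then have "z \<in> ball 0 r1 - {0}" "z \<in> ball 0 r2 - {0}" using r by blast+
    then show "f z / g z = h1 z / h2 z * z powi (k - l)" using 1(4)[of z] 2(4)[of z] z by (simp add: power_int_diff)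
  qed
qed

lemma order_at0_add_holomorphic:
  assumes f: "order_at0 f (- int a)" and a: "a \<ge> 1" and g: "g holomorphic_on ball 0 r" "r > 0"
  shows "order_at0 (\<lambda>z. f z + g z) (- int a)"
proof -
  obtain r1 h1 where 1: "r1 > 0" "h1 holomorphic_on ball 0 r1" "\<And>z. z \<in> ball 0 r1 \<Longrightarrow> h1 z \<noteq> 0" "\<And>z. z \<in> ball 0 r1 - {0} \<Longrightarrow> f z = h1 z * z powi (- int a)"
    using f unfolding order_at0_def by blast
  define s where "s = min r1 r"
  have s: "s > 0" "ball 0 s \<subseteq> ball 0 r1" "ball 0 s \<subseteq> ball 0 r" using 1 g by (auto simp: s_def)
  show ?thesis
  proof (rule order_at0I[OF s(1), of "\<lambda>z. h1 z + z ^ a * g z"])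
    show "(\<lambda>z. h1 z + z ^ a * g z) holomorphic_on ball 0 s"
      by (intro holomorphic_intros holomorphic_on_subset[OF 1(2)] holomorphic_on_subset[OF g(1)] s)
    show "h1 0 + 0 ^ a * g 0 \<noteq> 0" using 1(1,3) a by (simp add: power_0_left)
    fix z :: complex assume z: "z \<in> ball 0 s - {0}"
    then have "z \<in> ball 0 r1 - {0}" using s by blast
    then show "f z + g z = (h1 z + z ^ a * g z) * z powi (- int a)"
      using 1(4)[of z] z by (simp add: power_int_minus distrib_right)
  qed
qed

text \<open>The largest exponent with nonzero coefficient decides. Which one it is remains unknown,
  so the conclusion only places the order in \<open>I\<close>.\<close>

lemma order_of_tail:
  assumes I: "finite I" "\<And>k. k \<in> I \<Longrightarrow> k \<ge> (1::nat)" and c: "\<exists>k\<in>I. c k \<noteq> (0::real)"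
    and g: "g holomorphic_on ball 0 1"
    and f: "\<And>z. z \<in> ball 0 1 \<Longrightarrow> f z = (\<Sum>k\<in>I. of_real (c k) * inverse z ^ k) - g z"
  shows "\<exists>k\<in>I. order_at0 f (- int k)"
proof -
  define J where "J = {k\<in>I. c k \<noteq> 0}"
  define m where "m = Max J"
  have J: "finite J" "J \<noteq> {}" using I c by (auto simp: J_def)
  have m: "m \<in> J" "\<And>k. k \<in> J \<Longrightarrow> k \<le> m" using Max_in[OF J] Max_ge[OF J(1)] by (auto simp: m_def)
  have m1: "m \<ge> 1" "m \<in> I" using m(1) I by (auto simp: J_def)
  define h where "h z = (\<Sum>k\<in>J. of_real (c k) * z ^ (m - k)) - z ^ m * g z" for z
  have "order_at0 f (- int m)"
  proof (rule order_at0I[of 1 h])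
    show "h holomorphic_on ball 0 1" unfolding h_def by (intro holomorphic_intros g)
    have "(\<Sum>k\<in>J. of_real (c k) * (0::complex) ^ (m - k)) = (\<Sum>k\<in>J. if k = m then of_real (c m) else 0)"
    proof (rule sum.cong[OF refl])
      fix k assume "k \<in> J"
      then have "k \<le> m" by (rule m(2))
      then show "of_real (c k) * (0::complex) ^ (m - k) = (if k = m then of_real (c m) else 0)"
        by (cases "k = m") (auto simp: power_0_left)
    qed
    also have "\<dots> = of_real (c m)" using m(1) J(1) by simp
    finally show "h 0 \<noteq> 0" using m(1) m1 by (simp add: h_def J_def power_0_left)
    fix z :: complex assume z: "z \<in> ball 0 1 - {0}"
    have "(\<Sum>k\<in>I. of_real (c k) * inverse z ^ k) = (\<Sum>k\<in>J. of_real (c k) * inverse z ^ k)"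
      by (rule sum.mono_neutral_right) (use I in \<open>auto simp: J_def\<close>)
    also have "\<dots> = (\<Sum>k\<in>J. of_real (c k) * z ^ (m - k) * inverse (z ^ m))"
    proof (rule sum.cong[OF refl])
      fix k assume "k \<in> J"
      then have "z ^ m = z ^ (m - k) * z ^ k" using m(2) by (simp flip: power_add)
      then show "of_real (c k) * inverse z ^ k = of_real (c k) * z ^ (m - k) * inverse (z ^ m)" using z by (simp add: power_inverse)
    qed
    finally show "f z = h z * z powi (- int m)" using f[of z] z
      by (simp add: h_def power_int_minus left_diff_distrib sum_distrib_right)
  qed simp
  then show ?thesis using m1 by blast
qed

lemma holomorphic_order_cases:
  assumes f: "f holomorphic_on ball 0 r" and r: "r > 0"
  shows "(\<forall>z\<in>ball 0 r. f z = f 0) \<or> (\<exists>n\<ge>1. order_at0 (\<lambda>z. f z - f 0) (int n) \<and> (deriv f 0 = 0 \<longrightarrow> n \<ge> 2))"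
proof (cases "\<forall>n>0. (deriv ^^ n) f 0 = 0")
  case True
  have "f z = f 0" if "z \<in> ball 0 r" for z
    by (rule holomorphic_fun_eq_const_on_connected[OF f open_ball]) (use True r that in auto)
  then show ?thesis by blast
next
  case False
  define n where "n = (LEAST n. n > 0 \<and> (deriv ^^ n) f 0 \<noteq> 0)"
  have n: "n > 0 \<and> (deriv ^^ n) f 0 \<noteq> 0" unfolding n_def by (rule LeastI_ex) (use False in blast)
  have least: "(deriv ^^ i) f 0 = 0" if "0 < i" "i < n" for i
    using not_less_Least[of i "\<lambda>n. n > 0 \<and> (deriv ^^ n) f 0 \<noteq> 0"] that unfolding n_def by blast
  have z0: "0 \<in> ball 0 r" using r by simp
  obtain g s where "0 < s" "g holomorphic_on ball 0 s" "\<And>w. w \<in> ball 0 s \<Longrightarrow> f w - f 0 = (w - 0) ^ n * g w" "\<And>w. w \<in> ball 0 s \<Longrightarrow> g w \<noteq> 0"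
  proof (rule holomorphic_factor_order_of_zero[OF f open_ball z0, of n])
    show "0 < n" "(deriv ^^ n) f 0 \<noteq> 0" using n by auto
    show "(deriv ^^ i) f 0 = 0" if "0 < i" "i < n" for i by (rule least[OF that])
    fix g s assume "0 < s" "g holomorphic_on ball 0 s" "\<And>w. w \<in> ball 0 s \<Longrightarrow> f w - f 0 = (w - 0) ^ n * g w" "\<And>w. w \<in> ball 0 s \<Longrightarrow> g w \<noteq> 0"
    then show ?thesis by (rule that)
  qed
  then have "order_at0 (\<lambda>z. f z - f 0) (int n)" by (intro order_at0I[of s g]) auto
  moreover have "deriv f 0 = 0 \<longrightarrow> n \<ge> 2"
  proof
    assume "deriv f 0 = 0"
    then have "n \<noteq> 1" using n by (cases "n = 1") auto
    then show "n \<ge> 2" using n by linarith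
  qed
  ultimately show ?thesis using n by (intro disjI2 exI[of _ n]) auto
qed

lemma holomorphic_order:
  assumes f: "f holomorphic_on ball 0 r" and r: "r > 0"
  shows "(\<forall>z\<in>ball 0 r. f z = 0) \<or> (\<exists>n::nat. order_at0 f (int n))"
proof (cases "f 0 = 0")
  case True
  then show ?thesis using holomorphic_order_cases[OF f r] by auto
next
  case False
  then have "order_at0 f (int 0)" using f r by (intro order_at0I[of r f]) auto
  then show ?thesis by blast
qed

lemma quotient_cases:
  assumes f: "f holomorphic_on ball 0 r" "g holomorphic_on ball 0 r" and r: "r > 0"
  shows "(\<exists>s>0. \<exists>h. h holomorphic_on ball 0 s \<and> (\<forall>z\<in>ball 0 s - {0}. f z / g z = h z)) \<or> (\<exists>j\<ge>1. order_at0 (\<lambda>z. f z / g z) (- int j))"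
proof (cases "(\<forall>z\<in>ball 0 r. f z = 0) \<or> (\<forall>z\<in>ball 0 r. g z = 0)")
  case True
  \<comment> \<open>If the denominator vanishes identically, the quotient is 0 by the convention for
    division by zero.\<close>
  then show ?thesis using r by (intro disjI1 exI[of _ r] conjI exI[of _ "\<lambda>_. 0"]) auto
next
  case False
  then obtain n m :: nat where "order_at0 f (int n)" "order_at0 g (int m)" using holomorphic_order f r by blast
  then have q: "order_at0 (\<lambda>z. f z / g z) (int n - int m)" by (rule order_at0_divide)
  show ?thesis
  proof (cases "n \<ge> m")
    case True
    then have e: "int n - int m = int (n - m)" by simp
    obtain s h where h: "s > 0" "h holomorphic_on ball 0 s" "\<And>z. z \<in> ball 0 s - {0} \<Longrightarrow> f z / g z = h z * z powi (int (n - m))"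
      using q unfolding order_at0_def e by blast
    then show ?thesis by (intro disjI1 exI[of _ s] conjI exI[of _ "\<lambda>z. h z * z ^ (n - m)"]) (auto intro!: holomorphic_intros)
  next
    case False
    then have e: "int n - int m = - int (m - n)" by simp
    show ?thesis using q False unfolding e by (intro disjI2 exI[of _ "m - n"]) auto
  qed
qed

section \<open>The contact curve\<close>

lemma infinite_ball: "r > 0 \<Longrightarrow> infinite (ball (a::complex) r)"
  using uncountable_ball countable_finite by blast

lemma vanish_center:
  fixes f :: "complex \<Rightarrow> complex"
  assumes "isCont f a" "r > 0" "\<And>w. w \<in> ball a r - {a} \<Longrightarrow> f w = 0"
  shows "f a = 0"
proof -
  have "\<forall>\<^sub>F w in at a. f w = 0" unfolding eventually_at
    by (rule exI[of _ r]) (use assms in \<open>auto simp: dist_commute\<close>)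
  then have "(f \<longlongrightarrow> 0) (at a)" by (rule tendsto_eventually)
  moreover have "(f \<longlongrightarrow> f a) (at a)" using assms(1) by (simp add: isCont_def)
  ultimately show ?thesis using tendsto_unique[OF at_neq_bot] by blast
qed

context riemann_surface
begin

lemma deriv_chart_change:
  assumes c: "c \<in> A" "d \<in> A" and z: "z \<in> snd c ` (fst c \<inter> fst d)"
    and f: "in_chart d f field_differentiable at (snd d (par c z))"
  shows "(in_chart c f has_field_derivative deriv (in_chart d f) (snd d (par c z)) * deriv (\<lambda>z. snd d (par c z)) z) (at z)"
proof -
  have "(in_chart d f has_field_derivative deriv (in_chart d f) (snd d (par c z))) (at (snd d (par c z)))"
    using f by (simp add: field_differentiable_derivI)
  from DERIV_chain2[OF this trans_deriv[OF c z]]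
  have *: "((\<lambda>z. in_chart d f (snd d (par c z))) has_field_derivative deriv (in_chart d f) (snd d (par c z)) * deriv (\<lambda>z. snd d (par c z)) z) (at z)" .
  show ?thesis
    by (rule has_field_derivative_transform_within_open[OF * overlap_open[OF c(1) chart_open[OF c(2)]] z]) (simp add: in_chart_trans[OF c])
qed

end

context compact_surface
begin

definition cx :: "'a \<Rightarrow> 'a chart" where
  "cx x = (SOME c. c \<in> A \<and> x \<in> fst c \<and> snd c x = 0 \<and> snd c ` fst c = ball 0 4)"

lemma cx: "x \<in> topspace X \<Longrightarrow> cx x \<in> A \<and> x \<in> fst (cx x) \<and> snd (cx x) x = 0 \<and> snd (cx x) ` fst (cx x) = ball 0 4"
  unfolding cx_def by (rule someI_ex) (use disc[OF openin_topspace, of x] in blast)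

lemma holo_cx:
  assumes "openin X S" "x \<in> S" "holo S f"
  obtains r where "r > 0" "in_chart (cx x) f holomorphic_on ball 0 r" "\<And>z. z \<in> ball 0 r \<Longrightarrow> z \<in> snd (cx x) ` (fst (cx x) \<inter> S)"
proof -
  have x: "x \<in> topspace X" using assms openin_subset by blast
  obtain r where "r > 0" "ball (snd (cx x) x) r \<subseteq> snd (cx x) ` (fst (cx x) \<inter> S)"
    using chart_nbhd_ball[of "cx x" S x] cx[OF x] assms by blast
  moreover have "in_chart (cx x) f holomorphic_on snd (cx x) ` (fst (cx x) \<inter> S)" using assms(3) cx[OF x] by (auto simp: holo_def)
  ultimately show ?thesis using cx[OF x] by (intro that[of r]) (auto intro: holomorphic_on_subset)
qed

text \<open>A weak gap theorem. If infinitely many orders were missing, m + 1 of them could be taken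
  as the exponents in \<open>principal_parts\<close>, and the resulting function would have one of
  the missing orders.\<close>

lemma pole_functions:
  assumes p: "p \<in> topspace X"
  shows "\<exists>K0. \<forall>k\<ge>K0. \<exists>G. holo (topspace X - {p}) G \<and> order_at0 (in_chart (cx p) G) (- int k)"
proof -
  obtain C where C: "finite C" "C \<subseteq> A" "\<And>c. c \<in> C \<Longrightarrow> snd c ` fst c = ball 0 4 \<and> True"
    "\<And>x. x \<in> topspace X \<Longrightarrow> \<exists>c\<in>C. x \<in> fst c \<and> norm (snd c x) < 1"
    using finite_disc_cover[of "\<lambda>_. True" 1] cx by (metis zero_less_one)
  obtain e where e: "bij_betw e {..<card C} C" using C(1) by (metis bij_betw_from_nat_into_finite)
  \<comment> \<open>The disc about \<open>p\<close> is put in front of the cover, as the 0-th chart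
    must be centred at the pole.\<close>
  define ch where "ch i = (case i of 0 \<Rightarrow> cx p | Suc i \<Rightarrow> e i)" for i
  have eC: "e i \<in> C" if "i < card C" for i using e that by (auto simp: bij_betw_def)
  interpret pointed_disc_cover X A ch "Suc (card C)" p
  proof unfold_locales
    show "ch i \<in> A" if "i < Suc (card C)" for i
      using that eC C(2) cx[OF p] by (cases i) (auto simp: ch_def)
    show "snd (ch i) ` fst (ch i) = ball 0 4" if "i < Suc (card C)" for i
    proof (cases i)
      case 0 then show ?thesis using cx[OF p] by (simp add: ch_def)
    next
      case (Suc k) then show ?thesis using that eC[of k] C(3)[of "e k"] by (simp add: ch_def)
    qed
    show "\<exists>i<Suc (card C). x \<in> fst (ch i) \<and> norm (snd (ch i) x) < 1" if x: "x \<in> topspace X" for x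
    proof -
      obtain c where c: "c \<in> C" "x \<in> fst c" "norm (snd c x) < 1" using C(4)[OF x] by blast
      then obtain i where "i < card C" "c = e i" using e by (auto simp: bij_betw_def)
      then show ?thesis using c by (intro exI[of _ "Suc i"]) (auto simp: ch_def)
    qed
    show "0 < Suc (card C)" by simp
    show "p \<in> fst (ch 0)" "snd (ch 0) p = 0" using cx[OF p] by (auto simp: ch_def)
  qed
  have ch0: "ch 0 = cx p" by (simp add: ch_def)
  obtain m where m: "\<And>I. finite I \<Longrightarrow> card I > m \<Longrightarrow> (\<exists>(c::nat \<Rightarrow> real) f g. (\<exists>k\<in>I. c k \<noteq> 0) \<and> holo (topspace X - {p}) f \<and> g holomorphic_on ball 0 1 \<and>
     (\<forall>z\<in>ball 0 1. in_chart (cx p) f z = (\<Sum>k\<in>I. of_real (c k) * inverse z ^ k) - g z))"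
    using principal_parts unfolding ch0 by blast
  define Bad where "Bad = {k. k \<ge> 1 \<and> \<not> (\<exists>G. holo (topspace X - {p}) G \<and> order_at0 (in_chart (cx p) G) (- int k))}"
  have "finite Bad"
  proof (rule ccontr)
    assume "infinite Bad"
    then obtain I where I: "finite I" "card I = Suc m" "I \<subseteq> Bad" by (meson infinite_arbitrarily_large)
    then obtain c :: "nat \<Rightarrow> real" and f g where *: "\<exists>k\<in>I. c k \<noteq> 0" "holo (topspace X - {p}) f" "g holomorphic_on ball 0 1"
      "\<And>z. z \<in> ball 0 1 \<Longrightarrow> in_chart (cx p) f z = (\<Sum>k\<in>I. of_real (c k) * inverse z ^ k) - g z"
      using m[OF I(1)] by (metis lessI)
    have "\<exists>k\<in>I. order_at0 (in_chart (cx p) f) (- int k)"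
      by (rule order_of_tail[OF I(1) _ *(1,3,4)]) (use I(3) in \<open>auto simp: Bad_def\<close>)
    then show False using I(3) *(2) by (auto simp: Bad_def)
  qed
  then obtain K where K: "\<And>k. k \<in> Bad \<Longrightarrow> k \<le> K" unfolding finite_nat_set_iff_bounded_le by blast
  show ?thesis
  proof (intro exI[of _ "Suc K"] allI impI)
    fix k assume "Suc K \<le> k"
    then have "k \<notin> Bad" "k \<ge> 1" using K[of k] by auto
    then show "\<exists>G. holo (topspace X - {p}) G \<and> order_at0 (in_chart (cx p) G) (- int k)" by (auto simp: Bad_def)
  qed
qed

lemma par_cx:
  assumes "x \<in> topspace X" "z \<in> ball 0 4"
  shows "par (cx x) z \<in> topspace X" "par (cx x) z \<in> fst (cx x)" "snd (cx x) (par (cx x) z) = z"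
proof -
  have z: "z \<in> snd (cx x) ` fst (cx x)" using cx[OF assms(1)] assms(2) by simp
  show "par (cx x) z \<in> fst (cx x)" by (rule par_mem[OF z])
  then show "par (cx x) z \<in> topspace X" using chart_sub[of "cx x"] cx[OF assms(1)] by blast
  show "snd (cx x) (par (cx x) z) = z" by (rule crd_par[OF z])
qed

lemma par_cx_0: "x \<in> topspace X \<Longrightarrow> par (cx x) 0 = x"
  using cx[of x] par_crd[of "cx x" x] by simp

lemma deriv_zero_cx:
  assumes x: "x \<in> topspace X" and z: "z \<in> ball 0 4" and f: "in_chart (cx x) f field_differentiable at z"
  shows "deriv (in_chart (cx (par (cx x) z)) f) 0 = 0 \<longleftrightarrow> deriv (in_chart (cx x) f) z = 0"
proof -
  let ?y = "par (cx x) z"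
  note y = par_cx[OF x z]
  have c: "cx ?y \<in> A" "?y \<in> fst (cx ?y)" "snd (cx ?y) ?y = 0" and d: "cx x \<in> A" using cx y x by auto
  have 0: "0 \<in> snd (cx ?y) ` (fst (cx ?y) \<inter> fst (cx x))" using c y(2) by (metis IntI imageI)
  have "snd (cx x) (par (cx ?y) 0) = z" by (simp add: par_cx_0[OF y(1)] y(3))
  then have "(in_chart (cx ?y) f has_field_derivative deriv (in_chart (cx x) f) z * deriv (\<lambda>z. snd (cx x) (par (cx ?y) z)) 0) (at 0)"
    using deriv_chart_change[OF c(1) d 0, of f] f by simp
  then show ?thesis using DERIV_imp_deriv trans_deriv_nonzero[OF c(1) d 0] by fastforce
qed

text \<open>Zeros of nonvanishing holomorphic germs are isolated, so each point has a punctured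
  neighbourhood inside or outside \<open>Z\<close>, and \<open>finite_or_generic\<close> applies.
  Membership of the centre is left open, which admits poles there.\<close>

lemma finite_zero_set:
  assumes Z: "Z \<subseteq> topspace X"
    and loc: "\<And>x. x \<in> topspace X \<Longrightarrow> \<exists>r>0. \<exists>f. f holomorphic_on ball 0 r \<and> (\<forall>z\<in>ball 0 r - {0}. z \<in> ball 0 4 \<longrightarrow> (par (cx x) z \<in> Z \<longleftrightarrow> f z = 0)) \<and>
        (x = p \<longrightarrow> (\<exists>z\<in>ball 0 r. f z \<noteq> 0))"
    and p: "p \<in> topspace X"
  shows "finite Z"
proof -
  have N: "\<exists>N. openin X N \<and> x \<in> N \<and> (N - {x} \<subseteq> Z \<and> x \<noteq> p \<or> N - {x} \<subseteq> - Z)" if x: "x \<in> topspace X" for x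
  proof -
    obtain r f where r: "r > 0" and f: "f holomorphic_on ball 0 r"
      and Zf: "\<And>z. z \<in> ball 0 r - {0} \<Longrightarrow> z \<in> ball 0 4 \<Longrightarrow> par (cx x) z \<in> Z \<longleftrightarrow> f z = 0"
      and np: "x = p \<Longrightarrow> \<exists>z\<in>ball 0 r. f z \<noteq> 0" using loc[OF x] by blast
    obtain e where e: "0 < e" "e \<le> r" and alt: "((\<forall>z\<in>ball 0 e - {0}. f z = 0) \<and> x \<noteq> p) \<or> (\<forall>z\<in>ball 0 e - {0}. f z \<noteq> 0)"
      using holomorphic_order[OF f r]
    proof
      assume "\<forall>z\<in>ball 0 r. f z = 0" then show ?thesis using that[of r] np r by auto
    next
      assume "\<exists>n::nat. order_at0 f (int n)"
      then obtain n s h where s: "s > 0" "\<And>z. z \<in> ball 0 s \<Longrightarrow> h z \<noteq> 0" "\<And>z. z \<in> ball 0 s - {0} \<Longrightarrow> f z = h z * z powi (int n)"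
        unfolding order_at0_def by blast
      have "f z \<noteq> 0" if "z \<in> ball 0 s - {0}" for z using s(2,3)[of z] that by auto
      then show ?thesis using s(1) r by (intro that[of "min r s"]) auto
    qed
    define N where "N = {y \<in> fst (cx x). snd (cx x) y \<in> ball 0 e}"
    have cA: "cx x \<in> A" using cx[OF x] by blast
    have oN: "openin X N" unfolding N_def by (intro chart_preimage_open cA open_ball)
    have xN: "x \<in> N" using cx[OF x] e by (auto simp: N_def)
    have NZ: "y \<in> Z \<longleftrightarrow> f (snd (cx x) y) = 0" "snd (cx x) y \<in> ball 0 e - {0}" if y: "y \<in> N - {x}" for y
    proof -
      have yf: "y \<in> fst (cx x)" "snd (cx x) y \<in> ball 0 e" using y by (auto simp: N_def)
      have "snd (cx x) y \<noteq> 0" using chart_inj[OF cA] cx[OF x] y yf(1) by (metis DiffD2 inj_onD singletonI)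
      then show *: "snd (cx x) y \<in> ball 0 e - {0}" using yf by auto
      then have r: "snd (cx x) y \<in> ball 0 r - {0}" using e by auto
      have 4: "snd (cx x) y \<in> ball 0 4" using cx[OF x] yf(1) by blast
      have "par (cx x) (snd (cx x) y) = y" by (rule par_crd[OF cA yf(1)])
      with Zf[OF r 4] show "y \<in> Z \<longleftrightarrow> f (snd (cx x) y) = 0" by simp
    qed
    from alt have "(N - {x} \<subseteq> Z \<and> x \<noteq> p) \<or> N - {x} \<subseteq> - Z"
    proof
      assume H: "(\<forall>z\<in>ball 0 e - {0}. f z = 0) \<and> x \<noteq> p"
      have "y \<in> Z" if "y \<in> N - {x}" for y using NZ[OF that] H by simp
      then show ?thesis using H by blast
    next
      assume H: "\<forall>z\<in>ball 0 e - {0}. f z \<noteq> 0"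
      have "y \<notin> Z" if "y \<in> N - {x}" for y using NZ[OF that] H by simp
      then show ?thesis by blast
    qed
    then show ?thesis using oN xN by blast
  qed
  obtain N0 where N0: "openin X N0" "p \<in> N0" "N0 - {p} \<subseteq> - Z" using N[OF p] by blast
  show ?thesis
    by (rule finite_or_generic[OF compact Z _ N0]) (use N in blast)
qed

lemma pole_deriv_nonzero:
  assumes "order_at0 b (- int m)" "m \<ge> 1"
  obtains r where "r > 0" "\<And>z. z \<in> ball 0 r - {0} \<Longrightarrow> deriv b z \<noteq> 0"
proof -
  obtain r \<beta> where r: "r > 0" "\<beta> holomorphic_on ball 0 r" "\<And>z. z \<in> ball 0 r \<Longrightarrow> \<beta> z \<noteq> 0"
    "\<And>z. z \<in> ball 0 r - {0} \<Longrightarrow> b z = \<beta> z * z powi (- int m)" using assms(1) unfolding order_at0_def by blast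
  define e where "e z = of_int (- int m) * \<beta> z + z * deriv \<beta> z" for z
  have eh: "e holomorphic_on ball 0 r" unfolding e_def by (intro holomorphic_intros holomorphic_deriv r open_ball)
  have e0: "e 0 \<noteq> 0" using r assms(2) by (simp add: e_def)
  obtain s where s: "0 < s" "s \<le> r" "\<And>z. z \<in> ball 0 s \<Longrightarrow> e z \<noteq> 0" using nonzero_ball[OF eh r(1) e0] by blast
  have "deriv b z \<noteq> 0" if z: "z \<in> ball 0 s - {0}" for z
  proof -
    have "z \<in> ball 0 r - {0}" using z s by auto
    then have "deriv b z = e z * z powi (- int m - 1)" unfolding e_def
      by (intro DERIV_imp_deriv powi_product_deriv[where c=0, OF r(2)]) (simp_all only: r(4) add_0)
    then show ?thesis using s(3)[of z] z by auto
  qed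
  then show ?thesis using s(1) that by blast
qed

text \<open>The pole keeps the derivative from vanishing near \<open>p\<close>, so the critical
  points are finite in number. If the function were constant on a small disc, all points of it other
  than \<open>p\<close> would be critical.\<close>

lemma critical_points_finite:
  assumes p: "p \<in> topspace X" and B: "holo (topspace X - {p}) B" and ord: "order_at0 (in_chart (cx p) B) (- int m)" and m: "m \<ge> 1"
  defines "Z \<equiv> {x \<in> topspace X - {p}. deriv (in_chart (cx x) B) 0 = 0}"
  shows "finite Z"
    and "x \<in> topspace X - {p} \<Longrightarrow> r > 0 \<Longrightarrow> r \<le> 4 \<Longrightarrow> \<not> (\<forall>z\<in>ball 0 r. in_chart (cx x) B z = in_chart (cx x) B 0)"
proof -
  have oS: "openin X (topspace X - {p})" by (intro openin_diff points_closed p) auto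
  have mem: "par (cx x) z \<in> Z \<longleftrightarrow> deriv (in_chart (cx x) B) z = 0"
    if x: "x \<in> topspace X" and z: "z \<in> ball 0 4" "par (cx x) z \<noteq> p" for x z
  proof -
    note y = par_cx[OF x z(1)]
    have zi: "z \<in> snd (cx x) ` (fst (cx x) \<inter> (topspace X - {p}))" using y z(2) by (intro image_eqI[of _ _ "par (cx x) z"]) auto
    have "in_chart (cx x) B holomorphic_on snd (cx x) ` (fst (cx x) \<inter> (topspace X - {p}))" using B cx[OF x] by (simp add: holo_def)
    then have "in_chart (cx x) B field_differentiable at z"
      by (rule holomorphic_on_imp_differentiable_at[OF _ overlap_open[OF _ oS] zi]) (use cx[OF x] in blast)
    from deriv_zero_cx[OF x z(1) this] show ?thesis using y z(2) by (simp add: Z_def)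
  qed
  show fin: "finite Z"
  proof (rule finite_zero_set[OF _ _ p])
    show "Z \<subseteq> topspace X" by (auto simp: Z_def)
    fix x assume x: "x \<in> topspace X"
    show "\<exists>r>0. \<exists>f. f holomorphic_on ball 0 r \<and> (\<forall>z\<in>ball 0 r - {0}. z \<in> ball 0 4 \<longrightarrow> (par (cx x) z \<in> Z \<longleftrightarrow> f z = 0)) \<and>
        (x = p \<longrightarrow> (\<exists>z\<in>ball 0 r. f z \<noteq> 0))"
    proof (cases "x = p")
      case True
      obtain s where s: "s > 0" "\<And>z. z \<in> ball 0 s - {0} \<Longrightarrow> deriv (in_chart (cx p) B) z \<noteq> 0" using pole_deriv_nonzero[OF ord m] by blast
      have "par (cx p) z \<notin> Z" if z: "z \<in> ball 0 s - {0}" "z \<in> ball 0 4" for z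
      proof -
        have "par (cx p) z \<noteq> p" using par_cx(3)[OF p z(2)] cx[OF p] z(1) by auto
        then show ?thesis using mem[OF p z(2)] s(2)[OF z(1)] by blast
      qed
      then show ?thesis using s(1) True by (intro exI[of _ s] conjI exI[of _ "\<lambda>z. 1"]) (auto intro: exI[of _ 0])
    next
      case False
      then have xS: "x \<in> topspace X - {p}" using x by blast
      obtain r where r: "r > 0" "in_chart (cx x) B holomorphic_on ball 0 r" "\<And>z. z \<in> ball 0 r \<Longrightarrow> z \<in> snd (cx x) ` (fst (cx x) \<inter> (topspace X - {p}))"
        using holo_cx[OF oS xS B] by blast
      have "par (cx x) z \<noteq> p" if "z \<in> ball 0 r" for z using r(3)[OF that] par_crd cx[OF x] by auto
      then have "\<forall>z\<in>ball 0 r - {0}. z \<in> ball 0 4 \<longrightarrow> (par (cx x) z \<in> Z \<longleftrightarrow> deriv (in_chart (cx x) B) z = 0)" using mem[OF x] by blast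
      then show ?thesis using r(1) holomorphic_deriv[OF r(2) open_ball] False by blast
    qed
  qed
  assume x: "x \<in> topspace X - {p}" and r: "r > 0" "r \<le> 4"
  then have xt: "x \<in> topspace X" by blast
  show "\<not> (\<forall>z\<in>ball 0 r. in_chart (cx x) B z = in_chart (cx x) B 0)"
  proof
    assume const: "\<forall>z\<in>ball 0 r. in_chart (cx x) B z = in_chart (cx x) B 0"
    have "par (cx x) z \<in> insert p Z" if z: "z \<in> ball 0 r" for z
    proof -
      have "(in_chart (cx x) B has_field_derivative 0) (at z)"
        by (rule has_field_derivative_transform_within_open[OF DERIV_const open_ball z, of "in_chart (cx x) B 0"]) (use const in auto)
      then show ?thesis using mem[OF xt, of z] z r by (auto simp: DERIV_imp_deriv)
    qed
    then have "finite (par (cx x) ` ball 0 r)" using fin by (meson finite.insertI finite_subset image_subsetI)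
    moreover have "inj_on (par (cx x)) (ball 0 r)" using r(2) cx[OF xt] by (intro inj_on_inv_into) auto
    ultimately show False using infinite_ball[OF r(1)] finite_imageD by blast
  qed
qed

text \<open>Take \<open>b\<close> with a single pole of order m at \<open>p\<close>. The only
  demands on \<open>a\<close> are orders at \<open>p\<close> and at the finitely many critical
  points of \<open>b\<close>; elsewhere \<open>b\<close> is a coordinate and every meromorphic germ
  \<open>a\<close> has a lift.\<close>

lemma curve_germs:
  "\<exists>a b p. p \<in> topspace X \<and> (\<forall>x\<in>topspace X. \<exists>r W. lift_of (in_chart (cx x) a) (in_chart (cx x) b) r W \<and>
     (x = p \<longrightarrow> W 0 0 = 0 \<and> W 1 0 = 0 \<and> W 3 0 \<noteq> 0))"
proof -
  obtain p where p: "p \<in> topspace X" using nonempty by blast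
  obtain K where K: "\<And>x k. x \<in> topspace X \<Longrightarrow> k \<ge> K x \<Longrightarrow> \<exists>G. holo (topspace X - {x}) G \<and> order_at0 (in_chart (cx x) G) (- int k)"
    using pole_functions by metis
  then obtain G where G: "\<And>x k. x \<in> topspace X \<Longrightarrow> k \<ge> K x \<Longrightarrow> holo (topspace X - {x}) (G x k) \<and> order_at0 (in_chart (cx x) (G x k)) (- int k)"
    by metis
  define m where "m = max 2 (K p)"
  have m: "m \<ge> 2" "m \<ge> K p" by (auto simp: m_def)
  define B where "B = G p m"
  have B: "holo (topspace X - {p}) B" "order_at0 (in_chart (cx p) B) (- int m)" using G[OF p m(2)] by (auto simp: B_def)
  define Z where "Z = {x \<in> topspace X - {p}. deriv (in_chart (cx x) B) 0 = 0}"
  have finZ: "finite Z" unfolding Z_def using m by (intro critical_points_finite(1)[OF p B]) auto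
  have op: "openin X (topspace X - {x})" if "x \<in> topspace X" for x by (intro openin_diff points_closed that) auto
  have Zord: "\<exists>k\<ge>1. order_at0 (\<lambda>z. in_chart (cx x) B z - in_chart (cx x) B 0) (int (Suc k))" if "x \<in> Z" for x
  proof -
    have x: "x \<in> topspace X - {p}" and d: "deriv (in_chart (cx x) B) 0 = 0" using that by (auto simp: Z_def)
    obtain r where r: "r > 0" "in_chart (cx x) B holomorphic_on ball 0 r" using holo_cx[OF op[OF p] x B(1)] by blast
    define s where "s = min r 4"
    have s: "s > 0" "s \<le> 4" "in_chart (cx x) B holomorphic_on ball 0 s" using r by (auto simp: s_def intro: holomorphic_on_subset)
    obtain n where "n \<ge> 2" "order_at0 (\<lambda>z. in_chart (cx x) B z - in_chart (cx x) B 0) (int n)"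
      using holomorphic_order_cases[OF s(3,1)] critical_points_finite(2)[OF p B _ x s(1,2)] m(1) d by auto
    then show ?thesis by (intro exI[of _ "n - 1"]) auto
  qed
  then obtain k where k: "\<And>x. x \<in> Z \<Longrightarrow> k x \<ge> 1 \<and> order_at0 (\<lambda>z. in_chart (cx x) B z - in_chart (cx x) B 0) (int (Suc (k x)))" by metis
  define S where "S = insert p Z"
  have finS: "finite S" "S \<subseteq> topspace X" using finZ p by (auto simp: S_def Z_def)
  \<comment> \<open>One common pole order that is available at every point of
    \<open>S\<close>.\<close>
  define L where "L = 1 + (\<Sum>x\<in>S. K x)"
  have L: "L \<ge> 1" "\<And>x. x \<in> S \<Longrightarrow> L \<ge> K x" using finS member_le_sum[of _ S K] by (auto simp: L_def intro: le_SucI)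
  \<comment> \<open>Pole orders of numerator and denominator. Their differences give
    \<open>a\<close> a pole of order m + 1 at \<open>p\<close> and a zero of order
    \<open>k x\<close> at a critical point x: zeros are prescribed as poles of the
    denominator.\<close>
  define an where "an x = (if x = p then L + Suc m else L)" for x
  define bn where "bn x = (if x = p then L else L + k x)" for x
  have num_ge: "an x \<ge> K x" "an x \<ge> 1" "bn x \<ge> K x" "bn x \<ge> 1" if "x \<in> S" for x using L(1) L(2)[OF that] by (auto simp: an_def bn_def)
  define num where "num x = (\<Sum>s\<in>S. G s (an s) x)" for x
  define den where "den x = (\<Sum>s\<in>S. G s (bn s) x)" for x
  define a where "a x = num x / den x" for x
  have Ghol: "\<exists>r>0. in_chart (cx x) (G s n) holomorphic_on ball 0 r" if H: "x \<in> topspace X" "s \<in> S" "s \<noteq> x" "n \<ge> K s" for x s n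
  proof -
    have st: "s \<in> topspace X" using H finS by blast
    obtain r where "r > 0" "in_chart (cx x) (G s n) holomorphic_on ball 0 r"
      using holo_cx[OF op[OF st], of x "G s n"] G[OF st H(4)] H(1-3) by auto
    then show ?thesis by blast
  qed
  have sumhol: "\<exists>r>0. (\<lambda>z. \<Sum>s\<in>T. in_chart (cx x) (G s (n s)) z) holomorphic_on ball 0 r" if "x \<in> topspace X" "T \<subseteq> S - {x}" "\<And>s. s \<in> S \<Longrightarrow> n s \<ge> K s" for x T n
  proof -
    have "\<forall>s. \<exists>r. s \<in> T \<longrightarrow> r > 0 \<and> in_chart (cx x) (G s (n s)) holomorphic_on ball 0 r" using Ghol that by blast
    then obtain R where R: "\<And>s. s \<in> T \<Longrightarrow> R s > 0 \<and> in_chart (cx x) (G s (n s)) holomorphic_on ball 0 (R s)" by metis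
    have finT: "finite T" using that finS finite_subset by blast
    define r where "r = Min (insert 1 (R ` T))"
    have r: "r > 0" "\<And>s. s \<in> T \<Longrightarrow> r \<le> R s" unfolding r_def using finT R by auto
    have "(\<lambda>z. \<Sum>s\<in>T. in_chart (cx x) (G s (n s)) z) holomorphic_on ball 0 r"
    proof (intro holomorphic_intros)
      fix s assume s: "s \<in> T"
      show "in_chart (cx x) (G s (n s)) holomorphic_on ball 0 r"
        using R[OF s] by (rule holomorphic_on_subset[OF conjunct2]) (use r(2)[OF s] in auto)
    qed
    then show ?thesis using r(1) by blast
  qed
  have sumpole: "order_at0 (\<lambda>z. \<Sum>s\<in>S. in_chart (cx x) (G s (n s)) z) (- int (n x))" if H: "x \<in> S" "\<And>s. s \<in> S \<Longrightarrow> n s \<ge> K s" "n x \<ge> 1" for x n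
  proof -
    have xt: "x \<in> topspace X" using H finS by blast
    obtain r where "r > 0" "(\<lambda>z. \<Sum>s\<in>S - {x}. in_chart (cx x) (G s (n s)) z) holomorphic_on ball 0 r"
      using sumhol[OF xt, of "S - {x}" n] H by blast
    with order_at0_add_holomorphic[of "in_chart (cx x) (G x (n x))" "n x"] G[OF xt H(2)[OF H(1)]] H(3)
    have "order_at0 (\<lambda>z. in_chart (cx x) (G x (n x)) z + (\<Sum>s\<in>S - {x}. in_chart (cx x) (G s (n s)) z)) (- int (n x))" by blast
    then show ?thesis using finS H(1) by (simp add: sum.remove)
  qed
  have aeq: "in_chart (cx x) a = (\<lambda>z. (\<Sum>s\<in>S. in_chart (cx x) (G s (an s)) z) / (\<Sum>s\<in>S. in_chart (cx x) (G s (bn s)) z))" for x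
    by (simp add: in_chart_def a_def num_def den_def fun_eq_iff)
  have aord: "order_at0 (in_chart (cx x) a) (int (bn x) - int (an x))" if "x \<in> S" for x
  proof -
    have "order_at0 (in_chart (cx x) a) (- int (an x) - - int (bn x))"
      unfolding aeq using num_ge that by (intro order_at0_divide sumpole) auto
    then show ?thesis by simp
  qed
  have "\<exists>r W. lift_of (in_chart (cx x) a) (in_chart (cx x) B) r W \<and> (x = p \<longrightarrow> W 0 0 = 0 \<and> W 1 0 = 0 \<and> W 3 0 \<noteq> 0)" if x: "x \<in> topspace X" for x
  proof (cases "x = p")
    case True
    have "order_at0 (in_chart (cx p) a) (- int (Suc m))"
      using aord[of p] by (simp add: S_def an_def bn_def)
    from lift_main_pole[OF this B(2) m(1)] show ?thesis using True by blast
  next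
    case False
    then have xS: "x \<in> topspace X - {p}" using x by blast
    show ?thesis
    proof (cases "x \<in> Z")
      case True
      have "order_at0 (in_chart (cx x) a) (int (k x))"
        using aord[of x] True False by (simp add: S_def an_def bn_def)
      from lift_critical[OF this] k[OF True] show ?thesis using False by blast
    next
      case nZ: False
      obtain r1 where r1: "r1 > 0" "in_chart (cx x) B holomorphic_on ball 0 r1" using holo_cx[OF op[OF p] xS B(1)] by blast
      have d: "deriv (in_chart (cx x) B) 0 \<noteq> 0" using nZ xS by (auto simp: Z_def)
      \<comment> \<open>Says that \<open>x\<close> is outside \<open>S\<close>, in the form in which
        \<open>sumhol\<close> asks for it.\<close>
      have Sx: "S \<subseteq> S - {x}" using nZ False by (auto simp: S_def)
      obtain r2 where r2: "r2 > 0" "(\<lambda>z. \<Sum>s\<in>S. in_chart (cx x) (G s (an s)) z) holomorphic_on ball 0 r2"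
        using sumhol[OF x Sx, of an] num_ge by blast
      obtain r3 where r3: "r3 > 0" "(\<lambda>z. \<Sum>s\<in>S. in_chart (cx x) (G s (bn s)) z) holomorphic_on ball 0 r3"
        using sumhol[OF x Sx, of bn] num_ge by blast
      define r where "r = min r2 r3"
      have "r > 0" "(\<lambda>z. \<Sum>s\<in>S. in_chart (cx x) (G s (an s)) z) holomorphic_on ball 0 r" "(\<lambda>z. \<Sum>s\<in>S. in_chart (cx x) (G s (bn s)) z) holomorphic_on ball 0 r"
        using r2 r3 by (auto simp: r_def intro: holomorphic_on_subset)
      from quotient_cases[OF this(2,3,1)]
      consider (reg) s h where "s > 0" "h holomorphic_on ball 0 s" "\<And>z. z \<in> ball 0 s - {0} \<Longrightarrow> in_chart (cx x) a z = h z"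
        | (pole) j where "j \<ge> 1" "order_at0 (in_chart (cx x) a) (- int j)"
        unfolding aeq by blast
      then show ?thesis
      proof cases
        case reg
        define t where "t = min s r1"
        have "t > 0" "h holomorphic_on ball 0 t" "in_chart (cx x) B holomorphic_on ball 0 t" using reg r1 by (auto simp: t_def intro: holomorphic_on_subset)
        moreover have "in_chart (cx x) a z = h z" if "z \<in> ball 0 t - {0}" for z using reg(3)[of z] that by (auto simp: t_def)
        ultimately show ?thesis using lift_regular[of t h "in_chart (cx x) a" "in_chart (cx x) B"] d False by blast
      next
        case pole
        show ?thesis using lift_pole[OF pole(2,1) r1 d] False by blast
      qed
    qed
  qed
  then show ?thesis using p by blast
qed

text \<open>Off its centre every lift is a multiple of the vector (1, a'/(2b'), b, a - b a'/(2b')),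
  and a'/b' does not depend on the chart, so two lifts are proportional. At the centre of the second
  lift the cross products vanish by continuity.\<close>

lemma germ_compat:
  assumes x: "x \<in> topspace X" and W: "lift_of (in_chart (cx x) a) (in_chart (cx x) b) r W"
    and z: "z \<in> ball 0 r - {0}" "z \<in> ball 0 4" and V: "lift_of (in_chart (cx (par (cx x) z)) a) (in_chart (cx (par (cx x) z)) b) s V"
    and ij: "i < 4" "j < 4"
  shows "V i 0 * W j z = V j 0 * W i z"
proof -
  let ?y = "par (cx x) z"
  define c where "c = cx ?y"
  define d where "d = cx x"
  have zi: "z \<in> snd d ` fst d" using z cx[OF x] by (simp add: d_def)
  have y: "?y \<in> fst d" using par_mem[OF zi] by (simp add: d_def)
  have d: "d \<in> A" using cx[OF x] by (simp add: d_def)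
  have yt: "?y \<in> topspace X" using chart_sub[OF d] y by blast
  have c: "c \<in> A" "?y \<in> fst c" "snd c ?y = 0" using cx[OF yt] by (auto simp: c_def)
  define \<tau> where "\<tau> w = snd d (par c w)" for w
  have pc0: "par c 0 = ?y" using par_crd[OF c(1,2)] c(3) by simp
  have t0: "\<tau> 0 = z" unfolding \<tau>_def pc0 using crd_par[OF zi] by (simp add: d_def)
  define O' where "O' = snd c ` (fst c \<inter> fst d)"
  have oO: "open O'" unfolding O'_def by (intro overlap_open c chart_open d)
  have 0: "0 \<in> O'" unfolding O'_def using c y by (metis IntI imageI)
  have th: "\<tau> holomorphic_on O'" unfolding O'_def \<tau>_def by (rule trans_holomorphic[OF c(1) d])
  have oP: "open (O' \<inter> \<tau> -` (ball 0 r - {0}))"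
    by (intro continuous_open_preimage holomorphic_on_imp_continuous_on th oO open_delete open_ball)
  have "0 \<in> O' \<inter> \<tau> -` (ball 0 r - {0})" using 0 t0 z by auto
  then obtain e where e: "e > 0" "ball 0 e \<subseteq> O' \<inter> \<tau> -` (ball 0 r - {0})" using oP openE by blast
  define \<epsilon> where "\<epsilon> = min e s"
  have Vh: "V i holomorphic_on ball 0 s" and s: "s > 0" and Wh: "W i holomorphic_on ball 0 r" for i using V W by (auto simp: lift_of_def)
  have \<epsilon>: "\<epsilon> > 0" "ball 0 \<epsilon> \<subseteq> O'" "\<And>w. w \<in> ball 0 \<epsilon> \<Longrightarrow> \<tau> w \<in> ball 0 r - {0}" "ball 0 \<epsilon> \<subseteq> ball 0 s"
    using e s by (auto simp: \<epsilon>_def)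
  have key: "V i w * W j (\<tau> w) - V j w * W i (\<tau> w) = 0" if w: "w \<in> ball 0 \<epsilon> - {0}" for w
  proof -
    have wO: "w \<in> snd c ` (fst c \<inter> fst d)" using w \<epsilon>(2) by (auto simp: O'_def)
    have tw: "\<tau> w \<in> ball 0 r - {0}" using w \<epsilon>(3) by blast
    have ws: "w \<in> ball 0 s - {0}" using w \<epsilon>(4) by blast
    let ?a = "deriv (in_chart d a) (\<tau> w)" and ?b = "deriv (in_chart d b) (\<tau> w)" and ?t = "deriv \<tau> w"
    have fd: "in_chart d a field_differentiable at (\<tau> w)" "in_chart d b field_differentiable at (\<tau> w)"
      and Wx: "W 1 (\<tau> w) = W 0 (\<tau> w) * (?a / (2 * ?b))" "W 2 (\<tau> w) = W 0 (\<tau> w) * in_chart d b (\<tau> w)"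
        "W 3 (\<tau> w) = W 0 (\<tau> w) * (in_chart d a (\<tau> w) - in_chart d b (\<tau> w) * (?a / (2 * ?b)))"
      using W tw by (auto simp: lift_of_def d_def)
    have Vx: "V 1 w = V 0 w * (deriv (in_chart c a) w / (2 * deriv (in_chart c b) w))" "V 2 w = V 0 w * in_chart c b w"
        "V 3 w = V 0 w * (in_chart c a w - in_chart c b w * (deriv (in_chart c a) w / (2 * deriv (in_chart c b) w)))"
      using V ws by (auto simp: lift_of_def c_def)
    have da: "deriv (in_chart c a) w = ?a * ?t" "deriv (in_chart c b) w = ?b * ?t"
      using deriv_chart_change[OF c(1) d wO, of a] deriv_chart_change[OF c(1) d wO, of b] fd
      by (auto simp: \<tau>_def[abs_def] intro!: DERIV_imp_deriv)
    have tnz: "?t \<noteq> 0" using trans_deriv_nonzero[OF c(1) d wO] by (simp add: \<tau>_def[abs_def])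
    have ab: "in_chart c a w = in_chart d a (\<tau> w)" "in_chart c b w = in_chart d b (\<tau> w)"
      using in_chart_trans[OF c(1) d wO] by (simp_all add: \<tau>_def)
    have q: "deriv (in_chart c a) w / (2 * deriv (in_chart c b) w) = ?a / (2 * ?b)" unfolding da using tnz by simp
    have "V k w = V 0 w * vec4 1 (?a / (2 * ?b)) (in_chart d b (\<tau> w)) (in_chart d a (\<tau> w) - in_chart d b (\<tau> w) * (?a / (2 * ?b))) k"
       "W k (\<tau> w) = W 0 (\<tau> w) * vec4 1 (?a / (2 * ?b)) (in_chart d b (\<tau> w)) (in_chart d a (\<tau> w) - in_chart d b (\<tau> w) * (?a / (2 * ?b))) k" if k: "k < 4" for k
    proof -
      have "k = 0 \<or> k = 1 \<or> k = 2 \<or> k = 3" using k by arith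
      then show "V k w = V 0 w * vec4 1 (?a / (2 * ?b)) (in_chart d b (\<tau> w)) (in_chart d a (\<tau> w) - in_chart d b (\<tau> w) * (?a / (2 * ?b))) k"
       "W k (\<tau> w) = W 0 (\<tau> w) * vec4 1 (?a / (2 * ?b)) (in_chart d b (\<tau> w)) (in_chart d a (\<tau> w) - in_chart d b (\<tau> w) * (?a / (2 * ?b))) k"
        using Vx[unfolded q ab] Wx by (elim disjE; simp)+
    qed
    from this[OF ij(1)] this[OF ij(2)] show ?thesis by simp
  qed
  have "(\<lambda>w. V i w * W j (\<tau> w) - V j w * W i (\<tau> w)) holomorphic_on ball 0 \<epsilon>"
  proof -
    have "(W k \<circ> \<tau>) holomorphic_on ball 0 \<epsilon>" for k
      by (rule holomorphic_on_compose_gen[OF holomorphic_on_subset[OF th \<epsilon>(2)] Wh]) (use \<epsilon>(3) in blast)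
    then have "(\<lambda>w. W k (\<tau> w)) holomorphic_on ball 0 \<epsilon>" for k by (simp add: o_def)
    then show ?thesis by (intro holomorphic_intros holomorphic_on_subset[OF Vh \<epsilon>(4)])
  qed
  then have "isCont (\<lambda>w. V i w * W j (\<tau> w) - V j w * W i (\<tau> w)) 0"
    using \<epsilon>(1) holomorphic_on_imp_continuous_on by (force simp: continuous_on_eq_continuous_at)
  from vanish_center[OF this \<epsilon>(1) key] show ?thesis using t0 by simp
qed

end

text \<open>Expresses in homogeneous coordinates that the projection \<open>(x\<^sub>1/x\<^sub>0, x\<^sub>2/x\<^sub>0)\<close> is immersed and avoids the
  origin, in a way that remains meaningful at the zeros of \<open>x\<^sub>0\<close>.\<close>

definition regular_at :: "(nat \<Rightarrow> complex \<Rightarrow> complex) \<Rightarrow> complex \<Rightarrow> bool" where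
  "regular_at Y w \<longleftrightarrow> contact_form (\<lambda>i. Y i w) (\<lambda>i. deriv (Y i) w) = 0 \<and> (Y 1 w \<noteq> 0 \<or> Y 2 w \<noteq> 0) \<and>
     (deriv (Y 1) w * Y 0 w \<noteq> Y 1 w * deriv (Y 0) w \<or> deriv (Y 2) w * Y 0 w \<noteq> Y 2 w * deriv (Y 0) w)"

text \<open>A plane of the pencil \<open>x\<^sub>3 = c x\<^sub>0\<close> becomes the plane at infinity; the other terms are a Heisenberg
  translation by \<open>(1, \<beta>)\<close>.\<close>

definition contact_change :: "complex \<Rightarrow> complex \<Rightarrow> (nat \<Rightarrow> complex) \<Rightarrow> nat \<Rightarrow> complex" where
  "contact_change c \<beta> x = vec4 (x 3 - c * x 0) (x 1 + (x 3 - c * x 0)) (x 2 + \<beta> * (x 3 - c * x 0)) (x 2 - x 0 - \<beta> * x 1)"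

section \<open>General position with respect to the plane at infinity\<close>

lemma less_4_cases: "k < (4::nat) \<Longrightarrow> k = 0 \<or> k = 1 \<or> k = 2 \<or> k = 3" by arith

lemma contact_form_contact_change: "contact_form (contact_change c \<beta> x) (contact_change c \<beta> y) = contact_form x y"
  by (simp add: contact_form_def contact_change_def algebra_simps)

text \<open>The transformation is invertible, so it cannot make position and velocity
  proportional.\<close>

lemma contact_change_independent:
  assumes wedge: "\<exists>i<4. \<exists>j<4. x i * x' j \<noteq> x j * x' i" and k: "\<And>i. i < 4 \<Longrightarrow> contact_change c \<beta> x' i = k * contact_change c \<beta> x i"
  shows False
proof -
  have e: "x' 3 - c * x' 0 = k * (x 3 - c * x 0)" "x' 1 + (x' 3 - c * x' 0) = k * (x 1 + (x 3 - c * x 0))"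
    "x' 2 + \<beta> * (x' 3 - c * x' 0) = k * (x 2 + \<beta> * (x 3 - c * x 0))" "x' 2 - x' 0 - \<beta> * x' 1 = k * (x 2 - x 0 - \<beta> * x 1)"
    using k[of 0] k[of 1] k[of 2] k[of 3] by (simp_all add: contact_change_def)
  have 1: "x' 1 = k * x 1" using e(2) unfolding e(1) by (simp add: algebra_simps)
  have 2: "x' 2 = k * x 2" using e(3) unfolding e(1) by (simp add: algebra_simps)
  have 0: "x' 0 = k * x 0" using e(4) unfolding 1 2 by (simp add: algebra_simps)
  have 3: "x' 3 = k * x 3" using e(1) unfolding 0 by (simp add: algebra_simps)
  have "x' i = k * x i" if "i < 4" for i using less_4_cases[OF that] 0 1 2 3 by (elim disjE) simp_all
  then show False using wedge by (auto simp: algebra_simps)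
qed

text \<open>Where the first coordinate is nonzero, the contact condition determines the velocity of
  the last affine coordinate from the other two, so the projection is immersed if the curve is.
  Where it vanishes with nonzero derivative, the condition forces the last coordinate to be 0 as
  soon as the two middle ones are, and that would be the zero vector.\<close>

lemma regular_values:
  fixes y y' :: "nat \<Rightarrow> complex"
  assumes cp: "contact_form y y' = 0" and ind: "\<And>k. \<not> (\<forall>i<4. y' i = k * y i)" and nz: "\<exists>i<4. y i \<noteq> 0"
    and 1: "y 0 = 0 \<Longrightarrow> y' 0 \<noteq> 0" and 2: "y 0 \<noteq> 0 \<Longrightarrow> y 1 \<noteq> 0 \<or> y 2 \<noteq> 0"
  shows "(y 1 \<noteq> 0 \<or> y 2 \<noteq> 0) \<and> (y' 1 * y 0 \<noteq> y 1 * y' 0 \<or> y' 2 * y 0 \<noteq> y 2 * y' 0)"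
proof (cases "y 0 = 0")
  case True
  have a: "y 1 \<noteq> 0 \<or> y 2 \<noteq> 0"
  proof (rule ccontr)
    assume "\<not> (y 1 \<noteq> 0 \<or> y 2 \<noteq> 0)"
    then have y: "y 1 = 0" "y 2 = 0" by auto
    then have "y 3 * y' 0 = 0" using cp True by (simp add: contact_form_def)
    then have "y 3 = 0" using 1[OF True] by simp
    then have "y i = 0" if "i < 4" for i using less_4_cases[OF that] y True by (elim disjE) simp_all
    then show False using nz by auto
  qed
  then show ?thesis using 1[OF True] True by auto
next
  case False
  have "y' 1 * y 0 \<noteq> y 1 * y' 0 \<or> y' 2 * y 0 \<noteq> y 2 * y' 0"
  proof (rule ccontr)
    assume "\<not> ?thesis"
    then have e: "y' 1 * y 0 = y 1 * y' 0" "y' 2 * y 0 = y 2 * y' 0" by auto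
    have "y 0 * y' 3 - y 3 * y' 0 = y 1 * y' 2 - y 2 * y' 1" using cp by (simp add: contact_form_def algebra_simps)
    then have "y 0 * (y 0 * y' 3 - y 3 * y' 0) = y 0 * (y 1 * y' 2 - y 2 * y' 1)" by (rule arg_cong)
    also have "\<dots> = y 1 * (y' 2 * y 0) - y 2 * (y' 1 * y 0)" by (simp add: algebra_simps)
    also have "\<dots> = 0" unfolding e by simp
    finally have e3: "y' 3 * y 0 = y 3 * y' 0" using False by (simp add: algebra_simps)
    have "y' i = (y' 0 / y 0) * y i" if "i < 4" for i
      using less_4_cases[OF that] e e3 False by (elim disjE) (simp_all add: field_simps)
    then show False using ind by blast
  qed
  then show ?thesis using 2[OF False] by blast
qed

context compact_surface
begin

text \<open>Both requirements of general position fail for finitely many parameters only: first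
  \<open>c\<close> is chosen so that the plane x3 = c x0 is nowhere tangent to the curve, then
  \<open>\<beta>\<close> so that the two middle coordinates have no common zero off that
  plane.\<close>

lemma regular_germs:
  "\<exists>\<phi>. \<forall>x\<in>topspace X. \<exists>r>0. \<exists>Y. (\<forall>i. Y i holomorphic_on ball 0 r) \<and>
     (\<forall>w\<in>ball 0 r. w \<in> ball 0 4 \<longrightarrow> (\<exists>l. l \<noteq> 0 \<and> (\<forall>i<4. \<phi> i (par (cx x) w) = l * Y i w))) \<and> (\<forall>w\<in>ball 0 r. contact_form (\<lambda>i. Y i w) (\<lambda>i. deriv (Y i) w) = 0) \<and> regular_at Y 0"
proof -
  obtain a b p where p: "p \<in> topspace X" and ex: "\<And>x. x \<in> topspace X \<Longrightarrow> \<exists>r W. lift_of (in_chart (cx x) a) (in_chart (cx x) b) r W \<and>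
     (x = p \<longrightarrow> W 0 0 = 0 \<and> W 1 0 = 0 \<and> W 3 0 \<noteq> 0)" using curve_germs by blast
  obtain r W where W: "\<And>x. x \<in> topspace X \<Longrightarrow> lift_of (in_chart (cx x) a) (in_chart (cx x) b) (r x) (W x)"
    and Wp: "W p 0 0 = 0" "W p 1 0 = 0" "W p 3 0 \<noteq> 0" using ex p by metis
  have r: "r x > 0" and hol: "W x i holomorphic_on ball 0 (r x)" and W0: "z \<in> ball 0 (r x) - {0} \<Longrightarrow> W x 0 z \<noteq> 0"
    and wedge: "\<exists>i<4. \<exists>j<4. W x i 0 * deriv (W x j) 0 \<noteq> W x j 0 * deriv (W x i) 0"
    and pencil: "c \<noteq> 0 \<Longrightarrow> W x 0 0 = 0 \<Longrightarrow> W x 3 0 = c * W x 0 0 \<Longrightarrow> deriv (W x 3) 0 \<noteq> c * deriv (W x 0) 0"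
    if "x \<in> topspace X" for x i z c using W[OF that] by (auto simp: lift_of_def)
  define \<phi> where "\<phi> i x = W x i 0" for i x
  have lift: "\<exists>l. l \<noteq> 0 \<and> (\<forall>i<4. \<phi> i (par (cx x) z) = l * W x i z)" if x: "x \<in> topspace X" and z: "z \<in> ball 0 (r x)" "z \<in> ball 0 4" for x z
  proof (cases "z = 0")
    case True then show ?thesis using par_cx_0[OF x] by (intro exI[of _ 1]) (simp add: \<phi>_def)
  next
    case False
    let ?y = "par (cx x) z"
    have y: "?y \<in> topspace X" by (rule par_cx[OF x z(2)])
    have z': "z \<in> ball 0 (r x) - {0}" using z False by simp
    have nz: "W x 0 z \<noteq> 0" by (rule W0[OF x z'])
    have e: "W ?y i 0 * W x 0 z = W ?y 0 0 * W x i z" if "i < 4" for i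
      by (rule germ_compat[OF x W[OF x] z' z(2) W[OF y] that]) simp
    have e': "W ?y i 0 = (W ?y 0 0 / W x 0 z) * W x i z" if "i < 4" for i using e[OF that] nz by (simp add: field_simps)
    have "W ?y 0 0 \<noteq> 0"
    proof
      assume "W ?y 0 0 = 0"
      then have "W ?y i 0 = 0" if "i < 4" for i using e'[OF that] by simp
      then show False using wedge[OF y] by auto
    qed
    then have "W ?y 0 0 / W x 0 z \<noteq> 0" using nz by simp
    moreover have "\<forall>i<4. \<phi> i ?y = (W ?y 0 0 / W x 0 z) * W x i z" unfolding \<phi>_def using e' by blast
    ultimately show ?thesis by blast
  qed
  \<comment> \<open>A plane of the pencil can be tangent to the curve off x0 = 0 only at a critical
    point of this quotient, whose derivative has numerator \<open>D\<close>.\<close>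
  define q where "q x = \<phi> 3 x / \<phi> 0 x" for x
  define D where "D x z = W x 0 z * deriv (W x 3) z - W x 3 z * deriv (W x 0) z" for x z
  have Dh: "D x holomorphic_on ball 0 (r x)" if "x \<in> topspace X" for x
    unfolding D_def by (intro holomorphic_intros holomorphic_deriv hol that open_ball)
  have dq: "(in_chart (cx x) q has_field_derivative D x z / (W x 0 z)\<^sup>2) (at z)"
    if x: "x \<in> topspace X" and z: "z \<in> ball 0 (r x)" "z \<in> ball 0 4" and nz: "W x 0 z \<noteq> 0" for x z
  proof -
    have q: "in_chart (cx x) q w = W x 3 w / W x 0 w" if w: "w \<in> ball 0 (r x) \<inter> ball 0 4" for w
    proof -
      obtain l where "l \<noteq> 0" "\<forall>i<4. \<phi> i (par (cx x) w) = l * W x i w" using lift[OF x] w by blast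
      then show ?thesis by (simp add: in_chart_def q_def)
    qed
    have o: "open (ball 0 (r x) \<inter> ball 0 4 :: complex set)" by auto
    have "((\<lambda>w. W x 3 w / W x 0 w) has_field_derivative (deriv (W x 3) z * W x 0 z - W x 3 z * deriv (W x 0) z) / (W x 0 z * W x 0 z)) (at z)"
      by (intro DERIV_divide deriv_at[OF hol[OF x] z(1)] nz)
    then have "((\<lambda>w. W x 3 w / W x 0 w) has_field_derivative D x z / (W x 0 z)\<^sup>2) (at z)" by (simp add: D_def power2_eq_square mult.commute)
    then show ?thesis
      by (rule has_field_derivative_transform_within_open[OF _ o]) (use z q in auto)
  qed
  define Z where "Z = {x \<in> topspace X. \<phi> 0 x \<noteq> 0 \<and> deriv (in_chart (cx x) q) 0 = 0}"
  have "finite Z"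
  proof (rule finite_zero_set[OF _ _ p])
    show "Z \<subseteq> topspace X" by (auto simp: Z_def)
    fix x assume x: "x \<in> topspace X"
    have "par (cx x) z \<in> Z \<longleftrightarrow> D x z = 0" if z: "z \<in> ball 0 (r x) - {0}" "z \<in> ball 0 4" for z
    proof -
      let ?y = "par (cx x) z"
      have zr: "z \<in> ball 0 (r x)" using z by simp
      have y: "?y \<in> topspace X" by (rule par_cx[OF x z(2)])
      have nz: "W x 0 z \<noteq> 0" by (rule W0[OF x z(1)])
      obtain l where "l \<noteq> 0" "\<forall>i<4. \<phi> i ?y = l * W x i z" using lift[OF x zr z(2)] by blast
      then have \<phi>0: "\<phi> 0 ?y \<noteq> 0" using nz by simp
      note dz = dq[OF x zr z(2) nz]
      have "deriv (in_chart (cx ?y) q) 0 = 0 \<longleftrightarrow> D x z = 0"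
        using deriv_zero_cx[OF x z(2), of q] dz nz DERIV_imp_deriv[OF dz] unfolding field_differentiable_def by auto
      then show ?thesis using \<phi>0 y by (simp add: Z_def)
    qed
    \<comment> \<open>If \<open>D\<close> vanished near \<open>p\<close>, the last coordinate would
      be a constant multiple of the first; but at \<open>p\<close> the first is 0 and the last is
      not.\<close>
    moreover have "\<exists>z\<in>ball 0 (r x). D x z \<noteq> 0" if "x = p"
    proof (rule ccontr)
      define \<rho> where "\<rho> = min (r x) 4"
      have \<rho>: "\<rho> > 0" "ball 0 \<rho> \<subseteq> ball 0 (r x)" using r[OF x] by (auto simp: \<rho>_def)
      assume "\<not> ?thesis"
      then have D0: "D x z = 0" if "z \<in> ball 0 \<rho>" for z using that \<rho> by blast
      have conn: "connected (ball 0 \<rho> - {0::complex})" using connected_punctured_ball[of "0::complex" \<rho>] by simp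
      have "(\<lambda>z. W x 3 z / W x 0 z) constant_on (ball 0 \<rho> - {0})"
      proof (rule has_field_derivative_0_imp_constant_on[OF _ conn])
        show "open (ball 0 \<rho> - {0::complex})" by auto
        fix z assume z: "z \<in> ball 0 \<rho> - {0::complex}"
        have zr: "z \<in> ball 0 (r x)" "z \<in> ball 0 (r x) - {0}" using z by (auto simp: \<rho>_def)
        have "((\<lambda>w. W x 3 w / W x 0 w) has_field_derivative (deriv (W x 3) z * W x 0 z - W x 3 z * deriv (W x 0) z) / (W x 0 z * W x 0 z)) (at z)"
          by (intro DERIV_divide deriv_at[OF hol[OF x] zr(1)] W0[OF x zr(2)])
        moreover have "deriv (W x 3) z * W x 0 z - W x 3 z * deriv (W x 0) z = 0" using D0[of z] z by (simp add: D_def mult.commute)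
        ultimately show "((\<lambda>w. W x 3 w / W x 0 w) has_field_derivative 0) (at z)" by simp
      qed
      then obtain k where k: "\<And>z. z \<in> ball 0 \<rho> - {0} \<Longrightarrow> W x 3 z / W x 0 z = k" unfolding constant_on_def by blast
      have "W x 3 z - k * W x 0 z = 0" if z: "z \<in> ball 0 \<rho> - {0}" for z
      proof -
        have "z \<in> ball 0 (r x) - {0}" using z by (auto simp: \<rho>_def)
        from W0[OF x this] k[OF z] show ?thesis by (simp add: divide_eq_eq)
      qed
      moreover have "isCont (\<lambda>z. W x 3 z - k * W x 0 z) 0"
        using r[OF x] by (intro continuous_intros holomorphic_on_imp_continuous_on[OF hol[OF x], unfolded continuous_on_eq_continuous_at[OF open_ball], rule_format]) auto
      ultimately have "W x 3 0 - k * W x 0 0 = 0" using vanish_center[where f="\<lambda>z. W x 3 z - k * W x 0 z" and a=0 and r=\<rho>] \<rho>(1) by blast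
      then show False using Wp that by simp
    qed
    ultimately show "\<exists>r>0. \<exists>f. f holomorphic_on ball 0 r \<and> (\<forall>z\<in>ball 0 r - {0}. z \<in> ball 0 4 \<longrightarrow> (par (cx x) z \<in> Z \<longleftrightarrow> f z = 0)) \<and>
        (x = p \<longrightarrow> (\<exists>z\<in>ball 0 r. f z \<noteq> 0))" using r[OF x] Dh[OF x] by (intro exI[of _ "r x"] conjI exI[of _ "D x"]) blast+
  qed
  then have "infinite (UNIV - insert 0 (q ` Z))" using infinite_UNIV_char_0[where 'a=complex] by (simp add: Diff_infinite_finite)
  \<comment> \<open>Critical values are excluded for the points with x0 nonzero; at those with x0 =
    0 transversality is part of the lift, for c nonzero.\<close>
  then obtain c where c: "c \<noteq> 0" "c \<notin> q ` Z" by (metis Diff_iff finite.emptyI insertCI insert_iff ex_in_conv)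
  \<comment> \<open>The zeros of the new second coordinate. At each of them off the plane at
    infinity exactly one value of the remaining parameter would make the third coordinate vanish
    too.\<close>
  define Z2 where "Z2 = {x \<in> topspace X. \<phi> 1 x + (\<phi> 3 x - c * \<phi> 0 x) = 0}"
  have "finite Z2"
  proof (rule finite_zero_set[OF _ _ p])
    show "Z2 \<subseteq> topspace X" by (auto simp: Z2_def)
    fix x assume x: "x \<in> topspace X"
    let ?f = "\<lambda>z. W x 1 z + (W x 3 z - c * W x 0 z)"
    have "par (cx x) z \<in> Z2 \<longleftrightarrow> ?f z = 0" if z: "z \<in> ball 0 (r x) - {0}" "z \<in> ball 0 4" for z
    proof -
      have zr: "z \<in> ball 0 (r x)" using z by simp
      obtain l where l: "l \<noteq> 0" "\<forall>i<4. \<phi> i (par (cx x) z) = l * W x i z" using lift[OF x zr z(2)] by blast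
      then have "\<phi> 1 (par (cx x) z) + (\<phi> 3 (par (cx x) z) - c * \<phi> 0 (par (cx x) z)) = l * ?f z" by (simp add: algebra_simps)
      then show ?thesis using l(1) par_cx(1)[OF x z(2)] by (simp add: Z2_def)
    qed
    moreover have "?f holomorphic_on ball 0 (r x)" by (intro holomorphic_intros hol x)
    moreover have "\<exists>z\<in>ball 0 (r x). ?f z \<noteq> 0" if "x = p" using Wp that r[OF x] by (intro bexI[of _ 0]) auto
    ultimately show "\<exists>r>0. \<exists>f. f holomorphic_on ball 0 r \<and> (\<forall>z\<in>ball 0 r - {0}. z \<in> ball 0 4 \<longrightarrow> (par (cx x) z \<in> Z2 \<longleftrightarrow> f z = 0)) \<and>
        (x = p \<longrightarrow> (\<exists>z\<in>ball 0 r. f z \<noteq> 0))" using r[OF x] by (intro exI[of _ "r x"] conjI exI[of _ ?f]) blast+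
  qed
  then have "infinite (UNIV - ((\<lambda>x. - \<phi> 2 x / (\<phi> 3 x - c * \<phi> 0 x)) ` Z2))" using infinite_UNIV_char_0[where 'a=complex] by (simp add: Diff_infinite_finite)
  then obtain \<beta> where \<beta>: "\<beta> \<notin> (\<lambda>x. - \<phi> 2 x / (\<phi> 3 x - c * \<phi> 0 x)) ` Z2" by (metis Diff_iff finite.emptyI ex_in_conv)
  show ?thesis
  proof (intro exI[of _ "\<lambda>i x. contact_change c \<beta> (\<lambda>k. \<phi> k x) i"] ballI)
    fix x assume x: "x \<in> topspace X"
    define Y where "Y i z = contact_change c \<beta> (\<lambda>k. W x k z) i" for i z
    have Yh: "Y i holomorphic_on ball 0 (r x)" for i
      unfolding Y_def contact_change_def vec4_def
      by (cases "i = 0"; cases "i = 1"; cases "i = 2"; auto intro!: holomorphic_intros hol x)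
    have r0: "0 \<in> ball 0 (r x)" using r[OF x] by simp
    have dYw: "deriv (Y i) w = contact_change c \<beta> (\<lambda>k. deriv (W x k) w) i" if w: "w \<in> ball 0 (r x)" for i w
      unfolding Y_def contact_change_def vec4_def
      by (cases "i = 0"; cases "i = 1"; cases "i = 2"; auto intro!: DERIV_imp_deriv derivative_eq_intros deriv_at[OF hol[OF x] w])
    note dY = dYw[OF r0]
    have cpw: "contact_form (\<lambda>i. Y i w) (\<lambda>i. deriv (Y i) w) = 0" if w: "w \<in> ball 0 (r x)" for w
      unfolding dYw[OF w] Y_def using lift_contact_form[OF W[OF x] w] by (simp add: contact_form_contact_change)
    have Y0: "Y i 0 = contact_change c \<beta> (\<lambda>k. \<phi> k x) i" for i by (simp add: Y_def \<phi>_def)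
    have "regular_at Y 0"
      unfolding regular_at_def
    proof (intro conjI)
      show cp: "contact_form (\<lambda>i. Y i 0) (\<lambda>i. deriv (Y i) 0) = 0" by (rule cpw[OF r0])
      have Yv: "(Y 1 0 \<noteq> 0 \<or> Y 2 0 \<noteq> 0) \<and> (deriv (Y 1) 0 * Y 0 0 \<noteq> Y 1 0 * deriv (Y 0) 0 \<or> deriv (Y 2) 0 * Y 0 0 \<noteq> Y 2 0 * deriv (Y 0) 0)"
      proof (rule regular_values[OF cp])
        show "\<not> (\<forall>i<4. deriv (Y i) 0 = k * Y i 0)" for k
          unfolding dY Y_def using contact_change_independent[OF wedge[OF x]] by blast
        show "\<exists>i<4. Y i 0 \<noteq> 0"
        proof (rule ccontr)
          assume "\<not> ?thesis"
          then have "Y i 0 = 0 * deriv (Y i) 0" if "i < 4" for i using that by simp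
          then have "contact_change c \<beta> (\<lambda>k. W x k 0) i = 0 * contact_change c \<beta> (\<lambda>k. deriv (W x k) 0) i" if "i < 4" for i
            using that unfolding dY Y_def by blast
          moreover have "\<exists>i<4. \<exists>j<4. deriv (W x i) 0 * W x j 0 \<noteq> deriv (W x j) 0 * W x i 0"
            using wedge[OF x] by (metis mult.commute)
          ultimately show False by (rule contact_change_independent[rotated])
        qed
        show "deriv (Y 0) 0 \<noteq> 0" if H: "Y 0 0 = 0"
        proof
          assume d: "deriv (Y 0) 0 = 0"
          have e: "W x 3 0 = c * W x 0 0" "deriv (W x 3) 0 = c * deriv (W x 0) 0"
            using H d unfolding dY by (simp_all add: Y_def contact_change_def)
          show False
          proof (cases "W x 0 0 = 0")
            case True then show False using pencil[OF x c(1) True e(1)] e(2) by blast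
          next
            case False
            have "D x 0 = 0" unfolding D_def e by simp
            then have "deriv (in_chart (cx x) q) 0 = 0" using DERIV_imp_deriv[OF dq[OF x r0 _ False]] by simp
            then have "x \<in> Z" using x False by (simp add: Z_def \<phi>_def)
            moreover have "q x = c" using e False by (simp add: q_def \<phi>_def)
            ultimately show False using c(2) by blast
          qed
        qed
        show "Y 1 0 \<noteq> 0 \<or> Y 2 0 \<noteq> 0" if H: "Y 0 0 \<noteq> 0"
        proof (rule ccontr)
          assume "\<not> ?thesis"
          then have e: "\<phi> 1 x + (\<phi> 3 x - c * \<phi> 0 x) = 0" "\<phi> 2 x + \<beta> * (\<phi> 3 x - c * \<phi> 0 x) = 0" and n: "\<phi> 3 x - c * \<phi> 0 x \<noteq> 0"
            using H by (simp_all add: Y0 contact_change_def)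
          have "x \<in> Z2" using e(1) x by (simp add: Z2_def)
          moreover have "\<beta> * (\<phi> 3 x - c * \<phi> 0 x) = - \<phi> 2 x" using e(2) by (simp add: add_eq_0_iff)
          then have "\<beta> = - \<phi> 2 x / (\<phi> 3 x - c * \<phi> 0 x)" using n by (metis nonzero_mult_div_cancel_right)
          ultimately show False using \<beta> by blast
        qed
      qed
      then show "Y 1 0 \<noteq> 0 \<or> Y 2 0 \<noteq> 0" "deriv (Y 1) 0 * Y 0 0 \<noteq> Y 1 0 * deriv (Y 0) 0 \<or> deriv (Y 2) 0 * Y 0 0 \<noteq> Y 2 0 * deriv (Y 0) 0" by blast+
    qed
    moreover have "\<exists>l. l \<noteq> 0 \<and> (\<forall>i<4. contact_change c \<beta> (\<lambda>k. \<phi> k (par (cx x) w)) i = l * Y i w)" if w: "w \<in> ball 0 (r x)" "w \<in> ball 0 4" for w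
    proof -
      obtain l where l: "l \<noteq> 0" "\<forall>i<4. \<phi> i (par (cx x) w) = l * W x i w" using lift[OF x w] by blast
      then have "contact_change c \<beta> (\<lambda>k. \<phi> k (par (cx x) w)) i = l * Y i w" for i
        by (simp add: Y_def contact_change_def vec4_def algebra_simps)
      then show ?thesis using l(1) by blast
    qed
    ultimately show "\<exists>r>0. \<exists>Y. (\<forall>i. Y i holomorphic_on ball 0 r) \<and>
     (\<forall>w\<in>ball 0 r. w \<in> ball 0 4 \<longrightarrow> (\<exists>l. l \<noteq> 0 \<and> (\<forall>i<4. contact_change c \<beta> (\<lambda>k. \<phi> k (par (cx x) w)) i = l * Y i w))) \<and> (\<forall>w\<in>ball 0 r. contact_form (\<lambda>i. Y i w) (\<lambda>i. deriv (Y i) w) = 0) \<and> regular_at Y 0"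
      using r[OF x] Yh cpw by (intro exI[of _ "r x"] conjI exI[of _ Y]) blast+
  qed
qed

section \<open>The global curve and its lifts over discs\<close>

definition curve_lift :: "(nat \<Rightarrow> 'a \<Rightarrow> complex) \<Rightarrow> 'a chart \<Rightarrow> complex set \<Rightarrow> (nat \<Rightarrow> complex \<Rightarrow> complex) \<Rightarrow> bool" where
  "curve_lift \<phi> c S Y \<longleftrightarrow> (\<forall>i. Y i holomorphic_on S) \<and>
     (\<forall>w\<in>S. regular_at Y w \<and> (\<exists>l. l \<noteq> 0 \<and> (\<forall>i<4. \<phi> i (par c w) = l * Y i w)))"

definition lifted_curve :: "(nat \<Rightarrow> 'a \<Rightarrow> complex) \<Rightarrow> bool" where
  "lifted_curve \<phi> \<longleftrightarrow> (\<forall>x\<in>topspace X. \<exists>c\<in>A. \<exists>Y.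
     x \<in> fst c \<and> snd c x = 0 \<and> snd c ` fst c = ball 0 4 \<and> curve_lift \<phi> c (ball 0 4) Y)"

text \<open>A change of chart multiplies all derivatives by one nonzero factor, and the conditions
  of \<open>regular_at\<close> are homogeneous in the derivatives.\<close>

lemma curve_lift_transport:
  assumes c: "c \<in> A" "d \<in> A" and S: "open S" "curve_lift \<phi> d S Y"
    and T: "open T" "T \<subseteq> snd c ` (fst c \<inter> fst d)" "\<And>w. w \<in> T \<Longrightarrow> snd d (par c w) \<in> S"
  shows "curve_lift \<phi> c T (\<lambda>i w. Y i (snd d (par c w)))"
  unfolding curve_lift_def
proof (intro conjI allI ballI)
  have Y: "Y i holomorphic_on S" for i using S by (simp add: curve_lift_def)
  have \<tau>: "(\<lambda>w. snd d (par c w)) holomorphic_on T" using trans_holomorphic[OF c] T(2) by (rule holomorphic_on_subset)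
  have "(Y i \<circ> (\<lambda>w. snd d (par c w))) holomorphic_on T" for i
    by (rule holomorphic_on_compose_gen[OF \<tau> Y]) (use T(3) in blast)
  then show "(\<lambda>w. Y i (snd d (par c w))) holomorphic_on T" for i by (simp add: o_def)
  fix w assume w: "w \<in> T"
  have wi: "w \<in> snd c ` (fst c \<inter> fst d)" using w T(2) by blast
  let ?t = "deriv (\<lambda>w. snd d (par c w)) w" and ?v = "snd d (par c w)"
  have v: "?v \<in> S" by (rule T(3)[OF w])
  have D: "deriv (\<lambda>w. Y i (snd d (par c w))) w = deriv (Y i) ?v * ?t" for i
    by (intro DERIV_imp_deriv DERIV_chain2[OF _ trans_deriv[OF c wi]] holomorphic_derivI[OF Y S(1) v])
  have t: "?t \<noteq> 0" by (rule trans_deriv_nonzero[OF c wi])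
  have g: "regular_at Y ?v" and l: "\<exists>l. l \<noteq> 0 \<and> (\<forall>i<4. \<phi> i (par d ?v) = l * Y i ?v)" using S(2) v by (auto simp: curve_lift_def)
  have "contact_form (\<lambda>i. Y i ?v) (\<lambda>i. deriv (Y i) ?v * ?t) = ?t * contact_form (\<lambda>i. Y i ?v) (\<lambda>i. deriv (Y i) ?v)"
    by (simp add: contact_form_def algebra_simps)
  moreover have "a * ?t * b = c' * (d' * ?t) \<longleftrightarrow> a * b = c' * d'" for a b c' d'
    using t by (simp add: mult.assoc mult.left_commute[of ?t] mult.commute[of _ ?t])
  ultimately show "regular_at (\<lambda>i w. Y i (snd d (par c w))) w" using g unfolding regular_at_def D by simp
  show "\<exists>l. l \<noteq> 0 \<and> (\<forall>i<4. \<phi> i (par c w) = l * Y i ?v)" using l trans_image(3)[OF c wi] by simp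
qed

text \<open>The contact condition holds on the whole disc by assumption, and the other conditions
  say that certain holomorphic functions are nonzero, which is open.\<close>

lemma regular_nbhd:
  assumes Y: "\<And>i. Y i holomorphic_on ball 0 r" "r > 0" and cp: "\<And>w. w \<in> ball 0 r \<Longrightarrow> contact_form (\<lambda>i. Y i w) (\<lambda>i. deriv (Y i) w) = 0"
    and g: "regular_at Y 0"
  obtains s where "0 < s" "s \<le> r" "\<And>w. w \<in> ball 0 s \<Longrightarrow> regular_at Y w"
proof -
  have h: "(\<lambda>w. deriv (Y i) w * Y 0 w - Y i w * deriv (Y 0) w) holomorphic_on ball 0 r" for i
    by (intro holomorphic_intros holomorphic_deriv Y open_ball)
  obtain i where i: "i = 1 \<or> i = 2" "Y i 0 \<noteq> 0" using g by (auto simp: regular_at_def)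
  obtain j where j: "j = 1 \<or> j = 2" "deriv (Y j) 0 * Y 0 0 - Y j 0 * deriv (Y 0) 0 \<noteq> 0" using g by (auto simp: regular_at_def)
  obtain s where s: "0 < s" "s \<le> r" "\<And>w. w \<in> ball 0 s \<Longrightarrow> Y i w \<noteq> 0" using nonzero_ball[OF Y i(2)] by blast
  obtain t where t: "0 < t" "t \<le> r" "\<And>w. w \<in> ball 0 t \<Longrightarrow> deriv (Y j) w * Y 0 w - Y j w * deriv (Y 0) w \<noteq> 0" using nonzero_ball[OF h Y(2) j(2)] by blast
  have "regular_at Y w" if "w \<in> ball 0 (min s t)" for w
  proof -
    have "w \<in> ball 0 s" "w \<in> ball 0 t" "w \<in> ball 0 r" using that s t by auto
    from s(3)[OF this(1)] t(3)[OF this(2)] cp[OF this(3)] show ?thesis using i(1) j(1) unfolding regular_at_def by auto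
  qed
  then show ?thesis using s t by (intro that[of "min s t"]) auto
qed

text \<open>The region on which a germ is regular may be small. A full disc chart inside it is
  chosen and the lift is carried over to that disc.\<close>

theorem lifted_curve_exists:
  "\<exists>\<phi>. lifted_curve \<phi>"
proof -
  obtain \<phi> where \<phi>: "\<forall>x\<in>topspace X. \<exists>r>0. \<exists>Y. (\<forall>i. Y i holomorphic_on ball 0 r) \<and>
     (\<forall>w\<in>ball 0 r. w \<in> ball 0 4 \<longrightarrow> (\<exists>l. l \<noteq> 0 \<and> (\<forall>i<4. \<phi> i (par (cx x) w) = l * Y i w))) \<and>
     (\<forall>w\<in>ball 0 r. contact_form (\<lambda>i. Y i w) (\<lambda>i. deriv (Y i) w) = 0) \<and> regular_at Y 0" using regular_germs by (rule exE)
  show ?thesis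
    unfolding lifted_curve_def
  proof (intro exI[of _ \<phi>] ballI)
    fix x assume x: "x \<in> topspace X"
    obtain r Y where Y: "r > 0" "\<And>i. Y i holomorphic_on ball 0 r"
      "\<And>w. w \<in> ball 0 r \<Longrightarrow> w \<in> ball 0 4 \<Longrightarrow> \<exists>l. l \<noteq> 0 \<and> (\<forall>i<4. \<phi> i (par (cx x) w) = l * Y i w)"
      "\<And>w. w \<in> ball 0 r \<Longrightarrow> contact_form (\<lambda>i. Y i w) (\<lambda>i. deriv (Y i) w) = 0" "regular_at Y 0" using bspec[OF \<phi> x] by (elim exE conjE) (rule that; blast)
    obtain s where s: "0 < s" "s \<le> r" "\<And>w. w \<in> ball 0 s \<Longrightarrow> regular_at Y w" using regular_nbhd[OF Y(2,1,4,5)] by blast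
    define t where "t = min s 4"
    have t: "t > 0" "t \<le> s" "t \<le> 4" using s by (auto simp: t_def)
    have L: "curve_lift \<phi> (cx x) (ball 0 t) Y"
      unfolding curve_lift_def
    proof (intro conjI ballI allI)
      show "Y i holomorphic_on ball 0 t" for i using Y(2) by (rule holomorphic_on_subset) (use t s in auto)
      fix w :: complex assume "w \<in> ball 0 t"
      then have "w \<in> ball 0 s" "w \<in> ball 0 r" "w \<in> ball 0 4" using s t by auto
      then show "regular_at Y w" "\<exists>l. l \<noteq> 0 \<and> (\<forall>i<4. \<phi> i (par (cx x) w) = l * Y i w)" using s(3) Y(3) by blast+
    qed
    define N where "N = {y \<in> fst (cx x). snd (cx x) y \<in> ball 0 t}"
    have cA: "cx x \<in> A" using cx[OF x] by blast
    have N: "openin X N" "x \<in> N" unfolding N_def using cx[OF x] t chart_preimage_open[OF cA open_ball, of 0 t] by auto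
    obtain d where d: "d \<in> A" "x \<in> fst d" "fst d \<subseteq> N" "snd d x = 0" "snd d ` fst d = ball 0 4" using disc[OF N] by blast
    have "curve_lift \<phi> d (ball 0 4) (\<lambda>i w. Y i (snd (cx x) (par d w)))"
    proof (rule curve_lift_transport[OF d(1) cA open_ball L open_ball])
      have "fst d \<inter> fst (cx x) = fst d" using d(3) by (auto simp: N_def)
      then show "ball 0 4 \<subseteq> snd d ` (fst d \<inter> fst (cx x))" using d(5) by simp
      fix w :: complex assume "w \<in> ball 0 4"
      then have "par d w \<in> fst d" using d(5) by (intro par_mem) simp
      then show "snd (cx x) (par d w) \<in> ball 0 t" using d(3) by (auto simp: N_def)
    qed
    then show "\<exists>c\<in>A. \<exists>Y. x \<in> fst c \<and> snd c x = 0 \<and> snd c ` fst c = ball 0 4 \<and> curve_lift \<phi> c (ball 0 4) Y" using d by blast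
  qed
qed

end

section \<open>Differentiability of finite order\<close>

lemma frechet_has_derivative: "f differentiable (at x) \<Longrightarrow> (f has_derivative frechet_derivative f (at x)) (at x)"
  by (simp add: frechet_derivative_works)

lemma frechet_derivativeI: "(f has_derivative D) (at x) \<Longrightarrow> frechet_derivative f (at x) = D"
  by (simp add: frechet_derivative_at[symmetric])

lemma times_differentiable_on_continuous: "times_differentiable_on n S f \<Longrightarrow> continuous_on S f"
  by (cases n) (auto intro: continuous_at_imp_continuous_on differentiable_imp_continuous_within)

lemma times_differentiable_on_SucD: "times_differentiable_on (Suc n) S f \<Longrightarrow> times_differentiable_on n S f"
proof (induction n arbitrary: f)
  case 0 show ?case unfolding times_differentiable_on.simps(1) by (rule times_differentiable_on_continuous[OF 0])
next
  case (Suc n) then show ?case by (simp only: times_differentiable_on.simps(2)) blast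
qed

lemma has_derivative_cong_open:
  assumes "open S" "x \<in> S" "\<And>y. y \<in> S \<Longrightarrow> f y = g y"
  shows "(f has_derivative D) (at x) \<longleftrightarrow> (g has_derivative D) (at x)"
  using has_derivative_transform_within_open[of f D x UNIV S g] has_derivative_transform_within_open[of g D x UNIV S f] assms by auto

lemma frechet_derivative_cong_open:
  assumes "open S" "x \<in> S" "\<And>y. y \<in> S \<Longrightarrow> f y = g y"
  shows "frechet_derivative f (at x) = frechet_derivative g (at x)"
  unfolding frechet_derivative_def using has_derivative_cong_open[OF assms] by simp

lemma times_differentiable_on_cong:
  assumes "open S" "\<And>y. y \<in> S \<Longrightarrow> f y = g y" "times_differentiable_on n S f"
  shows "times_differentiable_on n S g"
  using assms(2,3)
proof (induction n arbitrary: f g)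
  case 0 then show ?case by (simp cong: continuous_on_cong)
next
  case (Suc n)
  have "(f has_derivative D) (at x) \<longleftrightarrow> (g has_derivative D) (at x)" if "x \<in> S" for x D
    by (rule has_derivative_cong_open[OF assms(1) that]) (rule Suc.prems(1))
  then have "g differentiable (at x)" if "x \<in> S" for x
    using Suc.prems(2) that by (auto simp: differentiable_def)
  moreover have "times_differentiable_on n S (\<lambda>x. frechet_derivative g (at x) v)" for v
  proof (rule Suc.IH)
    show "times_differentiable_on n S (\<lambda>x. frechet_derivative f (at x) v)" using Suc.prems(2) by simp
    show "frechet_derivative f (at y) v = frechet_derivative g (at y) v" if "y \<in> S" for y
      by (rule arg_cong[of _ _ "\<lambda>D. D v"], rule frechet_derivative_cong_open[OF assms(1) that]) (rule Suc.prems(1))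
  qed
  ultimately show ?case by simp
qed

text \<open>Needed because a holomorphic lift exists only near each point of a chart.\<close>

lemma times_differentiable_on_local:
  assumes "\<And>x. x \<in> S \<Longrightarrow> \<exists>T. open T \<and> x \<in> T \<and> times_differentiable_on n T f"
  shows "times_differentiable_on n S f"
  using assms
proof (induction n arbitrary: f)
  case 0
  have "isCont f x" if "x \<in> S" for x using 0[OF that] by (auto simp: continuous_on_eq_continuous_at)
  then show ?case by (simp add: continuous_at_imp_continuous_on)
next
  case (Suc n)
  have "f differentiable (at x)" if "x \<in> S" for x using Suc.prems[OF that] by auto
  moreover have "times_differentiable_on n S (\<lambda>x. frechet_derivative f (at x) v)" for v
    by (rule Suc.IH) (use Suc.prems in fastforce)
  ultimately show ?case by simp
qed

text \<open>Lets the derivative be given by a formula, so that the inductions below run over sums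
  and products.\<close>

lemma times_differentiable_on_Suc_intro:
  assumes "open S" "\<And>x. x \<in> S \<Longrightarrow> (f has_derivative D x) (at x)" "\<And>v. times_differentiable_on n S (\<lambda>x. D x v)"
  shows "times_differentiable_on (Suc n) S f"
proof -
  have "times_differentiable_on n S (\<lambda>x. frechet_derivative f (at x) v)" for v
    by (rule times_differentiable_on_cong[OF assms(1) _ assms(3)[of v]]) (simp add: frechet_derivativeI[OF assms(2)])
  then show ?thesis using assms(2) by (auto simp: differentiable_def)
qed

lemma times_differentiable_on_bounded_linear:
  assumes L: "bounded_linear L" and S: "open S" and f: "times_differentiable_on n S f"
  shows "times_differentiable_on n S (\<lambda>x. L (f x))"
  using f
proof (induction n arbitrary: f)
  case 0 then show ?case by (simp add: bounded_linear.continuous_on[OF L])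
next
  case (Suc n)
  show ?case
  proof (rule times_differentiable_on_Suc_intro[OF S])
    show "((\<lambda>x. L (f x)) has_derivative (\<lambda>v. L (frechet_derivative f (at x) v))) (at x)" if "x \<in> S" for x
      using Suc.prems that by (intro bounded_linear.has_derivative[OF L] frechet_has_derivative) auto
    show "times_differentiable_on n S (\<lambda>x. L (frechet_derivative f (at x) v))" for v using Suc.prems by (intro Suc.IH) auto
  qed
qed

lemma times_differentiable_on_const: "times_differentiable_on n S (\<lambda>x. c)"
proof (induction n arbitrary: c)
  case (Suc n)
  show ?case by (simp add: frechet_derivativeI[OF has_derivative_const] Suc)
qed simp

lemma times_differentiable_on_ident: "open S \<Longrightarrow> times_differentiable_on n S (\<lambda>x. x)"
proof (cases n)
  case (Suc m)
  assume "open S" then show ?thesis unfolding Suc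
    by (intro times_differentiable_on_Suc_intro[of S _ "\<lambda>x v. v"] has_derivative_ident times_differentiable_on_const) auto
qed simp

lemma times_differentiable_on_add:
  assumes S: "open S" and "times_differentiable_on n S f" "times_differentiable_on n S g"
  shows "times_differentiable_on n S (\<lambda>x. f x + g x)"
  using assms(2,3)
proof (induction n arbitrary: f g)
  case 0 then show ?case by (simp add: continuous_on_add)
next
  case (Suc n)
  show ?case
  proof (rule times_differentiable_on_Suc_intro[OF S])
    show "((\<lambda>x. f x + g x) has_derivative (\<lambda>v. frechet_derivative f (at x) v + frechet_derivative g (at x) v)) (at x)" if "x \<in> S" for x
      using Suc.prems that by (intro has_derivative_add frechet_has_derivative) auto
    show "times_differentiable_on n S (\<lambda>x. frechet_derivative f (at x) v + frechet_derivative g (at x) v)" for v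
      using Suc.prems by (intro Suc.IH) auto
  qed
qed

lemma times_differentiable_on_mult:
  fixes f g :: "'a::real_normed_vector \<Rightarrow> 'b::real_normed_algebra"
  assumes S: "open S" and "times_differentiable_on n S f" "times_differentiable_on n S g"
  shows "times_differentiable_on n S (\<lambda>x. f x * g x)"
  using assms(2,3)
proof (induction n arbitrary: f g)
  case 0 then show ?case by (simp add: continuous_on_mult)
next
  case (Suc n)
  show ?case
  proof (rule times_differentiable_on_Suc_intro[OF S])
    show "((\<lambda>x. f x * g x) has_derivative (\<lambda>v. f x * frechet_derivative g (at x) v + frechet_derivative f (at x) v * g x)) (at x)" if "x \<in> S" for x
      using Suc.prems that by (intro has_derivative_mult frechet_has_derivative) auto
    show "times_differentiable_on n S (\<lambda>x. f x * frechet_derivative g (at x) v + frechet_derivative f (at x) v * g x)" for v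
      using Suc.prems times_differentiable_on_SucD[OF Suc.prems(1)] times_differentiable_on_SucD[OF Suc.prems(2)]
      by (intro times_differentiable_on_add S Suc.IH) auto
  qed
qed

lemma times_differentiable_on_inverse:
  fixes f :: "'a::real_normed_vector \<Rightarrow> 'b::real_normed_field"
  assumes S: "open S" and "times_differentiable_on n S f" and nz: "\<And>x. x \<in> S \<Longrightarrow> f x \<noteq> 0"
  shows "times_differentiable_on n S (\<lambda>x. inverse (f x))"
  using assms(2)
proof (induction n)
  case 0 then show ?case using nz by (simp add: continuous_on_inverse)
next
  case (Suc n)
  have i: "times_differentiable_on n S (\<lambda>x. inverse (f x))" by (rule Suc.IH[OF times_differentiable_on_SucD[OF Suc.prems]])
  show ?case
  proof (rule times_differentiable_on_Suc_intro[OF S])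
    show "((\<lambda>x. inverse (f x)) has_derivative (\<lambda>v. - (inverse (f x) * frechet_derivative f (at x) v * inverse (f x)))) (at x)" if "x \<in> S" for x
      using Suc.prems that nz by (intro Deriv.has_derivative_inverse frechet_has_derivative) auto
    show "times_differentiable_on n S (\<lambda>x. - (inverse (f x) * frechet_derivative f (at x) v * inverse (f x)))" for v
      using Suc.prems i by (intro times_differentiable_on_bounded_linear[OF bounded_linear_minus[OF bounded_linear_ident]] times_differentiable_on_mult S) auto
  qed
qed

lemma times_differentiable_on_holomorphic:
  assumes "open S" "f holomorphic_on S" shows "times_differentiable_on n S f"
  using assms(2)
proof (induction n arbitrary: f)
  case 0 then show ?case by (simp add: holomorphic_on_imp_continuous_on)
next
  case (Suc n)
  show ?case
  proof (rule times_differentiable_on_Suc_intro[OF assms(1)])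
    show "(f has_derivative (\<lambda>v. deriv f x * v)) (at x)" if "x \<in> S" for x
      using holomorphic_derivI[OF Suc.prems assms(1) that] by (simp add: has_field_derivative_def)
    show "times_differentiable_on n S (\<lambda>x. deriv f x * v)" for v
      by (intro times_differentiable_on_mult times_differentiable_on_const assms(1) Suc.IH holomorphic_deriv Suc.prems)
  qed
qed

lemma times_differentiable_on_diff:
  "open S \<Longrightarrow> times_differentiable_on n S f \<Longrightarrow> times_differentiable_on n S g \<Longrightarrow> times_differentiable_on n S (\<lambda>x. f x - g x)"
  using times_differentiable_on_add[OF _ _ times_differentiable_on_bounded_linear[OF bounded_linear_minus[OF bounded_linear_ident]], of S n f g] by simp

lemma times_differentiable_on_divide:
  fixes f g :: "'a::real_normed_vector \<Rightarrow> 'b::real_normed_field"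
  shows "open S \<Longrightarrow> times_differentiable_on n S f \<Longrightarrow> times_differentiable_on n S g \<Longrightarrow> (\<And>x. x \<in> S \<Longrightarrow> g x \<noteq> 0) \<Longrightarrow>
    times_differentiable_on n S (\<lambda>x. f x / g x)"
  by (simp add: divide_inverse times_differentiable_on_mult times_differentiable_on_inverse)

lemma times_differentiable_on_Pair:
  fixes f :: "'a::real_normed_vector \<Rightarrow> 'b::real_normed_vector" and g :: "'a \<Rightarrow> 'c::real_normed_vector"
  assumes S: "open S" and "times_differentiable_on n S f" "times_differentiable_on n S g"
  shows "times_differentiable_on n S (\<lambda>x. (f x, g x))"
proof -
  have "bounded_linear (\<lambda>y::'b. (y, 0::'c))" "bounded_linear (\<lambda>y::'c. (0::'b, y))"
    by (intro bounded_linear_Pair bounded_linear_ident bounded_linear_zero)+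
  from times_differentiable_on_add[OF S times_differentiable_on_bounded_linear[OF this(1) S assms(2)] times_differentiable_on_bounded_linear[OF this(2) S assms(3)]]
  show ?thesis by simp
qed

section \<open>The Lagrangian map\<close>

text \<open>In affine coordinates these are the components of \<open>\<zeta>\<close> and \<open>w\<close>, multiplied by \<open>|x\<^sub>0|\<^sup>2\<close>.\<close>

definition mnum1 :: "(nat \<Rightarrow> complex) \<Rightarrow> complex" where "mnum1 y = y 1 * cnj (y 0) - y 0 * cnj (y 2)"
definition mnum2 :: "(nat \<Rightarrow> complex) \<Rightarrow> complex" where "mnum2 y = y 2 * cnj (y 0) + y 0 * cnj (y 1)"
definition mden :: "(nat \<Rightarrow> complex) \<Rightarrow> complex" where
  "mden y = 2 * (y 1 * cnj (y 1) + y 2 * cnj (y 2) + y 3 * cnj (y 0) - y 0 * cnj (y 3))"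
definition lag_map :: "(nat \<Rightarrow> complex) \<Rightarrow> complex \<times> complex" where "lag_map y = (mnum1 y / mden y, mnum2 y / mden y)"
definition lag_potential :: "(nat \<Rightarrow> complex) \<Rightarrow> real" where "lag_potential y = Im (y 0 * cnj (y 0) / mden y) / 4"

text \<open>The last two terms form a difference of conjugates and are imaginary; the real part is 2
  (|y1|^2 + |y2|^2).\<close>

lemma mden_nonzero: assumes "y 1 \<noteq> 0 \<or> y 2 \<noteq> 0" shows "mden y \<noteq> 0"
proof -
  have "Re (mden y) = 2 * ((norm (y 1))\<^sup>2 + (norm (y 2))\<^sup>2)"
    unfolding mden_def complex_norm_square[symmetric] by (simp add: algebra_simps)
  moreover have "(norm (y 1))\<^sup>2 + (norm (y 2))\<^sup>2 > 0" using assms by (auto simp: add_pos_nonneg add_nonneg_pos)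
  ultimately have "Re (mden y) \<noteq> 0" by simp
  then show ?thesis by auto
qed

lemma mden_scale:
  assumes "\<And>i. i < 4 \<Longrightarrow> x i = l * y i"
  shows "mnum1 x = l * cnj l * mnum1 y" "mnum2 x = l * cnj l * mnum2 y" "mden x = l * cnj l * mden y" "x 0 * cnj (x 0) = l * cnj l * (y 0 * cnj (y 0))"
proof -
  have e: "x 0 = l * y 0" "x 1 = l * y 1" "x 2 = l * y 2" "x 3 = l * y 3" using assms by auto
  show "mnum1 x = l * cnj l * mnum1 y" "mnum2 x = l * cnj l * mnum2 y" "mden x = l * cnj l * mden y" "x 0 * cnj (x 0) = l * cnj l * (y 0 * cnj (y 0))"
    unfolding mnum1_def mnum2_def mden_def e by (simp_all add: algebra_simps)
qed

lemma lag_map_scale: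
  assumes "l \<noteq> 0" "\<And>i. i < 4 \<Longrightarrow> x i = l * y i"
  shows "lag_map x = lag_map y" "lag_potential x = lag_potential y"
proof -
  have c: "l * cnj l \<noteq> 0" using assms by simp
  have s: "mnum1 x = l * cnj l * mnum1 y" "mnum2 x = l * cnj l * mnum2 y" "mden x = l * cnj l * mden y" "x 0 * cnj (x 0) = l * cnj l * (y 0 * cnj (y 0))"
    by (rule mden_scale, rule assms(2), assumption)+
  show "lag_map x = lag_map y" unfolding lag_map_def s mult_divide_mult_cancel_left[OF c] by (rule refl)
  show "lag_potential x = lag_potential y" unfolding lag_potential_def s mult_divide_mult_cancel_left[OF c] by (rule refl)
qed

text \<open>The algebra of \<zeta>/w when the differential of w is twice the Hermitian product
  \<open>sA\<close> of d\<zeta> with \<zeta>. The rank-one terms cancel because twice the real part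
  of w is 2 |\<zeta>|^2. In the second identity the right-hand side is half the differential of 1/w,
  which makes the Liouville form exact.\<close>

lemma inversion_isometry:
  fixes A1 A2 B1 B2 z1 z2 w :: complex
  defines "sA \<equiv> A1 * cnj z1 + A2 * cnj z2" and "sB \<equiv> B1 * cnj z1 + B2 * cnj z2"
  assumes w: "w + cnj w = 2 * (z1 * cnj z1 + z2 * cnj z2)" "w \<noteq> 0"
  shows "(A1 * w - z1 * (2 * sA)) / (w * w) * cnj ((B1 * w - z1 * (2 * sB)) / (w * w)) +
         (A2 * w - z2 * (2 * sA)) / (w * w) * cnj ((B2 * w - z2 * (2 * sB)) / (w * w)) = (A1 * cnj B1 + A2 * cnj B2) / (w * cnj w)"
    and "cnj (z1 / w) * ((A1 * w - z1 * (2 * sA)) / (w * w)) + cnj (z2 / w) * ((A2 * w - z2 * (2 * sA)) / (w * w)) = - sA / (w * w)"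
proof -
  let ?S = "z1 * cnj z1 + z2 * cnj z2"
  \<comment> \<open>The bracket \<open>4 * ?S - 2 * (w + cnj w)\<close> is 0 by hypothesis.\<close>
  have n: "(A1 * w - z1 * (2 * sA)) * cnj (B1 * w - z1 * (2 * sB)) + (A2 * w - z2 * (2 * sA)) * cnj (B2 * w - z2 * (2 * sB))
     = w * cnj w * (A1 * cnj B1 + A2 * cnj B2) + sA * cnj sB * (4 * ?S - 2 * (w + cnj w))"
    unfolding sA_def sB_def by (simp add: algebra_simps)
  have "(A1 * w - z1 * (2 * sA)) / (w * w) * cnj ((B1 * w - z1 * (2 * sB)) / (w * w)) +
         (A2 * w - z2 * (2 * sA)) / (w * w) * cnj ((B2 * w - z2 * (2 * sB)) / (w * w)) =
     ((A1 * w - z1 * (2 * sA)) * cnj (B1 * w - z1 * (2 * sB)) + (A2 * w - z2 * (2 * sA)) * cnj (B2 * w - z2 * (2 * sB))) / (w * w * cnj (w * w))"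
    unfolding complex_cnj_divide times_divide_times_eq add_divide_distrib ..
  also have "\<dots> = w * cnj w * (A1 * cnj B1 + A2 * cnj B2) / (w * cnj w * (w * cnj w))" unfolding n w by (simp add: mult_ac)
  also have "\<dots> = (A1 * cnj B1 + A2 * cnj B2) / (w * cnj w)" using w(2) by (intro mult_divide_mult_cancel_left) simp
  finally show "(A1 * w - z1 * (2 * sA)) / (w * w) * cnj ((B1 * w - z1 * (2 * sB)) / (w * w)) +
         (A2 * w - z2 * (2 * sA)) / (w * w) * cnj ((B2 * w - z2 * (2 * sB)) / (w * w)) = (A1 * cnj B1 + A2 * cnj B2) / (w * cnj w)" .
  have m: "cnj z1 * (A1 * w - z1 * (2 * sA)) + cnj z2 * (A2 * w - z2 * (2 * sA)) = sA * (w - 2 * ?S)" unfolding sA_def by (simp add: algebra_simps)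
  have "cnj (z1 / w) * ((A1 * w - z1 * (2 * sA)) / (w * w)) + cnj (z2 / w) * ((A2 * w - z2 * (2 * sA)) / (w * w)) =
    (cnj z1 * (A1 * w - z1 * (2 * sA)) + cnj z2 * (A2 * w - z2 * (2 * sA))) / (cnj w * (w * w))"
    unfolding complex_cnj_divide times_divide_times_eq add_divide_distrib ..
  also have "\<dots> = cnj w * (- sA) / (cnj w * (w * w))" unfolding m w(1)[symmetric] by simp
  also have "\<dots> = - sA / (w * w)" using w(2) by (intro mult_divide_mult_cancel_left) simp
  finally show "cnj (z1 / w) * ((A1 * w - z1 * (2 * sA)) / (w * w)) + cnj (z2 / w) * ((A2 * w - z2 * (2 * sA)) / (w * w)) = - sA / (w * w)" .
qed

lemma cnj_inner: "u * cnj v + cnj u * v = of_real (2 * (u \<bullet> v))"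
  by (simp add: complex_eq_iff inner_complex_def)

lemma has_derivative_cnj: "(f has_derivative D) F \<Longrightarrow> ((\<lambda>x. cnj (f x)) has_derivative (\<lambda>v. cnj (D v))) F"
  by (rule bounded_linear.has_derivative[OF bounded_linear_cnj])

lemma has_derivative_Im_part: "(f has_derivative D) F \<Longrightarrow> ((\<lambda>x. Im (f x)) has_derivative (\<lambda>v. Im (D v))) F"
  by (rule bounded_linear.has_derivative[OF bounded_linear_Im])

text \<open>Half of the sum of x dy - y dx, written as the imaginary part of a Hermitian product; it
  is linear in the base point.\<close>

definition liouville :: "complex \<times> complex \<Rightarrow> complex \<times> complex \<Rightarrow> real" where
  "liouville p v = Im (cnj (fst p) * fst v + cnj (snd p) * snd v) / 2"

definition conformal_exact_at :: "(complex \<Rightarrow> complex \<times> complex) \<Rightarrow> (complex \<Rightarrow> real) \<Rightarrow> complex \<Rightarrow> bool" where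
  "conformal_exact_at f h z \<longleftrightarrow> (\<exists>D \<mu>. (f has_derivative D) (at z) \<and> \<mu> > 0 \<and>
     (\<forall>u v. fst (D u) * cnj (fst (D v)) + snd (D u) * cnj (snd (D v)) = of_real (\<mu> * (u \<bullet> v))) \<and>
     (h has_derivative (\<lambda>v. liouville (f z) (D v))) (at z))"

lemma conformal_exact_at_cong:
  assumes "open T" "z \<in> T" "\<And>w. w \<in> T \<Longrightarrow> f w = g w" "\<And>w. w \<in> T \<Longrightarrow> h w = k w" "conformal_exact_at f h z"
  shows "conformal_exact_at g k z"
proof -
  have "(f has_derivative D) (at z) \<longleftrightarrow> (g has_derivative D) (at z)" "(h has_derivative E) (at z) \<longleftrightarrow> (k has_derivative E) (at z)" for D E
    by (rule has_derivative_cong_open[OF assms(1,2)], erule assms)+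
  then show ?thesis using assms(5) unfolding conformal_exact_at_def assms(3)[OF assms(2)] by simp
qed

text \<open>The components of \<zeta> combine f and g with conjugates in such a way that in the
  Hermitian product of d\<zeta>(u) with d\<zeta>(v) the terms in u v and in its conjugate cancel.
  What remains is (|a|^2 + |b|^2) (u cnj v + cnj u v), a real number; the hypothesis on
  \<open>h\<close> is the contact condition.\<close>

lemma lag_map_derivative_affine:
  fixes f g h :: "complex \<Rightarrow> complex"
  assumes f: "(f has_field_derivative a) (at z)" and g: "(g has_field_derivative b) (at z)"
    and h: "(h has_field_derivative (f z * b - g z * a)) (at z)"
    and ab: "a \<noteq> 0 \<or> b \<noteq> 0" and fg: "f z \<noteq> 0 \<or> g z \<noteq> 0"
  defines "y \<equiv> \<lambda>w. vec4 1 (f w) (g w) (h w)"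
  shows "conformal_exact_at (\<lambda>w. lag_map (y w)) (\<lambda>w. lag_potential (y w)) z"
proof -
  define z1 where "z1 w = f w - cnj (g w)" for w
  define z2 where "z2 w = g w + cnj (f w)" for w
  define W where "W w = 2 * (f w * cnj (f w) + g w * cnj (g w) + h w - cnj (h w))" for w
  have cm: "lag_map (y w) = (z1 w / W w, z2 w / W w)" "lag_potential (y w) = Im (1 / W w) / 4" and Wm: "W w = mden (y w)" for w
    by (simp_all add: lag_map_def lag_potential_def mnum1_def mnum2_def mden_def y_def z1_def z2_def W_def)
  have Wnz: "W z \<noteq> 0" unfolding Wm by (rule mden_nonzero) (use fg in \<open>auto simp: y_def\<close>)
  have f': "(f has_derivative (\<lambda>v. a * v)) (at z)" and g': "(g has_derivative (\<lambda>v. b * v)) (at z)"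
    and h': "(h has_derivative (\<lambda>v. (f z * b - g z * a) * v)) (at z)" using f g h by (simp_all add: has_field_derivative_def)
  define A1 where "A1 v = a * v - cnj (b * v)" for v
  define A2 where "A2 v = b * v + cnj (a * v)" for v
  define s where "s v = A1 v * cnj (z1 z) + A2 v * cnj (z2 z)" for v
  have d1: "(z1 has_derivative A1) (at z)" unfolding z1_def[abs_def] A1_def[abs_def] by (intro has_derivative_diff has_derivative_cnj f' g')
  have d2: "(z2 has_derivative A2) (at z)" unfolding z2_def[abs_def] A2_def[abs_def] by (intro has_derivative_add has_derivative_cnj f' g')
  have "(W has_derivative (\<lambda>v. 2 * ((f z * cnj (a * v) + a * v * cnj (f z)) + (g z * cnj (b * v) + b * v * cnj (g z)) + (f z * b - g z * a) * v - cnj ((f z * b - g z * a) * v)))) (at z)"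
    unfolding W_def[abs_def] by (intro has_derivative_mult_right has_derivative_diff has_derivative_add has_derivative_mult has_derivative_cnj f' g' h')
  moreover have "2 * ((f z * cnj (a * v) + a * v * cnj (f z)) + (g z * cnj (b * v) + b * v * cnj (g z)) + (f z * b - g z * a) * v - cnj ((f z * b - g z * a) * v)) = 2 * s v" for v
    unfolding s_def A1_def A2_def z1_def z2_def by (simp add: algebra_simps)
  ultimately have dW: "(W has_derivative (\<lambda>v. 2 * s v)) (at z)" by simp
  have wc: "W z + cnj (W z) = 2 * (z1 z * cnj (z1 z) + z2 z * cnj (z2 z))"
    unfolding W_def z1_def z2_def by (simp add: algebra_simps)
  define D where "D v = ((A1 v * W z - z1 z * (2 * s v)) / (W z * W z), (A2 v * W z - z2 z * (2 * s v)) / (W z * W z))" for v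
  define \<mu> where "\<mu> = 2 * ((norm a)\<^sup>2 + (norm b)\<^sup>2) / (norm (W z))\<^sup>2"
  have "((\<lambda>w. lag_map (y w)) has_derivative D) (at z)"
    unfolding cm D_def[abs_def] by (intro has_derivative_Pair has_derivative_divide' d1 d2 dW Wnz)
  moreover have "\<mu> > 0" using ab Wnz by (auto simp: \<mu>_def add_pos_nonneg add_nonneg_pos)
  moreover have "fst (D u) * cnj (fst (D v)) + snd (D u) * cnj (snd (D v)) = of_real (\<mu> * (u \<bullet> v))" for u v
  proof -
    have "fst (D u) * cnj (fst (D v)) + snd (D u) * cnj (snd (D v)) = (A1 u * cnj (A1 v) + A2 u * cnj (A2 v)) / (W z * cnj (W z))"
      unfolding D_def fst_conv snd_conv s_def by (rule inversion_isometry(1)[OF wc Wnz])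
    also have "A1 u * cnj (A1 v) + A2 u * cnj (A2 v) = (a * cnj a + b * cnj b) * (u * cnj v + cnj u * v)"
      unfolding A1_def A2_def by (simp add: algebra_simps)
    also have "\<dots> / (W z * cnj (W z)) = of_real (\<mu> * (u \<bullet> v))"
      unfolding cnj_inner complex_norm_square[symmetric] \<mu>_def by simp
    finally show ?thesis .
  qed
  moreover have "((\<lambda>w. lag_potential (y w)) has_derivative (\<lambda>v. liouville (lag_map (y z)) (D v))) (at z)"
  proof -
    have "((\<lambda>w. Im (1 / W w) / 4) has_derivative (\<lambda>v. Im ((0 * W z - 1 * (2 * s v)) / (W z * W z)) / 4)) (at z)"
      by (intro bounded_linear.has_derivative[OF bounded_linear_divide] has_derivative_Im_part has_derivative_divide' dW Wnz has_derivative_const)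
    moreover have "Im ((0 * W z - 1 * (2 * s v)) / (W z * W z)) / 4 = liouville (lag_map (y z)) (D v)" for v
    proof -
      have "cnj (fst (lag_map (y z))) * fst (D v) + cnj (snd (lag_map (y z))) * snd (D v) = - s v / (W z * W z)"
        unfolding cm D_def fst_conv snd_conv s_def by (rule inversion_isometry(2)[OF wc Wnz])
      moreover have "(0 * W z - 1 * (2 * s v)) / (W z * W z) = 2 * (- s v / (W z * W z))" by simp
      moreover have "Im (2 * x) / 4 = Im x / 2" for x by simp
      ultimately show ?thesis by (simp only: liouville_def)
    qed
    ultimately show ?thesis unfolding cm(2) by (simp only:)
  qed
  ultimately show ?thesis unfolding conformal_exact_at_def by blast
qed

lemma hermitian_divide: "a / w * cnj (b / w) + c / w * cnj (d / w) = (a * cnj b + c * cnj d) / (w * cnj w)"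
  by (simp add: add_divide_distrib)

text \<open>At a point at infinity both numerators vanish and the denominator does not, so the map
  passes through the origin and only the derivatives of the numerators count. The numerator |y0|^2
  of the potential vanishes to second order, in accordance with the Liouville form being 0 at the
  origin.\<close>

lemma lag_map_derivative_at_zero:
  assumes Y: "\<And>i. (Y i has_field_derivative Y' i) (at z)" and Y0: "Y 0 z = 0" "Y' 0 \<noteq> 0" and nz: "Y 1 z \<noteq> 0 \<or> Y 2 z \<noteq> 0"
  shows "conformal_exact_at (\<lambda>w. lag_map (\<lambda>i. Y i w)) (\<lambda>w. lag_potential (\<lambda>i. Y i w)) z"
proof -
  have Y': "(Y i has_derivative (\<lambda>v. Y' i * v)) (at z)" for i using Y[of i] by (simp add: has_field_derivative_def)
  define W where "W w = mden (\<lambda>i. Y i w)" for w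
  have Wnz: "W z \<noteq> 0" unfolding W_def by (rule mden_nonzero[OF nz])
  have "(W has_derivative (\<lambda>v. 2 * ((Y 1 z * cnj (Y' 1 * v) + Y' 1 * v * cnj (Y 1 z)) + (Y 2 z * cnj (Y' 2 * v) + Y' 2 * v * cnj (Y 2 z)) + (Y 3 z * cnj (Y' 0 * v) + Y' 3 * v * cnj (Y 0 z)) - (Y 0 z * cnj (Y' 3 * v) + Y' 0 * v * cnj (Y 3 z))))) (at z)"
    unfolding W_def mden_def by (intro has_derivative_mult_right has_derivative_diff has_derivative_add has_derivative_mult has_derivative_cnj Y')
  then obtain dW where dW: "(W has_derivative dW) (at z)" by blast
  have "((\<lambda>w. mnum1 (\<lambda>i. Y i w)) has_derivative (\<lambda>v. (Y 1 z * cnj (Y' 0 * v) + Y' 1 * v * cnj (Y 0 z)) - (Y 0 z * cnj (Y' 2 * v) + Y' 0 * v * cnj (Y 2 z)))) (at z)"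
    unfolding mnum1_def by (intro has_derivative_diff has_derivative_add has_derivative_mult has_derivative_cnj Y')
  then have d1: "((\<lambda>w. mnum1 (\<lambda>i. Y i w)) has_derivative (\<lambda>v. Y 1 z * cnj (Y' 0 * v) - Y' 0 * v * cnj (Y 2 z))) (at z)" by (simp add: Y0)
  have "((\<lambda>w. mnum2 (\<lambda>i. Y i w)) has_derivative (\<lambda>v. (Y 2 z * cnj (Y' 0 * v) + Y' 2 * v * cnj (Y 0 z)) + (Y 0 z * cnj (Y' 1 * v) + Y' 0 * v * cnj (Y 1 z)))) (at z)"
    unfolding mnum2_def by (intro has_derivative_diff has_derivative_add has_derivative_mult has_derivative_cnj Y')
  then have d2: "((\<lambda>w. mnum2 (\<lambda>i. Y i w)) has_derivative (\<lambda>v. Y 2 z * cnj (Y' 0 * v) + Y' 0 * v * cnj (Y 1 z))) (at z)" by (simp add: Y0)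
  have "((\<lambda>w. Y 0 w * cnj (Y 0 w)) has_derivative (\<lambda>v. Y 0 z * cnj (Y' 0 * v) + Y' 0 * v * cnj (Y 0 z))) (at z)"
    by (intro has_derivative_mult has_derivative_cnj Y')
  then have d0: "((\<lambda>w. Y 0 w * cnj (Y 0 w)) has_derivative (\<lambda>v. 0)) (at z)" by (simp add: Y0)
  have n0: "mnum1 (\<lambda>i. Y i z) = 0" "mnum2 (\<lambda>i. Y i z) = 0" by (simp_all add: mnum1_def mnum2_def Y0)
  define D where "D v = ((Y 1 z * cnj (Y' 0 * v) - Y' 0 * v * cnj (Y 2 z)) / W z, (Y 2 z * cnj (Y' 0 * v) + Y' 0 * v * cnj (Y 1 z)) / W z)" for v
  define \<mu> where "\<mu> = 2 * (norm (Y' 0))\<^sup>2 * ((norm (Y 1 z))\<^sup>2 + (norm (Y 2 z))\<^sup>2) / (norm (W z))\<^sup>2"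
  have q: "(d * W z - 0 * dw) / (W z * W z) = d / W z" for d dw using Wnz by simp
  have "((\<lambda>w. lag_map (\<lambda>i. Y i w)) has_derivative (\<lambda>v. (((Y 1 z * cnj (Y' 0 * v) - Y' 0 * v * cnj (Y 2 z)) * W z - mnum1 (\<lambda>i. Y i z) * dW v) / (W z * W z),
      ((Y 2 z * cnj (Y' 0 * v) + Y' 0 * v * cnj (Y 1 z)) * W z - mnum2 (\<lambda>i. Y i z) * dW v) / (W z * W z)))) (at z)"
    unfolding lag_map_def W_def[symmetric] by (intro has_derivative_Pair has_derivative_divide' d1 d2 dW Wnz)
  then have "((\<lambda>w. lag_map (\<lambda>i. Y i w)) has_derivative D) (at z)" unfolding n0 q D_def[abs_def] .
  moreover have "\<mu> > 0" using Y0 Wnz nz by (auto simp: \<mu>_def add_pos_nonneg add_nonneg_pos intro!: divide_pos_pos mult_pos_pos)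
  moreover have "fst (D u) * cnj (fst (D v)) + snd (D u) * cnj (snd (D v)) = of_real (\<mu> * (u \<bullet> v))" for u v
  proof -
    have "fst (D u) * cnj (fst (D v)) + snd (D u) * cnj (snd (D v)) =
      ((Y 1 z * cnj (Y' 0 * u) - Y' 0 * u * cnj (Y 2 z)) * cnj (Y 1 z * cnj (Y' 0 * v) - Y' 0 * v * cnj (Y 2 z)) +
      (Y 2 z * cnj (Y' 0 * u) + Y' 0 * u * cnj (Y 1 z)) * cnj (Y 2 z * cnj (Y' 0 * v) + Y' 0 * v * cnj (Y 1 z))) / (W z * cnj (W z))"
      unfolding D_def fst_conv snd_conv by (rule hermitian_divide)
    also have "\<dots> = (Y' 0 * cnj (Y' 0)) * (Y 1 z * cnj (Y 1 z) + Y 2 z * cnj (Y 2 z)) * (u * cnj v + cnj u * v) / (W z * cnj (W z))"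
      by (simp add: algebra_simps)
    also have "\<dots> = of_real (\<mu> * (u \<bullet> v))"
      unfolding cnj_inner complex_norm_square[symmetric] \<mu>_def by simp
    finally show ?thesis .
  qed
  moreover have "((\<lambda>w. lag_potential (\<lambda>i. Y i w)) has_derivative (\<lambda>v. liouville (lag_map (\<lambda>i. Y i z)) (D v))) (at z)"
  proof -
    have "((\<lambda>w. Im (Y 0 w * cnj (Y 0 w) / W w) / 4) has_derivative (\<lambda>v. Im ((0 * W z - (Y 0 z * cnj (Y 0 z)) * dW v) / (W z * W z)) / 4)) (at z)"
      by (intro bounded_linear.has_derivative[OF bounded_linear_divide] has_derivative_Im_part has_derivative_divide' dW d0 Wnz)
    then show ?thesis unfolding lag_potential_def W_def[symmetric] by (simp add: lag_map_def liouville_def n0 Y0)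
  qed
  ultimately show ?thesis unfolding conformal_exact_at_def by blast
qed

lemma lag_map_derivative:
  assumes S: "open S" "z \<in> S" and Y: "\<And>i. Y i holomorphic_on S" and regular_at: "regular_at Y z"
  shows "conformal_exact_at (\<lambda>w. lag_map (\<lambda>i. Y i w)) (\<lambda>w. lag_potential (\<lambda>i. Y i w)) z"
proof (cases "Y 0 z = 0")
  case True
  show ?thesis
    by (rule lag_map_derivative_at_zero[where Y=Y and Y'="\<lambda>i. deriv (Y i) z"])
       (use regular_at True in \<open>auto simp: regular_at_def intro: holomorphic_derivI[OF Y S]\<close>)
next
  case False
  have dY: "(Y i has_field_derivative deriv (Y i) z) (at z)" for i by (rule holomorphic_derivI[OF Y S])
  define T where "T = S \<inter> Y 0 -` (- {0})"
  have T: "open T" "z \<in> T" unfolding T_def using S False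
    by (auto intro!: continuous_open_preimage holomorphic_on_imp_continuous_on Y)
  define q where "q i w = Y i w / Y 0 w" for i w
  define q' where "q' i = (deriv (Y i) z * Y 0 z - Y i z * deriv (Y 0) z) / (Y 0 z * Y 0 z)" for i
  have q: "(q i has_field_derivative q' i) (at z)" for i
    unfolding q_def[abs_def] q'_def by (intro DERIV_divide dY False)
  have cp: "contact_form (\<lambda>i. Y i z) (\<lambda>i. deriv (Y i) z) = 0" using regular_at by (simp add: regular_at_def)
  have e: "q' 3 = q 1 z * q' 2 - q 2 z * q' 1"
  proof -
    have k: "Y 0 z * deriv (Y 3) z - Y 3 z * deriv (Y 0) z = Y 1 z * deriv (Y 2) z - Y 2 z * deriv (Y 1) z"
      using cp by (simp add: contact_form_def algebra_simps)
    have "q 1 z * q' 2 - q 2 z * q' 1 = (Y 1 z * (deriv (Y 2) z * Y 0 z - Y 2 z * deriv (Y 0) z) - Y 2 z * (deriv (Y 1) z * Y 0 z - Y 1 z * deriv (Y 0) z)) / (Y 0 z * (Y 0 z * Y 0 z))"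
      unfolding q_def q'_def times_divide_times_eq diff_divide_distrib[symmetric] by (rule refl)
    also have "Y 1 z * (deriv (Y 2) z * Y 0 z - Y 2 z * deriv (Y 0) z) - Y 2 z * (deriv (Y 1) z * Y 0 z - Y 1 z * deriv (Y 0) z) =
       Y 0 z * (Y 1 z * deriv (Y 2) z - Y 2 z * deriv (Y 1) z)" by (simp add: algebra_simps)
    also have "\<dots> / (Y 0 z * (Y 0 z * Y 0 z)) = (Y 1 z * deriv (Y 2) z - Y 2 z * deriv (Y 1) z) / (Y 0 z * Y 0 z)"
      using False by (intro mult_divide_mult_cancel_left)
    finally show ?thesis unfolding k[symmetric] q'_def by (simp add: mult.commute)
  qed
  have h3: "(q 3 has_field_derivative q 1 z * q' 2 - q 2 z * q' 1) (at z)" using q[of 3] unfolding e .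
  have nz: "q' 1 \<noteq> 0 \<or> q' 2 \<noteq> 0" "q 1 z \<noteq> 0 \<or> q 2 z \<noteq> 0" using regular_at False by (auto simp: regular_at_def q'_def q_def)
  have sc: "lag_map (\<lambda>i. Y i w) = lag_map (vec4 1 (q 1 w) (q 2 w) (q 3 w))" "lag_potential (\<lambda>i. Y i w) = lag_potential (vec4 1 (q 1 w) (q 2 w) (q 3 w))" if "w \<in> T" for w
  proof -
    have n: "Y 0 w \<noteq> 0" using that by (simp add: T_def)
    have s: "Y i w = Y 0 w * vec4 1 (q 1 w) (q 2 w) (q 3 w) i" if "i < 4" for i
      using less_4_cases[OF that] n by (elim disjE) (simp_all add: q_def)
    show "lag_map (\<lambda>i. Y i w) = lag_map (vec4 1 (q 1 w) (q 2 w) (q 3 w))" "lag_potential (\<lambda>i. Y i w) = lag_potential (vec4 1 (q 1 w) (q 2 w) (q 3 w))"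
      by (rule lag_map_scale[OF n s], assumption)+
  qed
  have "conformal_exact_at (\<lambda>w. lag_map (vec4 1 (q 1 w) (q 2 w) (q 3 w))) (\<lambda>w. lag_potential (vec4 1 (q 1 w) (q 2 w) (q 3 w))) z"
    by (rule lag_map_derivative_affine[OF q q h3 nz])
  then show ?thesis by (rule conformal_exact_at_cong[OF T, rotated 2]) (simp_all add: sc)
qed

section \<open>The primitive of the symplectic form and the geometry of the map\<close>

lemma bounded_linear_liouville: "bounded_linear (\<lambda>p. liouville p v)"
  unfolding liouville_def
  by (intro bounded_linear_compose[OF bounded_linear_divide] bounded_linear_compose[OF bounded_linear_Im] bounded_linear_add
      bounded_linear_compose[OF bounded_linear_mult_left] bounded_linear_compose[OF bounded_linear_cnj] bounded_linear_fst bounded_linear_snd)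

lemma smooth_one_form_liouville: "smooth_one_form liouville"
  unfolding smooth_one_form_def
proof (intro conjI allI)
  show "linear (liouville p)" for p
    by (rule linearI) (simp_all add: liouville_def field_simps)
  show "smooth_on UNIV (\<lambda>p. liouville p v)" for v
    by (simp add: smooth_on_def times_differentiable_on_bounded_linear[OF bounded_linear_liouville] times_differentiable_on_ident)
qed

lemma exterior_derivative_liouville: "exterior_derivative liouville = (\<lambda>p. symplectic_form)"
proof (intro ext)
  fix p v w :: "complex \<times> complex"
  have "frechet_derivative (\<lambda>q. liouville q u) (at p) = (\<lambda>q. liouville q u)" for u
    by (rule frechet_derivativeI[OF bounded_linear_imp_has_derivative[OF bounded_linear_liouville]])
  then show "exterior_derivative liouville p v w = symplectic_form v w"
    by (simp add: exterior_derivative_def liouville_def symplectic_form_def field_simps)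
qed

context compact_surface
begin

lemma lift_everywhere:
  assumes \<phi>: "lifted_curve \<phi>"
    and c: "c \<in> A" and z: "z \<in> chart_image c"
  obtains T Y where "open T" "z \<in> T" "T \<subseteq> chart_image c" "curve_lift \<phi> c T Y"
proof -
  have zi: "z \<in> snd c ` fst c" using z by (simp add: chart_image_def)
  have x: "par c z \<in> fst c" by (rule par_mem[OF zi])
  then have "par c z \<in> topspace X" using chart_sub[OF c] by blast
  then obtain d Y where d: "d \<in> A" "par c z \<in> fst d" "snd d ` fst d = ball 0 4" and Y: "curve_lift \<phi> d (ball 0 4) Y" using \<phi> unfolding lifted_curve_def by blast
  define T where "T = snd c ` (fst c \<inter> fst d)"
  have T: "open T" unfolding T_def by (intro overlap_open c chart_open d)
  have zT: "z \<in> T" unfolding T_def using x d(2) crd_par[OF zi] by (metis IntI imageI)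
  have "curve_lift \<phi> c T (\<lambda>i w. Y i (snd d (par c w)))"
  proof (rule curve_lift_transport[OF c d(1) open_ball Y T])
    show "T \<subseteq> snd c ` (fst c \<inter> fst d)" by (simp add: T_def)
    fix w assume "w \<in> T"
    then have "par c w \<in> fst d" unfolding T_def using trans_image(1)[OF c d(1)] by blast
    then show "snd d (par c w) \<in> ball 0 4" using d(3) by blast
  qed
  then show ?thesis using T zT by (intro that) (auto simp: T_def chart_image_def)
qed

theorem curve_map_geometry:
  assumes \<phi>: "lifted_curve \<phi>"
  defines "F \<equiv> \<lambda>x. lag_map (\<lambda>i. \<phi> i x)"
  shows "immersion A F" "conformal A F" "exact_lagrangian A F"
proof -
  define h where "h = (\<lambda>x. lag_potential (\<lambda>i. \<phi> i x))"
  have loc: "smooth_on T (in_chart c F)" "smooth_on T (in_chart c h)"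
     "conformal_exact_at (in_chart c F) (in_chart c h) z"
    if T: "open T" "z \<in> T" and L: "curve_lift \<phi> c T Y" for c T Y z
  proof -
    have Yh: "Y i holomorphic_on T" and g: "w \<in> T \<Longrightarrow> regular_at Y w" for i w using L by (auto simp: curve_lift_def)
    have e: "in_chart c F w = lag_map (\<lambda>i. Y i w)" "in_chart c h w = lag_potential (\<lambda>i. Y i w)" if "w \<in> T" for w
    proof -
      have "\<exists>l. l \<noteq> 0 \<and> (\<forall>i<4. \<phi> i (par c w) = l * Y i w)" using L that by (simp add: curve_lift_def)
      then obtain l where "l \<noteq> 0 \<and> (\<forall>i<4. \<phi> i (par c w) = l * Y i w)" by (rule exE)
      then have l: "l \<noteq> 0" "\<And>i. i < 4 \<Longrightarrow> \<phi> i (par c w) = l * Y i w" by simp_all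
      show "in_chart c F w = lag_map (\<lambda>i. Y i w)" "in_chart c h w = lag_potential (\<lambda>i. Y i w)"
        using lag_map_scale[of l "\<lambda>i. \<phi> i (par c w)" "\<lambda>i. Y i w", OF l] by (simp_all add: in_chart_def F_def h_def)
    qed
    have den: "mden (\<lambda>i. Y i w) \<noteq> 0" if "w \<in> T" for w using g[OF that] by (intro mden_nonzero) (auto simp: regular_at_def)
    note sm = times_differentiable_on_add times_differentiable_on_diff times_differentiable_on_mult times_differentiable_on_const
      times_differentiable_on_bounded_linear[OF bounded_linear_cnj] times_differentiable_on_holomorphic Yh T(1)
    have "times_differentiable_on n T (in_chart c F)" "times_differentiable_on n T (in_chart c h)" for n
    proof -
      have s: "times_differentiable_on n T (\<lambda>w. mden (\<lambda>i. Y i w))" "times_differentiable_on n T (\<lambda>w. mnum1 (\<lambda>i. Y i w))"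
        "times_differentiable_on n T (\<lambda>w. mnum2 (\<lambda>i. Y i w))" "times_differentiable_on n T (\<lambda>w. Y 0 w * cnj (Y 0 w))"
        unfolding mden_def mnum1_def mnum2_def by (intro sm)+
      note q = times_differentiable_on_divide[OF T(1) _ s(1) den]
      show "times_differentiable_on n T (in_chart c F)"
        by (rule times_differentiable_on_cong[OF T(1) _ times_differentiable_on_Pair[OF T(1) q[OF s(2)] q[OF s(3)]]]) (simp_all add: e lag_map_def)
      show "times_differentiable_on n T (in_chart c h)"
        by (rule times_differentiable_on_cong[OF T(1) _ times_differentiable_on_bounded_linear[OF bounded_linear_divide[of 4] T(1)
          times_differentiable_on_bounded_linear[OF bounded_linear_Im T(1) q[OF s(4)]]]]) (simp_all add: e lag_potential_def)
    qed
    then show "smooth_on T (in_chart c F)" "smooth_on T (in_chart c h)" by (simp_all add: smooth_on_def)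
    show "conformal_exact_at (in_chart c F) (in_chart c h) z"
      by (rule conformal_exact_at_cong[OF T _ _ lag_map_derivative[OF T Yh g[OF T(2)]]]) (simp_all add: e)
  qed
  have nbhd: "\<exists>T. open T \<and> z \<in> T \<and> times_differentiable_on n T (in_chart c F)" "\<exists>T. open T \<and> z \<in> T \<and> times_differentiable_on n T (in_chart c h)"
    if c: "c \<in> A" "z \<in> chart_image c" for c z n
  proof -
    obtain T Y where T: "open T" "z \<in> T" and "T \<subseteq> chart_image c" and L: "curve_lift \<phi> c T Y" by (rule lift_everywhere[OF \<phi> c])
    show "\<exists>T. open T \<and> z \<in> T \<and> times_differentiable_on n T (in_chart c F)" "\<exists>T. open T \<and> z \<in> T \<and> times_differentiable_on n T (in_chart c h)"
      using T loc(1,2)[OF T L] by (intro exI[of _ T]; simp add: smooth_on_def)+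
  qed
  have smooth: "smooth_map A F" "smooth_map A h"
    unfolding smooth_map_def smooth_on_def by (intro ballI allI times_differentiable_on_local nbhd; assumption)+
  have diff: "\<exists>\<mu>. linear (differential c F z) \<and> \<mu> > 0 \<and>
     (\<forall>u v. fst (differential c F z u) * cnj (fst (differential c F z v)) + snd (differential c F z u) * cnj (snd (differential c F z v)) = of_real (\<mu> * (u \<bullet> v))) \<and>
     (\<forall>v. differential c h z v = liouville (in_chart c F z) (differential c F z v))"
    if c: "c \<in> A" "z \<in> chart_image c" for c z
  proof -
    obtain T Y where T: "open T" "z \<in> T" and "T \<subseteq> chart_image c" and L: "curve_lift \<phi> c T Y" by (rule lift_everywhere[OF \<phi> c])
    obtain D \<mu> where D: "(in_chart c F has_derivative D) (at z)" "\<mu> > 0"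
      "\<forall>u v. fst (D u) * cnj (fst (D v)) + snd (D u) * cnj (snd (D v)) = of_real (\<mu> * (u \<bullet> v))"
      "(in_chart c h has_derivative (\<lambda>v. liouville (in_chart c F z) (D v))) (at z)"
      using loc(3)[OF T L] unfolding conformal_exact_at_def by blast
    have "differential c F z = D" "differential c h z = (\<lambda>v. liouville (in_chart c F z) (D v))"
      unfolding differential_def by (rule frechet_derivativeI[OF D(1)], rule frechet_derivativeI[OF D(4)])
    then show ?thesis using D has_derivative_linear[OF D(1)] by auto
  qed
  have inner: "x \<bullet> y = Re (fst x * cnj (fst y) + snd x * cnj (snd y))" "symplectic_form x y = - Im (fst x * cnj (fst y) + snd x * cnj (snd y))"
    for x y :: "complex \<times> complex" by (simp_all add: inner_prod_def inner_complex_def symplectic_form_def)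
  have conf: "\<exists>\<mu>>0. \<forall>v w. differential c F z v \<bullet> differential c F z w = \<mu> * (v \<bullet> w)" if c: "c \<in> A" "z \<in> chart_image c" for c z
  proof -
    obtain \<mu> where \<mu>: "\<mu> > 0" "\<forall>u v. fst (differential c F z u) * cnj (fst (differential c F z v)) + snd (differential c F z u) * cnj (snd (differential c F z v)) = of_real (\<mu> * (u \<bullet> v))"
      using diff[OF c] by blast
    show ?thesis by (rule exI[of _ \<mu>]) (simp only: inner \<mu> Re_complex_of_real simp_thms)
  qed
  then show "conformal A F" by (simp add: conformal_def)
  show "immersion A F"
    unfolding immersion_def
  proof (intro conjI smooth ballI)
    fix c z assume c: "c \<in> A" "z \<in> chart_image c"
    obtain \<mu> where \<mu>: "\<mu> > 0" "\<forall>v w. differential c F z v \<bullet> differential c F z w = \<mu> * (v \<bullet> w)" using conf[OF c] by blast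
    have lin: "linear (differential c F z)" using diff[OF c] by blast
    have "v = 0" if "differential c F z v = 0" for v
    proof -
      have "\<mu> * (v \<bullet> v) = 0" using \<mu>(2)[rule_format, of v v] that by simp
      then show ?thesis using \<mu>(1) by simp
    qed
    then show "inj (differential c F z)" using linear_injective_0[OF lin] by blast
  qed
  have "symplectic_form (differential c F z v) (differential c F z w) = 0" if c: "c \<in> A" "z \<in> chart_image c" for c z v w
  proof -
    obtain \<mu> where "\<forall>u v. fst (differential c F z u) * cnj (fst (differential c F z v)) + snd (differential c F z u) * cnj (snd (differential c F z v)) = of_real (\<mu> * (u \<bullet> v))"
      using diff[OF c] by blast
    then show ?thesis by (simp only: inner Im_complex_of_real minus_zero)
  qed
  then have "lagrangian A F" by (simp add: lagrangian_def)
  moreover have "pullback_exact A F liouville"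
    unfolding pullback_exact_def
    by (rule exI[of _ h]) (use smooth(2) diff in blast)
  ultimately show "exact_lagrangian A F"
    unfolding exact_lagrangian_def using smooth_one_form_liouville exterior_derivative_liouville by blast
qed

end

section \<open>Algebraic relations\<close>

text \<open>Homogeneous polynomials of degree n in the first four coordinates, kept as functions and
  generated by rules so that induction replaces monomial expansions.\<close>

inductive hform :: "nat \<Rightarrow> ((nat \<Rightarrow> complex) \<Rightarrow> complex) \<Rightarrow> bool" where
  hform_const: "hform 0 (\<lambda>x. c)"
| hform_var: "hform n P \<Longrightarrow> i < 4 \<Longrightarrow> hform (Suc n) (\<lambda>x. x i * P x)"
| hform_add: "hform n P \<Longrightarrow> hform n Q \<Longrightarrow> hform n (\<lambda>x. P x + Q x)"

lemma hform_scale: "hform n P \<Longrightarrow> hform n (\<lambda>x. c * P x)"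
proof (induction rule: hform.induct)
  case (hform_const d) show ?case by (rule hform.hform_const)
next
  case (hform_var n P i)
  then show ?case using hform.hform_var[of n "\<lambda>x. c * P x" i] by (simp add: mult.left_commute)
next
  case (hform_add n P Q)
  then show ?case using hform.hform_add[of n "\<lambda>x. c * P x" "\<lambda>x. c * Q x"] by (simp add: distrib_left)
qed

lemma hform_mult: "hform m P \<Longrightarrow> hform n Q \<Longrightarrow> hform (m + n) (\<lambda>x. P x * Q x)"
proof (induction rule: hform.induct)
  case (hform_const d) then show ?case by (simp add: hform_scale)
next
  case (hform_var m P i)
  then show ?case using hform.hform_var[of "m + n" "\<lambda>x. P x * Q x" i] by (simp add: mult.assoc)
next
  case (hform_add m P R)
  then show ?case using hform.hform_add[of "m + n" "\<lambda>x. P x * Q x" "\<lambda>x. R x * Q x"] by (simp add: distrib_right)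
qed

lemma hform_zero: "hform n (\<lambda>x. 0)"
proof (induction n)
  case 0 show ?case by (rule hform_const)
next
  case (Suc n) then show ?case using hform_var[of n "\<lambda>x. 0" 0] by simp
qed

lemma hform_coord: "i < 4 \<Longrightarrow> hform 1 (\<lambda>x. x i)"
  using hform_var[OF hform_const[of 1]] by simp

lemma hform_cnj: "hform n P \<Longrightarrow> hform n (\<lambda>x. cnj (P (\<lambda>i. cnj (x i))))"
proof (induction rule: hform.induct)
  case (hform_const d) show ?case by (rule hform.hform_const)
next
  case (hform_var n P i)
  then show ?case using hform.hform_var[OF hform_var.IH hform_var.hyps(2)] by simp
next
  case (hform_add n P Q)
  then show ?case using hform.hform_add[OF hform_add.IH] by simp
qed

lemma hform_homogeneous: "hform n P \<Longrightarrow> (\<And>i. i < 4 \<Longrightarrow> x i = l * y i) \<Longrightarrow> P x = l ^ n * P y"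
  by (induction rule: hform.induct) (simp_all add: algebra_simps)

lemma hform_holomorphic: "hform n P \<Longrightarrow> (\<And>i. Y i holomorphic_on S) \<Longrightarrow> (\<lambda>z. P (\<lambda>i. Y i z)) holomorphic_on S"
  by (induction rule: hform.induct) (auto intro!: holomorphic_intros)

lemma hform_bound: "hform n P \<Longrightarrow> \<exists>B\<ge>0. \<forall>x. norm (P x) \<le> B * (\<Sum>i<4. norm (x i)) ^ n"
proof (induction rule: hform.induct)
  case (hform_const d) show ?case by (rule exI[of _ "norm d"]) simp
next
  case (hform_var n P i)
  then obtain B where B: "B \<ge> 0" "\<And>x. norm (P x) \<le> B * (\<Sum>i<4. norm (x i)) ^ n" by blast
  have "norm (x i * P x) \<le> B * (\<Sum>i<4. norm (x i)) ^ Suc n" for x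
  proof -
    have "norm (x i) \<le> (\<Sum>i<4. norm (x i))" using hform_var.hyps(2) by (intro member_le_sum) auto
    then have "norm (x i) * norm (P x) \<le> (\<Sum>i<4. norm (x i)) * (B * (\<Sum>i<4. norm (x i)) ^ n)"
      using B by (intro mult_mono) (auto intro: sum_nonneg)
    then show ?thesis by (simp add: norm_mult mult_ac)
  qed
  then show ?case using B(1) by blast
next
  case (hform_add n P Q)
  then obtain B C where B: "B \<ge> 0" "\<And>x. norm (P x) \<le> B * (\<Sum>i<4. norm (x i)) ^ n"
    and C: "C \<ge> 0" "\<And>x. norm (Q x) \<le> C * (\<Sum>i<4. norm (x i)) ^ n" by blast
  have "norm (P x + Q x) \<le> (B + C) * (\<Sum>i<4. norm (x i)) ^ n" for x
    using norm_triangle_le[OF add_mono[OF B(2) C(2)]] by (simp add: distrib_right)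
  then show ?case using B(1) C(1) by (intro exI[of _ "B + C"]) auto
qed

text \<open>Polynomials of bidegree (n, n); the second argument will be the conjugate of the
  first.\<close>

inductive biform :: "nat \<Rightarrow> ((nat \<Rightarrow> complex) \<Rightarrow> (nat \<Rightarrow> complex) \<Rightarrow> complex) \<Rightarrow> bool" where
  biform_prod: "hform n P \<Longrightarrow> hform n R \<Longrightarrow> biform n (\<lambda>x y. P x * R y)"
| biform_add: "biform n Q \<Longrightarrow> biform n R \<Longrightarrow> biform n (\<lambda>x y. Q x y + R x y)"

lemma biform_scale: "biform n Q \<Longrightarrow> biform n (\<lambda>x y. c * Q x y)"
proof (induction rule: biform.induct)
  case (biform_prod n P R)
  then show ?case using biform.biform_prod[OF hform_scale[of n P c], of R] by (simp add: mult.assoc)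
next
  case (biform_add n Q R)
  then show ?case using biform.biform_add[OF biform_add.IH] by (simp add: distrib_left)
qed

lemma biform_const: "biform 0 (\<lambda>x y. c)"
  using biform_prod[OF hform_const[of c] hform_const[of 1]] by simp

lemma biform_zero: "biform n (\<lambda>x y. 0)"
  using biform_prod[OF hform_zero hform_zero, of n] by simp

lemma biform_prod_mult: "biform n Q \<Longrightarrow> hform m P \<Longrightarrow> hform m R \<Longrightarrow> biform (m + n) (\<lambda>x y. P x * R y * Q x y)"
proof (induction rule: biform.induct)
  case (biform_prod n P' R')
  then show ?case using biform.biform_prod[OF hform_mult[of m P n P'] hform_mult[of m R n R']] by (simp add: mult_ac)
next
  case (biform_add n Q Q')
  then show ?case using biform.biform_add[of "m + n" "\<lambda>x y. P x * R y * Q x y" "\<lambda>x y. P x * R y * Q' x y"] by (simp add: distrib_left)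
qed

lemma biform_mult: "biform m Q \<Longrightarrow> biform n R \<Longrightarrow> biform (m + n) (\<lambda>x y. Q x y * R x y)"
proof (induction rule: biform.induct)
  case (biform_prod m P R') then show ?case by (intro biform_prod_mult)
next
  case (biform_add m Q Q')
  then show ?case using biform.biform_add[of "m + n" "\<lambda>x y. Q x y * R x y" "\<lambda>x y. Q' x y * R x y"] by (simp add: distrib_right)
qed

lemma biform_sum: "(\<And>a. a \<in> I \<Longrightarrow> biform n (Q a)) \<Longrightarrow> biform n (\<lambda>x y. \<Sum>a\<in>I. Q a x y)"
proof (induction I rule: infinite_finite_induct)
  case (insert a I)
  then show ?case using biform_add[of n "Q a" "\<lambda>x y. \<Sum>a\<in>I. Q a x y"] by simp
qed (simp_all add: biform_zero)

lemma biform_left: "biform n Q \<Longrightarrow> hform n (\<lambda>x. Q x y)"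
proof (induction rule: biform.induct)
  case (biform_prod n P R) then show ?case using hform_scale[of n P "R y"] by (simp add: mult.commute)
qed (rule hform_add)

lemma biform_right: "biform n Q \<Longrightarrow> hform n (\<lambda>y. Q x y)"
proof (induction rule: biform.induct)
  case (biform_prod n P R) then show ?case by (intro hform_scale)
qed (rule hform_add)

lemma biform_coords: "i < 4 \<Longrightarrow> j < 4 \<Longrightarrow> biform 1 (\<lambda>x y. x i * y j)"
  by (intro biform_prod hform_coord)

text \<open>A bound linear in the degree is the mark of a curve: Bezout's theorem would give it for
  an algebraic one. The constant must not depend on n.\<close>

definition determined :: "'m set \<Rightarrow> ('m \<Rightarrow> nat \<Rightarrow> complex) \<Rightarrow> bool" where
  "determined M \<phi> \<longleftrightarrow> (\<exists>C::nat. \<forall>n. \<exists>T\<subseteq>M. finite T \<and> card T \<le> C * (n + 1) \<and>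
     (\<forall>P. hform n P \<longrightarrow> (\<forall>t\<in>T. P (\<phi> t) = 0) \<longrightarrow> (\<forall>x\<in>M. P (\<phi> x) = 0)))"

text \<open>Vanishing on \<open>T \<times> T\<close> spreads first along the first argument with the
  second fixed in \<open>T\<close>, then along the second, which becomes a holomorphic form after
  conjugation. The diagonal is the case of interest.\<close>

lemma biform_determined:
  assumes T: "\<And>P. hform n P \<Longrightarrow> (\<forall>t\<in>T. P (\<phi> t) = 0) \<Longrightarrow> (\<forall>x\<in>M. P (\<phi> x) = 0)"
    and Q: "biform n Q" and 0: "\<And>s t. s \<in> T \<Longrightarrow> t \<in> T \<Longrightarrow> Q (\<phi> s) (\<lambda>i. cnj (\<phi> t i)) = 0"
    and x: "x \<in> M" "y \<in> M"
  shows "Q (\<phi> x) (\<lambda>i. cnj (\<phi> y i)) = 0"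
proof -
  have 1: "Q (\<phi> x) (\<lambda>i. cnj (\<phi> t i)) = 0" if "t \<in> T" for t
    using T[OF biform_left[OF Q, of "\<lambda>i. cnj (\<phi> t i)"]] 0 that x by blast
  have "hform n (\<lambda>y. cnj (Q (\<phi> x) (\<lambda>i. cnj (y i))))" by (rule hform_cnj[OF biform_right[OF Q]])
  then have "cnj (Q (\<phi> x) (\<lambda>i. cnj (\<phi> y i))) = 0" using T[of "\<lambda>y. cnj (Q (\<phi> x) (\<lambda>i. cnj (y i)))"] 1 x by simp
  then show ?thesis by simp
qed

text \<open>\<open>f\<close> is a bihomogeneous form of bidegree \<open>(2e, 2e)\<close> divided by \<open>g ^ e\<close>.\<close>

definition numerator_form :: "'m set \<Rightarrow> ('m \<Rightarrow> nat \<Rightarrow> complex) \<Rightarrow> ('m \<Rightarrow> complex) \<Rightarrow> nat \<Rightarrow> ('m \<Rightarrow> complex) \<Rightarrow> bool" where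
  "numerator_form M \<phi> g e f \<longleftrightarrow> (\<exists>Q. biform (2 * e) Q \<and> (\<forall>x\<in>M. f x * g x ^ e = Q (\<phi> x) (\<lambda>i. cnj (\<phi> x i))))"

lemma numerator_const: "numerator_form M \<phi> g 0 (\<lambda>x. c)"
  unfolding numerator_form_def by (rule exI[of _ "\<lambda>x y. c"]) (simp add: biform_const)

lemma numerator_mult:
  assumes "numerator_form M \<phi> g d f" "numerator_form M \<phi> g e h"
  shows "numerator_form M \<phi> g (d + e) (\<lambda>x. f x * h x)"
proof -
  obtain Q R where Q: "biform (2 * d) Q" "\<And>x. x \<in> M \<Longrightarrow> f x * g x ^ d = Q (\<phi> x) (\<lambda>i. cnj (\<phi> x i))"
    and R: "biform (2 * e) R" "\<And>x. x \<in> M \<Longrightarrow> h x * g x ^ e = R (\<phi> x) (\<lambda>i. cnj (\<phi> x i))"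
    using assms unfolding numerator_form_def by blast
  have "biform (2 * (d + e)) (\<lambda>x y. Q x y * R x y)" using biform_mult[OF Q(1) R(1)] by (simp add: distrib_left)
  moreover have "f x * h x * g x ^ (d + e) = Q (\<phi> x) (\<lambda>i. cnj (\<phi> x i)) * R (\<phi> x) (\<lambda>i. cnj (\<phi> x i))" if "x \<in> M" for x
    unfolding Q(2)[OF that, symmetric] R(2)[OF that, symmetric] by (simp add: power_add mult_ac)
  ultimately show ?thesis unfolding numerator_form_def by blast
qed

lemma numerator_add:
  assumes "numerator_form M \<phi> g e f" "numerator_form M \<phi> g e h"
  shows "numerator_form M \<phi> g e (\<lambda>x. f x + h x)"
proof -
  obtain Q R where Q: "biform (2 * e) Q" "\<And>x. x \<in> M \<Longrightarrow> f x * g x ^ e = Q (\<phi> x) (\<lambda>i. cnj (\<phi> x i))"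
    and R: "biform (2 * e) R" "\<And>x. x \<in> M \<Longrightarrow> h x * g x ^ e = R (\<phi> x) (\<lambda>i. cnj (\<phi> x i))"
    using assms unfolding numerator_form_def by blast
  then show ?thesis unfolding numerator_form_def
    by (intro exI[of _ "\<lambda>x y. Q x y + R x y"]) (simp add: biform_add distrib_right)
qed

lemma numerator_scale: "numerator_form M \<phi> g e f \<Longrightarrow> numerator_form M \<phi> g e (\<lambda>x. c * f x)"
  using numerator_mult[OF numerator_const, of M \<phi> g e f c] by simp

lemma numerator_raise:
  assumes "numerator_form M \<phi> g 1 (\<lambda>x. 1)" "numerator_form M \<phi> g d f" "d \<le> e"
  shows "numerator_form M \<phi> g e f"
  using assms(3)
proof (induction e rule: dec_induct)
  case (step e) then show ?case using numerator_mult[OF step.IH assms(1)] by simp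
qed (rule assms(2))

lemma numerator_power: "numerator_form M \<phi> g e f \<Longrightarrow> numerator_form M \<phi> g (e * k) (\<lambda>x. f x ^ k)"
proof (induction k)
  case 0 then show ?case by (simp add: numerator_const)
next
  case (Suc k) then show ?case using numerator_mult[of M \<phi> g e f "e * k" "\<lambda>x. f x ^ k"] by simp
qed

lemma numerator_polynomial:
  fixes F :: "'m \<Rightarrow> complex \<times> complex"
  assumes one: "numerator_form M \<phi> g 1 (\<lambda>x. 1)"
    and F: "numerator_form M \<phi> g 1 (\<lambda>x. fst (F x))" "numerator_form M \<phi> g 1 (\<lambda>x. cnj (fst (F x)))"
      "numerator_form M \<phi> g 1 (\<lambda>x. snd (F x))" "numerator_form M \<phi> g 1 (\<lambda>x. cnj (snd (F x)))"
    and p: "real_polynomial_function p"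
  shows "\<exists>e. numerator_form M \<phi> g e (\<lambda>x. of_real (p (F x)))"
  using p
proof (induction rule: real_polynomial_function.induct)
  case (linear p)
  have p: "p v = Re (fst v) * p (1, 0) + Im (fst v) * p (\<i>, 0) + Re (snd v) * p (0, 1) + Im (snd v) * p (0, \<i>)" for v
  proof -
    have "v = Re (fst v) *\<^sub>R (1, 0) + Im (fst v) *\<^sub>R (\<i>, 0) + Re (snd v) *\<^sub>R (0, 1) + Im (snd v) *\<^sub>R (0, \<i>)"
      by (simp add: prod_eq_iff complex_eq_iff)
    then have "p v = p (Re (fst v) *\<^sub>R (1, 0) + Im (fst v) *\<^sub>R (\<i>, 0) + Re (snd v) *\<^sub>R (0, 1) + Im (snd v) *\<^sub>R (0, \<i>))" by (rule arg_cong)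
    then show ?thesis unfolding linear_add[OF bounded_linear.linear[OF linear]] linear_cmul[OF bounded_linear.linear[OF linear]] by simp
  qed
  have re: "of_real (Re z) = (1/2) * z + (1/2) * cnj z" and im: "of_real (Im z) = (- \<i> / 2) * z + (\<i> / 2) * cnj z" for z
    by (simp_all add: complex_eq_iff)
  have "numerator_form M \<phi> g 1 (\<lambda>x. of_real (p (1, 0)) * of_real (Re (fst (F x))) + of_real (p (\<i>, 0)) * of_real (Im (fst (F x))) +
     of_real (p (0, 1)) * of_real (Re (snd (F x))) + of_real (p (0, \<i>)) * of_real (Im (snd (F x))))"
    unfolding re im by (intro numerator_add numerator_scale F)
  then show ?case by (subst p) (auto simp: mult.commute)
next
  case (const c) show ?case by (rule exI) (rule numerator_const)
next
  case (add f h)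
  then obtain d e where "numerator_form M \<phi> g d (\<lambda>x. of_real (f (F x)))" "numerator_form M \<phi> g e (\<lambda>x. of_real (h (F x)))" by blast
  from this[THEN numerator_raise[OF one], of "max d e"] show ?case by (auto dest: numerator_add)
next
  case (mult f h)
  then obtain d e where "numerator_form M \<phi> g d (\<lambda>x. of_real (f (F x)))" "numerator_form M \<phi> g e (\<lambda>x. of_real (h (F x)))" by blast
  from numerator_mult[OF this] show ?case by auto
qed

text \<open>The cube of N against C^2 (6e + 1)^2 times its square: N is taken one larger than that
  constant.\<close>

lemma relation_count:
  fixes C e :: nat
  defines "N \<equiv> C\<^sup>2 * (6 * e + 1)\<^sup>2 + 1"
  shows "(C * (2 * (3 * N * e) + 1))\<^sup>2 < N ^ 3"
proof -
  have N: "N \<ge> 1" by (simp add: N_def)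
  have "2 * (3 * N * e) + 1 \<le> (6 * e + 1) * N" using N by (simp add: algebra_simps)
  then have "(C * (2 * (3 * N * e) + 1))\<^sup>2 \<le> (C * ((6 * e + 1) * N))\<^sup>2" by (intro power_mono mult_left_mono) auto
  also have "\<dots> = (C\<^sup>2 * (6 * e + 1)\<^sup>2) * N\<^sup>2" by (simp only: power_mult_distrib mult.assoc)
  also have "\<dots> < N * N\<^sup>2" using N by (intro mult_strict_right_mono) (auto simp: N_def)
  finally show ?thesis by (simp add: power3_eq_cube power2_eq_square mult.assoc)
qed

definition algebraic_relation :: "'b set \<Rightarrow> ('b \<Rightarrow> real) \<Rightarrow> ('b \<Rightarrow> real) \<Rightarrow> ('b \<Rightarrow> real) \<Rightarrow> bool" where
  "algebraic_relation S q1 q2 q3 \<longleftrightarrow> (\<exists>N c. (\<exists>i<N. \<exists>j<N. \<exists>k<N. c i j k \<noteq> 0) \<and>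
     (\<forall>p\<in>S. (\<Sum>i<N. \<Sum>j<N. \<Sum>k<N. c i j k * q1 p ^ i * q2 p ^ j * q3 p ^ k) = 0))"

lemma algebraic_relationE:
  assumes "algebraic_relation S q1 q2 q3"
  obtains N c where "\<exists>i<N. \<exists>j<N. \<exists>k<N. c i j k \<noteq> 0" "\<forall>p\<in>S. (\<Sum>i<N. \<Sum>j<N. \<Sum>k<N. c i j k * q1 p ^ i * q2 p ^ j * q3 p ^ k) = 0"
proof -
  obtain N c where *: "(\<exists>i<N. \<exists>j<N. \<exists>k<N. c i j k \<noteq> 0) \<and> (\<forall>p\<in>S. (\<Sum>i<N. \<Sum>j<N. \<Sum>k<N. c i j k * q1 p ^ i * q2 p ^ j * q3 p ^ k) = 0)"
    using assms unfolding algebraic_relation_def by iprover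
  show ?thesis by (rule that[OF conjunct1[OF *] conjunct2[OF *]])
qed

text \<open>Brought to a common denominator, the N^3 monomials in the three polynomials become
  bihomogeneous forms. There are more of them than points in \<open>T \<times> T\<close>, so a
  nontrivial combination vanishes on that product and therefore on the whole diagonal.\<close>

theorem polynomial_relation:
  fixes F :: "'m \<Rightarrow> complex \<times> complex"
  assumes det: "determined M \<phi>" and g: "\<And>x. x \<in> M \<Longrightarrow> g x \<noteq> 0"
    and one: "numerator_form M \<phi> g 1 (\<lambda>x. 1)"
    and F: "numerator_form M \<phi> g 1 (\<lambda>x. fst (F x))" "numerator_form M \<phi> g 1 (\<lambda>x. cnj (fst (F x)))"
      "numerator_form M \<phi> g 1 (\<lambda>x. snd (F x))" "numerator_form M \<phi> g 1 (\<lambda>x. cnj (snd (F x)))"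
    and q: "real_polynomial_function q1" "real_polynomial_function q2" "real_polynomial_function q3"
  shows "algebraic_relation (F ` M) q1 q2 q3"
proof -
  obtain e1 e2 e3 where "numerator_form M \<phi> g e1 (\<lambda>x. of_real (q1 (F x)))" "numerator_form M \<phi> g e2 (\<lambda>x. of_real (q2 (F x)))"
    "numerator_form M \<phi> g e3 (\<lambda>x. of_real (q3 (F x)))" using q[THEN numerator_polynomial[OF one F]] by blast
  then have e: "numerator_form M \<phi> g (e1 + e2 + e3) (\<lambda>x. of_real (q1 (F x)))" "numerator_form M \<phi> g (e1 + e2 + e3) (\<lambda>x. of_real (q2 (F x)))"
    "numerator_form M \<phi> g (e1 + e2 + e3) (\<lambda>x. of_real (q3 (F x)))" by (auto intro: numerator_raise[OF one])
  define e where "e = e1 + e2 + e3"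
  obtain C where C: "\<And>n. \<exists>T\<subseteq>M. finite T \<and> card T \<le> C * (n + 1) \<and>
     (\<forall>P. hform n P \<longrightarrow> (\<forall>t\<in>T. P (\<phi> t) = 0) \<longrightarrow> (\<forall>x\<in>M. P (\<phi> x) = 0))" using det unfolding determined_def by blast
  define N where "N = C\<^sup>2 * (6 * e + 1)\<^sup>2 + 1"
  \<comment> \<open>Three factors with exponents below N, each of denominator order e.\<close>
  define n where "n = 3 * N * e"
  obtain T where T: "T \<subseteq> M" "finite T" "card T \<le> C * (2 * n + 1)"
    "\<And>P. hform (2 * n) P \<Longrightarrow> (\<forall>t\<in>T. P (\<phi> t) = 0) \<Longrightarrow> (\<forall>x\<in>M. P (\<phi> x) = 0)" using C[of "2 * n"] by blast
  define mon where "mon a x = complex_of_real (q1 (F x)) ^ fst a * (of_real (q2 (F x)) ^ fst (snd a) * of_real (q3 (F x)) ^ snd (snd a))" for a x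
  define I where "I = {..<N} \<times> {..<N} \<times> {..<N}"
  have "numerator_form M \<phi> g n (mon a)" if "a \<in> I" for a
  proof -
    have "e * fst a \<le> e * N" "e * fst (snd a) \<le> e * N" "e * snd (snd a) \<le> e * N" using that by (auto simp: I_def)
    moreover have "n = e * N + (e * N + e * N)" by (simp add: n_def)
    ultimately have le: "e * fst a + (e * fst (snd a) + e * snd (snd a)) \<le> n" by linarith
    have "numerator_form M \<phi> g (e * fst a + (e * fst (snd a) + e * snd (snd a))) (mon a)"
      unfolding mon_def[abs_def] e_def by (intro numerator_mult numerator_power e)
    then show ?thesis using le by (rule numerator_raise[OF one])
  qed
  then obtain Q where Q: "\<And>a. a \<in> I \<Longrightarrow> biform (2 * n) (Q a)" "\<And>a x. a \<in> I \<Longrightarrow> x \<in> M \<Longrightarrow> mon a x * g x ^ n = Q a (\<phi> x) (\<lambda>i. cnj (\<phi> x i))"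
    unfolding numerator_form_def by metis
  have cT: "card (T \<times> T) < card I"
  proof -
    have "card (T \<times> T) \<le> (C * (2 * n + 1))\<^sup>2" using T(3) by (simp add: card_cartesian_product power2_eq_square mult_mono)
    also have "\<dots> < N ^ 3" unfolding n_def N_def by (rule relation_count)
    finally show ?thesis by (simp add: I_def card_cartesian_product power3_eq_cube)
  qed
  have "\<exists>c. (\<exists>a\<in>I. c a \<noteq> 0) \<and> (\<forall>t\<in>T \<times> T. (\<Sum>a\<in>I. c a * Q a (\<phi> (fst t)) (\<lambda>i. cnj (\<phi> (snd t) i))) = 0)"
    by (rule homogeneous_system_nontrivial[OF _ _ cT]) (simp_all add: I_def T(2))
  then obtain c where c: "\<exists>a\<in>I. c a \<noteq> 0" "\<And>t. t \<in> T \<times> T \<Longrightarrow> (\<Sum>a\<in>I. c a * Q a (\<phi> (fst t)) (\<lambda>i. cnj (\<phi> (snd t) i))) = 0"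
    by blast
  have zero: "(\<Sum>a\<in>I. c a * mon a x) = 0" if x: "x \<in> M" for x
  proof -
    have "(\<Sum>a\<in>I. c a * Q a (\<phi> x) (\<lambda>i. cnj (\<phi> x i))) = 0"
    proof (rule biform_determined[where Q="\<lambda>x y. \<Sum>a\<in>I. c a * Q a x y", OF T(4) _ _ x x])
      show "biform (2 * n) (\<lambda>x y. \<Sum>a\<in>I. c a * Q a x y)" by (intro biform_sum biform_scale Q)
      show "(\<Sum>a\<in>I. c a * Q a (\<phi> s) (\<lambda>i. cnj (\<phi> t i))) = 0" if "s \<in> T" "t \<in> T" for s t using c(2)[of "(s, t)"] that by simp
    qed
    then have "(\<Sum>a\<in>I. c a * mon a x) * g x ^ n = 0" by (simp add: sum_distrib_right Q(2)[OF _ x, symmetric] mult.assoc)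
    then show ?thesis using g[OF x] by simp
  qed
  \<comment> \<open>The monomials take real values, so the real and the imaginary parts of the
    coefficients give relations separately, and one of the two is nontrivial.\<close>
  have rel: "\<exists>d. (\<exists>a\<in>I. d a \<noteq> (0::real)) \<and> (\<forall>x\<in>M. (\<Sum>a\<in>I. d a * (q1 (F x) ^ fst a * (q2 (F x) ^ fst (snd a) * q3 (F x) ^ snd (snd a)))) = 0)"
  proof -
    have m: "mon a x = of_real (q1 (F x) ^ fst a * (q2 (F x) ^ fst (snd a) * q3 (F x) ^ snd (snd a)))" for a x by (simp add: mon_def)
    have "(\<Sum>a\<in>I. Re (c a) * (q1 (F x) ^ fst a * (q2 (F x) ^ fst (snd a) * q3 (F x) ^ snd (snd a)))) = 0"
         "(\<Sum>a\<in>I. Im (c a) * (q1 (F x) ^ fst a * (q2 (F x) ^ fst (snd a) * q3 (F x) ^ snd (snd a)))) = 0" if "x \<in> M" for x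
      using arg_cong[OF zero[OF that], of Re] arg_cong[OF zero[OF that], of Im] unfolding m Re_sum Im_sum by simp_all
    moreover obtain a where "a \<in> I" "Re (c a) \<noteq> 0 \<or> Im (c a) \<noteq> 0" using c(1) by (auto simp: complex_eq_iff)
    ultimately show ?thesis by (elim disjE) (rule exI[of _ "\<lambda>a. Re (c a)"], blast, rule exI[of _ "\<lambda>a. Im (c a)"], blast)
  qed
  then obtain d where d: "\<exists>a\<in>I. d a \<noteq> (0::real)" "\<And>x. x \<in> M \<Longrightarrow> (\<Sum>a\<in>I. d a * (q1 (F x) ^ fst a * (q2 (F x) ^ fst (snd a) * q3 (F x) ^ snd (snd a)))) = 0" by blast
  show ?thesis
    unfolding algebraic_relation_def
  proof (rule exI[of _ N], rule exI[of _ "\<lambda>i j k. d (i, j, k)"], intro conjI ballI)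
    show "\<exists>i<N. \<exists>j<N. \<exists>k<N. d (i, j, k) \<noteq> 0" using d(1) by (auto simp: I_def)
    fix p assume "p \<in> F ` M"
    then obtain x where x: "x \<in> M" "p = F x" by blast
    have "(\<Sum>i<N. \<Sum>j<N. \<Sum>k<N. f (i, j, k)) = sum f I" for f :: "_ \<Rightarrow> real"
      by (simp add: I_def sum.cartesian_product case_prod_unfold)
    from this[of "\<lambda>a. d a * (q1 p ^ fst a * (q2 p ^ fst (snd a) * q3 p ^ snd (snd a)))"] d(2)[OF x(1)]
    show "(\<Sum>i<N. \<Sum>j<N. \<Sum>k<N. d (i, j, k) * q1 p ^ i * q2 p ^ j * q3 p ^ k) = 0"
      by (simp add: x(2) mult.assoc)
  qed
qed

section \<open>Dimension\<close>

lemma algebraic_zero_set: "real_polynomial_function r \<Longrightarrow> real_algebraic_set {x. r x = 0}"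
  unfolding real_algebraic_set_def by (rule exI[of _ "{r}"]) simp

lemma algebraic_Int:
  assumes "real_algebraic_set V" "real_algebraic_set W" shows "real_algebraic_set (V \<inter> W)"
proof -
  obtain P Q where "\<forall>p\<in>P. real_polynomial_function p" "V = {x. \<forall>p\<in>P. p x = 0}"
    "\<forall>p\<in>Q. real_polynomial_function p" "W = {x. \<forall>p\<in>Q. p x = 0}" using assms unfolding real_algebraic_set_def by blast
  then show ?thesis unfolding real_algebraic_set_def by (intro exI[of _ "P \<union> Q"]) auto
qed

lemma algebraic_Un:
  assumes "real_algebraic_set V" "real_algebraic_set W" shows "real_algebraic_set (V \<union> W)"
proof -
  obtain P Q where P: "\<forall>p\<in>P. real_polynomial_function p" "V = {x. \<forall>p\<in>P. p x = 0}"
    and Q: "\<forall>p\<in>Q. real_polynomial_function p" "W = {x. \<forall>p\<in>Q. p x = 0}" using assms unfolding real_algebraic_set_def by blast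
  have "V \<union> W = {x. \<forall>r\<in>{\<lambda>x. p x * q x | p q. p \<in> P \<and> q \<in> Q}. r x = 0}" unfolding P(2) Q(2) by fastforce
  moreover have "\<forall>r\<in>{\<lambda>x. p x * q x | p q. p \<in> P \<and> q \<in> Q}. real_polynomial_function r" using P(1) Q(1) by (auto intro: real_polynomial_function.intros(4))
  ultimately show ?thesis unfolding real_algebraic_set_def by blast
qed

lemma algebraic_separate:
  assumes "real_algebraic_set Z'" "x \<notin> Z'"
  obtains q where "real_polynomial_function q" "\<forall>z\<in>Z'. q z = 0" "q x \<noteq> 0"
  using assms unfolding real_algebraic_set_def by blast

text \<open>\<open>Z\<close> is the union of its intersections with the two zero sets: its vanishing
  ideal is prime.\<close>

lemma irreducible_prime:
  assumes Z: "irreducible_algebraic_set Z" and r: "real_polynomial_function r" "real_polynomial_function s"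
    and 0: "\<And>x. x \<in> Z \<Longrightarrow> r x * s x = 0"
  shows "(\<forall>x\<in>Z. r x = 0) \<or> (\<forall>x\<in>Z. s x = 0)"
proof -
  have "real_algebraic_set (Z \<inter> {x. r x = 0})" "real_algebraic_set (Z \<inter> {x. s x = 0})"
    using Z r by (auto simp: irreducible_algebraic_set_def intro!: algebraic_Int algebraic_zero_set)
  moreover have "Z = (Z \<inter> {x. r x = 0}) \<union> (Z \<inter> {x. s x = 0})" using 0 by auto
  ultimately have "Z = Z \<inter> {x. r x = 0} \<or> Z = Z \<inter> {x. s x = 0}" using Z unfolding irreducible_algebraic_set_def by blast
  then show ?thesis by blast
qed

lemma irreducible_subset_Un:
  assumes Z: "irreducible_algebraic_set Z" and V: "real_algebraic_set V" "real_algebraic_set W" "Z \<subseteq> V \<union> W"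
  shows "Z \<subseteq> V \<or> Z \<subseteq> W"
proof -
  have "real_algebraic_set Z" using Z by (simp add: irreducible_algebraic_set_def)
  then have "real_algebraic_set (Z \<inter> V)" "real_algebraic_set (Z \<inter> W)" by (simp_all add: algebraic_Int V)
  moreover have "Z = (Z \<inter> V) \<union> (Z \<inter> W)" using V by auto
  ultimately have "Z = Z \<inter> V \<or> Z = Z \<inter> W" using Z unfolding irreducible_algebraic_set_def by blast
  then show ?thesis by blast
qed

text \<open>The relation is \<open>q\<close> to the power \<open>i0\<close> times a rest, and as the
  vanishing ideal of \<open>Z\<close> is prime and \<open>q\<close> is not in it, the rest vanishes
  on \<open>Z\<close>. On \<open>Z'\<close>, where \<open>q\<close> is 0, the rest reduces to its
  first coefficient.\<close>

lemma lowest_coefficient_vanishes: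
  assumes Z: "irreducible_algebraic_set Z" and sub: "Z' \<subseteq> Z" and q: "real_polynomial_function q" "\<forall>x\<in>Z'. q x = 0" "x0 \<in> Z" "q x0 \<noteq> 0"
    and g: "\<And>i. real_polynomial_function (g i)" and i0: "i0 < N" "\<And>i x. i < i0 \<Longrightarrow> x \<in> Z \<Longrightarrow> g i x = 0"
    and rel: "\<And>x. x \<in> Z \<Longrightarrow> (\<Sum>i<N. g i x * q x ^ i) = 0"
  shows "\<forall>x\<in>Z'. g i0 x = 0"
proof -
  define s where "s x = (\<Sum>i\<in>{i0..<N}. g i x * q x ^ (i - i0))" for x
  have split: "{..<N} = {..<i0} \<union> {i0..<N}" "{..<i0} \<inter> {i0..<N} = {}" using i0(1) by auto
  have "q x ^ i0 * s x = 0" if x: "x \<in> Z" for x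
  proof -
    have "(\<Sum>i<N. g i x * q x ^ i) = (\<Sum>i<i0. g i x * q x ^ i) + (\<Sum>i\<in>{i0..<N}. g i x * q x ^ i)"
      unfolding split(1) by (rule sum.union_disjoint) (auto simp: split)
    also have "(\<Sum>i<i0. g i x * q x ^ i) = 0" using i0(2) x by (intro sum.neutral) auto
    also have "(\<Sum>i\<in>{i0..<N}. g i x * q x ^ i) = q x ^ i0 * s x"
      unfolding s_def sum_distrib_left by (rule sum.cong) (auto simp: power_add[symmetric] mult.left_commute)
    finally show ?thesis using rel[OF x] by simp
  qed
  moreover have "real_polynomial_function s" unfolding s_def[abs_def] using g q
    by (intro real_polynomial_function_sum real_polynomial_function.intros(4) real_polynomial_function_power) auto
  ultimately have "(\<forall>x\<in>Z. q x ^ i0 = 0) \<or> (\<forall>x\<in>Z. s x = 0)"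
    by (intro irreducible_prime[OF Z] real_polynomial_function_power q)
  then have s0: "\<forall>x\<in>Z. s x = 0" using q(3,4) by auto
  have "s x = g i0 x" if "x \<in> Z'" for x
  proof -
    have "s x = (\<Sum>i\<in>{i0..<N}. if i = i0 then g i0 x else 0)"
      unfolding s_def using q(2) that by (intro sum.cong) auto
    then show ?thesis using i0(1) by simp
  qed
  then show ?thesis using s0 sub by (metis subsetD)
qed

definition three_dependent :: "'b::euclidean_space set \<Rightarrow> bool" where
  "three_dependent S \<longleftrightarrow> (\<forall>q1 q2 q3. real_polynomial_function q1 \<longrightarrow> real_polynomial_function q2 \<longrightarrow> real_polynomial_function q3 \<longrightarrow>
     algebraic_relation S q1 q2 q3)"

text \<open>Each strict inclusion is witnessed by a polynomial that vanishes on the smaller set but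
  not on the larger. In a relation between the three polynomials the lowest coefficient passes down
  the chain, set by set, until a nonzero constant would vanish on the nonempty
  \<open>Z0\<close>.\<close>

lemma no_chain_three_dependent:
  assumes dep: "three_dependent Z3" and irr: "irreducible_algebraic_set Z0" "irreducible_algebraic_set Z1"
      "irreducible_algebraic_set Z2" "irreducible_algebraic_set Z3"
    and sub: "Z0 \<subset> Z1" "Z1 \<subset> Z2" "Z2 \<subset> Z3"
  shows False
proof -
  have alg: "real_algebraic_set Z0" "real_algebraic_set Z1" "real_algebraic_set Z2" using irr by (auto simp: irreducible_algebraic_set_def)
  obtain x1 x2 x3 where x: "x1 \<in> Z1" "x1 \<notin> Z0" "x2 \<in> Z2" "x2 \<notin> Z1" "x3 \<in> Z3" "x3 \<notin> Z2" using sub by blast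
  obtain q3 where q3: "real_polynomial_function q3" "\<forall>z\<in>Z0. q3 z = 0" "q3 x1 \<noteq> 0" using algebraic_separate[OF alg(1) x(2)] by blast
  obtain q2 where q2: "real_polynomial_function q2" "\<forall>z\<in>Z1. q2 z = 0" "q2 x2 \<noteq> 0" using algebraic_separate[OF alg(2) x(4)] by blast
  obtain q1 where q1: "real_polynomial_function q1" "\<forall>z\<in>Z2. q1 z = 0" "q1 x3 \<noteq> 0" using algebraic_separate[OF alg(3) x(6)] by blast
  obtain N c where ex: "\<exists>i<N. \<exists>j<N. \<exists>k<N. c i j k \<noteq> (0::real)"
    and rel: "\<forall>p\<in>Z3. (\<Sum>i<N. \<Sum>j<N. \<Sum>k<N. c i j k * q1 p ^ i * q2 p ^ j * q3 p ^ k) = 0"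
    by (rule algebraic_relationE[OF dep[unfolded three_dependent_def, rule_format, OF q1(1) q2(1) q3(1)]])
  \<comment> \<open>The indices i0, j0, k0 mark the lexicographically first nonzero
    coefficient.\<close>
  define i0 where "i0 = (LEAST i. i < N \<and> (\<exists>j<N. \<exists>k<N. c i j k \<noteq> 0))"
  have i0: "i0 < N" "\<exists>j<N. \<exists>k<N. c i0 j k \<noteq> 0" unfolding i0_def using LeastI_ex[OF ex[unfolded Bex_def]] by blast+
  have i0': "c i j k = 0" if "i < i0" "j < N" "k < N" for i j k
    using not_less_Least[of i "\<lambda>i. i < N \<and> (\<exists>j<N. \<exists>k<N. c i j k \<noteq> 0)"] that i0(1) unfolding i0_def[symmetric] by auto
  define j0 where "j0 = (LEAST j. j < N \<and> (\<exists>k<N. c i0 j k \<noteq> 0))"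
  have j0: "j0 < N" "\<exists>k<N. c i0 j0 k \<noteq> 0" unfolding j0_def using LeastI_ex[OF i0(2)[unfolded Bex_def]] by blast+
  have j0': "c i0 j k = 0" if "j < j0" "k < N" for j k
    using not_less_Least[of j "\<lambda>j. j < N \<and> (\<exists>k<N. c i0 j k \<noteq> 0)"] that j0(1) unfolding j0_def[symmetric] by auto
  define k0 where "k0 = (LEAST k. k < N \<and> c i0 j0 k \<noteq> 0)"
  have k0: "k0 < N" "c i0 j0 k0 \<noteq> 0" unfolding k0_def using LeastI_ex[OF j0(2)[unfolded Bex_def]] by blast+
  have k0': "c i0 j0 k = 0" if "k < k0" for k
    using not_less_Least[of k "\<lambda>k. k < N \<and> c i0 j0 k \<noteq> 0"] that k0(1) unfolding k0_def[symmetric] by auto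
  define g where "g i p = (\<Sum>j<N. \<Sum>k<N. c i j k * q2 p ^ j * q3 p ^ k)" for i p
  have gp: "real_polynomial_function (g i)" for i
    unfolding g_def[abs_def] using q2 q3
    by (intro real_polynomial_function_sum real_polynomial_function.intros(4) real_polynomial_function.intros(2) real_polynomial_function_power) auto
  have 1: "\<forall>p\<in>Z2. g i0 p = 0"
  proof (rule lowest_coefficient_vanishes[OF irr(4) _ q1(1,2) x(5) q1(3) gp i0(1)])
    show "g i p = 0" if "i < i0" for i p unfolding g_def using i0' that by (intro sum.neutral ballI) auto
    show "(\<Sum>i<N. g i p * q1 p ^ i) = 0" if "p \<in> Z3" for p
      using bspec[OF rel that] by (simp add: g_def sum_distrib_right sum_distrib_left mult_ac)
  qed (use sub in blast)
  define h where "h j p = (\<Sum>k<N. c i0 j k * q3 p ^ k)" for j p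
  have hp: "real_polynomial_function (h i)" for i
    unfolding h_def[abs_def] using q3
    by (intro real_polynomial_function_sum real_polynomial_function.intros(4) real_polynomial_function.intros(2) real_polynomial_function_power) auto
  have 2: "\<forall>p\<in>Z1. h j0 p = 0"
  proof (rule lowest_coefficient_vanishes[OF irr(3) _ q2(1,2) x(3) q2(3) hp j0(1)])
    show "h j p = 0" if "j < j0" for j p unfolding h_def using j0' that by (intro sum.neutral ballI) auto
    show "(\<Sum>j<N. h j p * q2 p ^ j) = 0" if "p \<in> Z2" for p
      using 1 that by (simp add: g_def h_def sum_distrib_right sum_distrib_left mult_ac)
  qed (use sub in blast)
  have 3: "\<forall>p\<in>Z0. c i0 j0 k0 = 0"
  proof (rule lowest_coefficient_vanishes[where g="\<lambda>k p. c i0 j0 k", OF irr(2) _ q3(1,2) x(1) q3(3) _ k0(1)])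
    show "c i0 j0 k = 0" if "k < k0" for k using k0' that by blast
    show "(\<Sum>k<N. c i0 j0 k * q3 p ^ k) = 0" if "p \<in> Z1" for p using 2 that by (simp add: h_def)
  qed (use sub in \<open>auto intro: real_polynomial_function.intros(2)\<close>)
  moreover have "Z0 \<noteq> {}" using irr(1) by (simp add: irreducible_algebraic_set_def)
  ultimately show False using k0(2) by blast
qed

definition zariski_closure :: "'b::euclidean_space set \<Rightarrow> 'b set" where
  "zariski_closure S = {x. \<forall>p\<in>{p. real_polynomial_function p \<and> (\<forall>s\<in>S. p s = 0)}. p x = 0}"

lemma zariski_closure_algebraic: "real_algebraic_set (zariski_closure S)"
  unfolding real_algebraic_set_def zariski_closure_def
  by (rule exI[of _ "{p. real_polynomial_function p \<and> (\<forall>s\<in>S. p s = 0)}"]) simp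

lemma zariski_closureD: "x \<in> zariski_closure S \<Longrightarrow> real_polynomial_function p \<Longrightarrow> \<forall>s\<in>S. p s = 0 \<Longrightarrow> p x = 0"
  by (simp add: zariski_closure_def)

text \<open>The relation is itself a polynomial equation in the point, so it persists on the Zariski
  closure.\<close>

lemma algebraic_relation_closure:
  assumes q: "real_polynomial_function q1" "real_polynomial_function q2" "real_polynomial_function q3" and S: "algebraic_relation S q1 q2 q3"
  shows "algebraic_relation (zariski_closure S) q1 q2 q3"
proof -
  obtain N c where c: "\<exists>i<N. \<exists>j<N. \<exists>k<N. c i j k \<noteq> 0" "\<forall>p\<in>S. (\<Sum>i<N. \<Sum>j<N. \<Sum>k<N. c i j k * q1 p ^ i * q2 p ^ j * q3 p ^ k) = 0"
    by (rule algebraic_relationE[OF S])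
  have r: "real_polynomial_function (\<lambda>p. \<Sum>i<N. \<Sum>j<N. \<Sum>k<N. c i j k * q1 p ^ i * q2 p ^ j * q3 p ^ k)"
    using q by (intro real_polynomial_function_sum real_polynomial_function.intros(2,4) real_polynomial_function_power) auto
  have "\<forall>p\<in>zariski_closure S. (\<Sum>i<N. \<Sum>j<N. \<Sum>k<N. c i j k * q1 p ^ i * q2 p ^ j * q3 p ^ k) = 0"
    by (rule ballI) (rule zariski_closureD[OF _ r c(2)])
  with c(1) show ?thesis unfolding algebraic_relation_def by iprover
qed

lemma three_dependent_closure: "three_dependent S \<Longrightarrow> three_dependent (zariski_closure S)"
  unfolding three_dependent_def by (intro allI impI algebraic_relation_closure; simp)

lemma algebraic_relation_subset:
  assumes S: "algebraic_relation S q1 q2 q3" and T: "T \<subseteq> S" shows "algebraic_relation T q1 q2 q3"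
proof -
  obtain N c where c: "\<exists>i<N. \<exists>j<N. \<exists>k<N. c i j k \<noteq> 0" "\<forall>p\<in>S. (\<Sum>i<N. \<Sum>j<N. \<Sum>k<N. c i j k * q1 p ^ i * q2 p ^ j * q3 p ^ k) = 0"
    by (rule algebraic_relationE[OF S])
  have "\<forall>p\<in>T. (\<Sum>i<N. \<Sum>j<N. \<Sum>k<N. c i j k * q1 p ^ i * q2 p ^ j * q3 p ^ k) = 0"
    by (rule ballI) (rule bspec[OF c(2) subsetD[OF T]])
  with c(1) show ?thesis unfolding algebraic_relation_def by iprover
qed

lemma three_dependent_subset: "three_dependent S \<Longrightarrow> T \<subseteq> S \<Longrightarrow> three_dependent T"
  unfolding three_dependent_def by (intro allI impI, rule algebraic_relation_subset; simp)

text \<open>Two points, one outside each of the two pieces, span a line in \<open>L\<close>. A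
  polynomial separating a point from a piece has finitely many zeros on that line, yet the two
  pieces would have to cover all of it.\<close>

lemma irreducible_affine:
  fixes L :: "'b::euclidean_space set"
  assumes L: "real_algebraic_set L" "L \<noteq> {}" and aff: "\<And>a b t. a \<in> L \<Longrightarrow> b \<in> L \<Longrightarrow> a + t *\<^sub>R (b - a) \<in> L"
  shows "irreducible_algebraic_set L"
  unfolding irreducible_algebraic_set_def
proof (intro conjI L allI impI, rule ccontr)
  fix V1 V2 assume V: "real_algebraic_set V1 \<and> real_algebraic_set V2 \<and> L = V1 \<union> V2" and n: "\<not> (L = V1 \<or> L = V2)"
  then obtain a b where a: "a \<in> L" "a \<notin> V1" and b: "b \<in> L" "b \<notin> V2" by blast
  obtain q where q: "real_polynomial_function q" "\<forall>z\<in>V1. q z = 0" "q a \<noteq> 0" using algebraic_separate[of V1 a] V a by blast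
  obtain r where r: "real_polynomial_function r" "\<forall>z\<in>V2. r z = 0" "r b \<noteq> 0" using algebraic_separate[of V2 b] V b by blast
  define l where "l t = a + t *\<^sub>R (b - a)" for t
  have "polynomial_function l" unfolding l_def[abs_def]
    by (intro polynomial_function_add polynomial_function_const polynomial_function_mult[OF polynomial_function_id])
  then have p: "real_polynomial_function (q \<circ> l)" "real_polynomial_function (r \<circ> l)" using q(1) r(1) by auto
  have fin: "finite {t. f t = 0}" if f: "real_polynomial_function f" "f s \<noteq> 0" for f and s :: real
  proof -
    obtain c n where c: "f = (\<lambda>x. \<Sum>i\<le>n. c i * x^i)" using real_polynomial_function_imp_sum[OF f(1)] by blast
    have "\<exists>i\<le>n. c i \<noteq> 0"
    proof (rule ccontr)
      assume "\<not> ?thesis"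
      then have "f s = 0" unfolding c by (intro sum.neutral) auto
      then show False using f(2) by blast
    qed
    then show ?thesis unfolding c using polyfun_finite_roots[of c n] by blast
  qed
  have "finite {t. (q \<circ> l) t = 0}" by (rule fin[OF p(1), of 0]) (simp add: l_def q)
  moreover have "finite {t. (r \<circ> l) t = 0}" by (rule fin[OF p(2), of 1]) (simp add: l_def r)
  moreover have "UNIV \<subseteq> {t. (q \<circ> l) t = 0} \<union> {t. (r \<circ> l) t = 0}"
  proof
    fix t :: real
    have "l t \<in> V1 \<union> V2" using aff[OF a(1) b(1), of t] V unfolding l_def by blast
    then show "t \<in> {t. (q \<circ> l) t = 0} \<union> {t. (r \<circ> l) t = 0}" using q(2) r(2) by auto
  qed
  ultimately have "finite (UNIV :: real set)" by (meson finite_UnI finite_subset)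
  then show False using infinite_UNIV_char_0 by blast
qed

text \<open>The top member of a chain is irreducible and so lies in one of the two sets, which rules
  out length 3; the given chain provides length 2.\<close>

lemma algebraic_dimension_two:
  fixes V W :: "'b::euclidean_space set"
  assumes V: "real_algebraic_set V" "three_dependent V" and W: "real_algebraic_set W" "three_dependent W"
    and Z: "irreducible_algebraic_set Z0" "irreducible_algebraic_set Z1" "irreducible_algebraic_set Z2" "Z0 \<subset> Z1" "Z1 \<subset> Z2" "Z2 \<subseteq> V \<union> W"
  shows "algebraic_dimension (V \<union> W) = 2"
proof (rule antisym)
  show "algebraic_dimension (V \<union> W) \<le> 2"
    unfolding algebraic_dimension_def
  proof (rule Sup_least)
    fix e assume "e \<in> {enat n | n. \<exists>Z :: nat \<Rightarrow> 'b set. (\<forall>i\<le>n. irreducible_algebraic_set (Z i) \<and> Z i \<subseteq> V \<union> W) \<and> (\<forall>i<n. Z i \<subset> Z (Suc i))}"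
    then obtain n and Z :: "nat \<Rightarrow> 'b set" where n: "e = enat n"
      and Z: "\<And>i. i \<le> n \<Longrightarrow> irreducible_algebraic_set (Z i) \<and> Z i \<subseteq> V \<union> W" "\<And>i. i < n \<Longrightarrow> Z i \<subset> Z (Suc i)" by blast
    have "n \<le> 2"
    proof (rule ccontr)
      assume "\<not> n \<le> 2"
      then have n3: "3 \<le> n" by simp
      have i: "irreducible_algebraic_set (Z 0)" "irreducible_algebraic_set (Z 1)" "irreducible_algebraic_set (Z 2)" "irreducible_algebraic_set (Z 3)"
        "Z 3 \<subseteq> V \<union> W" using Z(1) n3 by auto
      have s: "Z 0 \<subset> Z 1" "Z 1 \<subset> Z 2" "Z 2 \<subset> Z 3" using Z(2)[of 0] Z(2)[of 1] Z(2)[of 2] n3 by (auto simp: numeral_eq_Suc)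
      have "three_dependent (Z 3)" using irreducible_subset_Un[OF i(4) V(1) W(1) i(5)] three_dependent_subset V(2) W(2) by blast
      then show False using no_chain_three_dependent[OF _ i(1-4) s] by blast
    qed
    then show "e \<le> 2" unfolding n by (metis enat_ord_simps(1) numeral_eq_enat)
  qed
  define Z where "Z i = (if i = (0::nat) then Z0 else if i = 1 then Z1 else Z2)" for i
  have "(\<forall>i\<le>2. irreducible_algebraic_set (Z i) \<and> Z i \<subseteq> V \<union> W) \<and> (\<forall>i<2. Z i \<subset> Z (Suc i))"
    using assms(5-10) by (auto simp: Z_def)
  then have "enat 2 \<le> algebraic_dimension (V \<union> W)"
    unfolding algebraic_dimension_def by (intro Sup_upper) blast
  then show "2 \<le> algebraic_dimension (V \<union> W)" by (simp add: numeral_eq_enat)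
qed

section \<open>Forms determined by few points\<close>

lemma biform_diff: "biform n Q \<Longrightarrow> biform n R \<Longrightarrow> biform n (\<lambda>x y. Q x y - R x y)"
  using biform_add[OF _ biform_scale[of n R "-1"], of Q] by simp

lemma numeratorI: "biform 2 Q \<Longrightarrow> (\<And>x. x \<in> M \<Longrightarrow> f x * g x = Q (\<phi> x) (\<lambda>i. cnj (\<phi> x i))) \<Longrightarrow> numerator_form M \<phi> g 1 f"
  unfolding numerator_form_def by (intro exI[of _ Q]) simp

lemma biform2: "biform 1 Q \<Longrightarrow> biform 1 R \<Longrightarrow> biform 2 (\<lambda>x y. Q x y * R x y)"
  using biform_mult[of 1 Q 1 R] by (simp add: numeral_2_eq_2)

lemma hform_on_line: "hform n P \<Longrightarrow> \<exists>p. degree p \<le> n \<and> (\<forall>z. P (vec4 1 z 0 0) = poly p z)"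
proof (induction rule: hform.induct)
  case (hform_const c) show ?case by (rule exI[of _ "[:c:]"]) simp
next
  case (hform_var n P i)
  then obtain p where p: "degree p \<le> n" "\<And>z. P (vec4 1 z 0 0) = poly p z" by blast
  show ?case using less_4_cases[OF hform_var.hyps(2)]
  proof (elim disjE)
    assume "i = 0" then show ?thesis using p by (intro exI[of _ p]) auto
  next
    assume "i = 1" then show ?thesis using p degree_pCons_le[of 0 p] by (intro exI[of _ "pCons 0 p"]) auto
  next
    assume "i = 2" then show ?thesis by (intro exI[of _ 0]) simp
  next
    assume "i = 3" then show ?thesis by (intro exI[of _ 0]) simp
  qed
next
  case (hform_add n P Q)
  then obtain p q where "degree p \<le> n" "\<And>z. P (vec4 1 z 0 0) = poly p z" "degree q \<le> n" "\<And>z. Q (vec4 1 z 0 0) = poly q z" by blast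
  then show ?case by (intro exI[of _ "p + q"]) (auto intro: degree_add_le)
qed

text \<open>On this line a form of degree n is a polynomial of degree at most n, so n + 1 points
  suffice.\<close>

lemma plane_determined: "determined UNIV (\<lambda>z::complex. vec4 1 z 0 0)"
  unfolding determined_def
proof (intro exI[of _ "1::nat"] allI)
  fix n
  show "\<exists>T\<subseteq>UNIV. finite T \<and> card T \<le> 1 * (n + 1) \<and>
     (\<forall>P. hform n P \<longrightarrow> (\<forall>t\<in>T. P (vec4 1 t 0 0) = 0) \<longrightarrow> (\<forall>x\<in>UNIV. P (vec4 1 x 0 0) = 0))"
  proof (rule exI[of _ "of_nat ` {..n}"], intro conjI allI impI ballI)
    show "card (of_nat ` {..n} :: complex set) \<le> 1 * (n + 1)" using card_image_le[of "{..n}" of_nat] by simp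
    fix P and x :: complex assume P: "hform n P" "\<forall>t\<in>of_nat ` {..n}. P (vec4 1 t 0 0) = 0"
    obtain p where p: "degree p \<le> n" "\<And>z. P (vec4 1 z 0 0) = poly p z" using hform_on_line[OF P(1)] by blast
    have "p = 0"
    proof (rule ccontr)
      assume "p \<noteq> 0"
      then have f: "finite {z. poly p z = 0}" "card {z. poly p z = 0} \<le> degree p" by (simp_all add: poly_roots_finite card_poly_roots_bound)
      have "of_nat ` {..n} \<subseteq> {z. poly p z = 0}" using P(2) p(2) by auto
      then have "card (of_nat ` {..n} :: complex set) \<le> degree p" using card_mono[OF f(1)] f(2) by (meson le_trans)
      moreover have "card (of_nat ` {..n} :: complex set) = Suc n" by (subst card_image) (auto simp: inj_on_def)
      ultimately show False using p(1) by simp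
    qed
    then show "P (vec4 1 x 0 0) = 0" using p(2) by simp
  qed auto
qed

text \<open>The counting argument for the curve also covers the plane, with lift (1, z, 0, 0) and
  denominator 1.\<close>

lemma plane_three_dependent: "three_dependent (range (\<lambda>z::complex. (z, 0::complex)))"
  unfolding three_dependent_def
proof (intro allI impI)
  fix q1 q2 q3 :: "complex \<times> complex \<Rightarrow> real"
  assume q: "real_polynomial_function q1" "real_polynomial_function q2" "real_polynomial_function q3"
  let ?\<phi> = "\<lambda>z::complex. vec4 1 z 0 0"
  have b: "biform 2 (\<lambda>x y. (x i * y j) * (x 0 * y 0))" if "i < 4" "j < 4" for i j using that by (intro biform2 biform_coords) auto
  have n: "numerator_form UNIV ?\<phi> (\<lambda>z. 1) 1 (\<lambda>z. 1)" "numerator_form UNIV ?\<phi> (\<lambda>z. 1) 1 (\<lambda>z. z)" "numerator_form UNIV ?\<phi> (\<lambda>z. 1) 1 cnj"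
    using numeratorI[OF b[of 0 0], where \<phi>="?\<phi>" and g="\<lambda>z. 1" and f="\<lambda>z. 1"] numeratorI[OF b[of 1 0], where \<phi>="?\<phi>" and g="\<lambda>z. 1" and f="\<lambda>z. z"]
      numeratorI[OF b[of 0 1], where \<phi>="?\<phi>" and g="\<lambda>z. 1" and f=cnj] by simp_all
  have 0: "numerator_form UNIV ?\<phi> (\<lambda>z. 1) 1 (\<lambda>z. 0)" using numerator_scale[OF n(1), of 0] by simp
  show "algebraic_relation (range (\<lambda>z. (z, 0))) q1 q2 q3"
    by (rule polynomial_relation[where F="\<lambda>z. (z, 0)", OF plane_determined _ n(1) _ _ _ _ q]) (use n 0 in simp_all)
qed

section \<open>The Schwarz lemma with many zeros, applied to forms on the curve\<close>

lemma factor_zeros: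
  fixes f :: "complex \<Rightarrow> complex"
  assumes "finite S" "f holomorphic_on U" "open U" "\<And>s. s \<in> S \<Longrightarrow> f s = 0"
  shows "\<exists>g. g holomorphic_on U \<and> (\<forall>z\<in>U. f z = g z * (\<Prod>s\<in>S. z - s))"
  using assms(1,2,4)
proof (induction S arbitrary: f rule: finite_induct)
  case empty then show ?case by auto
next
  case (insert s S)
  define g where "g z = (if z = s then deriv f s else (f z - f s) / (z - s))" for z
  have g: "g holomorphic_on U" unfolding g_def[abs_def] by (rule pole_lemma_open[OF insert.prems(1) assms(3)])
  have fg: "f z = g z * (z - s)" for z using insert.prems(2)[of s] by (auto simp: g_def)
  have "g t = 0" if "t \<in> S" for t using fg[of t] insert.prems(2)[of t] insert.hyps(2) that by auto
  then obtain h where h: "h holomorphic_on U" "\<forall>z\<in>U. g z = h z * (\<Prod>s\<in>S. z - s)" using insert.IH[OF g] by blast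
  have "f z = h z * (\<Prod>s\<in>insert s S. z - s)" if "z \<in> U" for z
    using fg[of z] h(2) that insert.hyps by (simp add: mult_ac)
  then show ?case using h(1) by blast
qed

text \<open>Division by the factors z - s and the maximum principle on the disc of radius 2: on its
  boundary each factor is at least 3/2, and for z and s within 1/2 it is at most 1.\<close>

lemma schwarz_many_zeros:
  assumes f: "f holomorphic_on ball 0 4" and S: "finite S" "S \<subseteq> ball 0 (1/2)" "\<And>s. s \<in> S \<Longrightarrow> f s = 0"
    and B: "\<And>z. z \<in> cball 0 2 \<Longrightarrow> norm (f z) \<le> B" and z: "norm z \<le> 1/2"
  shows "norm (f z) \<le> B * (2/3) ^ card S"
proof -
  obtain g where g: "g holomorphic_on ball 0 4" "\<And>z. z \<in> ball 0 4 \<Longrightarrow> f z = g z * (\<Prod>s\<in>S. z - s)"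
    using factor_zeros[OF S(1) f open_ball S(3)] by blast
  have gz: "norm (g z) \<le> B / (3/2) ^ card S"
  proof (rule maximum_modulus_frontier[where S="cball 0 2" and f=g])
    show "g holomorphic_on interior (cball 0 2)" by (rule holomorphic_on_subset[OF g(1)]) auto
    show "continuous_on (closure (cball 0 2)) g" by (rule continuous_on_subset[OF holomorphic_on_imp_continuous_on[OF g(1)]]) auto
    show "z \<in> cball 0 2" using z by simp
    fix w :: complex assume "w \<in> frontier (cball 0 2)"
    then have w: "norm w = 2" by simp
    have "(3/2) ^ card S \<le> (\<Prod>s\<in>S. norm (w - s))"
    proof -
      have "(\<Prod>s\<in>S. 3/2) \<le> (\<Prod>s\<in>S. norm (w - s))"
      proof (rule prod_mono)
        fix s assume "s \<in> S"
        then have "norm s < 1/2" using S(2) by auto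
        then show "0 \<le> (3/2::real) \<and> 3/2 \<le> norm (w - s)" using norm_triangle_ineq2[of w s] w by linarith
      qed
      then show ?thesis by simp
    qed
    moreover have "norm (g w) * (\<Prod>s\<in>S. norm (w - s)) \<le> B" using g(2)[of w] B[of w] w by (simp add: norm_mult prod_norm)
    ultimately have "norm (g w) * (3/2) ^ card S \<le> B" by (meson mult_left_mono norm_ge_zero order_trans)
    then show "norm (g w) \<le> B / (3/2) ^ card S" by (simp add: pos_le_divide_eq)
  qed auto
  have "(\<Prod>s\<in>S. norm (z - s)) \<le> 1"
  proof (rule prod_le_1)
    fix s assume "s \<in> S"
    then have "norm s < 1/2" using S(2) by auto
    then show "0 \<le> norm (z - s) \<and> norm (z - s) \<le> 1" using norm_triangle_ineq4[of z s] z by simp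
  qed
  then have "norm (f z) \<le> norm (g z) * 1" using g(2)[of z] z by (simp add: norm_mult prod_norm mult_left_le)
  also have "\<dots> \<le> B * (2/3) ^ card S" using gz by (simp add: power_divide)
  finally show ?thesis .
qed

context compact_surface
begin

text \<open>Let s be the supremum of |P| divided by the n-th power of the norm of the lift, a
  quantity that does not depend on the lift. The Schwarz lemma on every disc shows that the quantity
  is at most s/2 everywhere, hence s = 0.\<close>

lemma curve_determined:
  assumes \<phi>: "lifted_curve \<phi>"
  shows "determined (topspace X) (\<lambda>x i. \<phi> i x)"
proof -
  define nrm :: "(nat \<Rightarrow> complex) \<Rightarrow> real" where "nrm y = (\<Sum>i<4. norm (y i))" for y
  obtain C where C: "finite C" "C \<subseteq> A" "\<And>c. c \<in> C \<Longrightarrow> snd c ` fst c = ball 0 4 \<and> (\<exists>Y. curve_lift \<phi> c (ball 0 4) Y)"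
    "\<And>x. x \<in> topspace X \<Longrightarrow> \<exists>c\<in>C. x \<in> fst c \<and> norm (snd c x) < 1/2"
  proof (rule finite_disc_cover[where P="\<lambda>c. \<exists>Y. curve_lift \<phi> c (ball 0 4) Y" and r="1/2"])
    show "\<exists>c\<in>A. x \<in> fst c \<and> snd c x = 0 \<and> snd c ` fst c = ball 0 4 \<and> (\<exists>Y. curve_lift \<phi> c (ball 0 4) Y)" if "x \<in> topspace X" for x
      using \<phi> that unfolding lifted_curve_def by blast
  qed auto
  then obtain Y where Y: "\<And>c. c \<in> C \<Longrightarrow> curve_lift \<phi> c (ball 0 4) (Y c)" by metis
  have Yh: "Y c i holomorphic_on ball 0 4" if "c \<in> C" for c i using Y[OF that] by (simp add: curve_lift_def)
  have Yl: "\<exists>l. l \<noteq> 0 \<and> (\<forall>i<4. \<phi> i (par c w) = l * Y c i w)" and Yn: "nrm (\<lambda>i. Y c i w) > 0" if "c \<in> C" "w \<in> ball 0 4" for c w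
  proof -
    show "\<exists>l. l \<noteq> 0 \<and> (\<forall>i<4. \<phi> i (par c w) = l * Y c i w)" using Y[OF that(1)] that(2) by (simp add: curve_lift_def)
    have "regular_at (Y c) w" using Y[OF that(1)] that(2) by (simp add: curve_lift_def)
    then obtain i where i: "i < 4" "Y c i w \<noteq> 0" unfolding regular_at_def by (metis one_less_numeral_iff semiring_norm(76) numeral_less_iff semiring_norm(78))
    show "nrm (\<lambda>i. Y c i w) > 0" unfolding nrm_def by (rule sum_pos2[OF _ _ _ , of _ i]) (use i in auto)
  qed
  have nc: "continuous_on (cball 0 2) (\<lambda>w. nrm (\<lambda>i. Y c i w))" if "c \<in> C" for c
    unfolding nrm_def using that
    by (intro continuous_intros continuous_on_subset[OF holomorphic_on_imp_continuous_on[OF Yh]]) auto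
  have "\<exists>U L. L > 0 \<and> (\<forall>w\<in>cball 0 2. L \<le> nrm (\<lambda>i. Y c i w) \<and> nrm (\<lambda>i. Y c i w) \<le> U)" if c: "c \<in> C" for c
  proof -
    have ne: "cball 0 2 \<noteq> ({}::complex set)" by simp
    obtain u where u: "\<And>w. w \<in> cball 0 2 \<Longrightarrow> nrm (\<lambda>i. Y c i w) \<le> nrm (\<lambda>i. Y c i u)"
      using continuous_attains_sup[OF compact_cball ne nc[OF c]] by blast
    obtain v where v: "v \<in> cball 0 2" "\<And>w. w \<in> cball 0 2 \<Longrightarrow> nrm (\<lambda>i. Y c i v) \<le> nrm (\<lambda>i. Y c i w)"
      using continuous_attains_inf[OF compact_cball ne nc[OF c]] by blast
    have "nrm (\<lambda>i. Y c i v) > 0" using Yn[OF c] v(1) by simp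
    then show ?thesis using u v(2) by blast
  qed
  then obtain U L where UL: "\<And>c. c \<in> C \<Longrightarrow> L c > 0" "\<And>c w. c \<in> C \<Longrightarrow> w \<in> cball 0 2 \<Longrightarrow> L c \<le> nrm (\<lambda>i. Y c i w)"
     "\<And>c w. c \<in> C \<Longrightarrow> w \<in> cball 0 2 \<Longrightarrow> nrm (\<lambda>i. Y c i w) \<le> U c" by metis
  have "\<forall>\<^sub>F K in sequentially. (2/3) ^ K * a \<le> (1/2::real)" for a
  proof -
    have "(\<lambda>K. (2/3) ^ K * a) \<longlonglongrightarrow> 0 * a" by (intro tendsto_intros LIMSEQ_realpow_zero) auto
    then have "\<forall>\<^sub>F K in sequentially. (2/3) ^ K * a < 1/2" by (rule order_tendstoD(2)) simp
    then show ?thesis by (rule eventually_mono) simp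
  qed
  then have "\<forall>\<^sub>F K in sequentially. (\<forall>c\<in>C. (2/3) ^ K * (U c / L c) \<le> 1/2) \<and> (2/3) ^ K * 1 \<le> (1/2::real)"
    by (intro eventually_conj eventually_ball_finite C(1)) blast+
  \<comment> \<open>The first condition lets the gain from K zeros beat the distortion U/L of the
    norm for each unit of degree; the second turns a further K zeros into the factor 1/2.\<close>
  then obtain K where K: "\<And>c. c \<in> C \<Longrightarrow> (2/3) ^ K * (U c / L c) \<le> 1/2" "(2/3) ^ K \<le> (1/2::real)"
    unfolding eventually_sequentially by force
  show ?thesis
    unfolding determined_def
  proof (rule exI[of _ "card C * K"], rule allI)
    fix n
    have "infinite (ball (0::complex) (1/2))" by (rule infinite_ball) simp
    \<comment> \<open>K zeros for every unit of the degree and K more; the same coordinates are used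
      in all discs.\<close>
    then obtain S where S: "finite S" "card S = K * (n + 1)" "S \<subseteq> ball (0::complex) (1/2)" using infinite_arbitrarily_large by blast
    define T where "T = (\<Union>c\<in>C. par c ` S)"
    have S4: "w \<in> ball 0 4" if "w \<in> S" for w using S(3) that by auto
    have pt: "par c w \<in> topspace X" if "c \<in> C" "w \<in> ball 0 4" for c w
    proof -
      have "par c w \<in> fst c" using C(3)[OF that(1)] that(2) by (intro par_mem) simp
      then show ?thesis using chart_sub C(2) that(1) by blast
    qed
    have "card T \<le> (\<Sum>c\<in>C. card (par c ` S))" unfolding T_def by (rule card_UN_le[OF C(1)])
    also have "\<dots> \<le> (\<Sum>c\<in>C. K * (n + 1))" by (intro sum_mono) (use card_image_le[OF S(1)] S(2) in metis)
    finally have cT: "card T \<le> card C * K * (n + 1)" by (simp add: algebra_simps)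
    have "\<forall>x\<in>topspace X. P (\<lambda>i. \<phi> i x) = 0" if P: "hform n P" and PT: "\<forall>t\<in>T. P (\<lambda>i. \<phi> i t) = 0" for P
    proof -
      \<comment> \<open>Homogeneous of degree 0, so it can be computed with the lift of any
        disc.\<close>
      define G where "G x = norm (P (\<lambda>i. \<phi> i x)) / nrm (\<lambda>i. \<phi> i x) ^ n" for x
      have Gc: "G (par c w) = norm (P (\<lambda>i. Y c i w)) / nrm (\<lambda>i. Y c i w) ^ n" "P (\<lambda>i. \<phi> i (par c w)) = 0 \<longleftrightarrow> P (\<lambda>i. Y c i w) = 0"
         "nrm (\<lambda>i. \<phi> i (par c w)) > 0" if cw: "c \<in> C" "w \<in> ball 0 4" for c w
      proof -
        obtain l where l: "l \<noteq> 0" "\<forall>i<4. \<phi> i (par c w) = l * Y c i w" using Yl[OF cw] by blast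
        have Pl: "P (\<lambda>i. \<phi> i (par c w)) = l ^ n * P (\<lambda>i. Y c i w)" by (rule hform_homogeneous[OF P]) (use l in simp)
        have nl: "nrm (\<lambda>i. \<phi> i (par c w)) = norm l * nrm (\<lambda>i. Y c i w)" using l(2) by (simp add: nrm_def norm_mult sum_distrib_left)
        show "G (par c w) = norm (P (\<lambda>i. Y c i w)) / nrm (\<lambda>i. Y c i w) ^ n" unfolding G_def Pl nl
          using l(1) by (simp add: norm_mult norm_power power_mult_distrib)
        show "P (\<lambda>i. \<phi> i (par c w)) = 0 \<longleftrightarrow> P (\<lambda>i. Y c i w) = 0" using Pl l(1) by simp
        show "nrm (\<lambda>i. \<phi> i (par c w)) > 0" using nl l(1) Yn[OF cw] by simp
      qed
      have pos: "\<exists>c\<in>C. \<exists>z. norm z < 1/2 \<and> z \<in> ball 0 4 \<and> x = par c z" if x: "x \<in> topspace X" for x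
      proof -
        obtain c where c: "c \<in> C" "x \<in> fst c" "norm (snd c x) < 1/2" using C(4)[OF x] by blast
        then have "x = par c (snd c x)" using par_crd[of c x] C(2) by auto
        then show ?thesis using c by (intro bexI[of _ c] exI[of _ "snd c x"]) auto
      qed
      obtain B where B: "B \<ge> 0" "\<And>y. norm (P y) \<le> B * nrm y ^ n" using hform_bound[OF P] unfolding nrm_def by blast
      have GB: "G x \<le> B" if x: "x \<in> topspace X" for x
      proof -
        have "nrm (\<lambda>i. \<phi> i x) > 0" using pos[OF x] Gc(3) by blast
        then show ?thesis unfolding G_def using B(2)[of "\<lambda>i. \<phi> i x"] by (simp add: pos_divide_le_eq)
      qed
      define s where "s = Sup (G ` topspace X)"
      have bdd: "bdd_above (G ` topspace X)" using GB by (intro bdd_aboveI2)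
      have Gs: "G x \<le> s" if "x \<in> topspace X" for x unfolding s_def by (rule cSup_upper[OF imageI[OF that] bdd])
      have G0: "G x \<ge> 0" for x by (simp add: G_def nrm_def sum_nonneg)
      obtain x0 where x0: "x0 \<in> topspace X" using nonempty by blast
      have s0: "s \<ge> 0" using Gs[OF x0] G0[of x0] by linarith
      have half: "G x \<le> s / 2" if x: "x \<in> topspace X" for x
      proof -
        obtain c z where c: "c \<in> C" "norm z < 1/2" "z \<in> ball 0 4" "x = par c z" using pos[OF x] by blast
        let ?f = "\<lambda>w. P (\<lambda>i. Y c i w)"
        have U0: "U c \<ge> 0" using UL(2)[OF c(1), of 0] UL(3)[OF c(1), of 0] UL(1)[OF c(1)] by simp
        have "norm (?f z) \<le> (s * U c ^ n) * (2/3) ^ card S"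
        proof (rule schwarz_many_zeros[OF hform_holomorphic[OF P Yh[OF c(1)]] S(1,3)])
          fix w assume w: "w \<in> S"
          have "P (\<lambda>i. \<phi> i (par c w)) = 0" using PT w c(1) unfolding T_def by blast
          then show "?f w = 0" using Gc(2)[OF c(1) S4[OF w]] by simp
        next
          fix w :: complex assume w: "w \<in> cball 0 2"
          then have w4: "w \<in> ball 0 4" by simp
          have "norm (?f w) = G (par c w) * nrm (\<lambda>i. Y c i w) ^ n" unfolding Gc(1)[OF c(1) w4] using Yn[OF c(1) w4] by simp
          also have "\<dots> \<le> s * U c ^ n"
            using Gs[OF pt[OF c(1) w4]] UL(3)[OF c(1) w] s0 Yn[OF c(1) w4] by (intro mult_mono power_mono) auto
          finally show "norm (?f w) \<le> s * U c ^ n" .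
        qed (use c(2) in simp)
        then have "G x \<le> (s * U c ^ n) * (2/3) ^ card S / nrm (\<lambda>i. Y c i z) ^ n"
          unfolding c(4) Gc(1)[OF c(1,3)] by (rule divide_right_mono) (use Yn[OF c(1,3)] in simp)
        also have "\<dots> \<le> (s * U c ^ n) * (2/3) ^ card S / L c ^ n"
          using UL(1,2)[OF c(1)] c(2) s0 U0 by (intro divide_left_mono power_mono mult_nonneg_nonneg mult_pos_pos zero_less_power Yn[OF c(1,3)]) auto
        also have "\<dots> = s * (((2/3) ^ K * (U c / L c)) ^ n * (2/3) ^ K)"
          unfolding S(2) by (simp add: power_mult_distrib power_divide power_mult power_add mult_ac)
        also have "\<dots> \<le> s * (1 ^ n * (1/2))"
        proof (intro mult_left_mono mult_mono power_mono K(2) s0)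
          show "(2/3) ^ K * (U c / L c) \<le> 1" using K(1)[OF c(1)] by linarith
          show "0 \<le> (2/3) ^ K * (U c / L c)" using U0 UL(1)[OF c(1)] by simp
        qed auto
        finally show ?thesis by simp
      qed
      have "s \<le> s / 2" unfolding s_def[of] by (rule cSup_least) (use x0 half in \<open>auto simp: s_def\<close>)
      then have "G x = 0" if "x \<in> topspace X" for x using Gs[OF that] G0[of x] s0 by linarith
      moreover have "nrm (\<lambda>i. \<phi> i x) > 0" if "x \<in> topspace X" for x using pos[OF that] Gc(3) by blast
      ultimately show ?thesis unfolding G_def by fastforce
    qed
    moreover have "T \<subseteq> topspace X" unfolding T_def using pt S4 by blast
    moreover have "finite T" unfolding T_def using C(1) S(1) by blast
    ultimately show "\<exists>T\<subseteq>topspace X. finite T \<and> card T \<le> card C * K * (n + 1) \<and>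
     (\<forall>P. hform n P \<longrightarrow> (\<forall>t\<in>T. P (\<lambda>i. \<phi> i t) = 0) \<longrightarrow> (\<forall>x\<in>topspace X. P (\<lambda>i. \<phi> i x) = 0))" using cT by blast
  qed
qed

end

section \<open>The algebraic surface that contains the image\<close>

lemma bounded_linear_coordinates:
  shows "real_polynomial_function (\<lambda>p :: complex \<times> complex. Re (snd p))" "real_polynomial_function (\<lambda>p :: complex \<times> complex. Im (snd p))"
    "real_polynomial_function (\<lambda>p :: complex \<times> complex. Re (fst p))" "real_polynomial_function (\<lambda>p :: complex \<times> complex. Im (fst p))"
  by (intro real_polynomial_function.intros(1) bounded_linear_compose[OF bounded_linear_Re] bounded_linear_compose[OF bounded_linear_Im]
      bounded_linear_fst bounded_linear_snd)+

lemma surface_chain: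
  defines "L0 \<equiv> {(0, 0) :: complex \<times> complex}" and "L1 \<equiv> {p :: complex \<times> complex. snd p = 0 \<and> Im (fst p) = 0}"
    and "L2 \<equiv> range (\<lambda>z. (z, 0)) :: (complex \<times> complex) set"
  shows "irreducible_algebraic_set L0" "irreducible_algebraic_set L1" "irreducible_algebraic_set L2" "L0 \<subset> L1" "L1 \<subset> L2"
proof -
  note z = bounded_linear_coordinates[THEN algebraic_zero_set]
  have e: "L0 = (({p. Re (snd p) = 0} \<inter> {p. Im (snd p) = 0}) \<inter> {p. Im (fst p) = 0}) \<inter> {p. Re (fst p) = 0}"
    "L1 = ({p. Re (snd p) = 0} \<inter> {p. Im (snd p) = 0}) \<inter> {p. Im (fst p) = 0}"
    "L2 = {p. Re (snd p) = 0} \<inter> {p. Im (snd p) = 0}" unfolding L0_def L1_def L2_def by (auto simp: complex_eq_iff prod_eq_iff image_iff)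
  show "irreducible_algebraic_set L0" "irreducible_algebraic_set L1" "irreducible_algebraic_set L2"
  proof (rule_tac [!] irreducible_affine)
    show "real_algebraic_set L0" "real_algebraic_set L1" "real_algebraic_set L2" unfolding e by (intro algebraic_Int z)+
  qed (auto simp: L0_def L1_def L2_def intro: exI[of _ "0::complex"])
  show "L0 \<subset> L1"
  proof
    show "L0 \<subseteq> L1" by (auto simp: L0_def L1_def)
    have "(1, 0) \<in> L1" "(1, 0) \<notin> L0" by (auto simp: L0_def L1_def)
    then show "L0 \<noteq> L1" by blast
  qed
  show "L1 \<subset> L2"
  proof
    show "L1 \<subseteq> L2" by (auto simp: L1_def L2_def image_iff prod_eq_iff)
    have "(\<i>, 0) \<in> L2" "(\<i>, 0) \<notin> L1" by (auto simp: L1_def L2_def)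
    then show "L1 \<noteq> L2" by blast
  qed
qed

context compact_surface
begin

lemma curve_three_dependent:
  assumes \<phi>: "lifted_curve \<phi>"
  shows "three_dependent ((\<lambda>x. lag_map (\<lambda>i. \<phi> i x)) ` topspace X)"
  unfolding three_dependent_def
proof (intro allI impI)
  fix q1 q2 q3 :: "complex \<times> complex \<Rightarrow> real"
  assume q: "real_polynomial_function q1" "real_polynomial_function q2" "real_polynomial_function q3"
  let ?\<phi> = "\<lambda>x i. \<phi> i x"
  have den: "mden (?\<phi> x) \<noteq> 0" if x: "x \<in> topspace X" for x
  proof (rule mden_nonzero)
    obtain c Y where c: "c \<in> A" "x \<in> fst c" "snd c x = 0" and L: "curve_lift \<phi> c (ball 0 4) Y" using \<phi> x unfolding lifted_curve_def by blast
    have "0 \<in> ball (0::complex) 4" by simp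
    then have g: "regular_at Y 0" "\<exists>l. l \<noteq> 0 \<and> (\<forall>i<4. \<phi> i (par c 0) = l * Y i 0)" using L unfolding curve_lift_def by blast+
    have "par c 0 = x" using par_crd[OF c(1,2)] c(3) by simp
    then obtain l where l: "l \<noteq> 0" "\<forall>i<4. \<phi> i x = l * Y i 0" using g(2) by auto
    then show "\<phi> 1 x \<noteq> 0 \<or> \<phi> 2 x \<noteq> 0" using g(1) by (simp add: regular_at_def)
  qed
  \<comment> \<open>The squared modulus of the denominator: it clears the denominators of the map
    and of its conjugate alike, at the price of bidegree (2, 2).\<close>
  define g where "g x = mden (?\<phi> x) * cnj (mden (?\<phi> x))" for x
  have g: "g x \<noteq> 0" if "x \<in> topspace X" for x using den[OF that] by (simp add: g_def)
  \<comment> \<open>The forms of the map in polarised shape; on the diagonal each primed form takes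
    the conjugate value of the unprimed one.\<close>
  define D where "D x y = 2 * (x 1 * y 1 + x 2 * y 2 + x 3 * y 0 - x 0 * y 3)" for x y :: "nat \<Rightarrow> complex"
  define D' where "D' x y = 2 * (x 1 * y 1 + x 2 * y 2 + x 0 * y 3 - x 3 * y 0)" for x y :: "nat \<Rightarrow> complex"
  define N1 where "N1 x y = x 1 * y 0 - x 0 * y 2" for x y :: "nat \<Rightarrow> complex"
  define N1' where "N1' x y = x 0 * y 1 - x 2 * y 0" for x y :: "nat \<Rightarrow> complex"
  define N2 where "N2 x y = x 2 * y 0 + x 0 * y 1" for x y :: "nat \<Rightarrow> complex"
  define N2' where "N2' x y = x 0 * y 2 + x 1 * y 0" for x y :: "nat \<Rightarrow> complex"
  have b: "biform 1 D" "biform 1 D'" "biform 1 N1" "biform 1 N1'" "biform 1 N2" "biform 1 N2'"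
    unfolding D_def[abs_def] D'_def[abs_def] N1_def[abs_def] N1'_def[abs_def] N2_def[abs_def] N2'_def[abs_def]
    by (intro biform_scale biform_diff biform_add biform_coords; simp)+
  have v: "D y (\<lambda>i. cnj (y i)) = mden y" "D' y (\<lambda>i. cnj (y i)) = cnj (mden y)" "N1 y (\<lambda>i. cnj (y i)) = mnum1 y"
    "N1' y (\<lambda>i. cnj (y i)) = cnj (mnum1 y)" "N2 y (\<lambda>i. cnj (y i)) = mnum2 y" "N2' y (\<lambda>i. cnj (y i)) = cnj (mnum2 y)" for y
    by (simp_all add: D_def D'_def N1_def N1'_def N2_def N2'_def mden_def mnum1_def mnum2_def mult.commute)
  show "algebraic_relation ((\<lambda>x. lag_map (\<lambda>i. \<phi> i x)) ` topspace X) q1 q2 q3"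
  proof (rule polynomial_relation[OF curve_determined[OF \<phi>] g _ _ _ _ _ q])
    show "numerator_form (topspace X) ?\<phi> g 1 (\<lambda>x. 1)"
      by (rule numeratorI[OF biform2[OF b(1,2)]]) (simp add: v g_def)
    show "numerator_form (topspace X) ?\<phi> g 1 (\<lambda>x. fst (lag_map (?\<phi> x)))"
      by (rule numeratorI[OF biform2[OF b(3,2)]]) (use den in \<open>simp add: v g_def lag_map_def\<close>)
    show "numerator_form (topspace X) ?\<phi> g 1 (\<lambda>x. cnj (fst (lag_map (?\<phi> x))))"
      by (rule numeratorI[OF biform2[OF b(4,1)]]) (use den in \<open>simp add: v g_def lag_map_def\<close>)
    show "numerator_form (topspace X) ?\<phi> g 1 (\<lambda>x. snd (lag_map (?\<phi> x)))"
      by (rule numeratorI[OF biform2[OF b(5,2)]]) (use den in \<open>simp add: v g_def lag_map_def\<close>)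
    show "numerator_form (topspace X) ?\<phi> g 1 (\<lambda>x. cnj (snd (lag_map (?\<phi> x))))"
      by (rule numeratorI[OF biform2[OF b(6,1)]]) (use den in \<open>simp add: v g_def lag_map_def\<close>)
  qed
qed

end

text \<open>The plane \<open>{(z, 0)}\<close> is added to the Zariski closure only to have a chain of length two at hand.\<close>

lemma in_algebraic_surfaceI:
  fixes S :: "(complex \<times> complex) set"
  assumes "three_dependent S"
  shows "in_algebraic_surface S"
proof -
  let ?L = "range (\<lambda>z. (z, 0)) :: (complex \<times> complex) set"
  have L: "real_algebraic_set ?L" using surface_chain(3) by (simp add: irreducible_algebraic_set_def)
  have "algebraic_dimension (zariski_closure S \<union> ?L) = 2"
    by (rule algebraic_dimension_two[OF zariski_closure_algebraic three_dependent_closure[OF assms] L plane_three_dependent surface_chain]) simp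
  moreover have "real_algebraic_set (zariski_closure S \<union> ?L)" by (intro algebraic_Un zariski_closure_algebraic L)
  moreover have "S \<subseteq> zariski_closure S" by (auto simp: zariski_closure_def)
  ultimately show ?thesis unfolding in_algebraic_surface_def by blast
qed

theorem corollary4p3:
  fixes X :: "'a topology" and A :: "'a chart set"
  assumes "riemann_surface X A" and "compact_space X"
  shows "\<exists>f :: 'a \<Rightarrow> complex \<times> complex.
           immersion A f \<and> conformal A f \<and> exact_lagrangian A f \<and>
           in_algebraic_surface (f ` topspace X)"
proof -
  \<comment> \<open>The construction runs in the refined atlas. The geometric properties quantify
    over charts, so they descend to the smaller atlas \<open>A\<close>.\<close>
  interpret compact_surface X "refined_atlas X A" by (rule compact_surface_refined[OF assms])
  have sub: "c \<in> refined_atlas X A" if "c \<in> A" for c using refined_atlas_superset[OF assms(1)] that by blast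
  obtain \<phi> where \<phi>: "lifted_curve \<phi>"
    using lifted_curve_exists by (rule exE)
  let ?f = "\<lambda>x. lag_map (\<lambda>i. \<phi> i x)"
  note geo = curve_map_geometry[OF \<phi>]
  have "immersion A ?f" using geo(1) sub by (auto simp: immersion_def smooth_map_def)
  moreover have "conformal A ?f" using geo(2) sub by (auto simp: conformal_def)
  moreover have "exact_lagrangian A ?f"
  proof -
    obtain \<eta> h where "smooth_one_form \<eta>" "exterior_derivative \<eta> = (\<lambda>p. symplectic_form)" "smooth_map (refined_atlas X A) h"
      "\<forall>c\<in>refined_atlas X A. \<forall>z\<in>chart_image c. \<forall>v. differential c h z v = \<eta> (in_chart c ?f z) (differential c ?f z v)"
      using geo(3) unfolding exact_lagrangian_def pullback_exact_def by blast
    moreover have "lagrangian A ?f" using geo(3) sub by (auto simp: exact_lagrangian_def lagrangian_def)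
    ultimately show ?thesis using sub unfolding exact_lagrangian_def pullback_exact_def smooth_map_def by blast
  qed
  moreover have "in_algebraic_surface (?f ` topspace X)" by (rule in_algebraic_surfaceI[OF curve_three_dependent[OF \<phi>]])
  ultimately show ?thesis by blast
qed

end
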